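(* Let $G$ be a connected Lie group whose Lie algebra $\mathfrak g$ is a noncompact noncomplex real simple Lie algebra, let $\theta$ be a Cartan involution with Cartan decomposition $\mathfrak g=\mathfrak k\oplus\mathfrak p$, and let $\mathfrak h_0=\mathfrak t\oplus\mathfrak a$ be a maximally noncompact $\theta$-stable Cartan subalgebra with $\mathfrak a=\mathfrak h_0\cap\mathfrak p$. Let $\alpha\in\Delta(\mathfrak g^{\mathbb C},\mathfrak h_0^{\mathbb C})$ be a real simple positive root and let $\beta=\alpha|_{\mathfrak a}$. If the restricted root system $\Sigma$ is reduced, let $\Sigma_1=\Sigma^+\setminus\{\beta\}$; if $\beta$ and $2\beta$ are both restricted roots, let $\Sigma_1=\Sigma^+\setminus\{\beta,2\beta\}$. In either of these cases define $\mathfrak n_1:=\bigoplus_{\mu\in\Sigma_1}\mathfrak g_\mu\subset\mathfrak n$. If $\Omega=Ad_GX$ is a regular orbit of type $\{\alpha\}$, where $X\in\mathfrak g$ is regular with stabilizer algebra $\mathfrak g_X=\mathfrak h_{\{\alpha\}}$, then $\Omega$ admits a left-invariant isotropic foliation $\mathcal N_1$ with $(\mathcal N_1)_X=\mathfrak n_1$.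
   Context: $B$ is the Killing form. $X\in\mathfrak g$ is regular if the coefficient of $\lambda^r$ in $\det(\lambda\mathbf 1-ad_X)$ is nonzero, $r$ being the rank of $\mathfrak g$; the stabilizer algebra is $\mathfrak g_X=\{Y:[X,Y]=0\}$. A regular orbit is the adjoint orbit of a regular element. $\Sigma=\Sigma(\mathfrak g,\mathfrak a)$ is the restricted root system, $\mathfrak g_\mu$ the restricted root spaces, $\mathfrak n=\bigoplus_{\mu\in\Sigma^+}\mathfrak g_\mu$. Positive and simple systems of $\Delta(\mathfrak g^{\mathbb C},\mathfrak h_0^{\mathbb C})$ and $\Sigma$ are chosen compatibly: positive (simple) roots with nonzero restriction to $\mathfrak a$ restrict to positive (simple) restricted roots. A root system is reduced if twice a root is never a root. $\mathfrak t=\mathfrak h_0\cap\mathfrak k$. A $\theta$-stable Cartan subalgebra $\mathfrak h$ is maximally noncompact if $\dim(\mathfrak h\cap\mathfrak p)$ is as large as possible. A root is real if it takes real values on $\mathfrak h_0$, equivalently vanishes on $\mathfrak t$. For a real root $\alpha$, $E_\alpha\in\mathfrak g_\alpha\cap\mathfrak g$ is a root vector normalized by $B(E_\alpha,\theta E_\alpha)=-2/|\alpha|^2$, and $\mathfrak h_{\{\alpha\}}=\ker(\alpha|_{\mathfrak h_0})\oplus\mathbb R(E_\alpha+\theta E_\alpha)$, a $\theta$-stable Cartan subalgebra. An orbit is of type $\{\alpha\}$ if the stabilizer algebras of its points are conjugate to $\mathfrak h_{\{\alpha\}}$. $T_X\Omega=\{[U,X]:U\in\mathfrak g\}$ is identified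 with $\mathfrak g/\mathfrak g_X$ via $U\mapsto[U,X]$, and a subspace $V\subset\mathfrak g$ with $V\cap\mathfrak g_X=0$ is regarded as the subspace $\{[U,X]:U\in V\}$. The Kirillov form is the $G$-invariant symplectic form on $\Omega$ with $\omega_X([U,X],[V,X])=B(X,[U,V])$. A foliation of $\Omega$ is left-invariant if its tangent distribution is invariant under the action of $G$ by $Ad$, and isotropic if $\omega$ vanishes on its tangent spaces. *)

theory Defs
  imports
    "HOL-Analysis.Analysis"
    "HOL-Algebra.Group"
    "HOL-Computational_Algebra.Polynomial"
begin

section \<open>Smooth maps, manifolds and Lie groups\<close>

primrec C_on :: "nat \<Rightarrow> 'a::euclidean_space set \<Rightarrow> ('a \<Rightarrow> 'b::euclidean_space) \<Rightarrow> bool" where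
  "C_on 0 U f \<longleftrightarrow> continuous_on U f"
| "C_on (Suc k) U f \<longleftrightarrow>
     f differentiable_on U \<and> (\<forall>v. C_on k U (\<lambda>x. frechet_derivative f (at x) v))"

text \<open>On an open set this is the usual notion of a \<open>C\<^sup>\<infinity>\<close> map; on an arbitrary set it asks for local
  smooth extensions.  The general case is needed for relatively open subsets of a linear subspace,
  which serve below as parameter domains of dimension possibly smaller than that of the type.\<close>

definition smooth_on :: "'a::euclidean_space set \<Rightarrow> ('a \<Rightarrow> 'b::euclidean_space) \<Rightarrow> bool" where
  "smooth_on S f \<longleftrightarrow>
     (\<forall>x\<in>S. \<exists>U g. open U \<and> x \<in> U \<and> (\<forall>k. C_on k U g) \<and> (\<forall>y\<in>S \<inter> U. g y = f y))"

type_synonym ('m, 'e) chart = "'m set \<times> ('m \<Rightarrow> 'e)"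

definition chart_inv :: "('m, 'e) chart \<Rightarrow> 'e \<Rightarrow> 'm" where
  "chart_inv c = inv_into (fst c) (snd c)"

definition chart :: "('m::topological_space, 'e::euclidean_space) chart \<Rightarrow> bool" where
  "chart c \<longleftrightarrow> open (fst c) \<and> open (snd c ` fst c) \<and>
     homeomorphism (fst c) (snd c ` fst c) (snd c) (chart_inv c)"

definition smooth_atlas :: "('m::topological_space, 'e::euclidean_space) chart set \<Rightarrow> bool" where
  "smooth_atlas A \<longleftrightarrow> (\<forall>c\<in>A. chart c) \<and> (\<Union>c\<in>A. fst c) = UNIV \<and>
     (\<forall>c\<in>A. \<forall>d\<in>A. smooth_on (snd c ` (fst c \<inter> fst d)) (snd d \<circ> chart_inv c))"

definition smooth_map ::
  "('m::topological_space, 'e::euclidean_space) chart set \<Rightarrow>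
   ('n::topological_space, 'f::euclidean_space) chart set \<Rightarrow> ('m \<Rightarrow> 'n) \<Rightarrow> bool" where
  "smooth_map A B f \<longleftrightarrow> continuous_on UNIV f \<and>
     (\<forall>c\<in>A. \<forall>d\<in>B. smooth_on (snd c ` (fst c \<inter> f -` fst d)) (snd d \<circ> f \<circ> chart_inv c))"

definition prod_atlas ::
  "('m, 'e) chart set \<Rightarrow> ('n, 'f) chart set \<Rightarrow> ('m \<times> 'n, 'e \<times> 'f) chart set" where
  "prod_atlas A B = {(fst c \<times> fst d, map_prod (snd c) (snd d)) | c d. c \<in> A \<and> d \<in> B}"

text \<open>The whole type \<open>'g\<close> is the underlying manifold; Hausdorff and second countable are
  expressed by its type classes.\<close>

definition lie_group ::
  "('g::{t2_space, second_countable_topology}) monoid \<Rightarrow>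
   ('g, 'e::euclidean_space) chart set \<Rightarrow> bool" where
  "lie_group G A \<longleftrightarrow> group G \<and> carrier G = UNIV \<and> smooth_atlas A \<and>
     smooth_map (prod_atlas A A) A (\<lambda>(x, y). x \<otimes>\<^bsub>G\<^esub> y) \<and>
     smooth_map A A (\<lambda>x. inv\<^bsub>G\<^esub> x)"

text \<open>A chart \<open>c\<close> around the identity identifies the tangent space at the identity with \<open>'e\<close>, and
  \<open>\<iota>\<close> identifies the Lie algebra (of type \<open>'a\<close>) with that tangent space.  \<open>Ad g\<close> is the derivative at
  the identity of conjugation by \<open>g\<close>.\<close>

definition Ad ::
  "'g monoid \<Rightarrow> ('g, 'e::euclidean_space) chart \<Rightarrow> ('a \<Rightarrow> 'e) \<Rightarrow> 'g \<Rightarrow> 'a \<Rightarrow> 'a" where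
  "Ad G c \<iota> g U = inv_into UNIV \<iota>
     (frechet_derivative (\<lambda>v. snd c (g \<otimes>\<^bsub>G\<^esub> chart_inv c v \<otimes>\<^bsub>G\<^esub> inv\<^bsub>G\<^esub> g))
        (at (snd c \<one>\<^bsub>G\<^esub>)) (\<iota> U))"

text \<open>The bracket of the Lie algebra of a Lie group is characterised by \<open>ad = d(Ad)\<close> at the
  identity.\<close>

definition has_lie_algebra ::
  "('g::{t2_space, second_countable_topology}) monoid \<Rightarrow> ('g, 'e::euclidean_space) chart set \<Rightarrow>
   ('g, 'e) chart \<Rightarrow> ('a::euclidean_space \<Rightarrow> 'e) \<Rightarrow> ('a \<Rightarrow> 'a \<Rightarrow> 'a) \<Rightarrow> bool" where
  "has_lie_algebra G A c \<iota> br \<longleftrightarrow> c \<in> A \<and> \<one>\<^bsub>G\<^esub> \<in> fst c \<and> linear \<iota> \<and> bij \<iota> \<and>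
     (\<forall>U V. br U V =
        frechet_derivative (\<lambda>x. Ad G c \<iota> (chart_inv c x) V) (at (snd c \<one>\<^bsub>G\<^esub>)) (\<iota> U))"


section \<open>Real Lie algebras\<close>

definition lie_algebra :: "(real^'n \<Rightarrow> real^'n \<Rightarrow> real^'n) \<Rightarrow> bool" where
  "lie_algebra br \<longleftrightarrow> bilinear br \<and> (\<forall>X. br X X = 0) \<and>
     (\<forall>X Y Z. br X (br Y Z) + br Y (br Z X) + br Z (br X Y) = 0)"

definition lie_ideal :: "(real^'n \<Rightarrow> real^'n \<Rightarrow> real^'n) \<Rightarrow> (real^'n) set \<Rightarrow> bool" where
  "lie_ideal br I \<longleftrightarrow> subspace I \<and> (\<forall>X. \<forall>Y\<in>I. br X Y \<in> I)"

definition simple_lie_algebra :: "(real^'n \<Rightarrow> real^'n \<Rightarrow> real^'n) \<Rightarrow> bool" where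
  "simple_lie_algebra br \<longleftrightarrow> lie_algebra br \<and> (\<exists>X Y. br X Y \<noteq> 0) \<and>
     (\<forall>I. lie_ideal br I \<longrightarrow> I = {0} \<or> I = UNIV)"

text \<open>A real Lie algebra is complex if it underlies a Lie algebra over the complex numbers, that is,
  if it has a complex structure for which the bracket is complex bilinear.\<close>

definition complex_lie_algebra :: "(real^'n \<Rightarrow> real^'n \<Rightarrow> real^'n) \<Rightarrow> bool" where
  "complex_lie_algebra br \<longleftrightarrow> (\<exists>J. linear J \<and> (\<forall>X. J (J X) = - X) \<and>
     (\<forall>X Y. br (J X) Y = J (br X Y) \<and> br X (J Y) = J (br X Y)))"

text \<open>For a bracket over any field; used both for a real Lie algebra and for its
  complexification.\<close>

definition killing :: "('f::field^'n \<Rightarrow> 'f^'n \<Rightarrow> 'f^'n) \<Rightarrow> 'f^'n \<Rightarrow> 'f^'n \<Rightarrow> 'f" where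
  "killing br X Y = trace (matrix (\<lambda>Z. br X (br Y Z)))"

text \<open>Compactness of a semisimple real Lie algebra.\<close>

definition compact_lie_algebra :: "(real^'n \<Rightarrow> real^'n \<Rightarrow> real^'n) \<Rightarrow> bool" where
  "compact_lie_algebra br \<longleftrightarrow> (\<forall>X. X \<noteq> 0 \<longrightarrow> killing br X X < 0)"

definition cartan_involution ::
  "(real^'n \<Rightarrow> real^'n \<Rightarrow> real^'n) \<Rightarrow> (real^'n \<Rightarrow> real^'n) \<Rightarrow> bool" where
  "cartan_involution br \<theta> \<longleftrightarrow> linear \<theta> \<and> (\<forall>X. \<theta> (\<theta> X) = X) \<and>
     (\<forall>X Y. \<theta> (br X Y) = br (\<theta> X) (\<theta> Y)) \<and>
     (\<forall>X. X \<noteq> 0 \<longrightarrow> - killing br X (\<theta> X) > 0)"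

definition \<pp> :: "(real^'n \<Rightarrow> real^'n) \<Rightarrow> (real^'n) set" where
  "\<pp> \<theta> = {X. \<theta> X = - X}"

primrec lower_central ::
  "(real^'n \<Rightarrow> real^'n \<Rightarrow> real^'n) \<Rightarrow> (real^'n) set \<Rightarrow> nat \<Rightarrow> (real^'n) set" where
  "lower_central br h 0 = h"
| "lower_central br h (Suc k) = span {br X Y | X Y. X \<in> h \<and> Y \<in> lower_central br h k}"

text \<open>A nilpotent subalgebra that equals its own normaliser.\<close>

definition cartan_subalgebra ::
  "(real^'n \<Rightarrow> real^'n \<Rightarrow> real^'n) \<Rightarrow> (real^'n) set \<Rightarrow> bool" where
  "cartan_subalgebra br h \<longleftrightarrow> subspace h \<and> (\<forall>X\<in>h. \<forall>Y\<in>h. br X Y \<in> h) \<and>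
     (\<exists>k. lower_central br h k = {0}) \<and> {X. \<forall>Y\<in>h. br X Y \<in> h} = h"

definition max_noncompact_csa ::
  "(real^'n \<Rightarrow> real^'n \<Rightarrow> real^'n) \<Rightarrow> (real^'n \<Rightarrow> real^'n) \<Rightarrow> (real^'n) set \<Rightarrow> bool" where
  "max_noncompact_csa br \<theta> h \<longleftrightarrow> cartan_subalgebra br h \<and> \<theta> ` h = h \<and>
     (\<forall>h'. cartan_subalgebra br h' \<and> \<theta> ` h' = h' \<longrightarrow> dim (h' \<inter> \<pp> \<theta>) \<le> dim (h \<inter> \<pp> \<theta>))"

text \<open>All Cartan subalgebras have the same dimension, so the choice is immaterial.\<close>

definition lie_rank :: "(real^'n \<Rightarrow> real^'n \<Rightarrow> real^'n) \<Rightarrow> nat" where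
  "lie_rank br = dim (SOME h. cartan_subalgebra br h)"

definition ad_charpoly :: "(real^'n \<Rightarrow> real^'n \<Rightarrow> real^'n) \<Rightarrow> real^'n \<Rightarrow> real poly" where
  "ad_charpoly br X =
     det (\<chi> i j. (if i = j then [:0, 1:] else 0) - [:matrix (br X) $ i $ j:])"

definition regular :: "(real^'n \<Rightarrow> real^'n \<Rightarrow> real^'n) \<Rightarrow> real^'n \<Rightarrow> bool" where
  "regular br X \<longleftrightarrow> coeff (ad_charpoly br X) (lie_rank br) \<noteq> 0"

definition stabilizer :: "(real^'n \<Rightarrow> real^'n \<Rightarrow> real^'n) \<Rightarrow> real^'n \<Rightarrow> (real^'n) set" where
  "stabilizer br X = {Y. br X Y = 0}"


section \<open>Complexification\<close>

definition cvec :: "real^'n \<Rightarrow> real^'n \<Rightarrow> complex^'n" where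
  "cvec X Y = (\<chi> i. Complex (X $ i) (Y $ i))"

definition re_vec :: "complex^'n \<Rightarrow> real^'n" where
  "re_vec Z = (\<chi> i. Re (Z $ i))"

definition im_vec :: "complex^'n \<Rightarrow> real^'n" where
  "im_vec Z = (\<chi> i. Im (Z $ i))"

definition cbr ::
  "(real^'n \<Rightarrow> real^'n \<Rightarrow> real^'n) \<Rightarrow> complex^'n \<Rightarrow> complex^'n \<Rightarrow> complex^'n" where
  "cbr br Z W =
     cvec (br (re_vec Z) (re_vec W) - br (im_vec Z) (im_vec W))
          (br (re_vec Z) (im_vec W) + br (im_vec Z) (re_vec W))"

definition complexify :: "(real^'n) set \<Rightarrow> (complex^'n) set" where
  "complexify S = {cvec X Y | X Y. X \<in> S \<and> Y \<in> S}"


section \<open>Roots and restricted roots\<close>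

text \<open>Linear functionals on a subspace \<open>S\<close> are represented by functions vanishing outside \<open>S\<close>, so
  that equal functionals are equal functions and sums and multiples may be formed pointwise.\<close>

definition functional_on :: "('f::field^'n) set \<Rightarrow> ('f^'n \<Rightarrow> 'f) \<Rightarrow> bool" where
  "functional_on S \<mu> \<longleftrightarrow> (\<forall>x\<in>S. \<forall>y\<in>S. \<mu> (x + y) = \<mu> x + \<mu> y) \<and>
     (\<forall>c. \<forall>x\<in>S. \<mu> (c *s x) = c * \<mu> x) \<and> (\<forall>x. x \<notin> S \<longrightarrow> \<mu> x = 0)"

definition root_space ::
  "('f::field^'n \<Rightarrow> 'f^'n \<Rightarrow> 'f^'n) \<Rightarrow> ('f^'n) set \<Rightarrow> ('f^'n \<Rightarrow> 'f) \<Rightarrow> ('f^'n) set" where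
  "root_space br S \<mu> = {Z. \<forall>H\<in>S. br H Z = \<mu> H *s Z}"

text \<open>With the complexified bracket and \<open>S\<close> a complexified Cartan subalgebra these are the roots; with
  the real bracket and \<open>S = \<aa>\<close> they are the restricted roots.\<close>

definition roots ::
  "('f::field^'n \<Rightarrow> 'f^'n \<Rightarrow> 'f^'n) \<Rightarrow> ('f^'n) set \<Rightarrow> ('f^'n \<Rightarrow> 'f) set" where
  "roots br S = {\<mu>. functional_on S \<mu> \<and> \<mu> \<noteq> (\<lambda>_. 0) \<and> root_space br S \<mu> \<noteq> {0}}"

definition positive_system ::
  "('f::field^'n \<Rightarrow> 'f) set \<Rightarrow> ('f^'n \<Rightarrow> 'f) set \<Rightarrow> bool" where
  "positive_system \<Phi> P \<longleftrightarrow> P \<subseteq> \<Phi> \<and>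
     (\<forall>\<mu>\<in>\<Phi>. (\<mu> \<in> P) \<noteq> ((\<lambda>H. - \<mu> H) \<in> P)) \<and>
     (\<forall>\<mu>\<in>P. \<forall>\<nu>\<in>P. (\<lambda>H. \<mu> H + \<nu> H) \<in> \<Phi> \<longrightarrow> (\<lambda>H. \<mu> H + \<nu> H) \<in> P)"

definition simple_roots :: "('f::field^'n \<Rightarrow> 'f) set \<Rightarrow> ('f^'n \<Rightarrow> 'f) set" where
  "simple_roots P = {\<mu>\<in>P. \<not> (\<exists>\<nu>\<in>P. \<exists>\<rho>\<in>P. \<mu> = (\<lambda>H. \<nu> H + \<rho> H))}"

definition reduced_roots :: "('f::field^'n \<Rightarrow> 'f) set \<Rightarrow> bool" where
  "reduced_roots \<Phi> \<longleftrightarrow> (\<forall>\<mu>\<in>\<Phi>. (\<lambda>H. 2 * \<mu> H) \<notin> \<Phi>)"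

text \<open>Roots take real values on \<open>\<aa>\<close>, so taking the real part loses nothing.\<close>

definition restrict_root :: "(complex^'n \<Rightarrow> complex) \<Rightarrow> (real^'n) set \<Rightarrow> real^'n \<Rightarrow> real" where
  "restrict_root \<alpha> a = (\<lambda>H. if H \<in> a then Re (\<alpha> (cvec H 0)) else 0)"

definition compatible_positivity ::
  "(real^'n) set \<Rightarrow> (complex^'n \<Rightarrow> complex) set \<Rightarrow> (real^'n \<Rightarrow> real) set \<Rightarrow> bool" where
  "compatible_positivity a \<Delta>p \<Sigma>p \<longleftrightarrow>
     (\<forall>\<gamma>\<in>\<Delta>p. restrict_root \<gamma> a \<noteq> (\<lambda>_. 0) \<longrightarrow> restrict_root \<gamma> a \<in> \<Sigma>p) \<and>
     (\<forall>\<gamma>\<in>simple_roots \<Delta>p. restrict_root \<gamma> a \<noteq> (\<lambda>_. 0) \<longrightarrow> restrict_root \<gamma> a \<in> simple_roots \<Sigma>p)"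

definition real_root :: "(real^'n) set \<Rightarrow> (complex^'n \<Rightarrow> complex) \<Rightarrow> bool" where
  "real_root h \<alpha> \<longleftrightarrow> (\<forall>H\<in>h. \<alpha> (cvec H 0) \<in> \<real>)"

text \<open>\<open>|\<alpha>|\<^sup>2 = B(H\<^sub>\<alpha>, H\<^sub>\<alpha>)\<close>, where \<open>H\<^sub>\<alpha>\<close> in the complexified Cartan subalgebra represents \<open>\<alpha>\<close> through
  the Killing form \<open>B\<close>.\<close>

definition root_vec ::
  "(real^'n \<Rightarrow> real^'n \<Rightarrow> real^'n) \<Rightarrow> (real^'n) set \<Rightarrow> (complex^'n \<Rightarrow> complex) \<Rightarrow> complex^'n" where
  "root_vec br h \<alpha> =
     (THE Z. Z \<in> complexify h \<and> (\<forall>H\<in>complexify h. killing (cbr br) Z H = \<alpha> H))"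

definition root_norm_sq ::
  "(real^'n \<Rightarrow> real^'n \<Rightarrow> real^'n) \<Rightarrow> (real^'n) set \<Rightarrow> (complex^'n \<Rightarrow> complex) \<Rightarrow> real" where
  "root_norm_sq br h \<alpha> = Re (killing (cbr br) (root_vec br h \<alpha>) (root_vec br h \<alpha>))"

definition normalized_root_vector ::
  "(real^'n \<Rightarrow> real^'n \<Rightarrow> real^'n) \<Rightarrow> (real^'n \<Rightarrow> real^'n) \<Rightarrow> (real^'n) set \<Rightarrow>
   (complex^'n \<Rightarrow> complex) \<Rightarrow> real^'n \<Rightarrow> bool" where
  "normalized_root_vector br \<theta> h \<alpha> E \<longleftrightarrow>
     cvec E 0 \<in> root_space (cbr br) (complexify h) \<alpha> \<and>
     killing br E (\<theta> E) = - 2 / root_norm_sq br h \<alpha>"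

text \<open>The Cartan subalgebra \<open>\<hh>\<^bsub>{\<alpha>}\<^esub>\<close> obtained from \<open>h\<close> by the Cayley transform in a real root.\<close>

definition cayley_csa ::
  "(real^'n \<Rightarrow> real^'n) \<Rightarrow> (real^'n) set \<Rightarrow> (complex^'n \<Rightarrow> complex) \<Rightarrow> real^'n \<Rightarrow> (real^'n) set" where
  "cayley_csa \<theta> h \<alpha> E = {H + c *\<^sub>R (E + \<theta> E) | H c. H \<in> h \<and> \<alpha> (cvec H 0) = 0}"


section \<open>Adjoint orbits\<close>

text \<open>Below, \<open>act\<close> is the adjoint action of the group on its Lie algebra.\<close>

definition orbit :: "('g \<Rightarrow> 'a \<Rightarrow> 'a) \<Rightarrow> 'a \<Rightarrow> 'a set" where
  "orbit act X = range (\<lambda>g. act g X)"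

definition orbit_of_type ::
  "(real^'n \<Rightarrow> real^'n \<Rightarrow> real^'n) \<Rightarrow> ('g \<Rightarrow> real^'n \<Rightarrow> real^'n) \<Rightarrow> (real^'n) set \<Rightarrow>
   (real^'n) set \<Rightarrow> bool" where
  "orbit_of_type br act \<Omega> h \<longleftrightarrow> (\<forall>Y\<in>\<Omega>. \<exists>g. stabilizer br Y = act g ` h)"

text \<open>The manifold topology of the orbit of \<open>X\<close>, i.e. the quotient topology from \<open>G\<close>.\<close>

definition orbit_topology ::
  "('g::topological_space \<Rightarrow> 'a \<Rightarrow> 'a) \<Rightarrow> 'a \<Rightarrow> 'a topology" where
  "orbit_topology act X = topology (\<lambda>V. V \<subseteq> orbit act X \<and> open {g. act g X \<in> V})"

lemma openin_orbit_topology: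
  "openin (orbit_topology act X) V \<longleftrightarrow> V \<subseteq> orbit act X \<and> open {g. act g X \<in> V}"
proof -
  have "istopology (\<lambda>V. V \<subseteq> orbit act X \<and> open {g. act g X \<in> V})"
    unfolding istopology_def
  proof (intro conjI allI impI)
    fix S T assume *: "S \<subseteq> orbit act X \<and> open {g. act g X \<in> S}" "T \<subseteq> orbit act X \<and> open {g. act g X \<in> T}"
    then show "S \<inter> T \<subseteq> orbit act X" by blast
    have "{g. act g X \<in> S \<inter> T} = {g. act g X \<in> S} \<inter> {g. act g X \<in> T}" by blast
    with * show "open {g. act g X \<in> S \<inter> T}" by (simp add: open_Int)
  next
    fix \<K> assume *: "\<forall>K\<in>\<K>. K \<subseteq> orbit act X \<and> open {g. act g X \<in> K}"
    then show "\<Union>\<K> \<subseteq> orbit act X" by blast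
    have "{g. act g X \<in> \<Union>\<K>} = (\<Union>K\<in>\<K>. {g. act g X \<in> K})" by blast
    with * show "open {g. act g X \<in> \<Union>\<K>}" by auto
  qed
  then show ?thesis unfolding orbit_topology_def by (simp add: topology_inverse')
qed

lemma topspace_orbit_topology: "topspace (orbit_topology act X) = orbit act X"
proof -
  have "openin (orbit_topology act X) (orbit act X)"
    by (simp add: openin_orbit_topology) (simp add: orbit_def)
  then show ?thesis
    by (metis openin_orbit_topology openin_subset openin_topspace subset_antisym)
qed

text \<open>\<open>\<omega>\<^bsub>Y\<^esub>([U,Y],[V,Y]) = B(Y,[U,V])\<close>.\<close>

definition kirillov_form ::
  "(real^'n \<Rightarrow> real^'n \<Rightarrow> real^'n) \<Rightarrow> real^'n \<Rightarrow> real^'n \<Rightarrow> real^'n \<Rightarrow> real" where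
  "kirillov_form br Y u v =
     (THE w. \<forall>U V. br U Y = u \<and> br V Y = v \<longrightarrow> w = killing br Y (br U V))"


section \<open>Foliations\<close>

text \<open>An immersed submanifold of a Euclidean space is given by its manifold topology \<open>\<tau>\<close>.  It is
  parametrised locally by immersions \<open>\<psi>\<close> of relatively open subsets \<open>W\<close> of a model space \<open>M\<close>, a linear
  subspace, that are homeomorphisms onto \<open>\<tau>\<close>-open sets.  Derivatives within \<open>W\<close> are determined only
  on \<open>M\<close>.\<close>

definition parametrization ::
  "'a::euclidean_space topology \<Rightarrow> 'a set \<Rightarrow> 'a set \<times> ('a \<Rightarrow> 'a) \<Rightarrow> bool" where
  "parametrization \<tau> M = (\<lambda>(W, \<psi>).
     openin (top_of_set M) W \<and> smooth_on W \<psi> \<and> openin \<tau> (\<psi> ` W) \<and>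
     homeomorphic_map (top_of_set W) (subtopology \<tau> (\<psi> ` W)) \<psi> \<and>
     (\<forall>x\<in>W. \<exists>D. (\<psi> has_derivative D) (at x within W) \<and> inj_on D M))"

text \<open>A foliated atlas: the model space \<open>M\<close> carries a subspace \<open>L\<close> (the leaf directions), and every
  change of parameters locally maps plaques, the pieces of translates of \<open>L\<close>, into plaques.\<close>

definition foliation ::
  "'a::euclidean_space topology \<Rightarrow> 'a set \<Rightarrow> 'a set \<Rightarrow> ('a set \<times> ('a \<Rightarrow> 'a)) set \<Rightarrow> bool" where
  "foliation \<tau> M L \<F> \<longleftrightarrow> subspace M \<and> subspace L \<and> L \<subseteq> M \<and>
     (\<forall>P\<in>\<F>. parametrization \<tau> M P) \<and>
     (\<Union>(W, \<psi>)\<in>\<F>. \<psi> ` W) = topspace \<tau> \<and>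
     (\<forall>(W, \<psi>)\<in>\<F>. \<forall>(W', \<psi>')\<in>\<F>. \<forall>x\<in>W. \<psi> x \<in> \<psi>' ` W' \<longrightarrow>
        (\<exists>N. openin (top_of_set W) N \<and> x \<in> N \<and> \<psi> ` N \<subseteq> \<psi>' ` W' \<and>
           (\<forall>y\<in>N. \<forall>z\<in>N. y - z \<in> L \<longrightarrow>
              inv_into W' \<psi>' (\<psi> y) - inv_into W' \<psi>' (\<psi> z) \<in> L)))"

text \<open>The tangent space at \<open>p\<close> to the leaf through \<open>p\<close>; all parametrizations around \<open>p\<close> contribute the
  same subspace.\<close>

definition leaf_tangent ::
  "'a::euclidean_space set \<Rightarrow> ('a set \<times> ('a \<Rightarrow> 'a)) set \<Rightarrow> 'a \<Rightarrow> 'a set" where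
  "leaf_tangent L \<F> p =
     {D v | W \<psi> x D v. (W, \<psi>) \<in> \<F> \<and> x \<in> W \<and> \<psi> x = p \<and>
        (\<psi> has_derivative D) (at x within W) \<and> v \<in> L}"

definition left_invariant :: "('g \<Rightarrow> 'a \<Rightarrow> 'a) \<Rightarrow> 'a set \<Rightarrow> ('a \<Rightarrow> 'a set) \<Rightarrow> bool" where
  "left_invariant act \<Omega> T \<longleftrightarrow> (\<forall>g. \<forall>Y\<in>\<Omega>. T (act g Y) = act g ` T Y)"

definition isotropic ::
  "(real^'n \<Rightarrow> real^'n \<Rightarrow> real^'n) \<Rightarrow> (real^'n) set \<Rightarrow> (real^'n \<Rightarrow> (real^'n) set) \<Rightarrow> bool" where
  "isotropic br \<Omega> T \<longleftrightarrow> (\<forall>Y\<in>\<Omega>. \<forall>u\<in>T Y. \<forall>v\<in>T Y. kirillov_form br Y u v = 0)"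

end

theory Submission
  imports Defs
begin

text \<open>
  Put \<open>\<hh> = \<gg>\<^sub>X\<close>.  It is abelian and \<open>\<theta>\<close>-stable, so \<open>ad X\<close> is a normal, hence semisimple, operator and
  \<open>\<gg> = \<hh> \<oplus> [X, \<gg>]\<close>.

  Root strings with \<open>\<beta>\<close> show that \<open>\<Sigma>\<^sub>1\<close> consists of the positive restricted roots that are no multiple of
  \<open>\<beta>\<close>, and that no two of them add up to a multiple of \<open>\<beta>\<close>.  Therefore \<open>\<nn>\<^sub>1\<close> is a subalgebra, is
  normalized by \<open>\<hh>\<close>, meets \<open>\<hh>\<close> trivially, and is preserved by every automorphism that fixes \<open>\<hh>\<close>
  pointwise.

  For an element \<open>g\<close> of the connected group \<open>G\<close>, the nullity of \<open>Ad g - 1\<close> is at least \<open>dim \<hh>\<close>: this holds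
  near the identity and propagates along entire families of operators.  If \<open>g\<close> fixes \<open>X\<close>, applying this to
  \<open>g exp (s X)\<close> shows that \<open>Ad g\<close> fixes \<open>\<hh>\<close> pointwise, and so preserves \<open>\<nn>\<^sub>1\<close>.  Hence \<open>Ad g \<nn>\<^sub>1\<close> depends only on
  \<open>Ad g X\<close>, and the distribution is well defined on the orbit.

  Since \<open>ad X\<close> maps \<open>\<nn>\<^sub>1\<close> onto itself, the orbit of \<open>X\<close> under the group generated by \<open>exp (ad \<nn>\<^sub>1)\<close> is
  the affine subspace \<open>X + \<nn>\<^sub>1\<close> near \<open>X\<close>.  The leaves are thus locally the translates \<open>g (X + \<nn>\<^sub>1)\<close>, and they are
  isotropic because \<open>B(X, [\<nn>\<^sub>1, \<nn>\<^sub>1]) \<subseteq> B(X, \<nn>\<^sub>1) = B(X, [X, \<nn>\<^sub>1]) = 0\<close>.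
\<close>

section \<open>Exponentials of linear operators\<close>

text \<open>Of \<open>G\<close> only charts and \<open>Ad\<close> are given, with no exponential
  map. Semisimplicity supplies a substitute: every automorphism close to the identity is
  \<open>expo (br Y)\<close> with small \<open>Y\<close>, and \<open>Ad\<close> attains all of these
  already on any neighbourhood of the unit. The topologies of \<open>G\<close> and of the orbit can
  therefore be expressed by automorphisms close to the identity.

  The obstacle is that the stabilizer of \<open>X\<close> in \<open>G\<close> need not be connected,
  so its action on \<open>n1\<close> cannot be read off from its Lie algebra. This is why nullities
  are controlled on all of \<open>G\<close>. Of \<open>a\<close>, only the kernel of \<beta> lies in
  the stabilizer algebra and is thereby known to be fixed; so \<open>n1\<close> must consist of
  complete joint eigenspaces of that kernel. That no two roots of \<open>S1\<close> add up to a
  multiple of \<beta> ensures that such an eigenspace does not mix \<open>S1\<close> with its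
  negative.

  In the charts of the orbit the directions transverse to the leaves act through one-parameter
  groups, whereas the leaf directions are added linearly. Plaques are then pieces of affine spaces,
  and matching them becomes linear algebra.\<close>

text \<open>The library has no algebra structure on \<open>'a \<Rightarrow>\<^sub>L 'a\<close>, which \<open>exp\<close> requires.\<close>

typedef (overloaded) 'a endo = "UNIV :: ('a::euclidean_space \<Rightarrow>\<^sub>L 'a) set"
  by simp

setup_lifting type_definition_endo

instantiation endo :: (euclidean_space) real_normed_algebra_1
begin

lift_definition zero_endo :: "'a endo" is 0 .
lift_definition one_endo :: "'a endo" is id_blinfun .
lift_definition plus_endo :: "'a endo \<Rightarrow> 'a endo \<Rightarrow> 'a endo" is "(+)" .
lift_definition minus_endo :: "'a endo \<Rightarrow> 'a endo \<Rightarrow> 'a endo" is "(-)" .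
lift_definition uminus_endo :: "'a endo \<Rightarrow> 'a endo" is uminus .
lift_definition times_endo :: "'a endo \<Rightarrow> 'a endo \<Rightarrow> 'a endo" is blinfun_compose .
lift_definition scaleR_endo :: "real \<Rightarrow> 'a endo \<Rightarrow> 'a endo" is scaleR .
lift_definition norm_endo :: "'a endo \<Rightarrow> real" is norm .
lift_definition sgn_endo :: "'a endo \<Rightarrow> 'a endo" is sgn .
lift_definition dist_endo :: "'a endo \<Rightarrow> 'a endo \<Rightarrow> real" is dist .
definition uniformity_endo :: "('a endo \<times> 'a endo) filter" where
  "uniformity_endo = (INF e\<in>{0 <..}. principal {(x, y). dist x y < e})"
definition open_endo :: "'a endo set \<Rightarrow> bool" where
  "open_endo U \<longleftrightarrow> (\<forall>x\<in>U. \<forall>\<^sub>F (x', y) in uniformity. x' = x \<longrightarrow> y \<in> U)"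

instance
proof
  show "(uniformity :: ('a endo \<times> 'a endo) filter) = (INF e\<in>{0 <..}. principal {(x, y). dist x y < e})"
    by (rule uniformity_endo_def)
  show "open U \<longleftrightarrow> (\<forall>x\<in>U. \<forall>\<^sub>F (x', y) in uniformity. x' = x \<longrightarrow> y \<in> U)" for U :: "'a endo set"
    by (rule open_endo_def)
  have "(id_blinfun :: 'a \<Rightarrow>\<^sub>L 'a) \<noteq> 0"
    by (metis norm_blinfun_id norm_zero zero_neq_one)
  then show "(0::'a endo) \<noteq> 1"
    by transfer simp
  show "norm (1::'a endo) = 1"
    by transfer (rule norm_blinfun_id)
  fix x y z :: "'a endo" and r s :: real
  show "x + y + z = x + (y + z)" by transfer simp
  show "x + y = y + x" by transfer simp
  show "0 + x = x" by transfer simp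
  show "- x + x = 0" by transfer simp
  show "x - y = x + - y" by transfer simp
  show "r *\<^sub>R (x + y) = r *\<^sub>R x + r *\<^sub>R y" by transfer (simp add: algebra_simps)
  show "(r + s) *\<^sub>R x = r *\<^sub>R x + s *\<^sub>R x" by transfer (simp add: algebra_simps)
  show "r *\<^sub>R s *\<^sub>R x = (r * s) *\<^sub>R x" by transfer simp
  show "1 *\<^sub>R x = x" by transfer simp
  show "dist x y = norm (x - y)" by transfer (rule dist_norm)
  show "sgn x = inverse (norm x) *\<^sub>R x" by transfer (rule sgn_div_norm)
  show "(norm x = 0) = (x = 0)" by transfer simp
  show "norm (x + y) \<le> norm x + norm y" by transfer (rule norm_triangle_ineq)
  show "norm (r *\<^sub>R x) = \<bar>r\<bar> * norm x" by transfer simp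
  show "x * y * z = x * (y * z)" by transfer (simp add: blinfun_eqI)
  show "1 * x = x" by transfer (simp add: blinfun_eqI)
  show "x * 1 = x" by transfer (simp add: blinfun_eqI)
  show "(x + y) * z = x * z + y * z"
    by transfer (simp add: blinfun_eqI blinfun.add_left)
  show "x * (y + z) = x * y + x * z"
    by transfer (simp add: blinfun_eqI blinfun.add_right blinfun.add_left)
  show "r *\<^sub>R x * y = r *\<^sub>R (x * y)"
    by transfer (simp add: blinfun_eqI blinfun.scaleR_left)
  show "x * r *\<^sub>R y = r *\<^sub>R (x * y)"
    by transfer (simp add: blinfun_eqI blinfun.scaleR_left blinfun.scaleR_right)
  show "norm (x * y) \<le> norm x * norm y"
    by transfer (rule norm_blinfun_compose)
qed

end

instance endo :: (euclidean_space) banach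
proof
  fix X :: "nat \<Rightarrow> 'a endo"
  assume "Cauchy X"
  then have "Cauchy (\<lambda>n. Rep_endo (X n))"
    unfolding Cauchy_def by (simp add: dist_endo.rep_eq)
  then obtain L where L: "(\<lambda>n. Rep_endo (X n)) \<longlonglongrightarrow> L"
    using Cauchy_convergent convergent_def by blast
  have "X \<longlonglongrightarrow> Abs_endo L"
    using L unfolding lim_sequentially by (simp add: dist_endo.rep_eq Abs_endo_inverse)
  then show "convergent X"
    by (auto simp: convergent_def)
qed

definition endo_apply :: "'a::euclidean_space endo \<Rightarrow> 'a \<Rightarrow> 'a" where
  "endo_apply A = blinfun_apply (Rep_endo A)"

text \<open>Meaningful for linear \<open>f\<close> only, since \<open>Blinfun\<close> is unspecified
  elsewhere; hence the linearity hypotheses in all later rules.\<close>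

definition endo_of :: "('a::euclidean_space \<Rightarrow> 'a) \<Rightarrow> 'a endo" where
  "endo_of f = Abs_endo (Blinfun f)"

lemma endo_apply_of: "linear f \<Longrightarrow> endo_apply (endo_of f) = f"
  by (simp add: endo_apply_def endo_of_def Abs_endo_inverse linear_conv_bounded_linear
      bounded_linear_Blinfun_apply)

lemma endo_eqI: "(\<And>v. endo_apply A v = endo_apply B v) \<Longrightarrow> A = B"
  by (metis Rep_endo_inject blinfun_eqI endo_apply_def)

lemma endo_apply_mult [simp]: "endo_apply (A * B) v = endo_apply A (endo_apply B v)"
  by (simp add: endo_apply_def times_endo.rep_eq)

lemma endo_apply_one [simp]: "endo_apply 1 v = v"
  by (simp add: endo_apply_def one_endo.rep_eq)

lemma endo_apply_zero [simp]: "endo_apply 0 v = 0"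
  by (simp add: endo_apply_def zero_endo.rep_eq)

lemma endo_apply_add [simp]: "endo_apply (A + B) v = endo_apply A v + endo_apply B v"
  by (simp add: endo_apply_def plus_endo.rep_eq blinfun.add_left)

lemma endo_apply_diff [simp]: "endo_apply (A - B) v = endo_apply A v - endo_apply B v"
  by (simp add: endo_apply_def minus_endo.rep_eq blinfun.diff_left)

lemma endo_apply_scaleR [simp]: "endo_apply (r *\<^sub>R A) v = r *\<^sub>R endo_apply A v"
  by (simp add: endo_apply_def scaleR_endo.rep_eq blinfun.scaleR_left)

lemma linear_endo_apply: "linear (endo_apply A)"
  unfolding endo_apply_def
  by (simp add: blinfun.bounded_linear_right bounded_linear.linear)

lemma norm_endo_apply: "norm (endo_apply A v) \<le> norm A * norm v"
  unfolding endo_apply_def norm_endo.rep_eq by (rule norm_blinfun)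

lemma norm_endo_le:
  assumes "0 \<le> b" "\<And>v. norm (endo_apply A v) \<le> b * norm v"
  shows "norm A \<le> b"
  unfolding norm_endo.rep_eq
  by (rule norm_blinfun_bound) (use assms in \<open>auto simp: endo_apply_def\<close>)

lemma bounded_linear_endo_apply_left: "bounded_linear (\<lambda>A. endo_apply A v)"
  by (rule bounded_linear_intro[where K="norm v"])
    (simp_all add: norm_endo_apply)

lemma endo_of_apply: "endo_of (endo_apply A) = A"
  by (rule endo_eqI) (simp add: endo_apply_of linear_endo_apply)

lemma endo_of_add:
  "linear f \<Longrightarrow> linear g \<Longrightarrow> endo_of (\<lambda>v. f v + g v) = endo_of f + endo_of g"
  by (rule endo_eqI) (simp add: endo_apply_of linear_compose_add)

lemma endo_of_diff:
  "linear f \<Longrightarrow> linear g \<Longrightarrow> endo_of (\<lambda>v. f v - g v) = endo_of f - endo_of g"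
  by (rule endo_eqI) (simp add: endo_apply_of linear_compose_sub)

lemma endo_of_scaleR: "linear f \<Longrightarrow> endo_of (\<lambda>v. r *\<^sub>R f v) = r *\<^sub>R endo_of f"
  by (rule endo_eqI) (simp add: endo_apply_of linear_compose_scale_right)

lemma endo_of_zero: "endo_of (\<lambda>v. 0) = 0"
  by (rule endo_eqI) (simp add: endo_apply_of linear_zero)

section \<open>Exponential estimates in a Banach algebra\<close>

text \<open>\<open>A\<close> and \<open>B\<close> need not commute, so the difference is telescoped
  as A (A^n - B^n) + (A - B) B^n. The truncated exponent at n = 0 is harmless because of the factor
  n.\<close>

lemma norm_power_diff_le:
  fixes A B :: "'a::real_normed_algebra_1"
  assumes "norm A \<le> r" "norm B \<le> r"
  shows "norm (A ^ n - B ^ n) \<le> of_nat n * r ^ (n - 1) * norm (A - B)"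
proof (induction n)
  case (Suc n)
  have r: "0 \<le> r" using assms norm_ge_zero order_trans by blast
  have "A ^ Suc n - B ^ Suc n = A * (A ^ n - B ^ n) + (A - B) * B ^ n"
    by (simp add: algebra_simps)
  then have "norm (A ^ Suc n - B ^ Suc n) \<le> norm A * norm (A ^ n - B ^ n) + norm (A - B) * norm (B ^ n)"
    by (metis add_mono norm_mult_ineq norm_triangle_mono)
  also have "\<dots> \<le> r * (of_nat n * r ^ (n - 1) * norm (A - B)) + norm (A - B) * r ^ n"
    using Suc assms r
    by (intro add_mono mult_mono order_trans[OF norm_power_ineq power_mono]) auto
  also have "\<dots> = of_nat (Suc n) * r ^ (Suc n - 1) * norm (A - B)"
    by (cases n) (auto simp: algebra_simps)
  finally show ?case .
qed simp

text \<open>After the terms of degree 0 and 1 are removed, the bounds n r^(n-1) / n! for n \<ge> 2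
  add up to exp r - 1. So exp differs from the identity by a map of small Lipschitz constant near 0,
  from which its derivative at 0, its continuity and its local bijectivity follow.\<close>

lemma norm_exp_diff_le:
  fixes A B :: "'a::{real_normed_algebra_1,banach}"
  assumes "norm A \<le> r" "norm B \<le> r"
  shows "norm (exp A - exp B - (A - B)) \<le> (exp r - 1) * norm (A - B)"
proof -
  define f where "f n = (A ^ n - B ^ n) /\<^sub>R fact n" for n
  have "f sums (exp A - exp B)"
    unfolding f_def scaleR_diff_right by (intro sums_diff exp_converges)
  then have f: "(\<lambda>n. f (Suc (Suc n))) sums (exp A - exp B - (A - B))"
    by (subst sums_Suc_iff, subst sums_Suc_iff) (simp add: f_def)
  define g where "g n = r ^ n /\<^sub>R fact n" for n
  have "g sums exp r" unfolding g_def by (rule exp_converges)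
  then have "(\<lambda>n. g (Suc n)) sums (exp r - 1)"
    by (subst sums_Suc_iff) (simp add: g_def)
  then have g: "(\<lambda>n. g (Suc n) * norm (A - B)) sums ((exp r - 1) * norm (A - B))"
    by (rule sums_mult2)
  have le: "norm (f (Suc (Suc n))) \<le> g (Suc n) * norm (A - B)" for n
  proof -
    have "norm (f (Suc (Suc n))) = norm (A ^ Suc (Suc n) - B ^ Suc (Suc n)) / fact (Suc (Suc n))"
      by (simp add: f_def divide_inverse_commute)
    also have "\<dots> \<le> (of_nat (Suc (Suc n)) * r ^ Suc n * norm (A - B)) / fact (Suc (Suc n))"
      using norm_power_diff_le[OF assms, of "Suc (Suc n)"] by (intro divide_right_mono) auto
    also have "\<dots> = g (Suc n) * norm (A - B)"
      unfolding g_def by (simp add: fact_Suc[of "Suc n"] divide_inverse_commute del: fact_Suc)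
    finally show ?thesis .
  qed
  have "norm (\<Sum>n. f (Suc (Suc n))) \<le> (\<Sum>n. g (Suc n) * norm (A - B))"
    by (rule norm_suminf_le) (use le g in \<open>auto simp: sums_iff\<close>)
  then show ?thesis using f g by (simp add: sums_iff)
qed

text \<open>The logarithm is found as the fixed point of D \<mapsto> D + A - exp D, a contraction
  with factor exp r - 1 \<le> 1/2 once r \<le> 1/4.\<close>

lemma exp_near_one_onto:
  fixes A :: "'a::{real_normed_algebra_1,banach}"
  assumes "0 < r" "r \<le> 1/4" "norm (A - 1) \<le> r / 2"
  obtains D where "norm D \<le> r" "exp D = A"
proof -
  have er: "exp r - 1 \<le> 1 / 2"
  proof -
    have "r * r \<le> r * (1/4)" using assms by (intro mult_left_mono) auto
    then show ?thesis using exp_bound[of r] assms unfolding power2_eq_square by linarith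
  qed
  define T where "T D = D + A - exp D" for D
  have "\<exists>!D\<in>cball 0 r. T D = D"
  proof (rule Banach_fix[of _ "1/2"])
    show "complete (cball (0::'a) r)" by (simp add: complete_eq_closed)
    show "cball (0::'a) r \<noteq> {}" using assms by auto
    show "T ` cball 0 r \<subseteq> cball 0 r"
    proof
      fix y assume "y \<in> T ` cball 0 r"
      then obtain D where D: "norm D \<le> r" "y = T D" by auto
      have "norm (exp D - exp 0 - (D - 0)) \<le> (exp r - 1) * norm (D - 0)"
        using D assms by (intro norm_exp_diff_le) auto
      also have "\<dots> \<le> 1/2 * r" using er D by (intro mult_mono) auto
      finally have "norm (exp D - 1 - D) \<le> r / 2" by simp
      moreover have "T D = (A - 1) - (exp D - 1 - D)" by (simp add: T_def)
      ultimately have "norm (T D) \<le> r"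
        using assms norm_triangle_ineq4[of "A - 1" "exp D - 1 - D"] by simp
      then show "y \<in> cball 0 r" using D by simp
    qed
    show "dist (T x) (T y) \<le> 1 / 2 * dist x y" if "x \<in> cball 0 r" "y \<in> cball 0 r" for x y
    proof -
      have "norm (exp x - exp y - (x - y)) \<le> (exp r - 1) * norm (x - y)"
        using that by (intro norm_exp_diff_le) auto
      also have "\<dots> \<le> 1/2 * norm (x - y)" using er by (intro mult_mono) auto
      finally show ?thesis
        by (simp add: T_def dist_norm norm_minus_commute algebra_simps)
    qed
  qed auto
  then show thesis using that unfolding T_def by auto
qed

section \<open>One-parameter groups of linear maps\<close>

definition expo :: "('a::euclidean_space \<Rightarrow> 'a) \<Rightarrow> 'a \<Rightarrow> 'a" where
  "expo D = endo_apply (exp (endo_of D))"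

lemma linear_expo: "linear (expo D)"
  by (simp add: expo_def linear_endo_apply)

lemma expo_zero [simp]: "expo (\<lambda>v. 0) v = v"
  by (simp add: expo_def endo_of_zero)

lemma expo_add_commuting:
  assumes "linear D" "linear D'" "\<And>v. D (D' v) = D' (D v)"
  shows "expo (\<lambda>v. D v + D' v) v = expo D (expo D' v)"
proof -
  have "endo_of D * endo_of D' = endo_of D' * endo_of D"
    by (rule endo_eqI) (simp add: endo_apply_of assms)
  then show ?thesis
    by (simp add: expo_def endo_of_add assms exp_add_commuting)
qed

lemma expo_scaleR: "linear D \<Longrightarrow> expo (\<lambda>v. t *\<^sub>R D v) = endo_apply (exp (t *\<^sub>R endo_of D))"
  by (simp add: expo_def endo_of_scaleR)

lemma expo_has_vector_derivative:
  assumes "linear D"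
  shows "((\<lambda>t. expo (\<lambda>v. t *\<^sub>R D v) w) has_vector_derivative D (expo (\<lambda>v. t *\<^sub>R D v) w)) (at t)"
    and "((\<lambda>t. expo (\<lambda>v. t *\<^sub>R D v) w) has_vector_derivative expo (\<lambda>v. t *\<^sub>R D v) (D w)) (at t)"
  unfolding expo_scaleR[OF assms]
  using bounded_linear.has_vector_derivative[OF bounded_linear_endo_apply_left
      exp_scaleR_has_vector_derivative_left[of "endo_of D" t], of w]
    bounded_linear.has_vector_derivative[OF bounded_linear_endo_apply_left
      exp_scaleR_has_vector_derivative_right[of "endo_of D" t UNIV], of w]
  by (simp_all add: endo_apply_of assms)

lemma expo_neg_cancel:
  assumes "linear D"
  shows "expo (\<lambda>v. - D v) (expo D v) = v" "expo D (expo (\<lambda>v. - D v) v) = v"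
  using expo_add_commuting[of "\<lambda>v. - D v" D v] expo_add_commuting[of D "\<lambda>v. - D v" v] assms
  by (simp_all add: linear_compose_neg linear_neg)

lemma expo_sums:
  assumes "linear D"
  shows "(\<lambda>n. (D ^^ n) v /\<^sub>R fact n) sums expo D v"
proof -
  have "endo_apply (endo_of D ^ n) v = (D ^^ n) v" for n
    by (induction n arbitrary: v) (simp_all add: endo_apply_of assms)
  then show ?thesis
    using bounded_linear.sums[OF bounded_linear_endo_apply_left exp_converges, of "endo_of D" v]
    by (simp add: expo_def)
qed

text \<open>All terms of positive degree lie in the closed subspace \<open>S\<close> as soon as
  \<open>D v\<close> does; \<open>v\<close> itself may lie outside. This covers the motion of a
  point along an affine leaf, and with the zero subspace it yields fixed points.\<close>

lemma expo_diff_in_subspace: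
  assumes "linear D" "subspace S" "\<And>w. w \<in> S \<Longrightarrow> D w \<in> S" "D v \<in> S"
  shows "expo D v - v \<in> S"
proof -
  have "(\<lambda>n. (D ^^ Suc n) v /\<^sub>R fact (Suc n)) sums (expo D v - v)"
    using expo_sums[OF assms(1), of v] by (subst sums_Suc_iff) simp
  moreover have "(D ^^ Suc n) v \<in> S" for n
    by (induction n) (use assms in auto)
  then have "(\<Sum>i<n. (D ^^ Suc i) v /\<^sub>R fact (Suc i)) \<in> S" for n
    by (intro subspace_sum[OF assms(2)] subspace_scale[OF assms(2)])
  ultimately show ?thesis
    unfolding sums_def using closed_sequentially[OF closed_subspace[OF assms(2)], of "\<lambda>n. \<Sum>i<n. (D ^^ Suc i) v /\<^sub>R fact (Suc i)"]
    by auto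
qed

lemma expo_in_subspace:
  assumes "linear D" "subspace S" "\<And>w. w \<in> S \<Longrightarrow> D w \<in> S" "v \<in> S"
  shows "expo D v \<in> S"
  using expo_diff_in_subspace[OF assms(1,2,3), of v] assms subspace_add[OF assms(2)] by fastforce

lemma expo_fixed:
  assumes "linear D" "D v = 0"
  shows "expo D v = v"
  using expo_diff_in_subspace[OF assms(1) subspace_single_0, of v] assms linear_0[OF assms(1)] by simp

lemma expo_conj:
  assumes "linear D" "linear \<phi>" "linear D'" "\<And>v. \<phi> (D v) = D' (\<phi> v)"
  shows "\<phi> (expo D v) = expo D' (\<phi> v)"
proof -
  have "\<phi> ((D ^^ n) v) = (D' ^^ n) (\<phi> v)" for n
    by (induction n) (simp_all add: assms)
  then have "(\<lambda>n. (D' ^^ n) (\<phi> v) /\<^sub>R fact n) sums \<phi> (expo D v)"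
    using bounded_linear.sums[OF _ expo_sums[OF assms(1), of v], of \<phi>] assms(2)
    by (simp add: linear_conv_bounded_linear linear_scale)
  then show ?thesis using expo_sums[OF assms(3)] sums_unique2 by blast
qed

lemma norm_expo_diff_le:
  assumes "linear D" "0 \<le> b" "\<And>v. norm (D v) \<le> b * norm v"
  shows "norm (expo D v - v) \<le> (exp b - 1) * norm v"
    and "norm (expo D v - v - D v) \<le> (exp b - 1) * b * norm v"
proof -
  have nD: "norm (endo_of D) \<le> b"
    using assms by (intro norm_endo_le) (auto simp: endo_apply_of)
  have eb: "0 \<le> exp b - 1" using assms by simp
  have "norm (exp (endo_of D) - 1 - endo_of D) \<le> (exp b - 1) * norm (endo_of D)"
    using norm_exp_diff_le[of "endo_of D" b 0] nD assms by simp
  also have "\<dots> \<le> (exp b - 1) * b" using nD eb by (intro mult_left_mono)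
  finally have *: "norm (exp (endo_of D) - 1 - endo_of D) \<le> (exp b - 1) * b" .
  have "expo D v - v - D v = endo_apply (exp (endo_of D) - 1 - endo_of D) v"
    by (simp add: expo_def endo_apply_of assms)
  then show "norm (expo D v - v - D v) \<le> (exp b - 1) * b * norm v"
    using norm_endo_apply[of "exp (endo_of D) - 1 - endo_of D" v] *
    by (metis mult_right_mono norm_ge_zero order_trans)
  define f where "f n = (endo_of D) ^ n /\<^sub>R fact n" for n
  have f: "(\<lambda>n. f (Suc n)) sums (exp (endo_of D) - 1)"
    using exp_converges[of "endo_of D"] unfolding f_def by (subst sums_Suc_iff) simp
  define g where "g n = b ^ n /\<^sub>R fact n" for n
  have g: "(\<lambda>n. g (Suc n)) sums (exp b - 1)"
    using exp_converges[of b] unfolding g_def by (subst sums_Suc_iff) simp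
  have "norm (f n) \<le> g n" for n
    unfolding f_def g_def
    by (auto intro!: mult_left_mono order_trans[OF norm_power_ineq] power_mono nD)
  then have "norm (\<Sum>n. f (Suc n)) \<le> (\<Sum>n. g (Suc n))"
    by (intro norm_suminf_le) (use g in \<open>auto simp: sums_iff\<close>)
  then have "norm (exp (endo_of D) - 1) \<le> exp b - 1"
    using f g by (simp add: sums_iff)
  moreover have "expo D v - v = endo_apply (exp (endo_of D) - 1) v"
    by (simp add: expo_def)
  ultimately show "norm (expo D v - v) \<le> (exp b - 1) * norm v"
    using norm_endo_apply[of "exp (endo_of D) - 1" v]
    by (metis mult_right_mono norm_ge_zero order_trans)
qed

text \<open>If \<open>expo D v = v\<close>, then \<open>t \<mapsto> w \<bullet> expo (t D) v\<close> has equal values at \<open>0\<close> and \<open>1\<close>, so by Rolle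
  its derivative \<open>w \<bullet> expo (t D) (D v)\<close> vanishes somewhere; take \<open>w = D v\<close>.\<close>

lemma expo_fixed_imp_kernel:
  assumes "linear D" "0 \<le> b" "exp b < 2" "\<And>v. norm (D v) \<le> b * norm v" "expo D v = v"
  shows "D v = 0"
proof (rule ccontr)
  assume nz: "D v \<noteq> 0"
  define f where "f t = D v \<bullet> expo (\<lambda>v. t *\<^sub>R D v) v" for t
  have der: "(f has_real_derivative D v \<bullet> expo (\<lambda>v. t *\<^sub>R D v) (D v)) (at t)" for t
    unfolding f_def has_real_derivative_iff_has_vector_derivative
    using bounded_linear.has_vector_derivative[OF bounded_linear_inner_right
        expo_has_vector_derivative(2)[OF assms(1)]] .
  have "f 0 = f 1" using assms by (simp add: f_def)
  then obtain t where t: "0 < t" "t < 1" "D v \<bullet> expo (\<lambda>v. t *\<^sub>R D v) (D v) = 0"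
    using MVT2[of 0 1 f "\<lambda>t. D v \<bullet> expo (\<lambda>v. t *\<^sub>R D v) (D v)", OF _ der] by auto
  have "norm (t *\<^sub>R D w) \<le> b * norm w" for w
  proof -
    have "norm (t *\<^sub>R D w) \<le> 1 * norm (D w)" using t by (simp add: mult_left_le_one_le)
    then show ?thesis using assms(4)[of w] by linarith
  qed
  then have "norm (expo (\<lambda>v. t *\<^sub>R D v) (D v) - D v) \<le> (exp b - 1) * norm (D v)"
    using assms by (intro norm_expo_diff_le) (auto simp: linear_compose_scale_right)
  also have "\<dots> < norm (D v)" using nz assms by simp
  finally have lt: "norm (expo (\<lambda>v. t *\<^sub>R D v) (D v) - D v) < norm (D v)" .
  have "D v \<bullet> D v = - (D v \<bullet> (expo (\<lambda>v. t *\<^sub>R D v) (D v) - D v))"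
    using t by (simp add: inner_diff_right)
  also have "\<dots> \<le> norm (D v) * norm (expo (\<lambda>v. t *\<^sub>R D v) (D v) - D v)"
    using norm_cauchy_schwarz[of "- D v" "expo (\<lambda>v. t *\<^sub>R D v) (D v) - D v"] by simp
  also have "\<dots> < norm (D v) * norm (D v)" using lt nz by simp
  finally show False by (simp add: power2_norm_eq_inner[symmetric] power2_eq_square)
qed

lemma expo_onto_near_id:
  fixes \<phi> :: "'a::euclidean_space \<Rightarrow> 'a"
  assumes "linear \<phi>" "0 < r" "r \<le> 1/4" "\<And>v. norm (\<phi> v - v) \<le> r / 2 * norm v"
  obtains D where "linear D" "\<And>v. norm (D v) \<le> r * norm v" "expo D = \<phi>"
proof -
  have "norm (endo_of \<phi> - 1) \<le> r / 2"
    using assms by (intro norm_endo_le) (auto simp: endo_apply_of)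
  then obtain D where D: "norm D \<le> r" "exp D = endo_of \<phi>"
    using exp_near_one_onto assms by blast
  show thesis
  proof
    show "linear (endo_apply D)" by (rule linear_endo_apply)
    show "norm (endo_apply D v) \<le> r * norm v" for v
      using norm_endo_apply[of D v] D(1) by (meson mult_right_mono norm_ge_zero order_trans)
    show "expo (endo_apply D) = \<phi>"
      by (simp add: expo_def endo_of_apply D endo_apply_of assms)
  qed
qed

section \<open>Automorphisms near the identity\<close>

lemma bounded_bilinear_endo_apply: "bounded_bilinear endo_apply"
proof
  show "\<exists>K. \<forall>A v. norm (endo_apply A v) \<le> norm A * norm v * K"
    by (rule exI[of _ 1]) (simp add: norm_endo_apply)
qed (simp_all add: linear_add[OF linear_endo_apply] linear_scale[OF linear_endo_apply])

lemma exp_has_derivative_0: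
  "((exp :: 'a::{real_normed_algebra_1,banach} \<Rightarrow> 'a) has_derivative (\<lambda>h. h)) (at 0)"
proof (rule has_derivativeI_sandwich[where e=1])
  show "((\<lambda>h. exp (norm h) - 1) \<longlongrightarrow> 0) (at (0::'a))"
    by (rule tendsto_eq_intros refl | simp)+
  fix y :: 'a assume "y \<noteq> 0"
  show "norm (exp y - exp 0 - (y - 0)) / norm (y - 0) \<le> exp (norm (y)) - 1"
    using norm_exp_diff_le[of y "norm y" 0] \<open>y \<noteq> 0\<close> by (simp add: divide_le_eq)
qed (auto)

lemma continuous_on_exp_algebra:
  fixes f :: "'b::topological_space \<Rightarrow> 'a::{real_normed_algebra_1,banach}"
  assumes "continuous_on S f"
  shows "continuous_on S (\<lambda>x. exp (f x))"
proof -
  have "isCont exp A" for A :: 'a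
  proof -
    define r where "r = norm A + 1"
    have "(exp r)-lipschitz_on (ball 0 r) (exp :: 'a \<Rightarrow> 'a)"
    proof (rule lipschitz_onI)
      fix x y :: 'a assume "x \<in> ball 0 r" "y \<in> ball 0 r"
      then have "norm (exp x - exp y - (x - y)) \<le> (exp r - 1) * norm (x - y)"
        by (intro norm_exp_diff_le) auto
      moreover have "norm (exp x - exp y) \<le> norm (exp x - exp y - (x - y)) + norm (x - y)"
        using norm_triangle_ineq[of "exp x - exp y - (x - y)" "x - y"] by simp
      ultimately show "dist (exp x) (exp y) \<le> exp r * dist x y"
        by (simp add: dist_norm algebra_simps)
    qed simp
    then have "continuous_on (ball 0 r) (exp :: 'a \<Rightarrow> 'a)" by (rule lipschitz_on_continuous_on)
    then show ?thesis
      by (rule continuous_on_interior) (simp add: r_def)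
  qed
  then show ?thesis
    using assms by (auto intro: continuous_on_compose2[of UNIV exp] simp: continuous_on_eq_continuous_at)
qed

definition lie_aut :: "(real^'n \<Rightarrow> real^'n \<Rightarrow> real^'n) \<Rightarrow> (real^'n \<Rightarrow> real^'n) \<Rightarrow> bool" where
  "lie_aut br \<phi> \<longleftrightarrow> linear \<phi> \<and> (\<forall>U V. \<phi> (br U V) = br (\<phi> U) (\<phi> V))"

text \<open>An operator norm neighbourhood of the identity, used in place of a topology on the
  automorphism group.\<close>

definition near_id :: "real \<Rightarrow> ('a::real_normed_vector \<Rightarrow> 'a) \<Rightarrow> bool" where
  "near_id d \<phi> \<longleftrightarrow> (\<forall>v. norm (\<phi> v - v) \<le> d * norm v)"

lemma near_id_mono: "near_id d \<phi> \<Longrightarrow> d \<le> d' \<Longrightarrow> near_id d' \<phi>"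
  unfolding near_id_def by (meson mult_right_mono norm_ge_zero order_trans)

text \<open>Turns pointwise closeness on finitely many vectors into closeness in norm, so that
  pointwise continuity of a family of operators suffices. The divisor pays for the sum over the
  coordinates.\<close>

lemma near_id_axis:
  fixes \<phi> :: "real^'n \<Rightarrow> real^'n"
  assumes "linear \<phi>" "\<And>i. norm (\<phi> (axis i 1) - axis i 1) \<le> d / CARD('n)"
  shows "near_id d \<phi>"
  unfolding near_id_def
proof
  fix v :: "real^'n"
  have "\<phi> v - v = (\<Sum>i\<in>UNIV. v $ i *\<^sub>R (\<phi> (axis i 1) - axis i 1))"
    using arg_cong[OF basis_expansion[of v], of \<phi>] basis_expansion[of v]
    by (simp add: linear_sum[OF assms(1)] linear_scale[OF assms(1)] scalar_mult_eq_scaleR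
        scaleR_diff_right sum_subtractf)
  then have "norm (\<phi> v - v) \<le> (\<Sum>i\<in>UNIV. norm (v $ i *\<^sub>R (\<phi> (axis i 1) - axis i 1)))"
    using norm_sum by metis
  also have "\<dots> \<le> (\<Sum>i\<in>(UNIV :: 'n set). norm v * (d / CARD('n)))"
    unfolding norm_scaleR by (intro sum_mono mult_mono component_le_norm_cart assms(2)) auto
  also have "\<dots> = d * norm v" by simp
  finally show "norm (\<phi> v - v) \<le> d * norm v" .
qed

lemma near_id_conj:
  fixes \<gamma> \<gamma>' :: "'a::euclidean_space \<Rightarrow> 'a"
  assumes "linear \<gamma>" "linear \<gamma>'" "\<And>v. \<gamma> (\<gamma>' v) = v"
  obtains C where "C > 0"
    "\<And>d (\<phi> :: 'a \<Rightarrow> 'a). near_id d \<phi> \<Longrightarrow> near_id (C * d) (\<lambda>v. \<gamma> (\<phi> (\<gamma>' v)))"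
proof -
  obtain B where B: "B > 0" "\<And>v. norm (\<gamma> v) \<le> B * norm v" using linear_bounded_pos[OF assms(1)] by blast
  obtain B' where B': "B' > 0" "\<And>v. norm (\<gamma>' v) \<le> B' * norm v" using linear_bounded_pos[OF assms(2)] by blast
  show thesis
  proof
    show "B * B' > 0" using B B' by simp
    fix d and \<phi> :: "'a \<Rightarrow> 'a" assume n: "near_id d \<phi>"
    show "near_id (B * B' * d) (\<lambda>v. \<gamma> (\<phi> (\<gamma>' v)))"
      unfolding near_id_def
    proof
      fix v
      have d0: "d \<ge> 0"
      proof -
        obtain b :: 'a where "b \<in> Basis" using nonempty_Basis by blast
        then have "0 \<le> d * norm b" using n norm_ge_zero order_trans unfolding near_id_def by blast
        then show ?thesis using \<open>b \<in> Basis\<close> by simp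
      qed
      have "\<gamma> (\<phi> (\<gamma>' v)) - v = \<gamma> (\<phi> (\<gamma>' v) - \<gamma>' v)"
        by (simp add: linear_diff[OF assms(1)] assms(3))
      also have "norm \<dots> \<le> B * (d * (B' * norm v))"
        using B(1) d0
        by (intro order_trans[OF B(2)] mult_left_mono order_trans[OF n[unfolded near_id_def, rule_format]] B'(2)) auto
      finally show "norm (\<gamma> (\<phi> (\<gamma>' v)) - v) \<le> B * B' * d * norm v" by (simp add: mult_ac)
    qed
  qed
qed

lemma near_id_comp:
  assumes "near_id d \<phi>" "near_id d' \<psi>" "0 \<le> d"
  shows "near_id (d * (1 + d') + d') (\<lambda>v. \<phi> (\<psi> v))"
  unfolding near_id_def
proof
  fix v
  have 1: "norm (\<psi> v - v) \<le> d' * norm v" using assms by (simp add: near_id_def)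
  have "norm (\<psi> v) \<le> norm v + norm (\<psi> v - v)" using norm_triangle_ineq[of v "\<psi> v - v"] by simp
  then have "norm (\<psi> v) \<le> (1 + d') * norm v" using 1 by (simp add: algebra_simps)
  moreover have "norm (\<phi> (\<psi> v) - \<psi> v) \<le> d * norm (\<psi> v)" using assms by (simp add: near_id_def)
  ultimately have "norm (\<phi> (\<psi> v) - \<psi> v) \<le> d * ((1 + d') * norm v)"
    using assms(3) by (meson mult_left_mono order_trans)
  moreover have "norm (\<phi> (\<psi> v) - v) \<le> norm (\<phi> (\<psi> v) - \<psi> v) + norm (\<psi> v - v)"
    using norm_triangle_ineq[of "\<phi> (\<psi> v) - \<psi> v" "\<psi> v - v"] by simp
  ultimately show "norm (\<phi> (\<psi> v) - v) \<le> (d * (1 + d') + d') * norm v"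
    using 1 by (simp add: algebra_simps)
qed

lemma lie_aut_comp: "lie_aut br \<phi> \<Longrightarrow> lie_aut br \<psi> \<Longrightarrow> lie_aut br (\<lambda>v. \<phi> (\<psi> v))"
  unfolding lie_aut_def by (auto simp: linear_compose[unfolded o_def])

lemma lie_aut_id: "lie_aut br (\<lambda>v. v)"
  unfolding lie_aut_def by (auto simp: linear_ident)

section \<open>Derivations and automorphisms of a bracket\<close>

locale bilinear_bracket =
  fixes br :: "real^'n \<Rightarrow> real^'n \<Rightarrow> real^'n"
  assumes bilinear_br: "bilinear br"
begin

lemma linear_br: "linear (br X)" and linear_br_left: "linear (\<lambda>X. br X Y)"
  using bilinear_br by (auto simp: bilinear_def)

lemma bounded_bilinear_br: "bounded_bilinear br"
  using bilinear_br by (simp add: bilinear_conv_bounded_bilinear)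

sublocale br: bounded_bilinear br by (rule bounded_bilinear_br)

lemma br_bounded: obtains K where "K > 0" "\<And>X Y. norm (br X Y) \<le> K * norm X * norm Y"
proof -
  obtain K where "0 < K" "\<And>X Y. norm (br X Y) \<le> norm X * norm Y * K"
    using br.pos_bounded by blast
  then show thesis by (intro that[of K]) (auto simp: mult_ac)
qed

lemma br_fun:
  "br (X + Y) = (\<lambda>v. br X v + br Y v)" "br (X - Y) = (\<lambda>v. br X v - br Y v)"
  "br (c *\<^sub>R X) = (\<lambda>v. c *\<^sub>R br X v)" "br (- X) = (\<lambda>v. - br X v)" "br 0 = (\<lambda>v. 0)"
  by (simp_all add: fun_eq_iff br.add_left br.diff_left br.scaleR_left br.minus_left br.zero_left)

text \<open>The path expo (-t D) [expo (t D) U, expo (t D) V] has zero derivative, so its values at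
  0 and 1 agree.\<close>

lemma expo_derivation_aut:
  assumes "linear D" "\<And>U V. D (br U V) = br (D U) V + br U (D V)"
  shows "lie_aut br (expo D)"
  unfolding lie_aut_def
proof (intro conjI allI)
  show "linear (expo D)" by (rule linear_expo)
  fix U V
  define e where "e t w = expo (\<lambda>v. t *\<^sub>R D v) w" for t w
  define e' where "e' t w = expo (\<lambda>v. t *\<^sub>R - D v) w" for t w
  have lD: "linear (\<lambda>v. - D v)" by (rule linear_compose_neg[OF assms(1)])
  have de: "((\<lambda>t. e t w) has_vector_derivative D (e t w)) (at t)" for t w
    unfolding e_def by (rule expo_has_vector_derivative[OF assms(1)])
  have de': "((\<lambda>t. exp (t *\<^sub>R endo_of (\<lambda>v. - D v))) has_vector_derivative
      exp (t *\<^sub>R endo_of (\<lambda>v. - D v)) * endo_of (\<lambda>v. - D v)) (at t)" for t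
    by (rule exp_scaleR_has_vector_derivative_right)
  have e'_eq: "e' t w = endo_apply (exp (t *\<^sub>R endo_of (\<lambda>v. - D v))) w" for t w
    unfolding e'_def using expo_scaleR[OF lD, of t] by simp
  have "((\<lambda>t. e' t (br (e t U) (e t V))) has_vector_derivative 0) (at t)" for t
  proof -
    note bounded_bilinear.has_vector_derivative[OF bounded_bilinear_endo_apply de'[of t]
        bounded_bilinear.has_vector_derivative[OF bounded_bilinear_br de[of U] de[of V]]]
    then show ?thesis unfolding e'_eq
      by (simp add: endo_apply_of[OF lD] assms(2) linear_diff[OF linear_endo_apply]
          linear_add[OF linear_endo_apply] linear_neg[OF linear_endo_apply] algebra_simps)
  qed
  then have "e' 1 (br (e 1 U) (e 1 V)) = e' 0 (br (e 0 U) (e 0 V))"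
    by (intro has_derivative_zero_unique[of UNIV, simplified]) (auto simp: has_vector_derivative_def)
  then have "expo (\<lambda>v. - D v) (br (expo D U) (expo D V)) = br U V"
    by (simp add: e_def e'_def)
  then show "expo D (br U V) = br (expo D U) (expo D V)"
    using expo_neg_cancel(2)[OF assms(1)] by metis
qed

text \<open>The defect \<open>\<delta>\<close> of \<open>D\<close> from being a derivation is transported along \<open>expo (s D)\<close>, and the path
  \<open>expo (- s D) [expo (s D) U, expo (s D) V]\<close> has equal ends; by Rolle a transported copy of \<open>\<delta>\<close> is
  orthogonal to \<open>\<delta>\<close>, which is absurd for small \<open>D\<close> at a point where \<open>\<delta>\<close> attains its norm.\<close>

lemma expo_aut_derivation:
  assumes D: "linear D" "\<And>v. norm (D v) \<le> b * norm v" "0 \<le> b" "exp b \<le> 9/8"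
    and aut: "lie_aut br (expo D)"
  shows "D (br U V) = br (D U) V + br U (D V)"
proof -
  define \<delta> where "\<delta> U V = br (D U) V + br U (D V) - D (br U V)" for U V
  have blD: "bounded_linear D" using D(1) linear_conv_bounded_linear by blast
  have bil: "bilinear \<delta>"
    unfolding \<delta>_def bilinear_def
    by (auto intro!: linearI simp: br.add_left br.add_right br.scaleR_left br.scaleR_right
        linear_add[OF D(1)] linear_scale[OF D(1)] algebra_simps)
  interpret \<delta>: bounded_bilinear \<delta> using bil by (simp add: bilinear_conv_bounded_bilinear)
  have "compact (sphere (0::real^'n) 1 \<times> sphere (0::real^'n) 1)"
    by (intro compact_Times compact_sphere)
  moreover have "sphere (0::real^'n) 1 \<times> sphere (0::real^'n) 1 \<noteq> {}"
    by (simp add: Times_empty)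
  moreover have "continuous_on (sphere (0::real^'n) 1 \<times> sphere (0::real^'n) 1) (\<lambda>p. norm (\<delta> (fst p) (snd p)))"
    by (intro continuous_intros \<delta>.continuous_on)
  ultimately obtain p where p: "p \<in> sphere (0::real^'n) 1 \<times> sphere (0::real^'n) 1"
      and pm: "\<And>q. q \<in> sphere (0::real^'n) 1 \<times> sphere (0::real^'n) 1 \<Longrightarrow>
        norm (\<delta> (fst q) (snd q)) \<le> norm (\<delta> (fst p) (snd p))"
    using continuous_attains_sup[of "sphere (0::real^'n) 1 \<times> sphere (0::real^'n) 1" "\<lambda>p. norm (\<delta> (fst p) (snd p))"]
    by blast
  define U0 V0 where "U0 = fst p" and "V0 = snd p"
  define M where "M = norm (\<delta> U0 V0)"
  have n1: "norm U0 = 1" "norm V0 = 1" using p by (auto simp: U0_def V0_def)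
  have M: "norm (\<delta> U V) \<le> M * norm U * norm V" for U V
  proof (cases "U = 0 \<or> V = 0")
    case False
    have "norm (\<delta> (U /\<^sub>R norm U) (V /\<^sub>R norm V)) \<le> M"
      using pm[of "(U /\<^sub>R norm U, V /\<^sub>R norm V)"] False by (simp add: M_def U0_def V0_def)
    then show ?thesis using False
      by (simp add: \<delta>.scaleR_left \<delta>.scaleR_right field_simps)
  qed (auto simp: \<delta>.zero_left \<delta>.zero_right)
  have "M = 0"
  proof (rule ccontr)
    assume "M \<noteq> 0"
    then have Mpos: "M > 0" by (simp add: M_def)
    define e where "e t w = expo (\<lambda>v. t *\<^sub>R D v) w" for t w
    define e' where "e' t w = expo (\<lambda>v. t *\<^sub>R - D v) w" for t w
    have lD: "linear (\<lambda>v. - D v)" by (rule linear_compose_neg[OF D(1)])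
    have de: "((\<lambda>t. e t w) has_vector_derivative D (e t w)) (at t)" for t w
      unfolding e_def by (rule expo_has_vector_derivative[OF D(1)])
    have de': "((\<lambda>t. exp (t *\<^sub>R endo_of (\<lambda>v. - D v))) has_vector_derivative
        exp (t *\<^sub>R endo_of (\<lambda>v. - D v)) * endo_of (\<lambda>v. - D v)) (at t)" for t
      by (rule exp_scaleR_has_vector_derivative_right)
    have e'_eq: "e' t w = endo_apply (exp (t *\<^sub>R endo_of (\<lambda>v. - D v))) w" for t w
      unfolding e'_def using expo_scaleR[OF lD, of t] by simp
    define w where "w = \<delta> U0 V0"
    have der: "((\<lambda>t. e' t (br (e t U0) (e t V0))) has_vector_derivative e' t (\<delta> (e t U0) (e t V0))) (at t)" for t
    proof -
      note bounded_bilinear.has_vector_derivative[OF bounded_bilinear_endo_apply de'[of t]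
          bounded_bilinear.has_vector_derivative[OF bounded_bilinear_br de[of U0] de[of V0]]]
      then show ?thesis unfolding e'_eq \<delta>_def
        by (simp add: endo_apply_of[OF lD] linear_diff[OF linear_endo_apply]
            linear_add[OF linear_endo_apply] linear_neg[OF linear_endo_apply] algebra_simps)
    qed
    define f where "f t = w \<bullet> e' t (br (e t U0) (e t V0))" for t
    have df: "(f has_real_derivative w \<bullet> e' t (\<delta> (e t U0) (e t V0))) (at t)" for t
      unfolding f_def has_real_derivative_iff_has_vector_derivative
      using bounded_linear.has_vector_derivative[OF bounded_linear_inner_right der] .
    have "br (expo D U0) (expo D V0) = expo D (br U0 V0)"
      using aut by (simp add: lie_aut_def)
    then have "f 0 = f 1"
      by (simp add: f_def e_def e'_def expo_neg_cancel[OF D(1)])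
    then obtain t where t: "0 < t" "t < 1" "w \<bullet> e' t (\<delta> (e t U0) (e t V0)) = 0"
      using MVT2[of 0 1 f "\<lambda>t. w \<bullet> e' t (\<delta> (e t U0) (e t V0))", OF _ df] by auto
    have tb: "norm (t *\<^sub>R D v) \<le> b * norm v" "norm (t *\<^sub>R - D v) \<le> b * norm v" for v
    proof -
      have "\<bar>t\<bar> * norm (D v) \<le> 1 * norm (D v)" using t by (intro mult_right_mono) auto
      then show "norm (t *\<^sub>R D v) \<le> b * norm v" "norm (t *\<^sub>R - D v) \<le> b * norm v"
        using D(2)[of v] by auto
    qed
    have small: "norm (e t v - v) \<le> 1/8 * norm v" "norm (e' t v - v) \<le> 1/8 * norm v" for v
    proof -
      have "norm (e t v - v) \<le> (exp b - 1) * norm v"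
        unfolding e_def using tb D by (intro norm_expo_diff_le linear_compose_scale_right) auto
      moreover have "norm (e' t v - v) \<le> (exp b - 1) * norm v"
        unfolding e'_def using tb D lD by (intro norm_expo_diff_le linear_compose_scale_right) auto
      moreover have "(exp b - 1) * norm v \<le> 1/8 * norm v"
        using D(4) by (intro mult_right_mono) auto
      ultimately show "norm (e t v - v) \<le> 1/8 * norm v" "norm (e' t v - v) \<le> 1/8 * norm v" by linarith+
    qed
    have le: "norm (e t v) \<le> 9/8 * norm v" for v
      using small(1)[of v] norm_triangle_sub[of "e t v" v] by simp
    define a where "a = \<delta> (e t U0) (e t V0)"
    have na: "norm a \<le> M * (9/8) * (9/8)"
      unfolding a_def using le[of U0] le[of V0] n1 Mpos
      by (intro order_trans[OF M] mult_mono) auto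
    have "a - w = \<delta> (e t U0 - U0) (e t V0) + \<delta> U0 (e t V0 - V0)"
      by (simp add: a_def w_def \<delta>.diff_left \<delta>.diff_right)
    moreover have "norm (\<delta> (e t U0 - U0) (e t V0)) \<le> M * (1/8) * (9/8)"
      using small(1)[of U0] le[of V0] n1 Mpos by (intro order_trans[OF M] mult_mono) auto
    moreover have "norm (\<delta> U0 (e t V0 - V0)) \<le> M * 1 * (1/8)"
      using small(1)[of V0] n1 Mpos by (intro order_trans[OF M] mult_mono) auto
    ultimately have 1: "norm (a - w) \<le> M * (1/8) * (9/8) + M * 1 * (1/8)"
      using norm_triangle_mono by metis
    have 2: "norm (e' t a - a) \<le> 1/8 * norm a" by (rule small(2))
    have "norm (e' t a - w) \<le> norm (e' t a - a) + norm (a - w)"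
      using norm_triangle_ineq[of "e' t a - a" "a - w"] by simp
    \<comment> \<open>The errors are at most 17/64 and 81/512 of \<open>M\<close>, together
      217/512.\<close>
    then have lt: "norm (e' t a - w) < M" using 1 2 na Mpos by simp
    have "w \<bullet> w = - (w \<bullet> (e' t a - w))" using t by (simp add: inner_diff_right a_def)
    also have "\<dots> \<le> norm w * norm (e' t a - w)"
      using norm_cauchy_schwarz[of "- w" "e' t a - w"] by simp
    also have "\<dots> < norm w * M" using lt Mpos by (intro mult_strict_left_mono) (auto simp: w_def M_def)
    finally show False by (simp add: w_def M_def power2_norm_eq_inner[symmetric] power2_eq_square)
  qed
  then have "\<delta> U V = 0" using M[of U V] by simp
  then show ?thesis by (simp add: \<delta>_def)
qed

lemma norm_expo_br_near:
  assumes "0 < d"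
  obtains r where "r > 0" "\<And>Y. norm Y \<le> r \<Longrightarrow> near_id d (expo (br Y))"
proof -
  obtain K where K: "K > 0" "\<And>X Y. norm (br X Y) \<le> K * norm X * norm Y" using br_bounded by blast
  define r where "r = ln (1 + d) / K"
  have r: "r > 0" "exp (K * r) - 1 = d" using assms K(1) by (auto simp: r_def)
  show thesis
  proof
    show "r > 0" by fact
    fix Y :: "real^'n" assume Y: "norm Y \<le> r"
    show "near_id d (expo (br Y))"
      unfolding near_id_def
    proof
      fix v
      have "norm (br Y v) \<le> K * r * norm v" for v
        using K Y by (intro order_trans[OF K(2)] mult_right_mono mult_left_mono) auto
      then have "norm (expo (br Y) v - v) \<le> (exp (K * r) - 1) * norm v"
        using K r by (intro norm_expo_diff_le) (auto simp: linear_br)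
      also have "\<dots> \<le> d * norm v" using r by (intro mult_right_mono) auto
      finally show "norm (expo (br Y) v - v) \<le> d * norm v" .
    qed
  qed
qed

lemma linear_endo_of_br: "linear (\<lambda>Y. endo_of (br Y))"
  by (rule linearI)
    (auto simp: br_fun endo_of_add endo_of_scaleR linear_br)

lemma continuous_on_expo_br:
  assumes "continuous_on S f" "continuous_on S g"
  shows "continuous_on S (\<lambda>x. expo (br (f x)) (g x))"
proof -
  have "bounded_linear (\<lambda>Y. endo_of (br Y))"
    using linear_endo_of_br linear_conv_bounded_linear by blast
  then have "continuous_on S (\<lambda>x. endo_of (br (f x)))"
    using assms(1) by (rule bounded_linear.continuous_on)
  then show ?thesis
    unfolding expo_def
    by (intro bounded_bilinear.continuous_on[OF bounded_bilinear_endo_apply] continuous_on_exp_algebra assms)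
qed

text \<open>Taken only where the exponent vanishes: there the derivative of exp is the identity,
  whereas at other points it would involve the commutators of the exponent with its
  increment.\<close>

lemma expo_br_has_derivative:
  assumes "(f has_derivative f') (at x within S)" "f x = 0" "(g has_derivative g') (at x within S)"
  shows "((\<lambda>x. expo (br (f x)) (g x)) has_derivative (\<lambda>v. br (f' v) (g x) + g' v)) (at x within S)"
proof -
  have bl: "bounded_linear (\<lambda>Y. endo_of (br Y))"
    using linear_endo_of_br linear_conv_bounded_linear by blast
  have "((\<lambda>x. endo_of (br (f x))) has_derivative (\<lambda>v. endo_of (br (f' v)))) (at x within S)"
    by (rule bounded_linear.has_derivative[OF bl assms(1)])
  moreover have "(exp has_derivative (\<lambda>h. h)) (at (endo_of (br (f x))))"
    using exp_has_derivative_0 assms(2) by (simp add: endo_of_zero br_fun)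
  ultimately have "((\<lambda>x. exp (endo_of (br (f x)))) has_derivative (\<lambda>v. endo_of (br (f' v)))) (at x within S)"
    by (rule has_derivative_compose)
  from bounded_bilinear.FDERIV[OF bounded_bilinear_endo_apply this assms(3)]
  show ?thesis
    unfolding expo_def
    by (simp add: assms(2) br_fun endo_of_zero endo_apply_of linear_br add.commute)
qed

end

locale lie_alg = bilinear_bracket +
  assumes br_self [simp]: "br X X = 0"
    and jacobi: "br X (br Y Z) + br Y (br Z X) + br Z (br X Y) = 0"
begin

lemma br_anticomm: "br Y X = - br X Y"
proof -
  have "br (X + Y) (X + Y) = br X X + br Y X + (br X Y + br Y Y)"
    by (simp only: br.add_left br.add_right)
  then have "br X Y + br Y X = 0" by (simp add: add.commute)
  then show ?thesis by (simp add: eq_neg_iff_add_eq_0 add.commute)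
qed

lemma br_derivation: "br X (br U V) = br (br X U) V + br U (br X V)"
proof -
  have "br U (br V X) = - br U (br X V)"
    using br_anticomm[of V X] by (metis br.minus_right)
  moreover have "br V (br X U) = - br (br X U) V" by (rule br_anticomm)
  ultimately have "br X (br U V) + - br U (br X V) + - br (br X U) V = 0"
    using jacobi[of X U V] by (simp only:)
  then have "br X (br U V) - br U (br X V) - br (br X U) V = 0"
    by (simp only: diff_conv_add_uminus)
  then show ?thesis by (simp only: right_minus_eq diff_eq_eq add_0)
qed

lemma br_br: "br (br X Y) Z = br X (br Y Z) - br Y (br X Z)"
  unfolding br_derivation[of X Y Z] by (simp only: add_diff_cancel_right')

lemma expo_br_aut: "lie_aut br (expo (br Y))"
  by (rule expo_derivation_aut[of "br Y", OF linear_br br_derivation])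

lemma expo_br_inverse:
  "expo (br (- Y)) (expo (br Y) v) = v" "expo (br Y) (expo (br (- Y)) v) = v"
  using expo_neg_cancel[OF linear_br, of Y v] by (simp_all add: br_fun)

lemma lie_aut_expo:
  assumes "lie_aut br \<phi>"
  shows "\<phi> (expo (br Y) v) = expo (br (\<phi> Y)) (\<phi> v)"
  using assms by (intro expo_conj[of "br Y" \<phi> "br (\<phi> Y)"] linear_br) (auto simp: lie_aut_def)

end

section \<open>Traces and the Killing form\<close>

lemma trace_matrix_comp:
  fixes f g :: "real^'n \<Rightarrow> real^'n"
  assumes "linear f" "linear g"
  shows "trace (matrix (\<lambda>v. f (g v))) = trace (matrix (\<lambda>v. g (f v)))"
  using matrix_compose[OF assms] matrix_compose[OF assms(2,1)] trace_mul_sym[of "matrix f" "matrix g"]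
  by (simp add: o_def)

lemma trace_matrix_add:
  "trace (matrix (\<lambda>v. f v + g v)) = trace (matrix f) + trace (matrix (g :: real^'n \<Rightarrow> real^'n))"
  by (simp add: trace_def matrix_def sum.distrib)

lemma trace_matrix_diff:
  "trace (matrix (\<lambda>v. f v - g v)) = trace (matrix f) - trace (matrix (g :: real^'n \<Rightarrow> real^'n))"
  by (simp add: trace_def matrix_def sum_subtractf)

lemma trace_matrix_scaleR:
  "trace (matrix (\<lambda>v. c *\<^sub>R f v)) = c * trace (matrix (f :: real^'n \<Rightarrow> real^'n))"
  by (simp add: trace_def matrix_def sum_distrib_left)

context lie_alg
begin

lemma linear_br_br: "linear (\<lambda>Z. br X (br Y Z))"
  using linear_compose[OF linear_br linear_br, of X Y] linear_compose[OF linear_br linear_br, of Y X] by (simp add: o_def)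

lemma killing_commute: "killing br X Y = killing br Y X"
  unfolding killing_def by (rule trace_matrix_comp[of "br X" "br Y", OF linear_br linear_br])

lemma killing_bilinear: "bilinear (killing br)"
proof -
  have "linear (killing br X)" for X
    unfolding killing_def
    by (rule linearI) (simp_all add: br.add_left br.add_right br.scaleR_left br.scaleR_right
        trace_matrix_add trace_matrix_scaleR)
  moreover have "linear (\<lambda>X. killing br X Y)" for Y
  proof -
    have "(\<lambda>X. killing br X Y) = killing br Y" using killing_commute by blast
    then show ?thesis using calculation by simp
  qed
  ultimately show ?thesis by (simp add: bilinear_def)
qed

sublocale killing: bounded_bilinear "killing br"
  using killing_bilinear by (simp add: bilinear_conv_bounded_bilinear)

lemma killing_invariant: "killing br (br X Y) Z = killing br X (br Y Z)"
proof -
  have "killing br (br X Y) Z = trace (matrix (\<lambda>v. br X (br Y (br Z v)))) - trace (matrix (\<lambda>v. br Y (br X (br Z v))))"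
    unfolding killing_def br_br trace_matrix_diff ..
  also have "trace (matrix (\<lambda>v. br Y (br X (br Z v)))) = trace (matrix (\<lambda>v. br X (br Z (br Y v))))"
    by (rule trace_matrix_comp[of "br Y" "\<lambda>v. br X (br Z v)", OF linear_br linear_br_br])
  also have "trace (matrix (\<lambda>v. br X (br Y (br Z v)))) - \<dots> = killing br X (br Y Z)"
    unfolding killing_def br_br br.diff_right trace_matrix_diff ..
  finally show ?thesis .
qed

lemma killing_aut:
  assumes "lie_aut br \<phi>" "\<And>v. \<phi> (\<psi> v) = v" "\<And>v. \<psi> (\<phi> v) = v"
  shows "killing br (\<phi> X) (\<phi> Y) = killing br X Y"
proof -
  have l: "linear \<phi>" using assms(1) by (simp add: lie_aut_def)
  have l': "linear \<psi>"
    by (rule linearI) (metis assms(2,3) linear_add[OF l], metis assms(2,3) linear_scale[OF l])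
  have "br (\<phi> X) (br (\<phi> Y) v) = \<phi> (br X (br Y (\<psi> v)))" for v
    using assms by (simp add: lie_aut_def)
  then have "killing br (\<phi> X) (\<phi> Y) = trace (matrix (\<lambda>v. \<phi> (br X (br Y (\<psi> v)))))"
    by (simp add: killing_def)
  also have "\<dots> = trace (matrix (\<lambda>v. br X (br Y (\<psi> (\<phi> v)))))"
    using linear_compose[OF l' linear_br_br, of X Y]
    by (intro trace_matrix_comp[of \<phi> "\<lambda>v. br X (br Y (\<psi> v))", OF l]) (simp add: o_def)
  finally show ?thesis by (simp add: assms killing_def)
qed

end

section \<open>Semisimplicity: automorphisms near the identity are inner\<close>

locale semisimple_lie_alg = lie_alg +
  assumes killing_nondeg: "(\<And>Y. killing br X Y = 0) \<Longrightarrow> X = 0"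
begin

lemma centre_trivial: "(\<And>Y. br X Y = 0) \<Longrightarrow> X = 0"
  by (rule killing_nondeg) (simp add: killing_def matrix_def trace_def)

text \<open>The functional Z \<mapsto> tr (D ad Z) is represented through the Killing form by some
  \<open>Y\<close>. Then D0 = D - ad Y is a derivation with tr (D0 ad Z) = 0 for all Z. As ad (D0 U)
  is the commutator of D0 and ad U, B (D0 U, V) equals tr (D0 ad [U, V]) = 0, so D0 vanishes by
  nondegeneracy.\<close>

lemma derivation_inner:
  assumes "linear D" "\<And>U V. D (br U V) = br (D U) V + br U (D V)"
  obtains Y where "D = br Y"
proof -
  define T where "T Y = (\<chi> i. killing br Y (axis i 1))" for Y
  have lT: "linear T"
    by (rule linearI) (simp_all add: T_def killing.add_left killing.scaleR_left vec_eq_iff)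
  have "inj T"
  proof (rule linear_injective_0[OF lT, THEN iffD2], intro allI impI)
    fix Y assume "T Y = 0"
    then have k: "killing br Y (axis i 1) = 0" for i by (simp add: T_def vec_eq_iff)
    have "killing br Y Z = 0" for Z
    proof -
      have "killing br Y (\<Sum>i\<in>UNIV. Z $ i *\<^sub>R axis i 1) = 0"
        by (simp add: killing.sum_right killing.scaleR_right k)
      then show ?thesis using basis_expansion[of Z] by (simp add: scalar_mult_eq_scaleR)
    qed
    then show "Y = 0" by (rule killing_nondeg)
  qed
  then have "surj T" using linear_injective_imp_surjective lT by blast
  define q where "q Z = trace (matrix (\<lambda>v. D (br Z v)))" for Z
  have lq: "linear q"
    by (rule linearI) (simp_all add: q_def br.add_left br.scaleR_left linear_add[OF assms(1)]
        linear_scale[OF assms(1)] trace_matrix_add trace_matrix_scaleR)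
  obtain Y where Y: "T Y = (\<chi> i. q (axis i 1))" using \<open>surj T\<close> by (metis surjD)
  have kq: "killing br Y Z = q Z" for Z
  proof -
    have "killing br Y (\<Sum>i\<in>UNIV. Z $ i *\<^sub>R axis i 1) = q (\<Sum>i\<in>UNIV. Z $ i *\<^sub>R axis i 1)"
      using Y by (simp add: killing.sum_right killing.scaleR_right linear_sum[OF lq] linear_scale[OF lq]
          T_def vec_eq_iff)
    then show ?thesis using basis_expansion[of Z] by (simp add: scalar_mult_eq_scaleR)
  qed
  define D0 where "D0 v = D v - br Y v" for v
  have l0: "linear D0" unfolding D0_def by (intro linear_compose_sub assms linear_br)
  have d0: "D0 (br U V) = br (D0 U) V + br U (D0 V)" for U V
    unfolding D0_def assms(2) br_derivation[of Y] by (simp add: br.diff_left br.diff_right)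
  have tr0: "trace (matrix (\<lambda>v. D0 (br Z v))) = 0" for Z
    using kq[of Z] unfolding D0_def trace_matrix_diff by (simp add: q_def killing_def)
  have "D0 U = 0" for U
  proof (rule killing_nondeg)
    fix V
    have "br (D0 U) (br V v) = D0 (br U (br V v)) - br U (D0 (br V v))" for v
      by (simp add: d0)
    then have "killing br (D0 U) V = trace (matrix (\<lambda>v. D0 (br U (br V v)))) - trace (matrix (\<lambda>v. br U (D0 (br V v))))"
      by (simp add: killing_def trace_matrix_diff)
    also have "trace (matrix (\<lambda>v. br U (D0 (br V v)))) = trace (matrix (\<lambda>v. D0 (br V (br U v))))"
      using linear_compose[OF linear_br l0, of V] by (intro trace_matrix_comp[of "br U" "\<lambda>v. D0 (br V v)", OF linear_br]) (simp add: o_def)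
    also have "trace (matrix (\<lambda>v. D0 (br U (br V v)))) - \<dots> = trace (matrix (\<lambda>v. D0 (br (br U V) v)))"
      unfolding br_br linear_diff[OF l0] trace_matrix_diff ..
    finally show "killing br (D0 U) V = 0" by (simp add: tr0)
  qed
  then have "D = br Y" by (auto simp: D0_def)
  then show thesis by (rule that)
qed

text \<open>A linear map from operators to the algebra that recovers \<open>Y\<close> from ad Y,
  which exists since the centre is trivial. Written through the images of basis vectors it applies
  to every operator, and along a family of operators pointwise continuity makes it
  continuous.\<close>

lemma ad_left_inverse:
  obtains P :: "'a \<Rightarrow> real^'a \<Rightarrow> real^'a"
  where "\<And>i. linear (P i)" "\<And>Y. (\<Sum>i\<in>UNIV. P i (br Y (axis i 1))) = Y"
proof -
  define f where "f Y = (\<chi> i. br Y (axis i 1))" for Y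
  have lf: "linear f"
    by (rule linearI) (simp_all add: f_def br.add_left br.scaleR_left vec_eq_iff)
  have "inj f"
  proof (rule linear_injective_0[OF lf, THEN iffD2], intro allI impI)
    fix Y assume "f Y = 0"
    then have k: "br Y (axis i 1) = 0" for i by (simp add: f_def vec_eq_iff)
    have "br Y Z = 0" for Z
    proof -
      have "br Y (\<Sum>i\<in>UNIV. Z $ i *\<^sub>R axis i 1) = 0"
        by (simp add: br.sum_right br.scaleR_right k)
      then show ?thesis using basis_expansion[of Z] by (simp add: scalar_mult_eq_scaleR)
    qed
    then show "Y = 0" by (rule centre_trivial)
  qed
  then obtain g where g: "linear g" "g \<circ> f = id" using linear_injective_left_inverse lf by blast
  show thesis
  proof
    show "linear (\<lambda>w. g (axis i w))" for i
    proof -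
      have "linear (\<lambda>w :: real^'a. axis i w)"
        by (rule linearI) (simp_all add: axis_def vec_eq_iff)
      then show ?thesis using linear_compose[OF _ g(1)] by (simp add: o_def)
    qed
    fix Y
    have "(\<Sum>i\<in>UNIV. g (axis i (br Y (axis i 1)))) = g (\<Sum>i\<in>UNIV. axis i (br Y (axis i 1)))"
      by (simp add: linear_sum[OF g(1)])
    also have "(\<Sum>i\<in>UNIV. axis i (br Y (axis i 1))) = f Y"
      by (simp add: f_def vec_eq_iff axis_def if_distrib[of "\<lambda>x. x $ _"] sum.If_cases)
    finally show "(\<Sum>i\<in>UNIV. g (axis i (br Y (axis i 1)))) = Y"
      using g(2) by (metis comp_apply id_apply)
  qed
qed

text \<open>The logarithm of the automorphism is small, hence a derivation, hence inner; the left
  inverse of ad bounds \<open>Y\<close> by the norm of ad Y.\<close>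

lemma aut_near_id:
  assumes "0 < e"
  obtains d where "d > 0" "\<And>\<phi>. lie_aut br \<phi> \<Longrightarrow> near_id d \<phi> \<Longrightarrow> \<exists>Y. norm Y \<le> e \<and> \<phi> = expo (br Y)"
proof -
  obtain P :: "'a \<Rightarrow> real^'a \<Rightarrow> real^'a" where P: "\<And>i. linear (P i)" "\<And>Y. (\<Sum>i\<in>UNIV. P i (br Y (axis i 1))) = Y"
    using ad_left_inverse by blast
  have "\<forall>i. \<exists>B>0. \<forall>v. norm (P i v) \<le> B * norm v" using linear_bounded_pos[OF P(1)] by metis
  then obtain B where B: "\<And>i. B i > 0" "\<And>i v. norm (P i v) \<le> B i * norm v" by metis
  define C where "C = sum B UNIV"
  have C: "C > 0" unfolding C_def using B(1) by (intro sum_pos) auto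
  have bd: "norm Y \<le> C * b" if "\<And>v. norm (br Y v) \<le> b * norm v" for Y b
  proof -
    have "norm (P i (br Y (axis i 1))) \<le> B i * b" for i
      using B(1)[of i] that[of "axis i 1"] by (intro order_trans[OF B(2)]) auto
    then have "norm (\<Sum>i\<in>UNIV. P i (br Y (axis i 1))) \<le> (\<Sum>i\<in>UNIV. B i * b)"
      by (intro sum_norm_le) auto
    then show ?thesis by (simp add: P(2) C_def sum_distrib_right)
  qed
  \<comment> \<open>The bound 1/10 gives exp b \<le> 1 + b + b^2 \<le> 9/8, as
    \<open>expo_aut_derivation\<close> requires; the bound e / C keeps \<open>Y\<close> below
    \<open>e\<close>.\<close>
  define b where "b = min (1/10) (e / C)"
  have b: "0 < b" "b \<le> 1/10" "C * b \<le> e" using assms C by (auto simp: b_def min_def field_simps)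
  have eb: "exp b \<le> 9/8"
    using exp_bound[of b] b mult_mono[of b "1/10" b "1/10"] unfolding power2_eq_square by simp
  show thesis
  proof
    show "b / 2 > 0" using b by simp
    fix \<phi> assume \<phi>: "lie_aut br \<phi>" "near_id (b / 2) \<phi>"
    obtain D where D: "linear D" "\<And>v. norm (D v) \<le> b * norm v" "expo D = \<phi>"
      using expo_onto_near_id[of \<phi> b] \<phi> b by (auto simp: lie_aut_def near_id_def)
    have "D (br U V) = br (D U) V + br U (D V)" for U V
      using D b eb \<phi> by (intro expo_aut_derivation[of D b]) auto
    then obtain Y where Y: "D = br Y" using derivation_inner D(1) by blast
    then have "norm Y \<le> C * b" using bd D by blast
    then show "\<exists>Y. norm Y \<le> e \<and> \<phi> = expo (br Y)" using D Y b by (intro exI[of _ Y]) auto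
  qed
qed

end

context semisimple_lie_alg
begin

text \<open>The maps \<open>P\<close> recover \<open>Y\<close> from the linear part of exp (ad Y),
  and the remaining part has too small a Lipschitz constant to compensate a difference of
  \<open>Y\<close> and \<open>Y'\<close>.\<close>

lemma expo_ad_determined:
  fixes P :: "'a \<Rightarrow> real^'a \<Rightarrow> real^'a"
  assumes P: "\<And>i. linear (P i)" "\<And>Y. (\<Sum>i\<in>UNIV. P i (br Y (axis i 1))) = Y"
  obtains r where "r > 0" "\<And>Y Y'. norm Y \<le> r \<Longrightarrow> norm Y' \<le> r \<Longrightarrow>
    (\<Sum>i\<in>UNIV. P i (expo (br Y) (axis i 1))) = (\<Sum>i\<in>UNIV. P i (expo (br Y') (axis i 1))) \<Longrightarrow> Y = Y'"
proof -
  obtain K where K: "K > 0" "\<And>X Y. norm (br X Y) \<le> K * norm X * norm Y" using br_bounded by blast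
  have "\<forall>i. \<exists>B>0. \<forall>v. norm (P i v) \<le> B * norm v" using linear_bounded_pos[OF P(1)] by metis
  then obtain B where B: "\<And>i. B i > 0" "\<And>i v. norm (P i v) \<le> B i * norm v" by metis
  define C where "C = sum B UNIV"
  have C: "C > 0" unfolding C_def using B(1) by (intro sum_pos) auto
  \<comment> \<open>\<open>K\<close> bounds ad and \<open>C\<close> bounds the maps
    \<open>P\<close>; with this radius the remainder contributes at most half the distance of
    \<open>Y\<close> and \<open>Y'\<close>.\<close>
  define r where "r = ln (1 + 1 / (2 * C * K)) / K"
  have r: "r > 0" "exp (K * r) - 1 = 1 / (2 * C * K)"
    using C K(1) by (auto simp: r_def add_pos_pos)
  show thesis
  proof
    show "r > 0" by fact
    fix Y Y' :: "real^'a"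
    assume Y: "norm Y \<le> r" "norm Y' \<le> r"
      "(\<Sum>i\<in>UNIV. P i (expo (br Y) (axis i 1))) = (\<Sum>i\<in>UNIV. P i (expo (br Y') (axis i 1)))"
    define A A' where "A = endo_of (br Y)" and "A' = endo_of (br Y')"
    have le: "norm (endo_of (br Z)) \<le> K * norm Z" for Z
      using K by (intro norm_endo_le) (auto simp: endo_apply_of linear_br)
    have "norm A \<le> K * r" "norm A' \<le> K * r"
      using le[of Y] le[of Y'] Y K(1) mult_left_mono[of _ r K] by (auto simp: A_def A'_def intro: order_trans)
    then have "norm (exp A - exp A' - (A - A')) \<le> 1 / (2 * C * K) * norm (A - A')"
      using norm_exp_diff_le r(2) by metis
    also have "\<dots> \<le> 1 / (2 * C * K) * (K * norm (Y - Y'))"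
      using le[of "Y - Y'"] C K(1) unfolding A_def A'_def
      by (intro mult_left_mono) (simp_all add: br_fun endo_of_diff linear_br)
    finally have d: "norm (exp A - exp A' - (A - A')) \<le> norm (Y - Y') / (2 * C)"
      using K(1) by simp
    have "norm (\<Sum>i\<in>UNIV. P i (endo_apply (exp A - exp A' - (A - A')) (axis i 1)))
        \<le> (\<Sum>i\<in>UNIV. B i * (norm (Y - Y') / (2 * C)))"
    proof (rule sum_norm_le)
      fix i :: 'a
      have "norm (endo_apply (exp A - exp A' - (A - A')) (axis i 1)) \<le> norm (Y - Y') / (2 * C)"
        using norm_endo_apply[of "exp A - exp A' - (A - A')" "axis i 1"] d
        by (simp del: endo_apply_diff)
      then show "norm (P i (endo_apply (exp A - exp A' - (A - A')) (axis i 1))) \<le> B i * (norm (Y - Y') / (2 * C))"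
        using B(1)[of i] by (intro order_trans[OF B(2)] mult_left_mono) auto
    qed
    also have "\<dots> = norm (Y - Y') / 2"
      using C unfolding sum_distrib_right[symmetric] C_def[symmetric] by simp
    also have "(\<Sum>i\<in>UNIV. P i (endo_apply (exp A - exp A' - (A - A')) (axis i 1))) = - (Y - Y')"
    proof -
      have "P i (endo_apply (exp A - exp A' - (A - A')) (axis i 1)) =
          P i (expo (br Y) (axis i 1)) - P i (expo (br Y') (axis i 1)) - P i (br (Y - Y') (axis i 1))" for i
        by (simp add: A_def A'_def expo_def endo_apply_of linear_br linear_diff[OF P(1)] br.diff_left)
      then show ?thesis using Y(3) by (simp add: sum_subtractf P(2))
    qed
    finally show "Y = Y'" by (simp add: norm_minus_commute)
  qed
qed

text \<open>A family of automorphisms through the identity covers a neighbourhood of the identity in the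
  automorphism group as soon as its derivative is onto the inner derivations.\<close>

lemma aut_family_covers:
  fixes \<kappa> :: "'d::real_normed_vector \<Rightarrow> real^'a \<Rightarrow> real^'a"
  assumes "open S" "x0 \<in> S" "0 < e"
    and aut: "\<And>x. x \<in> S \<Longrightarrow> lie_aut br (\<kappa> x)"
    and cont: "\<And>w. continuous_on S (\<lambda>x. \<kappa> x w)"
    and id: "\<And>w. \<kappa> x0 w = w"
    and der: "\<And>w. ((\<lambda>x. \<kappa> x w) has_derivative (\<lambda>v. br (L v) w)) (at x0)"
    and L: "bounded_linear R" "\<And>Y. L (R Y) = Y"
  obtains d where "d > 0"
    "\<And>\<phi>. lie_aut br \<phi> \<Longrightarrow> near_id d \<phi> \<Longrightarrow> \<exists>x\<in>S. dist x x0 < e \<and> \<kappa> x = \<phi>"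
proof -
  obtain P :: "'a \<Rightarrow> real^'a \<Rightarrow> real^'a" where P: "\<And>i. linear (P i)" "\<And>Y. (\<Sum>i\<in>UNIV. P i (br Y (axis i 1))) = Y"
    using ad_left_inverse by blast
  have blP: "bounded_linear (P i)" for i using P(1) linear_conv_bounded_linear by blast
  obtain r where r: "r > 0" "\<And>Y Y'. norm Y \<le> r \<Longrightarrow> norm Y' \<le> r \<Longrightarrow>
    (\<Sum>i\<in>UNIV. P i (expo (br Y) (axis i 1))) = (\<Sum>i\<in>UNIV. P i (expo (br Y') (axis i 1))) \<Longrightarrow> Y = Y'"
    using expo_ad_determined[OF P] by blast
  obtain d1 where d1: "d1 > 0" "\<And>\<phi>. lie_aut br \<phi> \<Longrightarrow> near_id d1 \<phi> \<Longrightarrow> \<exists>Y. norm Y \<le> r \<and> \<phi> = expo (br Y)"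
    using aut_near_id[OF r(1)] by blast
  define T where "T = {x\<in>S. dist x x0 < e \<and> near_id d1 (\<kappa> x)}"
  define F where "F x = (\<Sum>i\<in>UNIV. P i (\<kappa> x (axis i 1)))" for x
  define N where "N = S \<inter> ball x0 e \<inter> (\<Inter>i. {x\<in>S. norm (\<kappa> x (axis i 1) - axis i 1) < d1 / CARD('a)})"
  have "open {x\<in>S. norm (\<kappa> x (axis i 1) - axis i 1) < d1 / CARD('a)}" for i
  proof -
    have "continuous_on S (\<lambda>x. norm (\<kappa> x (axis i 1) - axis i 1))"
      by (intro continuous_intros cont)
    from continuous_open_preimage[OF this assms(1) open_lessThan[of "d1 / CARD('a)"]]
    have "open (S \<inter> (\<lambda>x. norm (\<kappa> x (axis i 1) - axis i 1)) -` {..<d1 / CARD('a)})" .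
    moreover have "S \<inter> (\<lambda>x. norm (\<kappa> x (axis i 1) - axis i 1)) -` {..<d1 / CARD('a)} =
        {x\<in>S. norm (\<kappa> x (axis i 1) - axis i 1) < d1 / CARD('a)}" by blast
    ultimately show ?thesis by (simp only:)
  qed
  then have "open N" unfolding N_def using assms by (intro open_Int open_INT) auto
  moreover have "x0 \<in> N" using assms d1 by (auto simp: N_def)
  moreover have "N \<subseteq> T"
  proof
    fix x assume x: "x \<in> N"
    then have xS: "x \<in> S" "dist x x0 < e" by (simp_all add: N_def dist_commute)
    have "norm (\<kappa> x (axis i 1) - axis i 1) \<le> d1 / CARD('a)" for i
      using x unfolding N_def by (blast intro: less_imp_le)
    then have "near_id d1 (\<kappa> x)"
      using aut[OF xS(1)] unfolding lie_aut_def by (intro near_id_axis) auto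
    then show "x \<in> T" using xS by (simp add: T_def)
  qed
  ultimately have x0T: "x0 \<in> interior T" using interiorI by blast
  have "continuous_on S F"
    unfolding F_def by (intro continuous_intros bounded_linear.continuous_on[OF blP] cont)
  moreover have "(F has_derivative L) (at x0)"
  proof -
    have "(F has_derivative (\<lambda>v. \<Sum>i\<in>UNIV. P i (br (L v) (axis i 1)))) (at x0)"
      unfolding F_def by (intro has_derivative_sum bounded_linear.has_derivative[OF blP] der)
    then show ?thesis by (simp add: P(2))
  qed
  moreover have "L \<circ> R = id" using L by auto
  moreover have "T \<subseteq> S" by (auto simp: T_def)
  \<comment> \<open>The derivative is known at the single point \<open>x0\<close> only, so openness
    comes from this mapping theorem rather than from the inverse function theorem.\<close>
  ultimately have "F x0 \<in> interior (F ` T)"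
    using assms(1,2) L(1) x0T by (intro sussmann_open_mapping[of S F x0 L R T])
  then obtain \<rho> where \<rho>: "\<rho> > 0" "ball (F x0) \<rho> \<subseteq> F ` T"
    unfolding mem_interior by blast
  have "\<forall>i. \<exists>B>0. \<forall>v. norm (P i v) \<le> B * norm v" using linear_bounded_pos[OF P(1)] by metis
  then obtain B where B: "\<And>i. B i > 0" "\<And>i v. norm (P i v) \<le> B i * norm v" by metis
  define C where "C = sum B UNIV"
  have C: "C > 0" unfolding C_def using B(1) by (intro sum_pos) auto
  define d where "d = min d1 (\<rho> / (2 * C))"
  have d: "d > 0" "d \<le> d1" "C * d < \<rho>"
  proof -
    show "d > 0" "d \<le> d1" using d1 \<rho> C by (auto simp: d_def)
    have "C * d \<le> C * (\<rho> / (2 * C))" using C by (intro mult_left_mono) (auto simp: d_def)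
    also have "\<dots> < \<rho>" using C \<rho> by simp
    finally show "C * d < \<rho>" .
  qed
  show thesis
  proof
    show "d > 0" by fact
    fix \<phi> assume \<phi>: "lie_aut br \<phi>" "near_id d \<phi>"
    define y where "y = (\<Sum>i\<in>UNIV. P i (\<phi> (axis i 1)))"
    have "y - F x0 = (\<Sum>i\<in>UNIV. P i (\<phi> (axis i 1) - axis i 1))"
      by (simp add: y_def F_def id linear_diff[OF P(1)] sum_subtractf)
    moreover have "norm \<dots> \<le> (\<Sum>i\<in>UNIV. B i * d)"
    proof (rule sum_norm_le)
      fix i :: 'a
      have "norm (\<phi> (axis i 1) - axis i 1) \<le> d * norm (axis i 1 :: real^'a)"
        using \<phi>(2) unfolding near_id_def by blast
      then show "norm (P i (\<phi> (axis i 1) - axis i 1)) \<le> B i * d"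
        using B(1)[of i] by (intro order_trans[OF B(2)] mult_left_mono) auto
    qed
    ultimately have "norm (y - F x0) \<le> C * d"
      by (simp add: C_def sum_distrib_right)
    then have "y \<in> ball (F x0) \<rho>" using d by (simp add: dist_norm norm_minus_commute)
    then obtain x where x: "x \<in> T" "F x = y" using \<rho> by blast
    have "lie_aut br (\<kappa> x)" "near_id d1 (\<kappa> x)" using x aut by (auto simp: T_def)
    then obtain Y1 where Y1: "norm Y1 \<le> r" "\<kappa> x = expo (br Y1)" using d1 by blast
    obtain Y2 where Y2: "norm Y2 \<le> r" "\<phi> = expo (br Y2)" using d1 \<phi> near_id_mono[OF _ d(2)] by blast
    \<comment> \<open>\<open>F\<close> sees only a projection of the operators. Equality of the
      operators themselves follows because both are exponentials of small elements, which this
      projection separates.\<close>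
    have "Y1 = Y2" using r(2)[OF Y1(1) Y2(1)] x by (simp add: F_def y_def Y1 Y2)
    then show "\<exists>x\<in>S. dist x x0 < e \<and> \<kappa> x = \<phi>"
      using x Y1 Y2 by (auto simp: T_def)
  qed
qed

end

section \<open>Nullity along entire families of operators\<close>

definition entire_fun :: "(real \<Rightarrow> real) \<Rightarrow> bool" where
  "entire_fun f \<longleftrightarrow> (\<exists>a. \<forall>t. (\<lambda>n. a n * t ^ n) sums f t)"

lemma entire_fun_const: "entire_fun (\<lambda>t. c)"
  unfolding entire_fun_def
proof (intro exI allI)
  fix t :: real
  have "(\<lambda>n. if n = 0 then c else 0) sums c" by (rule sums_single)
  moreover have "(\<lambda>n. if n = 0 then c else 0) = (\<lambda>n. (if n = 0 then c else 0) * t ^ n)" by auto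
  ultimately show "(\<lambda>n. (if n = 0 then c else 0) * t ^ n) sums c" by simp
qed

lemma entire_fun_ident: "entire_fun (\<lambda>t. t)"
  unfolding entire_fun_def
proof (intro exI allI)
  fix t :: real
  have "(\<lambda>n. if n = 1 then t else 0) sums t" by (rule sums_single)
  moreover have "(\<lambda>n. if n = 1 then t else 0) = (\<lambda>n. (if n = 1 then 1 else 0) * t ^ n)" by auto
  ultimately show "(\<lambda>n. (if n = 1 then 1 else 0) * t ^ n) sums t" by simp
qed

lemma entire_fun_add: "entire_fun f \<Longrightarrow> entire_fun g \<Longrightarrow> entire_fun (\<lambda>t. f t + g t)"
  unfolding entire_fun_def
proof (elim exE)
  fix a b assume "\<forall>t. (\<lambda>n. a n * t ^ n) sums f t" "\<forall>t. (\<lambda>n. b n * t ^ n) sums g t"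
  then have "\<forall>t. (\<lambda>n. (a n + b n) * t ^ n) sums (f t + g t)"
    by (simp add: distrib_right sums_add)
  then show "\<exists>c. \<forall>t. (\<lambda>n. c n * t ^ n) sums (f t + g t)"
    by (intro exI[of _ "\<lambda>n. a n + b n"])
qed

lemma entire_fun_mult: "entire_fun f \<Longrightarrow> entire_fun g \<Longrightarrow> entire_fun (\<lambda>t. f t * g t)"
  unfolding entire_fun_def
proof (elim exE)
  fix a b assume ab: "\<forall>t. (\<lambda>n. a n * t ^ n) sums f t" "\<forall>t. (\<lambda>n. b n * t ^ n) sums g t"
  have abs: "summable (\<lambda>n. norm (c n * t ^ n))"
    if "\<forall>t. (\<lambda>n. c n * t ^ n) sums h t" for c h and t :: real
    by (rule powser_insidea[where x="\<bar>t\<bar> + 1"]) (use that in \<open>auto simp: sums_iff\<close>)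
  have "(\<lambda>n. (\<Sum>i\<le>n. a i * b (n - i)) * t ^ n) sums (f t * g t)" for t
  proof -
    have "(\<lambda>n. \<Sum>i\<le>n. (a i * t ^ i) * (b (n - i) * t ^ (n - i))) sums ((\<Sum>n. a n * t ^ n) * (\<Sum>n. b n * t ^ n))"
      by (rule Cauchy_product_sums[OF abs[OF ab(1)] abs[OF ab(2)]])
    moreover have "(\<Sum>i\<le>n. (a i * t ^ i) * (b (n - i) * t ^ (n - i))) = (\<Sum>i\<le>n. a i * b (n - i)) * t ^ n" for n
      unfolding sum_distrib_right
    proof (rule sum.cong)
      fix i assume "i \<in> {..n}"
      then have "t ^ n = t ^ i * t ^ (n - i)" by (simp flip: power_add)
      then show "a i * t ^ i * (b (n - i) * t ^ (n - i)) = a i * b (n - i) * t ^ n" by simp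
    qed simp
    ultimately show ?thesis using ab by (simp add: sums_iff)
  qed
  then show "\<exists>c. \<forall>t. (\<lambda>n. c n * t ^ n) sums (f t * g t)"
    by (intro exI[of _ "\<lambda>n. \<Sum>i\<le>n. a i * b (n - i)"] allI)
qed

lemma entire_fun_sum: "(\<And>i. i \<in> I \<Longrightarrow> entire_fun (f i)) \<Longrightarrow> entire_fun (\<lambda>t. \<Sum>i\<in>I. f i t)"
  by (induction I rule: infinite_finite_induct) (auto intro: entire_fun_const entire_fun_add)

lemma entire_fun_prod: "(\<And>i. i \<in> I \<Longrightarrow> entire_fun (f i)) \<Longrightarrow> entire_fun (\<lambda>t. \<Prod>i\<in>I. f i t)"
  by (induction I rule: infinite_finite_induct) (auto intro: entire_fun_const entire_fun_mult)

lemma entire_fun_det: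
  fixes M :: "real \<Rightarrow> real^'n^'n"
  assumes "\<And>i j. entire_fun (\<lambda>t. M t $ i $ j)"
  shows "entire_fun (\<lambda>t. det (M t))"
  unfolding det_def
  by (intro entire_fun_sum entire_fun_mult entire_fun_prod entire_fun_const assms)

text \<open>The coefficients vanish one after the other: once those below n are zero, f x / x^n is a
  power series that tends to its constant term \<open>a n\<close> and is zero near 0.\<close>

lemma entire_fun_zero:
  assumes "entire_fun f" "e > 0" "\<And>t. \<bar>t\<bar> < e \<Longrightarrow> f t = 0"
  shows "f t = 0"
proof -
  obtain a where a: "\<And>t. (\<lambda>n. a n * t ^ n) sums f t" using assms(1) by (auto simp: entire_fun_def)
  have "a n = 0" for n
  proof (induction n rule: less_induct)
    case (less n)
    define g where "g x = (if x = 0 then a n else 0)" for x :: real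
    have "(\<lambda>k. a (k + n) * x ^ k) sums g x" if x: "norm x < e" for x
    proof (cases "x = 0")
      case False
      have "(\<lambda>k. a (k + n) * x ^ (k + n)) sums (f x - (\<Sum>k<n. a k * x ^ k))"
        using a[of x] by (rule sums_split_initial_segment)
      then have "(\<lambda>k. a (k + n) * x ^ (k + n) / x ^ n) sums (0 / x ^ n)"
        using less assms(3)[of x] x by (intro sums_divide) simp
      then show ?thesis using False by (simp add: g_def power_add)
    qed (simp add: g_def)
    from powser_limit_0[OF \<open>e > 0\<close> this] have "(g \<longlongrightarrow> a n) (at 0)" by simp
    moreover have "(g \<longlongrightarrow> 0) (at 0)"
      by (rule tendsto_eventually) (simp add: g_def eventually_at_filter)
    ultimately show ?case using tendsto_unique[of "at 0"] by (metis at_neq_bot)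
  qed
  then show ?thesis using a[of t] by (simp add: sums_iff)
qed

lemma entire_fun_expo:
  fixes D :: "real^'n \<Rightarrow> real^'n"
  assumes "linear D" "\<And>i. entire_fun (\<lambda>t. w t $ i)"
  shows "entire_fun (\<lambda>t. expo (\<lambda>v. t *\<^sub>R D v) (w t) $ i)"
proof -
  have e: "entire_fun (\<lambda>t. expo (\<lambda>v. t *\<^sub>R D v) u $ i)" for u
    unfolding entire_fun_def
  proof (intro exI allI)
    fix t
    have "bounded_linear (\<lambda>A. endo_apply A u $ i)"
      by (rule bounded_linear_compose[OF bounded_linear_vec_nth bounded_linear_endo_apply_left])
    from bounded_linear.sums[OF this exp_converges[of "t *\<^sub>R endo_of D"]]
    show "(\<lambda>n. (endo_apply (endo_of D ^ n /\<^sub>R fact n) u $ i) * t ^ n) sums (expo (\<lambda>v. t *\<^sub>R D v) u $ i)"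
      by (simp add: expo_scaleR[OF assms(1)] scaleR_power mult_ac)
  qed
  have "expo (\<lambda>v. t *\<^sub>R D v) (w t) $ i = (\<Sum>j\<in>UNIV. w t $ j * expo (\<lambda>v. t *\<^sub>R D v) (axis j 1) $ i)" for t
    using arg_cong[OF basis_expansion[of "w t"], of "\<lambda>v. expo (\<lambda>v. t *\<^sub>R D v) v $ i"]
    by (simp add: linear_sum[OF linear_expo] linear_scale[OF linear_expo] scalar_mult_eq_scaleR)
  then show ?thesis by (simp only:) (intro entire_fun_sum entire_fun_mult assms e)
qed

section \<open>Rank and nullity\<close>

lemma orthogonal_decomp:
  fixes S :: "'a::euclidean_space set"
  assumes "subspace S"
  shows "\<exists>y z. y \<in> S \<and> (\<forall>w\<in>S. orthogonal w z) \<and> v = y + z"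
proof (rule orthogonal_subspace_decomp_exists[of S v])
  fix y z assume "y \<in> span S" "\<And>w. w \<in> span S \<Longrightarrow> orthogonal z w" "v = y + z"
  then show ?thesis
    using assms by (intro exI[of _ y] exI[of _ z])
      (auto simp: span_eq_iff[THEN iffD2] orthogonal_commute)
qed

lemma dim_kernel_range:
  fixes T :: "'a::euclidean_space \<Rightarrow> 'b::euclidean_space"
  assumes "linear T"
  shows "dim {v. T v = 0} + dim (range T) = DIM('a)"
proof -
  let ?K = "{v. T v = 0}" and ?R = "{y \<in> UNIV. \<forall>x\<in>{v. T v = 0}. orthogonal x y}"
  have sK: "subspace ?K" by (rule linear_subspace_kernel[OF assms])
  have sR: "subspace ?R" using subspace_orthogonal_to_vectors[of ?K] by simp
  have "inj_on T ?R"
  proof (rule inj_onI)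
    fix x y assume xy: "x \<in> ?R" "y \<in> ?R" "T x = T y"
    then have "x - y \<in> ?R" using sR by (intro subspace_diff)
    moreover have "x - y \<in> ?K" using xy by (simp add: linear_diff[OF assms])
    ultimately have "orthogonal (x - y) (x - y)" by blast
    then show "x = y" by (simp add: orthogonal_self)
  qed
  then have "dim (T ` ?R) = dim ?R" using assms sR by (intro dim_image_eq) (simp_all add: span_eq_iff[THEN iffD2])
  moreover have "T ` ?R = range T"
  proof
    show "range T \<subseteq> T ` ?R"
    proof
      fix w assume "w \<in> range T"
      then obtain v where v: "w = T v" by blast
      obtain y z where yz: "y \<in> ?K" "\<forall>w\<in>?K. orthogonal w z" "v = y + z"
        using orthogonal_decomp[OF sK, of v] by blast
      then have "w = T z" by (simp add: v linear_add[OF assms])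
      moreover have "z \<in> ?R" using yz(2) by simp
      ultimately show "w \<in> T ` ?R" by blast
    qed
  qed auto
  moreover have "dim ?R + dim ?K = DIM('a)"
    using dim_subspace_orthogonal_to_vectors[OF sK subspace_UNIV] by simp
  ultimately show ?thesis by simp
qed

text \<open>The kernel of \<open>C\<close> has dimension greater than n - m and therefore meets the
  kernel of \<open>T\<close>. Together with the converse \<open>det_nonzero_of_nullity\<close>,
  nullity at least m means that det (T + C) = 0 for every \<open>C\<close> of rank below m, which
  expresses the bound by polynomials without minors.\<close>

lemma det_zero_of_nullity:
  fixes T C :: "real^'n \<Rightarrow> real^'n"
  assumes "linear T" "linear C" "m \<le> dim {v. T v = 0}" "dim (range C) < m"
  shows "det (matrix (\<lambda>v. T v + C v)) = 0"
proof -
  have 1: "dim {v. C v = 0} + dim (range C) = CARD('n)"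
    using dim_kernel_range[OF assms(2)] by simp
  have sub: "subspace {v. T v = 0}" "subspace {v. C v = 0}"
    using linear_subspace_kernel assms by auto
  have "dim {x + y | x y. x \<in> {v. T v = 0} \<and> y \<in> {v. C v = 0}} + dim ({v. T v = 0} \<inter> {v. C v = 0})
      = dim {v. T v = 0} + dim {v. C v = 0}"
    by (rule dim_sums_Int[OF sub])
  moreover have "dim {x + y | x y. x \<in> {v. T v = 0} \<and> y \<in> {v. C v = 0}} \<le> CARD('n)"
    using dim_subset_UNIV[of "{x + y | x y. x \<in> {v. T v = 0} \<and> y \<in> {v. C v = 0}}"] by simp
  ultimately have "dim ({v. T v = 0} \<inter> {v. C v = 0}) \<noteq> 0" using 1 assms by linarith
  then obtain v where v: "v \<noteq> 0" "T v = 0" "C v = 0" by (auto simp: dim_eq_0)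
  have l: "linear (\<lambda>v. T v + C v)" using assms by (intro linear_compose_add)
  have "T v + C v = 0" using v by simp
  then have "\<not> inj (\<lambda>v. T v + C v)" using v(1) linear_injective_0[OF l] by blast
  then show ?thesis using det_nz_iff_inj[OF l] by blast
qed

lemma complement_projection:
  fixes S T :: "'a::real_vector set"
  assumes "subspace S" "subspace T" "S \<inter> T \<subseteq> {0}" "\<And>v. \<exists>s\<in>S. v - s \<in> T"
  obtains p where "linear p" "\<And>v. p v \<in> S" "\<And>v. v - p v \<in> T"
    "\<And>v. v \<in> S \<Longrightarrow> p v = v" "\<And>v. v \<in> T \<Longrightarrow> p v = 0"
proof -
  obtain p where p: "\<And>v. p v \<in> S" "\<And>v. v - p v \<in> T" using assms(4) by metis
  have unique: "p v = s" if "s \<in> S" "v - s \<in> T" for v s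
  proof -
    have "p v - s \<in> S" using p(1) that(1) assms(1) by (intro subspace_diff)
    moreover have "p v - s \<in> T" using subspace_diff[OF assms(2) that(2) p(2)[of v]] by simp
    ultimately show ?thesis using assms(3) by auto
  qed
  show thesis
  proof
    show "linear p"
    proof (rule linearI)
      fix x y c
      have "x + y - (p x + p y) \<in> T"
        using subspace_add[OF assms(2) p(2)[of x] p(2)[of y]] by (simp add: algebra_simps)
      then show "p (x + y) = p x + p y"
        using subspace_add[OF assms(1) p(1)[of x] p(1)[of y]] by (intro unique)
      have "c *\<^sub>R x - c *\<^sub>R p x \<in> T"
        using subspace_scale[OF assms(2) p(2)[of x], of c] by (simp add: algebra_simps)
      then show "p (c *\<^sub>R x) = c *\<^sub>R p x"
        using subspace_scale[OF assms(1) p(1)[of x], of c] by (intro unique)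
    qed
    show "p v = v" if "v \<in> S" for v using that subspace_0[OF assms(2)] by (intro unique) simp_all
    show "p v = 0" if "v \<in> T" for v using that subspace_0[OF assms(1)] by (intro unique) simp_all
  qed (rule p)+
qed

text \<open>\<open>C\<close> projects orthogonally onto the kernel of \<open>T\<close> and then maps
  it isometrically onto the orthogonal complement of the range; this repairs precisely the defect of
  \<open>T\<close>.\<close>

lemma det_nonzero_of_nullity:
  fixes T :: "real^'n \<Rightarrow> real^'n"
  assumes "linear T" "dim {v. T v = 0} < m"
  obtains C where "linear C" "dim (range C) < m" "det (matrix (\<lambda>v. T v + C v)) \<noteq> 0"
proof -
  let ?K = "{v. T v = 0}" and ?R = "{y. \<forall>x\<in>range T. orthogonal x y}"
  have sK: "subspace ?K" using linear_subspace_kernel assms by auto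
  have sR: "subspace ?R" by (rule subspace_orthogonal_to_vectors)
  have "dim ?R + dim (range T) = CARD('n)"
    using dim_subspace_orthogonal_to_vectors[of "range T" UNIV] linear_subspace_image[OF assms(1) subspace_UNIV]
    by (simp add: dim_UNIV)
  moreover have "dim ?K + dim (range T) = CARD('n)"
    using dim_kernel_range[OF assms(1)] by simp
  ultimately have eq: "dim ?K = dim ?R" by simp
  have "\<exists>f. linear f \<and> f ` ?K = ?R \<and> (\<forall>x\<in>?K. norm (f x) = norm x)"
    by (rule isometries_subspaces[OF sK sR eq]) blast
  then obtain f where f: "linear f" "f ` ?K = ?R" "\<And>x. x \<in> ?K \<Longrightarrow> norm (f x) = norm x"
    by blast
  obtain p where p: "linear p" "\<And>v. p v \<in> ?K" "\<And>v. v \<in> ?K \<Longrightarrow> p v = v"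
  proof -
    have "subspace {y. \<forall>x\<in>?K. orthogonal x y}" by (rule subspace_orthogonal_to_vectors)
    moreover have "?K \<inter> {y. \<forall>x\<in>?K. orthogonal x y} \<subseteq> {0}" by (auto simp: orthogonal_self)
    moreover have "\<exists>s\<in>?K. v - s \<in> {y. \<forall>x\<in>?K. orthogonal x y}" for v
    proof -
      obtain y z where "y \<in> ?K" "\<forall>w\<in>?K. orthogonal w z" "v = y + z"
        using orthogonal_decomp[OF sK, of v] by blast
      then show ?thesis by (intro bexI[of _ y]) auto
    qed
    ultimately show thesis by (rule complement_projection[OF sK]) (rule that)
  qed
  show thesis
  proof
    show l: "linear (\<lambda>v. f (p v))" using linear_compose[OF p(1) f(1)] by (simp add: o_def)
    have "range (\<lambda>v. f (p v)) \<subseteq> f ` ?K" using p(2) by auto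
    then have "dim (range (\<lambda>v. f (p v))) \<le> dim (f ` ?K)" by (rule dim_subset)
    also have "\<dots> \<le> dim ?K" by (rule dim_image_le[OF f(1)])
    finally show "dim (range (\<lambda>v. f (p v))) < m" using assms by simp
    have l2: "linear (\<lambda>v. T v + f (p v))" using assms l by (intro linear_compose_add)
    have "v = 0" if "T v + f (p v) = 0" for v
    proof -
      have "f (p v) \<in> ?R" using f(2) p(2) by blast
      then have "orthogonal (T v) (f (p v))" by blast
      then have "orthogonal (T v) (T v)" using that
        by (metis add_eq_0_iff inner_minus_right neg_equal_0_iff_equal orthogonal_def)
      then have "T v = 0" by (simp add: orthogonal_self)
      then have "p v = v" "f (p v) = 0" using p(3) that by auto
      then show "v = 0" using f(3)[of v] \<open>T v = 0\<close> by simp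
    qed
    then show "det (matrix (\<lambda>v. T v + f (p v))) \<noteq> 0"
      using det_nz_iff_inj[OF l2] linear_injective_0[OF l2] by blast
  qed
qed

text \<open>That the nullity is at least \<open>m\<close> is a family of polynomial conditions, so it propagates along an
  entire path.\<close>

lemma nullity_entire:
  fixes T :: "real \<Rightarrow> real^'n \<Rightarrow> real^'n"
  assumes lin: "\<And>t. linear (T t)" and ent: "\<And>w i. entire_fun (\<lambda>t. T t w $ i)"
    and "0 < e" and null: "\<And>t. \<bar>t\<bar> < e \<Longrightarrow> m \<le> dim {v. T t v = 0}"
  shows "m \<le> dim {v. T t v = 0}"
proof (rule ccontr)
  assume "\<not> ?thesis"
  then obtain C where C: "linear C" "dim (range C) < m" "det (matrix (\<lambda>v. T t v + C v)) \<noteq> 0"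
    using det_nonzero_of_nullity[OF lin] by (metis not_le)
  have "entire_fun (\<lambda>t. det (matrix (\<lambda>v. T t v + C v)))"
    by (intro entire_fun_det) (simp add: matrix_def entire_fun_add ent entire_fun_const)
  moreover have "det (matrix (\<lambda>v. T s v + C v)) = 0" if "\<bar>s\<bar> < e" for s
    using det_zero_of_nullity[OF lin C(1) null[OF that] C(2)] .
  ultimately show False using entire_fun_zero[of _ e] \<open>0 < e\<close> C(3) by blast
qed

section \<open>The adjoint representation of a Lie group\<close>

lemma C_on_subset: "C_on k U f \<Longrightarrow> V \<subseteq> U \<Longrightarrow> C_on k V f"
  by (induction k arbitrary: f) (auto intro: continuous_on_subset differentiable_on_subset)

lemma C_on_has_derivative:
  assumes "C_on (Suc k) U f" "open U" "x \<in> U"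
  shows "(f has_derivative frechet_derivative f (at x)) (at x)"
  using assms by (auto simp: differentiable_on_eq_differentiable_at frechet_derivative_works[symmetric])

lemma chartD:
  assumes "chart d"
  shows "open (fst d)" "open (snd d ` fst d)"
    "\<And>x. x \<in> fst d \<Longrightarrow> chart_inv d (snd d x) = x"
    "\<And>u. u \<in> snd d ` fst d \<Longrightarrow> chart_inv d u \<in> fst d \<and> snd d (chart_inv d u) = u"
    "continuous_on (fst d) (snd d)" "continuous_on (snd d ` fst d) (chart_inv d)"
  using assms by (auto simp: chart_def homeomorphism_def)

lemma smooth_on_openD:
  assumes "smooth_on S f" "open S" "x \<in> S"
  shows "\<exists>U g. open U \<and> x \<in> U \<and> U \<subseteq> S \<and> (\<forall>k. C_on k U g) \<and> (\<forall>y\<in>U. g y = f y)"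
proof -
  obtain U g where U: "open U" "x \<in> U" "\<forall>k. C_on k U g" "\<forall>y\<in>S \<inter> U. g y = f y"
    using assms unfolding smooth_on_def by blast
  have "C_on k (U \<inter> S) g" for k
    using U(3) C_on_subset[of k U g "U \<inter> S"] by blast
  then show ?thesis
    using U assms(2,3) by (intro exI[of _ "U \<inter> S"] exI[of _ g]) auto
qed

locale lie_group_algebra =
  fixes G :: "('g::{t2_space, second_countable_topology}) monoid"
    and A :: "('g, 'e::euclidean_space) chart set"
    and c :: "('g, 'e) chart"
    and \<iota> :: "'a::euclidean_space \<Rightarrow> 'e"
    and br :: "'a \<Rightarrow> 'a \<Rightarrow> 'a"
  assumes lie_group: "lie_group G A" and lie_algebra: "has_lie_algebra G A c \<iota> br"
begin

abbreviation "gmult x y \<equiv> x \<otimes>\<^bsub>G\<^esub> y"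
abbreviation "ginv x \<equiv> inv\<^bsub>G\<^esub> x"
abbreviation "\<e> \<equiv> \<one>\<^bsub>G\<^esub>"
abbreviation "\<kappa> \<equiv> snd c"
abbreviation "\<kappa>' \<equiv> chart_inv c"

lemma carrier_UNIV: "carrier G = UNIV" and is_group: "group G"
  using lie_group by (auto simp: lie_group_def)

sublocale group G by (rule is_group)

lemma in_carrier [simp]: "x \<in> carrier G"
  by (simp add: carrier_UNIV)

lemma chart_A: "d \<in> A \<Longrightarrow> chart d"
  using lie_group by (auto simp: lie_group_def smooth_atlas_def)

lemma ex_chart: "\<exists>d\<in>A. x \<in> fst d"
proof -
  have "x \<in> (\<Union>d\<in>A. fst d)" using lie_group by (simp add: lie_group_def smooth_atlas_def)
  then show ?thesis by blast
qed

lemma c_in: "c \<in> A" "\<e> \<in> fst c"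
  using lie_algebra by (auto simp: has_lie_algebra_def)

lemmas chart_c = chartD[OF chart_A[OF c_in(1)]]

lemma cont_mult: "continuous_on UNIV (\<lambda>(x, y). gmult x y)"
  using lie_group by (auto simp: lie_group_def smooth_map_def)

lemma cont_inv: "continuous_on UNIV (\<lambda>x. ginv x)"
  using lie_group by (auto simp: lie_group_def smooth_map_def)

lemma continuous_on_mult:
  assumes "continuous_on S f" "continuous_on S g"
  shows "continuous_on S (\<lambda>x. gmult (f x) (g x))"
  using continuous_on_compose2[OF cont_mult continuous_on_Pair[OF assms]] by simp

lemma continuous_on_ginv:
  assumes "continuous_on S f"
  shows "continuous_on S (\<lambda>x. ginv (f x))"
  using continuous_on_compose2[OF cont_inv assms] by simp

text \<open>Smoothness in the product atlas, restated for a function of two Euclidean variables on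
  an open set on which all group elements involved stay inside the chosen charts. Conjugation is
  composed from such functions.\<close>

lemma mult_chart:
  assumes "d1 \<in> A" "d2 \<in> A" "d3 \<in> A" "x \<in> fst d1" "y \<in> fst d2" "gmult x y \<in> fst d3"
  obtains U g where "open U" "(snd d1 x, snd d2 y) \<in> U" "\<And>k. C_on k U g"
    "\<And>u v. (u, v) \<in> U \<Longrightarrow> u \<in> snd d1 ` fst d1 \<and> v \<in> snd d2 ` fst d2 \<and>
       gmult (chart_inv d1 u) (chart_inv d2 v) \<in> fst d3 \<and>
       g (u, v) = snd d3 (gmult (chart_inv d1 u) (chart_inv d2 v))"
proof -
  note c1 = chartD[OF chart_A[OF assms(1)]] and c2 = chartD[OF chart_A[OF assms(2)]]
  let ?p = "(fst d1 \<times> fst d2, map_prod (snd d1) (snd d2))"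
  define S where "S = map_prod (snd d1) (snd d2) ` (fst d1 \<times> fst d2 \<inter> (\<lambda>(x, y). gmult x y) -` fst d3)"
  have inv: "chart_inv ?p (u, v) = (chart_inv d1 u, chart_inv d2 v)"
    if "u \<in> snd d1 ` fst d1" "v \<in> snd d2 ` fst d2" for u v
    unfolding chart_inv_def fst_conv snd_conv
  proof (rule inv_into_f_eq)
    show "inj_on (map_prod (snd d1) (snd d2)) (fst d1 \<times> fst d2)"
      using c1(3) c2(3) by (intro map_prod_inj_on) (metis inj_onI)+
    show "(inv_into (fst d1) (snd d1) u, inv_into (fst d2) (snd d2) v) \<in> fst d1 \<times> fst d2"
      using that by (auto intro: inv_into_into)
    show "map_prod (snd d1) (snd d2) (inv_into (fst d1) (snd d1) u, inv_into (fst d2) (snd d2) v) = (u, v)"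
      using that by (auto simp: f_inv_into_f)
  qed
  have S_eq: "S = {p \<in> snd d1 ` fst d1 \<times> snd d2 ` fst d2. gmult (chart_inv d1 (fst p)) (chart_inv d2 (snd p)) \<in> fst d3}"
    (is "S = ?S")
  proof
    show "S \<subseteq> ?S" unfolding S_def using c1(3) c2(3) by auto
    show "?S \<subseteq> S"
    proof
      fix p assume p: "p \<in> ?S"
      then have "p = map_prod (snd d1) (snd d2) (chart_inv d1 (fst p), chart_inv d2 (snd p))"
        using c1(4) c2(4) by (auto simp: prod_eq_iff)
      moreover have "(chart_inv d1 (fst p), chart_inv d2 (snd p)) \<in> fst d1 \<times> fst d2 \<inter> (\<lambda>(x, y). gmult x y) -` fst d3"
        using p c1(4) c2(4) by auto
      ultimately show "p \<in> S" unfolding S_def by blast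
    qed
  qed
  have "open S"
  proof -
    have "continuous_on (snd d1 ` fst d1 \<times> snd d2 ` fst d2) (\<lambda>p. gmult (chart_inv d1 (fst p)) (chart_inv d2 (snd p)))"
      by (intro continuous_on_mult continuous_on_compose2[OF c1(6)] continuous_on_compose2[OF c2(6)]
          continuous_intros) auto
    from continuous_open_preimage[OF this open_Times[OF c1(2) c2(2)] chartD(1)[OF chart_A[OF assms(3)]]]
    show ?thesis unfolding S_eq by (simp add: vimage_def Int_def)
  qed
  have "?p \<in> prod_atlas A A" unfolding prod_atlas_def using assms by blast
  moreover have "smooth_map (prod_atlas A A) A (\<lambda>(x, y). gmult x y)"
    using lie_group by (simp add: lie_group_def)
  ultimately have "smooth_on (snd ?p ` (fst ?p \<inter> (\<lambda>(x, y). gmult x y) -` fst d3))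
      (snd d3 \<circ> (\<lambda>(x, y). gmult x y) \<circ> chart_inv ?p)"
    unfolding smooth_map_def using assms(3) by blast
  then have sm: "smooth_on S (snd d3 \<circ> (\<lambda>(x, y). gmult x y) \<circ> chart_inv ?p)"
    by (simp add: S_def)
  have pS: "(snd d1 x, snd d2 y) \<in> S" unfolding S_def using assms by auto
  obtain U g where U: "open U" "(snd d1 x, snd d2 y) \<in> U" "U \<subseteq> S" "\<And>k. C_on k U g"
      "\<And>y. y \<in> U \<Longrightarrow> g y = (snd d3 \<circ> (\<lambda>(x, y). gmult x y) \<circ> chart_inv ?p) y"
    using smooth_on_openD[OF sm \<open>open S\<close> pS] by blast
  show thesis
  proof
    fix u v assume uv: "(u, v) \<in> U"
    then have "(u, v) \<in> S" using U by blast
    then have *: "u \<in> snd d1 ` fst d1" "v \<in> snd d2 ` fst d2" "gmult (chart_inv d1 u) (chart_inv d2 v) \<in> fst d3"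
      unfolding S_eq by auto
    then show "u \<in> snd d1 ` fst d1 \<and> v \<in> snd d2 ` fst d2 \<and>
       gmult (chart_inv d1 u) (chart_inv d2 v) \<in> fst d3 \<and>
       g (u, v) = snd d3 (gmult (chart_inv d1 u) (chart_inv d2 v))"
      using U(5)[OF uv] inv by simp
  qed (use U in auto)
qed

lemma inv_chart:
  obtains U g where "open U" "\<kappa> \<e> \<in> U" "\<And>k. C_on k U g"
    "\<And>u. u \<in> U \<Longrightarrow> u \<in> \<kappa> ` fst c \<and> ginv (\<kappa>' u) \<in> fst c \<and> g u = \<kappa> (ginv (\<kappa>' u))"
proof -
  define S where "S = \<kappa> ` (fst c \<inter> (\<lambda>x. ginv x) -` fst c)"
  have S_eq: "S = {u \<in> \<kappa> ` fst c. ginv (\<kappa>' u) \<in> fst c}" (is "S = ?S")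
  proof
    show "S \<subseteq> ?S" unfolding S_def using chart_c(3) by auto
    show "?S \<subseteq> S"
    proof
      fix u assume u: "u \<in> ?S"
      then have "u = \<kappa> (\<kappa>' u)" "\<kappa>' u \<in> fst c" using chart_c(4) by auto
      then show "u \<in> S" unfolding S_def using u by blast
    qed
  qed
  have "open S"
  proof -
    have "continuous_on (\<kappa> ` fst c) (\<lambda>u. ginv (\<kappa>' u))"
      by (intro continuous_on_ginv chart_c(6))
    from continuous_open_preimage[OF this chart_c(2) chart_c(1)]
    show ?thesis unfolding S_eq by (simp add: vimage_def Int_def)
  qed
  have sm: "smooth_on S (\<kappa> \<circ> (\<lambda>x. ginv x) \<circ> \<kappa>')"
    using lie_group c_in unfolding lie_group_def smooth_map_def S_def by blast
  have eS: "\<kappa> \<e> \<in> S" unfolding S_def using c_in by auto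
  obtain U g where U: "open U" "\<kappa> \<e> \<in> U" "U \<subseteq> S" "\<And>k. C_on k U g"
      "\<And>y. y \<in> U \<Longrightarrow> g y = (\<kappa> \<circ> (\<lambda>x. ginv x) \<circ> \<kappa>') y"
    using smooth_on_openD[OF sm \<open>open S\<close> eS] by blast
  show thesis
    by (rule that[of U g]) (use U in \<open>auto simp: S_eq\<close>)
qed

definition conj_chart :: "'g \<Rightarrow> 'e \<Rightarrow> 'e" where
  "conj_chart g v = \<kappa> (gmult (gmult g (\<kappa>' v)) (ginv g))"

lemma Ad_eq: "Ad G c \<iota> g U = inv_into UNIV \<iota> (frechet_derivative (conj_chart g) (at (\<kappa> \<e>)) (\<iota> U))"
  by (simp add: Ad_def conj_chart_def[abs_def])

lemma inv_one [simp]: "\<kappa>' (\<kappa> \<e>) = \<e>"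
  using chart_c(3) c_in by simp

lemma conj_chart_one [simp]: "conj_chart g (\<kappa> \<e>) = \<kappa> \<e>"
  by (simp add: conj_chart_def)

lemma open_image_c: "open (\<kappa> ` fst c)" "\<kappa> \<e> \<in> \<kappa> ` fst c"
  using chart_c c_in by auto

lemma conj_chart_near:
  obtains N where "open N" "\<kappa> \<e> \<in> N" "N \<subseteq> \<kappa> ` fst c"
    "\<And>v. v \<in> N \<Longrightarrow> gmult (gmult g (\<kappa>' v)) (ginv g) \<in> fst c"
proof -
  have "continuous_on (\<kappa> ` fst c) (\<lambda>v. gmult (gmult g (\<kappa>' v)) (ginv g))"
    by (intro continuous_on_mult continuous_intros chart_c(6))
  from continuous_open_preimage[OF this chart_c(2) chart_c(1)]
  have "open (\<kappa> ` fst c \<inter> (\<lambda>v. gmult (gmult g (\<kappa>' v)) (ginv g)) -` fst c)" .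
  then show thesis by (rule that) (use c_in in auto)
qed

text \<open>An arbitrary \<open>g\<close> and its inverse may lie outside the chart
  \<open>c\<close>. Left multiplication by \<open>g\<close> passes from \<open>c\<close> to a chart
  around \<open>g\<close>, and right multiplication by the inverse, seen in a third chart, leads
  back to \<open>c\<close>.\<close>

lemma conj_chart_differentiable: "conj_chart g differentiable at (\<kappa> \<e>)"
proof -
  obtain d where d: "d \<in> A" "g \<in> fst d" using ex_chart by blast
  obtain d' where d': "d' \<in> A" "ginv g \<in> fst d'" using ex_chart by blast
  obtain U1 g1 where U1: "open U1" "(snd d g, \<kappa> \<e>) \<in> U1" "\<And>k. C_on k U1 g1"
    "\<And>u v. (u, v) \<in> U1 \<Longrightarrow> u \<in> snd d ` fst d \<and> v \<in> snd c ` fst c \<and>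
       gmult (chart_inv d u) (chart_inv c v) \<in> fst d \<and>
       g1 (u, v) = snd d (gmult (chart_inv d u) (chart_inv c v))"
    using mult_chart[OF d(1) c_in(1) d(1) d(2) c_in(2)] d by auto
  obtain U2 g2 where U2: "open U2" "(snd d g, snd d' (ginv g)) \<in> U2" "\<And>k. C_on k U2 g2"
    "\<And>u v. (u, v) \<in> U2 \<Longrightarrow> u \<in> snd d ` fst d \<and> v \<in> snd d' ` fst d' \<and>
       gmult (chart_inv d u) (chart_inv d' v) \<in> fst c \<and>
       g2 (u, v) = snd c (gmult (chart_inv d u) (chart_inv d' v))"
    using mult_chart[OF d(1) d'(1) c_in(1) d(2) d'(2)] c_in by auto
  have dg: "chart_inv d (snd d x) = x" if "x \<in> fst d" for x using chartD(3)[OF chart_A[OF d(1)]] that .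
  have dg': "chart_inv d' (snd d' x) = x" if "x \<in> fst d'" for x using chartD(3)[OF chart_A[OF d'(1)]] that .
  define q where "q v = g1 (snd d g, v)" for v
  define r where "r u = g2 (u, snd d' (ginv g))" for u
  define V1 where "V1 = {v. (snd d g, v) \<in> U1}"
  define V2 where "V2 = {u. (u, snd d' (ginv g)) \<in> U2}"
  have oV: "open V1" "open V2"
  proof -
    have "V1 = (\<lambda>v. (snd d g, v)) -` U1" "V2 = (\<lambda>u. (u, snd d' (ginv g))) -` U2"
      by (auto simp: V1_def V2_def)
    then show "open V1" "open V2"
      using U1(1) U2(1) by (auto intro!: open_vimage continuous_intros)
  qed
  have dq: "q differentiable at v" if "v \<in> V1" for v
  proof -
    have "(g1 has_derivative frechet_derivative g1 (at (snd d g, v))) (at (snd d g, v))"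
      using C_on_has_derivative[OF U1(3) U1(1), of "(snd d g, v)"] that by (auto simp: V1_def)
    moreover have "((\<lambda>v. (snd d g, v)) has_derivative (\<lambda>h. (0, h))) (at v)"
      by (auto intro!: derivative_eq_intros)
    ultimately show ?thesis unfolding q_def differentiable_def
      using has_derivative_compose[of "\<lambda>v. (snd d g, v)" _ v UNIV g1] by blast
  qed
  have dr: "r differentiable at u" if "u \<in> V2" for u
  proof -
    have "(g2 has_derivative frechet_derivative g2 (at (u, snd d' (ginv g)))) (at (u, snd d' (ginv g)))"
      using C_on_has_derivative[OF U2(3) U2(1), of "(u, snd d' (ginv g))"] that by (auto simp: V2_def)
    moreover have "((\<lambda>u. (u, snd d' (ginv g))) has_derivative (\<lambda>h. (h, 0))) (at u)"
      by (auto intro!: derivative_eq_intros)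
    ultimately show ?thesis unfolding r_def differentiable_def
      using has_derivative_compose[of "\<lambda>u. (u, snd d' (ginv g))" _ u UNIV g2] by blast
  qed
  have q1: "q (\<kappa> \<e>) = snd d g" using U1(4)[OF U1(2)] d dg by (simp add: q_def)
  have eV: "\<kappa> \<e> \<in> V1" "snd d g \<in> V2" using U1 U2 by (auto simp: V1_def V2_def)
  have diff: "(r \<circ> q) differentiable at (\<kappa> \<e>)"
    using dq[OF eV(1)] dr[OF eV(2)] q1 by (intro differentiable_chain_at) auto
  have "continuous_on V1 q"
    using dq by (intro differentiable_imp_continuous_on differentiable_at_imp_differentiable_on)
  from continuous_open_preimage[OF this oV]
  have oN: "open (V1 \<inter> q -` V2)" .
  have eN: "\<kappa> \<e> \<in> V1 \<inter> q -` V2" using eV q1 by simp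
  have "(r \<circ> q) v = conj_chart g v" if "v \<in> V1 \<inter> q -` V2" for v
  proof -
    have 1: "(snd d g, v) \<in> U1" "(q v, snd d' (ginv g)) \<in> U2" using that by (auto simp: V1_def V2_def)
    have "q v = snd d (gmult g (\<kappa>' v))" "gmult g (\<kappa>' v) \<in> fst d"
      using U1(4)[OF 1(1)] d dg by (auto simp: q_def)
    then show ?thesis using U2(4)[OF 1(2)] dg dg' d' by (simp add: r_def conj_chart_def)
  qed
  then have eq: "\<And>v. v \<in> V1 \<inter> q -` V2 \<Longrightarrow> (r \<circ> q) v = conj_chart g v" .
  obtain D where "((r \<circ> q) has_derivative D) (at (\<kappa> \<e>))" using diff unfolding differentiable_def by blast
  from has_derivative_transform_within_open[OF this oN eN eq]
  show ?thesis unfolding differentiable_def by blast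
qed

lemma conj_chart_has_derivative:
  "(conj_chart g has_derivative frechet_derivative (conj_chart g) (at (\<kappa> \<e>))) (at (\<kappa> \<e>))"
  using conj_chart_differentiable frechet_derivative_works by blast

lemma linear_iota: "linear \<iota>" and bij_iota: "bij \<iota>"
  using lie_algebra by (auto simp: has_lie_algebra_def)

lemma inv_iota [simp]: "inv_into UNIV \<iota> (\<iota> U) = U" "\<iota> (inv_into UNIV \<iota> w) = w"
  using bij_iota by (auto simp: bij_def surj_f_inv_f)

lemma linear_inv_iota: "linear (inv_into UNIV \<iota>)"
  by (rule linearI) (metis inv_iota linear_add[OF linear_iota], metis inv_iota linear_scale[OF linear_iota])

lemma linear_Ad: "linear (Ad G c \<iota> g)"
proof -
  have "linear (\<lambda>U. inv_into UNIV \<iota> (frechet_derivative (conj_chart g) (at (\<kappa> \<e>)) (\<iota> U)))"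
    using linear_compose[OF linear_compose[OF linear_iota
        linear_frechet_derivative[OF conj_chart_differentiable]] linear_inv_iota]
    by (simp add: o_def)
  then show ?thesis by (simp add: Ad_eq[abs_def])
qed

lemma Ad_one: "Ad G c \<iota> \<e> U = U"
proof -
  have "conj_chart \<e> v = v" if "v \<in> \<kappa> ` fst c" for v
    using chart_c(4)[OF that] by (simp add: conj_chart_def)
  then have "\<And>v. v \<in> \<kappa> ` fst c \<Longrightarrow> v = conj_chart \<e> v" by simp
  from has_derivative_transform_within_open[OF has_derivative_ident open_image_c this]
  have "(conj_chart \<e> has_derivative (\<lambda>h. h)) (at (\<kappa> \<e>))" by simp
  then have "frechet_derivative (conj_chart \<e>) (at (\<kappa> \<e>)) = (\<lambda>h. h)"
    by (metis frechet_derivative_at)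
  then show ?thesis by (simp add: Ad_eq)
qed

lemma Ad_mult: "Ad G c \<iota> (gmult g h) U = Ad G c \<iota> g (Ad G c \<iota> h U)"
proof -
  obtain N where N: "open N" "\<kappa> \<e> \<in> N" "N \<subseteq> \<kappa> ` fst c"
      "\<And>v. v \<in> N \<Longrightarrow> gmult (gmult h (\<kappa>' v)) (ginv h) \<in> fst c"
    using conj_chart_near by blast
  have eq: "conj_chart g (conj_chart h v) = conj_chart (gmult g h) v" if "v \<in> N" for v
    using chart_c(3)[OF N(4)[OF that]]
    by (simp add: conj_chart_def inv_mult_group m_assoc)
  have "((\<lambda>v. conj_chart g (conj_chart h v)) has_derivative
      (\<lambda>w. frechet_derivative (conj_chart g) (at (\<kappa> \<e>)) (frechet_derivative (conj_chart h) (at (\<kappa> \<e>)) w))) (at (\<kappa> \<e>))"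
    using has_derivative_compose[OF conj_chart_has_derivative[of h], of "conj_chart g"]
      conj_chart_has_derivative[of g] by simp
  from has_derivative_transform_within_open[OF this N(1,2) eq]
  have "(conj_chart (gmult g h) has_derivative
      (\<lambda>w. frechet_derivative (conj_chart g) (at (\<kappa> \<e>)) (frechet_derivative (conj_chart h) (at (\<kappa> \<e>)) w))) (at (\<kappa> \<e>))"
    by simp
  then have "frechet_derivative (conj_chart (gmult g h)) (at (\<kappa> \<e>)) =
      (\<lambda>w. frechet_derivative (conj_chart g) (at (\<kappa> \<e>)) (frechet_derivative (conj_chart h) (at (\<kappa> \<e>)) w))"
    by (metis frechet_derivative_at)
  then show ?thesis by (simp add: Ad_eq)
qed

lemma Ad_inv [simp]: "Ad G c \<iota> (ginv g) (Ad G c \<iota> g U) = U" "Ad G c \<iota> g (Ad G c \<iota> (ginv g) U) = U"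
  by (simp_all add: Ad_mult[symmetric] Ad_one)

text \<open>By the chain rule Ad is a composition of two partial derivatives of the multiplication
  \<open>m\<close>, taken at points that depend differentiably on \<open>x\<close>; second
  differentiability of \<open>m\<close> then makes it differentiable in \<open>x\<close>.\<close>

lemma Ad_chart_differentiable:
  "\<exists>N. open N \<and> \<kappa> \<e> \<in> N \<and> N \<subseteq> \<kappa> ` fst c \<and>
    (\<forall>x\<in>N. \<forall>V. (\<lambda>x. Ad G c \<iota> (\<kappa>' x) V) differentiable at x)"
proof -
  obtain U1 m where U1: "open U1" "(\<kappa> \<e>, \<kappa> \<e>) \<in> U1" "\<And>k. C_on k U1 m"
    "\<And>u v. (u, v) \<in> U1 \<Longrightarrow> u \<in> \<kappa> ` fst c \<and> v \<in> \<kappa> ` fst c \<and>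
       gmult (\<kappa>' u) (\<kappa>' v) \<in> fst c \<and> m (u, v) = \<kappa> (gmult (\<kappa>' u) (\<kappa>' v))"
    using mult_chart[OF c_in(1) c_in(1) c_in(1) c_in(2) c_in(2)] c_in by auto
  obtain U2 i where U2: "open U2" "\<kappa> \<e> \<in> U2" "\<And>k. C_on k U2 i"
    "\<And>u. u \<in> U2 \<Longrightarrow> u \<in> \<kappa> ` fst c \<and> ginv (\<kappa>' u) \<in> fst c \<and> i u = \<kappa> (ginv (\<kappa>' u))"
    using inv_chart by blast
  have di: "(i has_derivative frechet_derivative i (at x)) (at x)" if "x \<in> U2" for x
    using C_on_has_derivative[OF U2(3) U2(1) that] .
  have dm: "(m has_derivative frechet_derivative m (at p)) (at p)" if "p \<in> U1" for p
    using C_on_has_derivative[OF U1(3) U1(1) that] .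
  have d2m: "(\<lambda>p. frechet_derivative m (at p) q) differentiable at p" if "p \<in> U1" for p q
  proof -
    have "C_on (Suc 0) U1 (\<lambda>p. frechet_derivative m (at p) q)"
      using U1(3)[of "Suc (Suc 0)"] by (simp only: C_on.simps) blast
    then show ?thesis using U1(1) that by (simp add: differentiable_on_eq_differentiable_at)
  qed
  define N where "N = (U2 \<inter> (\<lambda>x. (x, i x)) -` U1) \<inter> (\<lambda>x. (x, \<kappa> \<e>)) -` U1"
  have ci: "continuous_on U2 i"
    using di by (intro differentiable_imp_continuous_on differentiable_at_imp_differentiable_on)
      (auto simp: differentiable_def)
  have "open (U2 \<inter> (\<lambda>x. (x, i x)) -` U1)"
    by (rule continuous_open_preimage[OF _ U2(1) U1(1)]) (intro continuous_intros ci)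
  moreover have "open ((\<lambda>x. (x, \<kappa> \<e>)) -` U1)"
    by (intro open_vimage[OF U1(1)] continuous_intros)
  ultimately have oN: "open N" unfolding N_def by (rule open_Int)
  have eN: "\<kappa> \<e> \<in> N" using U1 U2 by (simp add: N_def)
  have NU: "N \<subseteq> U2" by (auto simp: N_def)
  have NC: "N \<subseteq> \<kappa> ` fst c" using NU U2(4) by blast
  have D: "frechet_derivative (conj_chart (\<kappa>' x)) (at (\<kappa> \<e>)) h =
      frechet_derivative m (at (x, i x)) (frechet_derivative m (at (x, \<kappa> \<e>)) (0, h), 0)" if x: "x \<in> N" for x h
  proof -
    have xU: "(x, i x) \<in> U1" "(x, \<kappa> \<e>) \<in> U1" "x \<in> U2" using x by (auto simp: N_def)
    define V where "V = {v. (x, v) \<in> U1}"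
    have oV: "open V"
    proof -
      have "V = (\<lambda>v. (x, v)) -` U1" by (auto simp: V_def)
      then show ?thesis using U1(1) by (auto intro!: open_vimage continuous_intros)
    qed
    define q where "q v = m (x, v)" for v
    have dq: "(q has_derivative (\<lambda>h. frechet_derivative m (at (x, v)) (0, h))) (at v)" if "v \<in> V" for v
    proof -
      have "((\<lambda>v. (x, v)) has_derivative (\<lambda>h. (0, h))) (at v)"
        by (auto intro!: derivative_eq_intros)
      from has_derivative_compose[OF this, of m] dm[of "(x, v)"] that
      show ?thesis unfolding q_def V_def by simp
    qed
    have cq: "continuous_on V q"
      using dq by (intro differentiable_imp_continuous_on differentiable_at_imp_differentiable_on)
        (auto simp: differentiable_def)
    define W where "W = V \<inter> q -` ((\<lambda>u. (u, i x)) -` U1)"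
    have "open ((\<lambda>u. (u, i x)) -` U1)"
      using U1(1) by (auto intro!: open_vimage continuous_intros)
    from continuous_open_preimage[OF cq oV this]
    have oW: "open W" by (simp add: W_def)
    have qe: "q (\<kappa> \<e>) = x"
      using U1(4)[OF xU(2)] chart_c(4)[of x] by (simp add: q_def)
    have eW: "\<kappa> \<e> \<in> W" using xU qe by (simp add: W_def V_def)
    have ix: "\<kappa>' (i x) = ginv (\<kappa>' x)" using U2(4)[OF xU(3)] chart_c(3) by simp
    have eq: "m (q v, i x) = conj_chart (\<kappa>' x) v" if "v \<in> W" for v
    proof -
      have 1: "(x, v) \<in> U1" "(q v, i x) \<in> U1" using that by (auto simp: W_def V_def)
      have "\<kappa>' (q v) = gmult (\<kappa>' x) (\<kappa>' v)" using U1(4)[OF 1(1)] chart_c(3) by (simp add: q_def)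
      then show ?thesis using U1(4)[OF 1(2)] ix by (simp add: conj_chart_def)
    qed
    have "((\<lambda>v. (q v, i x)) has_derivative (\<lambda>h. (frechet_derivative m (at (x, \<kappa> \<e>)) (0, h), 0))) (at (\<kappa> \<e>))"
      using dq[of "\<kappa> \<e>"] xU by (auto intro!: derivative_eq_intros simp: V_def)
    from has_derivative_compose[OF this, of m] dm[OF xU(1)] qe
    have "((\<lambda>v. m (q v, i x)) has_derivative
        (\<lambda>h. frechet_derivative m (at (x, i x)) (frechet_derivative m (at (x, \<kappa> \<e>)) (0, h), 0))) (at (\<kappa> \<e>))"
      by simp
    from has_derivative_transform_within_open[OF this oW eW eq]
    have "(conj_chart (\<kappa>' x) has_derivative
        (\<lambda>h. frechet_derivative m (at (x, i x)) (frechet_derivative m (at (x, \<kappa> \<e>)) (0, h), 0))) (at (\<kappa> \<e>))"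
      by simp
    then show ?thesis using frechet_derivative_at by metis
  qed
  have "(\<lambda>x. Ad G c \<iota> (\<kappa>' x) V) differentiable at x" if x: "x \<in> N" for x V
  proof -
    define w where "w y = frechet_derivative m (at (y, \<kappa> \<e>)) (0, \<iota> V)" for y
    have eq: "inv_into UNIV \<iota> (\<Sum>b\<in>Basis. (w y \<bullet> b) *\<^sub>R frechet_derivative m (at (y, i y)) (b, 0)) = Ad G c \<iota> (\<kappa>' y) V" (is "?f y = _")
      if y: "y \<in> N" for y
    proof -
      have lin: "linear (frechet_derivative m (at (y, i y)))"
        using dm[of "(y, i y)"] y by (auto simp: N_def intro: has_derivative_linear)
      \<comment> \<open>\<open>d2m\<close> treats a derivative of \<open>m\<close> in a fixed
        direction, while the direction \<open>w y\<close> varies with \<open>y\<close>. Expansion in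
        the basis leaves fixed directions with differentiable coefficients.\<close>
      have "(w y, 0) = (\<Sum>b\<in>Basis. (w y \<bullet> b) *\<^sub>R (b, 0 :: 'e))"
        by (simp add: prod_eq_iff fst_sum snd_sum euclidean_representation)
      then have "frechet_derivative m (at (y, i y)) (w y, 0) =
          (\<Sum>b\<in>Basis. (w y \<bullet> b) *\<^sub>R frechet_derivative m (at (y, i y)) (b, 0))"
        by (simp add: linear_sum[OF lin] linear_scale[OF lin] del: scaleR_Pair)
      then show ?thesis using D[OF y] by (simp add: Ad_eq w_def)
    qed
    have diff: "(\<lambda>y. inv_into UNIV \<iota> (\<Sum>b\<in>Basis. (w y \<bullet> b) *\<^sub>R frechet_derivative m (at (y, i y)) (b, 0))) differentiable at x"
    proof -
      have xU: "(x, i x) \<in> U1" "(x, \<kappa> \<e>) \<in> U1" "x \<in> U2" using x by (auto simp: N_def)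
      have 1: "(\<lambda>y. (y, i y)) differentiable at x"
        using di[OF xU(3)] by (intro differentiable_Pair) (auto simp: differentiable_def)
      have 2: "(\<lambda>y. frechet_derivative m (at (y, i y)) (b, 0)) differentiable at x" for b
        using differentiable_chain_at[OF 1, of "\<lambda>p. frechet_derivative m (at p) (b, 0)"] d2m[OF xU(1)]
        by (simp add: o_def)
      have 3: "(\<lambda>y. (y, \<kappa> \<e>)) differentiable at x"
        by (intro differentiable_Pair) auto
      have 4: "w differentiable at x"
        using differentiable_chain_at[OF 3, of "\<lambda>p. frechet_derivative m (at p) (0, \<iota> V)"] d2m[OF xU(2)]
        by (simp add: o_def w_def[abs_def])
      have "(\<lambda>y. \<Sum>b\<in>Basis. (w y \<bullet> b) *\<^sub>R frechet_derivative m (at (y, i y)) (b, 0)) differentiable at x"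
        using 2 4 by (intro differentiable_sum differentiable_scaleR differentiable_inner) auto
      from differentiable_chain_at[OF this linear_imp_differentiable[OF linear_inv_iota]]
      show ?thesis by (simp add: o_def)
    qed
    then obtain D where "((\<lambda>y. inv_into UNIV \<iota> (\<Sum>b\<in>Basis. (w y \<bullet> b) *\<^sub>R frechet_derivative m (at (y, i y)) (b, 0))) has_derivative D) (at x)"
      unfolding differentiable_def by blast
    from has_derivative_transform_within_open[OF this oN x eq]
    show ?thesis
      unfolding differentiable_def by blast
  qed
  then show ?thesis using oN eN NC by blast
qed

lemma Ad_chart_has_derivative:
  "((\<lambda>x. Ad G c \<iota> (\<kappa>' x) V) has_derivative (\<lambda>w. br (inv_into UNIV \<iota> w) V)) (at (\<kappa> \<e>))"
proof -
  have "(\<lambda>x. Ad G c \<iota> (\<kappa>' x) V) differentiable at (\<kappa> \<e>)"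
    using Ad_chart_differentiable by blast
  moreover have "frechet_derivative (\<lambda>x. Ad G c \<iota> (\<kappa>' x) V) (at (\<kappa> \<e>)) = (\<lambda>w. br (inv_into UNIV \<iota> w) V)"
    using lie_algebra unfolding has_lie_algebra_def by (metis inv_iota(2))
  ultimately show ?thesis using frechet_derivative_works by metis
qed

text \<open>Both sides are derivatives at the unit of the same function of x, namely Ad (g x g^-1)
  (Ad g V) = Ad g (Ad x V).\<close>

lemma Ad_bracket: "Ad G c \<iota> g (br U V) = br (Ad G c \<iota> g U) (Ad G c \<iota> g V)"
proof -
  define W where "W = Ad G c \<iota> g V"
  obtain N where N: "open N" "\<kappa> \<e> \<in> N" "N \<subseteq> \<kappa> ` fst c"
      "\<And>v. v \<in> N \<Longrightarrow> gmult (gmult g (\<kappa>' v)) (ginv g) \<in> fst c"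
    using conj_chart_near by blast
  have eq: "Ad G c \<iota> (\<kappa>' (conj_chart g x)) W = Ad G c \<iota> g (Ad G c \<iota> (\<kappa>' x) V)" if "x \<in> N" for x
    using chart_c(3)[OF N(4)[OF that]] by (simp add: conj_chart_def Ad_mult W_def)
  have "((\<lambda>x. Ad G c \<iota> (\<kappa>' (conj_chart g x)) W) has_derivative
      (\<lambda>w. br (inv_into UNIV \<iota> (frechet_derivative (conj_chart g) (at (\<kappa> \<e>)) w)) W)) (at (\<kappa> \<e>))"
    using has_derivative_compose[OF conj_chart_has_derivative[of g], of "\<lambda>x. Ad G c \<iota> (\<kappa>' x) W"]
      Ad_chart_has_derivative[of W] by simp
  from has_derivative_transform_within_open[OF this N(1,2) eq]
  have "((\<lambda>x. Ad G c \<iota> g (Ad G c \<iota> (\<kappa>' x) V)) has_derivative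
      (\<lambda>w. br (inv_into UNIV \<iota> (frechet_derivative (conj_chart g) (at (\<kappa> \<e>)) w)) W)) (at (\<kappa> \<e>))" by simp
  moreover have "((\<lambda>x. Ad G c \<iota> g (Ad G c \<iota> (\<kappa>' x) V)) has_derivative
      (\<lambda>w. Ad G c \<iota> g (br (inv_into UNIV \<iota> w) V))) (at (\<kappa> \<e>))"
    using linear_Ad linear_conv_bounded_linear
    by (intro bounded_linear.has_derivative[OF _ Ad_chart_has_derivative]) blast
  ultimately have "(\<lambda>w. Ad G c \<iota> g (br (inv_into UNIV \<iota> w) V)) =
      (\<lambda>w. br (inv_into UNIV \<iota> (frechet_derivative (conj_chart g) (at (\<kappa> \<e>)) w)) W)"
    using has_derivative_unique by blast
  from fun_cong[OF this, of "\<iota> U"] show ?thesis by (simp add: Ad_eq[symmetric] W_def)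
qed

text \<open>Differentiability gives continuity near the unit only; left translation by the inverse
  of \<open>g0\<close> carries it to any point.\<close>

lemma continuous_Ad: "continuous_on UNIV (\<lambda>g. Ad G c \<iota> g V)"
proof -
  obtain N where N: "open N" "\<kappa> \<e> \<in> N" "N \<subseteq> \<kappa> ` fst c"
    "\<And>x V. x \<in> N \<Longrightarrow> (\<lambda>x. Ad G c \<iota> (\<kappa>' x) V) differentiable at x"
    using Ad_chart_differentiable by blast
  have c0: "continuous_on N (\<lambda>x. Ad G c \<iota> (\<kappa>' x) V)"
    using N(4) by (intro differentiable_imp_continuous_on differentiable_at_imp_differentiable_on)
  define S where "S = fst c \<inter> \<kappa> -` N"
  have oS: "open S" unfolding S_def
    by (rule continuous_open_preimage[OF chart_c(5) chart_c(1) N(1)])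
  have "continuous_on S (\<lambda>g. Ad G c \<iota> (\<kappa>' (\<kappa> g)) V)"
    by (rule continuous_on_compose2[OF c0])
      (auto simp: S_def intro: continuous_on_subset[OF chart_c(5)])
  then have cS: "continuous_on S (\<lambda>g. Ad G c \<iota> g V)"
    by (rule continuous_on_eq) (auto simp: S_def chart_c(3))
  have "isCont (\<lambda>g. Ad G c \<iota> g V) g0" for g0
  proof -
    define T where "T = (\<lambda>g. gmult (ginv g0) g) -` S"
    have cm: "continuous_on UNIV (\<lambda>g. gmult (ginv g0) g)"
      by (intro continuous_on_mult continuous_intros)
    have oT: "open T" unfolding T_def using oS cm by (rule open_vimage)
    have gT: "g0 \<in> T" unfolding T_def S_def using N c_in by simp
    have "continuous_on T (\<lambda>g. Ad G c \<iota> g0 (Ad G c \<iota> (gmult (ginv g0) g) V))"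
    proof (rule continuous_on_compose2[where g="Ad G c \<iota> g0" and t=UNIV])
      show "continuous_on UNIV (Ad G c \<iota> g0)" by (rule linear_continuous_on) (simp add: linear_Ad linear_conv_bounded_linear[symmetric])
      show "continuous_on T (\<lambda>g. Ad G c \<iota> (gmult (ginv g0) g) V)"
        by (rule continuous_on_compose2[OF cS]) (auto simp: T_def intro: continuous_on_subset[OF cm])
    qed simp
    then have "continuous_on T (\<lambda>g. Ad G c \<iota> g V)"
      by (rule continuous_on_eq) (simp add: Ad_mult)
    then show ?thesis using oT gT by (simp add: continuous_on_eq_continuous_at)
  qed
  then show ?thesis by (simp add: continuous_on_eq_continuous_at)
qed

end

lemma kernel_range_projection:
  fixes T :: "'a::euclidean_space \<Rightarrow> 'a"
  assumes "linear T" "\<And>v. T (T v) = 0 \<Longrightarrow> T v = 0"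
  shows "\<exists>p. linear p \<and> (\<forall>v. T (p v) = 0) \<and> (\<forall>v. v - p v \<in> range T) \<and>
    (\<forall>v. T v = 0 \<longrightarrow> p v = v) \<and> (\<forall>v. p (T v) = 0)"
proof -
  let ?K = "{v. T v = 0}" and ?R = "range T"
  have sub: "subspace ?K" "subspace ?R"
    using linear_subspace_kernel[OF assms(1)] linear_subspace_image[OF assms(1) subspace_UNIV] by auto
  have int: "?K \<inter> ?R \<subseteq> {0}" using assms(2) by auto
  let ?S = "{x + y | x y. x \<in> ?K \<and> y \<in> ?R}"
  have "dim ?S + dim (?K \<inter> ?R) = dim ?K + dim ?R" by (rule dim_sums_Int[OF sub])
  moreover have "dim (?K \<inter> ?R) = 0" using int dim_eq_0 by blast
  ultimately have "dim ?S = DIM('a)" using dim_kernel_range[OF assms(1)] by linarith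
  then have "?S = UNIV"
    by (intro subspace_dim_equal[OF subspace_sums[OF sub] subspace_UNIV subset_UNIV]) simp
  then have ex: "\<exists>s\<in>?K. v - s \<in> ?R" for v
  proof -
    have "v \<in> ?S" using \<open>?S = UNIV\<close> by blast
    then obtain x y where "x \<in> ?K" "y \<in> ?R" "v = x + y" by blast
    then show ?thesis by (intro bexI[of _ x]) auto
  qed
  show ?thesis
  proof (rule complement_projection[OF sub int ex])
    fix p assume "linear p" "\<And>v. p v \<in> ?K" "\<And>v. v - p v \<in> ?R"
      "\<And>v. v \<in> ?K \<Longrightarrow> p v = v" "\<And>v. v \<in> ?R \<Longrightarrow> p v = 0"
    then show ?thesis by (intro exI[of _ p]) auto
  qed
qed

section \<open>The adjoint group of a connected semisimple group\<close>

locale semisimple_lie_group = lie_group_algebra G A c \<iota> br + semisimple_lie_alg br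
  for G :: "('g::{t2_space, second_countable_topology}) monoid"
    and A :: "('g, 'e::euclidean_space) chart set"
    and c :: "('g, 'e) chart"
    and \<iota> :: "real^'n \<Rightarrow> 'e"
    and br :: "real^'n \<Rightarrow> real^'n \<Rightarrow> real^'n" +
  assumes conn: "connected (UNIV :: 'g set)"
begin

abbreviation ad :: "'g \<Rightarrow> real^'n \<Rightarrow> real^'n" where "ad \<equiv> Ad G c \<iota>"

lemma lie_aut_Ad: "lie_aut br (ad g)"
  by (simp add: lie_aut_def linear_Ad Ad_bracket)

text \<open>The substitute for the exponential map of \<open>G\<close>. In the chart, Ad is a family
  of automorphisms whose derivative at the unit runs through all inner derivations, so
  \<open>aut_family_covers\<close> applies.\<close>

lemma Ad_covers:
  assumes "open W" "\<e> \<in> W"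
  shows "\<exists>d>0. \<forall>\<phi>. lie_aut br \<phi> \<longrightarrow> near_id d \<phi> \<longrightarrow> (\<exists>g\<in>W. ad g = \<phi>)"
proof -
  obtain N where N: "open N" "\<kappa> \<e> \<in> N" "N \<subseteq> \<kappa> ` fst c"
    "\<And>x V. x \<in> N \<Longrightarrow> (\<lambda>x. ad (\<kappa>' x) V) differentiable at x"
    using Ad_chart_differentiable by blast
  define S where "S = N \<inter> \<kappa>' -` W"
  have oS: "open S" unfolding S_def
    by (rule continuous_open_preimage[OF continuous_on_subset[OF chart_c(6) N(3)] N(1) assms(1)])
  have eS: "\<kappa> \<e> \<in> S" using N assms by (simp add: S_def)
  have cont: "continuous_on S (\<lambda>x. ad (\<kappa>' x) V)" for V
    using N(4) by (intro differentiable_imp_continuous_on differentiable_at_imp_differentiable_on)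
      (auto simp: S_def)
  obtain d where d: "d > 0" "\<And>\<phi>. lie_aut br \<phi> \<Longrightarrow> near_id d \<phi> \<Longrightarrow> \<exists>x\<in>S. dist x (\<kappa> \<e>) < 1 \<and> ad (\<kappa>' x) = \<phi>"
  proof (rule aut_family_covers[OF oS eS zero_less_one])
    show "lie_aut br (ad (\<kappa>' x))" for x by (rule lie_aut_Ad)
    show "continuous_on S (\<lambda>x. ad (\<kappa>' x) w)" for w by (rule cont)
    show "ad (\<kappa>' (\<kappa> \<e>)) w = w" for w by (simp add: Ad_one)
    show "((\<lambda>x. ad (\<kappa>' x) w) has_derivative (\<lambda>v. br (inv_into UNIV \<iota> v) w)) (at (\<kappa> \<e>))" for w
      by (rule Ad_chart_has_derivative)
    show "bounded_linear \<iota>" using linear_iota linear_conv_bounded_linear by blast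
    show "inv_into UNIV \<iota> (\<iota> Y) = Y" for Y by simp
  qed blast
  then show ?thesis unfolding S_def by blast
qed

lemma Ad_near:
  assumes "0 < d"
  shows "\<exists>W. open W \<and> \<e> \<in> W \<and> (\<forall>g\<in>W. near_id d (ad g))"
proof -
  define W where "W = (\<Inter>i. (\<lambda>g. norm (ad g (axis i 1) - axis i 1)) -` {..<d / CARD('n)})"
  have "open ((\<lambda>g. norm (ad g (axis i 1) - axis i 1)) -` {..<d / CARD('n)})" for i
    by (intro open_vimage continuous_intros continuous_Ad)
  then have "open W" unfolding W_def by (intro open_INT) auto
  moreover have "\<e> \<in> W" using assms by (simp add: W_def Ad_one)
  moreover have "near_id d (ad g)" if "g \<in> W" for g
  proof (rule near_id_axis[OF linear_Ad])
    show "norm (ad g (axis i 1) - axis i 1) \<le> d / CARD('n)" for i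
      using that unfolding W_def by (blast intro: less_imp_le)
  qed
  ultimately show ?thesis by blast
qed

lemma expo_br_of_nat: "expo (br (of_nat k *\<^sub>R Z)) v = ((expo (br Z)) ^^ k) v"
proof (induction k arbitrary: v)
  case (Suc k)
  have "br Z (br (of_nat k *\<^sub>R Z) v) = br (of_nat k *\<^sub>R Z) (br Z v)" for v
    by (simp add: br.scaleR_left br.scaleR_right)
  then have "expo (\<lambda>v. br Z v + br (of_nat k *\<^sub>R Z) v) v = expo (br Z) (expo (br (of_nat k *\<^sub>R Z)) v)"
    by (intro expo_add_commuting linear_br)
  moreover have "(\<lambda>v. br Z v + br (of_nat k *\<^sub>R Z) v) = br (of_nat (Suc k) *\<^sub>R Z)"
    by (simp add: br_fun algebra_simps fun_eq_iff)
  ultimately show ?case using Suc by simp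
qed (simp add: br_fun)

text \<open>Only small exponentials are known to be attained, so the given one is written as the
  k-th power of that of Y / k.\<close>

lemma expo_in_Ad: "\<exists>g. ad g = expo (br Y)"
proof -
  obtain d where d: "d > 0" "\<forall>\<phi>. lie_aut br \<phi> \<longrightarrow> near_id d \<phi> \<longrightarrow> (\<exists>g\<in>UNIV. ad g = \<phi>)"
    using Ad_covers[OF open_UNIV UNIV_I] by blast
  obtain r where r: "r > 0" "\<And>Y. norm Y \<le> r \<Longrightarrow> near_id d (expo (br Y))"
    using norm_expo_br_near[OF d(1)] by blast
  obtain k where k: "norm Y / r < real k" using reals_Archimedean2 by blast
  then have k0: "k > 0" using r(1) by (metis divide_nonneg_pos gr0I norm_ge_zero not_less of_nat_0)
  define Z where "Z = Y /\<^sub>R of_nat k"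
  have "norm Z \<le> r" using k k0 r(1) by (simp add: Z_def field_simps)
  then have "near_id d (expo (br Z))" using r by blast
  then obtain g where g: "ad g = expo (br Z)" using d(2) expo_br_aut by blast
  have "\<exists>g'. ad g' = (expo (br Z)) ^^ j" for j
  proof (induction j)
    case 0
    have "ad \<e> = id" using Ad_one by auto
    then show ?case by (metis funpow_0 eq_id_iff)
  next
    case (Suc j)
    then obtain g' where "ad g' = (expo (br Z)) ^^ j" by blast
    then have "ad (gmult g g') = (expo (br Z)) ^^ Suc j" using g by (simp add: fun_eq_iff Ad_mult)
    then show ?case by blast
  qed
  moreover have "expo (br Y) = (expo (br Z)) ^^ k"
    using expo_br_of_nat[of k Z] k0 by (simp add: fun_eq_iff Z_def)
  ultimately show ?thesis by metis
qed

definition expo_list :: "(real^'n) list \<Rightarrow> real^'n \<Rightarrow> real^'n" where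
  "expo_list Ys v = foldr (\<lambda>Y. expo (br Y)) Ys v"

text \<open>The elements of \<open>G\<close> that act by products of exponentials form an open set
  with open complement, because near each point only one further exponential factor is
  involved.\<close>

lemma Ad_eq_expo_list: "\<exists>Ys. ad g = expo_list Ys"
proof -
  obtain d where d: "d > 0" "\<And>\<phi>. lie_aut br \<phi> \<Longrightarrow> near_id d \<phi> \<Longrightarrow> \<exists>Y. norm Y \<le> 1 \<and> \<phi> = expo (br Y)"
    using aut_near_id[OF zero_less_one] by blast
  obtain W where W: "open W" "\<e> \<in> W" "\<And>g. g \<in> W \<Longrightarrow> near_id d (ad g)"
    using Ad_near[OF d(1)] by blast
  have We: "\<exists>Y. ad g = expo (br Y)" if "g \<in> W" for g using d(2)[OF lie_aut_Ad W(3)[OF that]] by blast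
  define H where "H = {g. \<exists>Ys. ad g = expo_list Ys}"
  define T where "T g = (\<lambda>g'. gmult (ginv g) g') -` W" for g
  have oT: "open (T g)" for g
    unfolding T_def by (intro open_vimage[OF W(1)] continuous_on_mult continuous_intros)
  have gT: "g \<in> T g" for g using W(2) by (simp add: T_def)
  have 1: "g' \<in> H" if h: "g \<in> H" "g' \<in> T g" for g g'
  proof -
    obtain Ys where Ys: "ad g = expo_list Ys" using h(1) unfolding H_def by blast
    obtain Y where Y: "ad (gmult (ginv g) g') = expo (br Y)" using We h(2) unfolding T_def by blast
    have "ad g' v = expo_list (Ys @ [Y]) v" for v
    proof -
      have "ad g' v = ad (gmult g (gmult (ginv g) g')) v" by (simp flip: m_assoc)
      also have "\<dots> = expo_list Ys (expo (br Y) v)" by (simp only: Ad_mult Ys Y)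
      finally show ?thesis by (simp add: expo_list_def)
    qed
    then have "ad g' = expo_list (Ys @ [Y])" by blast
    then show ?thesis unfolding H_def by blast
  qed
  have 2: "g \<in> H" if h: "g' \<in> H" "g' \<in> T g" for g g'
  proof -
    obtain Ys where Ys: "ad g' = expo_list Ys" using h(1) unfolding H_def by blast
    obtain Y where Y: "ad (gmult (ginv g) g') = expo (br Y)" using We h(2) unfolding T_def by blast
    have "ad g v = expo_list (Ys @ [- Y]) v" for v
    proof -
      have "ad g v = ad g (expo (br Y) (expo (br (- Y)) v))" by (simp add: expo_br_inverse)
      also have "\<dots> = ad (gmult g (gmult (ginv g) g')) (expo (br (- Y)) v)" by (simp only: Ad_mult Y)
      also have "gmult g (gmult (ginv g) g') = g'" by (simp flip: m_assoc)
      finally show ?thesis by (simp add: expo_list_def Ys)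
    qed
    then have "ad g = expo_list (Ys @ [- Y])" by blast
    then show ?thesis unfolding H_def by blast
  qed
  have "open H"
    unfolding open_subopen[of H] using 1 oT gT by blast
  moreover have "open (- H)"
    unfolding open_subopen[of "- H"] using 2 oT gT by blast
  moreover have "\<e> \<in> H"
    unfolding H_def by (auto intro!: exI[of _ "[]"] simp: expo_list_def Ad_one fun_eq_iff)
  ultimately have "H = UNIV" using connectedD[OF conn, of H "- H"] by auto
  then show ?thesis unfolding H_def by blast
qed

lemma linear_expo_list: "linear (expo_list Ys)"
proof (induction Ys)
  case (Cons Y Ys)
  then show ?case using linear_compose[OF Cons linear_expo[of "br Y"]] by (simp add: expo_list_def[abs_def] o_def)
qed (simp add: expo_list_def[abs_def] linear_ident)

lemma lie_aut_expo_list: "lie_aut br (expo_list Ys)"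
proof (induction Ys)
  case (Cons Y Ys)
  then show ?case using lie_aut_comp[OF expo_br_aut Cons, of Y] by (simp add: expo_list_def[abs_def])
qed (simp add: expo_list_def[abs_def] lie_aut_id)

lemma continuous_expo_list: "continuous_on UNIV (\<lambda>t. expo_list (map (\<lambda>Y. t *\<^sub>R Y) Ys) v)"
  by (induction Ys) (auto simp: expo_list_def intro!: continuous_on_expo_br continuous_intros)

text \<open>Scaling all factors by \<open>t\<close> joins the identity to a given product by a path
  that is entire in \<open>t\<close>; properties valid near the identity can be transported along
  it.\<close>

lemma entire_expo_list: "entire_fun (\<lambda>t. expo_list (map (\<lambda>Y. t *\<^sub>R Y) Ys) v $ i)"
proof (induction Ys arbitrary: i)
  case (Cons Y Ys)
  have "entire_fun (\<lambda>t. expo (\<lambda>v. t *\<^sub>R br Y v) (expo_list (map (\<lambda>Y. t *\<^sub>R Y) Ys) v) $ i)"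
    using Cons by (intro entire_fun_expo linear_br)
  then show ?case by (simp add: expo_list_def br_fun)
qed (simp add: expo_list_def entire_fun_const)

lemma expo_list_near:
  assumes "0 < d"
  shows "\<exists>e>0. \<forall>t. \<bar>t\<bar> < e \<longrightarrow> near_id d (expo_list (map (\<lambda>Y. t *\<^sub>R Y) Ys))"
proof -
  define W where "W = (\<Inter>i. (\<lambda>t. norm (expo_list (map (\<lambda>Y. t *\<^sub>R Y) Ys) (axis i 1) - axis i 1)) -` {..<d / CARD('n)})"
  have "open ((\<lambda>t. norm (expo_list (map (\<lambda>Y. t *\<^sub>R Y) Ys) (axis i 1) - axis i 1)) -` {..<d / CARD('n)})" for i
    by (intro open_vimage continuous_intros continuous_expo_list)
  then have "open W" unfolding W_def by (intro open_INT) auto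
  have id: "expo_list (map (\<lambda>Y. 0 *\<^sub>R Y) Ys) v = v" for v
    by (induction Ys) (auto simp: expo_list_def br_fun)
  have "0 \<in> W" unfolding W_def using assms by (simp only: INT_iff vimage_eq id) simp
  with \<open>open W\<close> obtain e where e: "e > 0" "ball 0 e \<subseteq> W" using open_contains_ball by blast
  have "near_id d (expo_list (map (\<lambda>Y. t *\<^sub>R Y) Ys))" if "\<bar>t\<bar> < e" for t
  proof (rule near_id_axis[OF linear_expo_list])
    have "t \<in> W" using e that by auto
    then show "norm (expo_list (map (\<lambda>Y. t *\<^sub>R Y) Ys) (axis i 1) - axis i 1) \<le> d / CARD('n)" for i
      unfolding W_def by (blast intro: less_imp_le)
  qed
  then show ?thesis using e by blast
qed

end

section \<open>Stabilizers of semisimple elements with abelian centralizer\<close>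

text \<open>Both assumptions on \<open>X\<close> will come from its stabilizer algebra being abelian
  and \<theta>-stable.\<close>

locale regular_element = semisimple_lie_group G A c \<iota> br
  for G :: "('g::{t2_space, second_countable_topology}) monoid"
    and A :: "('g, 'e::euclidean_space) chart set"
    and c :: "('g, 'e) chart"
    and \<iota> :: "real^'n \<Rightarrow> 'e"
    and br :: "real^'n \<Rightarrow> real^'n \<Rightarrow> real^'n" +
  fixes X :: "real^'n"
  assumes semisimple: "br X (br X V) = 0 \<Longrightarrow> br X V = 0"
    and centralizer_abelian: "br X U = 0 \<Longrightarrow> br X V = 0 \<Longrightarrow> br U V = 0"
begin

text \<open>With \<open>p\<close> the projection to the centralizer along the range of ad X, the map
  v \<mapsto> expo (ad v) (X + p v) covers a neighbourhood of \<open>X\<close>. So every nearby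
  \<open>Z\<close> is conjugate to an element of the centralizer of \<open>X\<close>, which being
  abelian is contained in that element's own centralizer.\<close>

lemma nullity_near_X:
  "\<exists>e>0. \<forall>Z. norm (Z - X) < e \<longrightarrow> dim {v. br X v = 0} \<le> dim {v. br Z v = 0}"
proof -
  obtain p where p: "linear p" "\<forall>v. br X (p v) = 0" "\<forall>v. v - p v \<in> range (br X)"
      "\<forall>v. br X v = 0 \<longrightarrow> p v = v" "\<forall>v. p (br X v) = 0"
    using kernel_range_projection[OF linear_br semisimple] by blast
  define f where "f v = expo (br v) (X + p v)" for v
  define f' where "f' v = br v X + p v" for v
  have lf': "linear f'" unfolding f'_def by (intro linear_compose_add linear_br_left p)
  have "v = 0" if "f' v = 0" for v
  proof -
    have "br v X = - br X v" by (rule br_anticomm)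
    then have 1: "p v = br X v" using that by (simp add: f'_def)
    then have "br X (br X v) = 0" using p(2) by metis
    then have "br X v = 0" by (rule semisimple)
    then show ?thesis using 1 p(4) by simp
  qed
  then have "inj f'" using linear_injective_0[OF lf'] by blast
  then have "surj f'" using linear_injective_imp_surjective lf' by blast
  then obtain g' where g': "linear g'" "f' \<circ> g' = id" using linear_surjective_right_inverse lf' by blast
  have "(f has_derivative f') (at 0)"
  proof -
    have "((\<lambda>v. X + p v) has_derivative p) (at 0)"
      using linear_imp_has_derivative[OF p(1)] by (auto intro!: derivative_eq_intros)
    from expo_br_has_derivative[OF has_derivative_ident _ this]
    show ?thesis unfolding f_def f'_def by (simp add: linear_0[OF p(1)])
  qed
  moreover have "continuous_on UNIV f"
    unfolding f_def using p(1)
    by (intro continuous_on_expo_br continuous_intros linear_continuous_on) (simp add: linear_conv_bounded_linear)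
  moreover have "bounded_linear g'" using g' linear_conv_bounded_linear by blast
  ultimately have "f 0 \<in> interior (f ` UNIV)"
    using g' by (intro sussmann_open_mapping[of UNIV f 0 f' g' UNIV]) auto
  moreover have "f 0 = X" by (simp add: f_def br_fun linear_0[OF p(1)])
  ultimately obtain e where e: "e > 0" "ball X e \<subseteq> range f" unfolding mem_interior by auto
  have "dim {v. br X v = 0} \<le> dim {v. br Z v = 0}" if "norm (Z - X) < e" for Z
  proof -
    have "Z \<in> ball X e" using that by (simp add: dist_norm norm_minus_commute)
    then obtain v where v: "Z = f v" using e by blast
    have "expo (br v) ` {u. br X u = 0} \<subseteq> {u. br Z u = 0}"
    proof clarify
      fix u assume u: "br X u = 0"
      have "br Z (expo (br v) u) = expo (br v) (br (X + p v) u)"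
        using expo_br_aut[of v] by (simp add: v f_def lie_aut_def)
      also have "br (X + p v) u = 0"
        using u centralizer_abelian[of "p v" u] p(2) by (simp add: br.add_left)
      finally show "br Z (expo (br v) u) = 0" by (simp add: linear_0[OF linear_expo])
    qed
    then have "dim (expo (br v) ` {u. br X u = 0}) \<le> dim {u. br Z u = 0}" by (rule dim_subset)
    moreover have "inj (expo (br v))" by (metis expo_br_inverse(1) injI)
    then have "dim (expo (br v) ` {u. br X u = 0}) = dim {u. br X u = 0}"
      by (intro dim_image_eq linear_expo) (auto intro: inj_on_subset)
    ultimately show ?thesis by simp
  qed
  then show ?thesis using e by blast
qed

text \<open>ad is entire along the line from \<open>X\<close> to \<open>Z\<close>, so the local
  bound extends to the whole algebra.\<close>

lemma nullity_ge: "dim {v. br X v = 0} \<le> dim {v. br Z v = 0}"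
proof -
  obtain e where e: "e > 0" "\<And>Z. norm (Z - X) < e \<Longrightarrow> dim {v. br X v = 0} \<le> dim {v. br Z v = 0}"
    using nullity_near_X by blast
  define e' where "e' = e / (norm (Z - X) + 1)"
  have n: "norm (Z - X) + 1 > 0" using norm_ge_zero[of "Z - X"] by linarith
  have "dim {v. br X v = 0} \<le> dim {v. br (X + 1 *\<^sub>R (Z - X)) v = 0}"
  proof (rule nullity_entire[where e=e'])
    show "linear (br (X + t *\<^sub>R (Z - X)))" for t by (rule linear_br)
    show "entire_fun (\<lambda>t. br (X + t *\<^sub>R (Z - X)) w $ i)" for w i
      by (simp add: br.add_left br.scaleR_left entire_fun_add entire_fun_mult entire_fun_const entire_fun_ident)
    show "e' > 0" using e n by (simp add: e'_def)
    fix t assume "\<bar>t\<bar> < e'"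
    then have "\<bar>t\<bar> * (norm (Z - X) + 1) < e" using n by (simp add: e'_def field_simps)
    then have "\<bar>t\<bar> * norm (Z - X) < e" by (simp add: algebra_simps)
    then show "dim {v. br X v = 0} \<le> dim {v. br (X + t *\<^sub>R (Z - X)) v = 0}" by (intro e(2)) simp
  qed
  then show ?thesis by simp
qed

text \<open>Close to the identity each member of the path to \<open>ad g\<close> is some
  \<open>expo (br Y)\<close>, which fixes the kernel of ad Y, and that kernel is large enough by
  \<open>nullity_ge\<close>.\<close>

lemma fixed_space_Ad_ge: "dim {v. br X v = 0} \<le> dim {v. ad g v - v = 0}"
proof -
  obtain Ys where Ys: "ad g = expo_list Ys" using Ad_eq_expo_list by blast
  obtain d where d: "d > 0" "\<And>\<phi>. lie_aut br \<phi> \<Longrightarrow> near_id d \<phi> \<Longrightarrow> \<exists>Y. norm Y \<le> 1 \<and> \<phi> = expo (br Y)"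
    using aut_near_id[OF zero_less_one] by blast
  obtain e where e: "e > 0" "\<And>t. \<bar>t\<bar> < e \<Longrightarrow> near_id d (expo_list (map (\<lambda>Y. t *\<^sub>R Y) Ys))"
    using expo_list_near[OF d(1)] by blast
  have "dim {v. br X v = 0} \<le> dim {v. expo_list (map (\<lambda>Y. 1 *\<^sub>R Y) Ys) v - v = 0}"
  proof (rule nullity_entire[where e=e])
    show "linear (\<lambda>v. expo_list (map (\<lambda>Y. t *\<^sub>R Y) Ys) v - v)" for t
      by (intro linear_compose_sub linear_expo_list linear_ident)
    show "entire_fun (\<lambda>t. (expo_list (map (\<lambda>Y. t *\<^sub>R Y) Ys) w - w) $ i)" for w i
      using entire_fun_add[OF entire_expo_list entire_fun_const[of "- w $ i"]] by simp
    fix t assume "\<bar>t\<bar> < e"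
    then obtain Y where Y: "expo_list (map (\<lambda>Y. t *\<^sub>R Y) Ys) = expo (br Y)"
      using d(2)[OF lie_aut_expo_list e(2)] by blast
    have "{v. br Y v = 0} \<subseteq> {v. expo_list (map (\<lambda>Y. t *\<^sub>R Y) Ys) v - v = 0}"
      using expo_fixed[OF linear_br] by (auto simp: Y)
    then have "dim {v. br Y v = 0} \<le> dim {v. expo_list (map (\<lambda>Y. t *\<^sub>R Y) Ys) v - v = 0}" by (rule dim_subset)
    then show "dim {v. br X v = 0} \<le> dim {v. expo_list (map (\<lambda>Y. t *\<^sub>R Y) Ys) v - v = 0}"
      using nullity_ge[of Y] by linarith
  qed (use e in auto)
  then show ?thesis by (simp add: Ys)
qed

lemma expo_br_scale_add:
  "expo (br (s *\<^sub>R Y)) (expo (br (t *\<^sub>R Y)) v) = expo (br ((s + t) *\<^sub>R Y)) v"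
proof -
  have "br (s *\<^sub>R Y) (br (t *\<^sub>R Y) v) = br (t *\<^sub>R Y) (br (s *\<^sub>R Y) v)" for v
    by (simp add: br.scaleR_left br.scaleR_right)
  from expo_add_commuting[OF linear_br linear_br this] show ?thesis
    by (simp add: br_fun scaleR_add_left)
qed

text \<open>The spaces \<open>{v. \<phi> (expo (s ad X) v) = v}\<close> in the range of \<open>ad X\<close> are independent for different
  small \<open>s\<close>, so some of them is trivial.\<close>

lemma ex_no_fixed_vector:
  assumes \<phi>: "lie_aut br \<phi>" "\<phi> X = X"
  shows "\<exists>s. \<forall>v\<in>range (br X). \<phi> (expo (br (s *\<^sub>R X)) v) = v \<longrightarrow> v = 0"
proof (rule ccontr)
  assume neg: "\<not> ?thesis"
  have lp: "linear \<phi>" using \<phi> by (simp add: lie_aut_def)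
  define F where "F s v = \<phi> (expo (br (s *\<^sub>R X)) v)" for s v
  have lF: "linear (F s)" for s
    unfolding F_def using linear_compose[OF linear_expo lp] by (simp add: o_def)
  define V where "V s = {v \<in> range (br X). F s v = v}" for s
  from neg have "\<forall>s. \<exists>v. v \<in> V s \<and> v \<noteq> 0" unfolding V_def F_def by blast
  then obtain u where u: "\<And>s. u s \<in> V s" "\<And>s. u s \<noteq> 0" by metis
  have \<phi>E: "\<phi> (expo (br (s *\<^sub>R X)) v) = expo (br (s *\<^sub>R X)) (\<phi> v)" for s v
    using lie_aut_expo[OF \<phi>(1), of "s *\<^sub>R X" v] \<phi>(2) by (simp add: linear_scale[OF lp])
  have FF: "F s (F t v) = F t (F s v)" for s t v
    unfolding F_def by (simp add: \<phi>E expo_br_scale_add add.commute)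
  obtain K where K: "K > 0" "\<And>X Y. norm (br X Y) \<le> K * norm X * norm Y" using br_bounded by blast
  \<comment> \<open>For parameters in this range the operator (s - t) ad X has norm at most 1/2, and
    exp (1/2) < 2 is what \<open>expo_fixed_imp_kernel\<close> asks for.\<close>
  define e where "e = (1/2) / (K * (norm X + 1))"
  have nX: "norm X + 1 > 0" using norm_ge_zero[of X] by linarith
  have e: "e > 0" using K(1) nX by (simp add: e_def)
  have fixed: "v = 0" if st_v: "s \<in> {0<..<e}" "t \<in> {0<..<e}" "s \<noteq> t" "v \<in> V s" "v \<in> V t" for s t v
  proof -
    have "F s v = F t v" using st_v by (simp add: V_def)
    then have "expo (br (s *\<^sub>R X)) (\<phi> v) = expo (br (t *\<^sub>R X)) (\<phi> v)" by (simp add: F_def \<phi>E)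
    then have "expo (br ((- t) *\<^sub>R X)) (expo (br (s *\<^sub>R X)) (\<phi> v)) = expo (br ((- t) *\<^sub>R X)) (expo (br (t *\<^sub>R X)) (\<phi> v))"
      by simp
    then have 1: "expo (br ((s - t) *\<^sub>R X)) (\<phi> v) = \<phi> v" unfolding expo_br_scale_add by (simp add: br_fun)
    have "F s v = v" using st_v by (simp add: V_def)
    then have "expo (br (s *\<^sub>R X)) (expo (br ((s - t) *\<^sub>R X)) (\<phi> v)) = v" using 1 by (simp add: F_def \<phi>E)
    then have "expo (br ((s - t) *\<^sub>R X)) (expo (br (s *\<^sub>R X)) (\<phi> v)) = v"
      by (simp add: expo_br_scale_add add.commute)
    then have 2: "expo (br ((s - t) *\<^sub>R X)) v = v" using \<open>F s v = v\<close> by (simp add: F_def \<phi>E)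
    have st: "\<bar>s - t\<bar> \<le> e" using st_v by auto
    have "K * norm ((s - t) *\<^sub>R X) \<le> K * (e * (norm X + 1))"
      using K(1) st by (auto intro!: mult_left_mono mult_mono)
    also have "\<dots> = 1/2" using K(1) nX by (simp add: e_def)
    finally have Kb: "K * norm ((s - t) *\<^sub>R X) \<le> 1/2" .
    have "exp (1/2::real) < 2"
      using exp_bound[of "1/2"] by (simp add: power2_eq_square)
    have "br ((s - t) *\<^sub>R X) v = 0"
    proof (rule expo_fixed_imp_kernel[of "br ((s - t) *\<^sub>R X)" "1/2"])
      show "norm (br ((s - t) *\<^sub>R X) w) \<le> 1/2 * norm w" for w
        using K(2)[of "(s - t) *\<^sub>R X" w] Kb mult_right_mono[OF Kb norm_ge_zero[of w]] by linarith
    qed (use 2 \<open>exp (1/2::real) < 2\<close> in \<open>auto intro: linear_br\<close>)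
    then have "br X v = 0" using st_v by (simp add: br.scaleR_left)
    moreover obtain w where "v = br X w" using st_v by (auto simp: V_def)
    ultimately show "v = 0" using semisimple by simp
  qed
  \<comment> \<open>The operators F s commute, so \<open>F s0 - 1\<close> preserves every
    \<open>V s\<close>; it annihilates the summand in \<open>V s0\<close> and is injective on the
    others by \<open>fixed\<close>. This reduces a relation to a shorter one.\<close>
  have indep: "\<forall>s\<in>T. w s = 0" if "finite T" "T \<subseteq> {0<..<e}" "\<forall>s\<in>T. w s \<in> V s" "(\<Sum>s\<in>T. w s) = 0" for T w
    using that
  proof (induction T arbitrary: w rule: finite_induct)
    case (insert s0 T)
    define a where "a v = F s0 v - v" for v
    have la: "linear a" unfolding a_def by (intro linear_compose_sub lF linear_ident)
    have aV: "a (w s) \<in> V s" if sT: "s \<in> T" for s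
    proof -
      have ws: "w s \<in> V s" using insert.prems sT by auto
      then obtain y where y: "w s = br X y" by (auto simp: V_def)
      have "F s0 (br X y) = br X (F s0 y)"
      proof -
        have "br (s0 *\<^sub>R X) X = 0" by (simp add: br.scaleR_left)
        then have "expo (br (s0 *\<^sub>R X)) X = X" by (intro expo_fixed linear_br)
        then have "expo (br (s0 *\<^sub>R X)) (br X y) = br X (expo (br (s0 *\<^sub>R X)) y)"
          using expo_br_aut[of "s0 *\<^sub>R X"] by (simp add: lie_aut_def)
        then show ?thesis using \<phi> by (simp add: F_def lie_aut_def)
      qed
      then have "a (w s) = br X (F s0 y - y)" by (simp add: a_def y br.diff_right)
      moreover have "F s (a (w s)) = a (w s)"
        using ws FF[of s s0 "w s"] by (simp add: a_def V_def linear_diff[OF lF])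
      ultimately show ?thesis by (simp add: V_def)
    qed
    have "a (w s0) = 0" using insert.prems by (simp add: a_def V_def)
    moreover have "a (\<Sum>s\<in>insert s0 T. w s) = 0" using insert.prems linear_0[OF la] by simp
    ultimately have "(\<Sum>s\<in>T. a (w s)) = 0" using insert.hyps by (simp add: linear_add[OF la] linear_sum[OF la])
    then have "\<forall>s\<in>T. a (w s) = 0" using insert.IH[of "\<lambda>s. a (w s)"] aV insert.prems by auto
    then have z: "\<forall>s\<in>T. w s = 0"
    proof (intro ballI)
      fix s assume s: "s \<in> T"
      then have "F s0 (w s) = w s" using \<open>\<forall>s\<in>T. a (w s) = 0\<close> by (simp add: a_def)
      then have "w s \<in> V s0" using insert.prems s by (auto simp: V_def)
      moreover have "s \<in> {0<..<e}" "s0 \<in> {0<..<e}" "s \<noteq> s0" "w s \<in> V s"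
        using insert.prems insert.hyps s by auto
      ultimately show "w s = 0" using fixed[of s s0 "w s"] by blast
    qed
    then have "w s0 = 0" using insert.prems insert.hyps by simp
    with z show ?case by simp
  qed simp
  \<comment> \<open>One more parameter than the dimension, hence too many independent
    vectors.\<close>
  obtain T where T: "T \<subseteq> {0<..<e}" "finite T" "card T = Suc CARD('n)"
    using infinite_arbitrarily_large[OF infinite_Ioo[OF e]] by blast
  have inj: "inj_on u T"
  proof (rule inj_onI, rule ccontr)
    fix s t assume st: "s \<in> T" "t \<in> T" "u s = u t" "s \<noteq> t"
    then have "u s \<in> V t" using u(1)[of t] by simp
    moreover have "s \<in> {0<..<e}" "t \<in> {0<..<e}" using st T by blast+
    ultimately show False using fixed[of s t "u s"] u st by blast
  qed
  have "independent (u ` T)"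
  proof -
    have "\<forall>v\<in>u ` T. q v = 0" if "(\<Sum>v\<in>u ` T. q v *\<^sub>R v) = 0" for q
    proof -
      have "(\<Sum>s\<in>T. q (u s) *\<^sub>R u s) = 0" using that by (simp add: sum.reindex[OF inj])
      moreover have "\<forall>s\<in>T. q (u s) *\<^sub>R u s \<in> V s"
      proof
        fix s
        obtain y where "u s = br X y" using u(1)[of s] by (auto simp: V_def)
        then have "q (u s) *\<^sub>R u s = br X (q (u s) *\<^sub>R y)" by (simp add: br.scaleR_right)
        then have "q (u s) *\<^sub>R u s \<in> range (br X)" by blast
        moreover have "F s (q (u s) *\<^sub>R u s) = q (u s) *\<^sub>R u s"
          using u(1)[of s] unfolding linear_scale[OF lF] by (simp add: V_def)
        ultimately show "q (u s) *\<^sub>R u s \<in> V s" by (simp add: V_def)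
      qed
      ultimately show ?thesis using indep[OF T(2,1), of "\<lambda>s. q (u s) *\<^sub>R u s"] u(2) by auto
    qed
    then show ?thesis using T(2) by (auto simp: dependent_finite)
  qed
  then have "card (u ` T) \<le> CARD('n)" using independent_bound by force
  then show False using T inj by (simp add: card_image)
qed

text \<open>For suitable \<open>s\<close> the product \<psi> of \<open>ad g\<close> and expo (s ad
  X) fixes no nonzero vector in the range of ad X. As \<psi> respects the splitting into centralizer
  and range, its fixed vectors lie in the centralizer; by dimension they fill it. The factor expo (s
  ad X) is the identity there, so \<open>ad g\<close> is too.\<close>

theorem stabilizer_fixes_centralizer:
  assumes "ad g X = X" "br X H = 0"
  shows "ad g H = H"
proof -
  have lp: "linear (ad g)" by (rule linear_Ad)
  obtain s where s: "\<And>v. v \<in> range (br X) \<Longrightarrow> ad g (expo (br (s *\<^sub>R X)) v) = v \<Longrightarrow> v = 0"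
    using ex_no_fixed_vector[OF lie_aut_Ad assms(1)] by blast
  obtain g' where g': "ad g' = expo (br (s *\<^sub>R X))" using expo_in_Ad by blast
  define \<psi> where "\<psi> v = ad g (expo (br (s *\<^sub>R X)) v)" for v
  have \<psi>: "\<psi> = ad (gmult g g')" by (simp add: fun_eq_iff \<psi>_def Ad_mult g')
  have l\<psi>: "linear \<psi>" by (simp add: \<psi> linear_Ad)
  have Efix: "expo (br (s *\<^sub>R X)) v = v" if "br X v = 0" for v
    using that by (intro expo_fixed linear_br) (simp add: br.scaleR_left)
  have \<psi>X: "\<psi> X = X" using assms(1) Efix[of X] by (simp add: \<psi>_def)
  have \<psi>br: "\<psi> (br X v) = br X (\<psi> v)" for v
    using Ad_bracket[of "gmult g g'" X v] \<psi>X by (simp add: \<psi>)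
  obtain p where p: "linear p" "\<forall>v. br X (p v) = 0" "\<forall>v. v - p v \<in> range (br X)"
      "\<forall>v. br X v = 0 \<longrightarrow> p v = v" "\<forall>v. p (br X v) = 0"
    using kernel_range_projection[OF linear_br semisimple] by blast
  have sub: "{v. ad (gmult g g') v - v = 0} \<subseteq> {v. br X v = 0}"
  proof clarify
    fix v assume "ad (gmult g g') v - v = 0"
    then have v: "\<psi> v = v" by (simp add: \<psi>)
    define b where "b = v - p v"
    obtain y where y: "b = br X y" using p(3) by (auto simp: b_def)
    have "br X (\<psi> (p v)) = 0" using p(2) by (simp add: \<psi>br[symmetric] linear_0[OF l\<psi>])
    moreover have "\<psi> b = br X (\<psi> y)" by (simp add: y \<psi>br)
    moreover have "\<psi> v = \<psi> (p v) + \<psi> b" by (simp add: b_def linear_diff[OF l\<psi>])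
    ultimately have "p v = \<psi> (p v)" using v p(4,5) by (metis add.right_neutral linear_add[OF p(1)])
    then have "\<psi> b = b" using v by (simp add: b_def linear_diff[OF l\<psi>])
    then have "b = 0" using s[of b] y by (auto simp: \<psi>_def)
    then show "br X v = 0" using p(2) by (metis b_def right_minus_eq)
  qed
  have "{v. ad (gmult g g') v - v = 0} = {v. br X v = 0}"
  proof (rule subspace_dim_equal[OF _ _ sub])
    show "subspace {v. ad (gmult g g') v - v = 0}"
      by (intro linear_subspace_kernel linear_compose_sub linear_Ad linear_ident)
    show "subspace {v. br X v = 0}" by (rule linear_subspace_kernel[OF linear_br])
  qed (rule fixed_space_Ad_ge)
  then have "\<psi> H = H" using assms(2) \<psi> by auto
  then show ?thesis using Efix[OF assms(2)] by (simp add: \<psi>_def)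
qed

end

section \<open>Smoothness\<close>

lemma C_on_Suc_imp: "C_on (Suc k) U f \<Longrightarrow> C_on k U f"
  by (induction k arbitrary: f) (auto intro: differentiable_imp_continuous_on)

lemma C_on_cong:
  assumes "open U" "\<And>x. x \<in> U \<Longrightarrow> f x = g x"
  shows "C_on k U f \<longleftrightarrow> C_on k U g"
  using assms(2)
proof (induction k arbitrary: f g)
  case (Suc k)
  have der: "(f has_derivative D) (at x) \<longleftrightarrow> (g has_derivative D) (at x)" if "x \<in> U" for x D
    using has_derivative_transform_within_open[OF _ assms(1) that, of f D UNIV g]
      has_derivative_transform_within_open[OF _ assms(1) that, of g D UNIV f] Suc.prems by auto
  then have "frechet_derivative f (at x) = frechet_derivative g (at x)" if "x \<in> U" for x
    using that by (simp add: frechet_derivative_def)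
  then have "C_on k U (\<lambda>x. frechet_derivative f (at x) v) \<longleftrightarrow> C_on k U (\<lambda>x. frechet_derivative g (at x) v)" for v
    by (intro Suc.IH) simp
  moreover have "f differentiable_on U \<longleftrightarrow> g differentiable_on U"
    using der assms(1) by (auto simp: differentiable_on_eq_differentiable_at differentiable_def)
  ultimately show ?case by simp
qed (metis C_on.simps(1) continuous_on_cong)

lemma C_on_SucI:
  assumes "open U" "\<And>x. x \<in> U \<Longrightarrow> (f has_derivative f' x) (at x)" "\<And>v. C_on k U (\<lambda>x. f' x v)"
  shows "C_on (Suc k) U f"
proof -
  have "C_on k U (\<lambda>x. frechet_derivative f (at x) v)" for v
  proof (rule C_on_cong[THEN iffD1, OF assms(1) _ assms(3)[of v]])
    show "f' x v = frechet_derivative f (at x) v" if "x \<in> U" for x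
      using frechet_derivative_at[OF assms(2)[OF that]] by simp
  qed
  then show ?thesis
    using assms(1,2) by (auto simp: differentiable_on_eq_differentiable_at differentiable_def)
qed

lemma C_on_linear_compose:
  fixes T :: "'b::euclidean_space \<Rightarrow> 'c::euclidean_space"
  assumes "open U" "linear T" "C_on k U f"
  shows "C_on k U (\<lambda>x. T (f x))"
proof -
  have bl: "bounded_linear T" using assms(2) linear_conv_bounded_linear by blast
  show ?thesis using assms(3)
  proof (induction k arbitrary: f)
    case 0
    then show ?case by (simp add: bounded_linear.continuous_on[OF bl])
  next
    case (Suc k)
    show ?case
    proof (rule C_on_SucI[OF assms(1)])
      show "((\<lambda>x. T (f x)) has_derivative (\<lambda>v. T (frechet_derivative f (at x) v))) (at x)" if "x \<in> U" for x
        by (rule bounded_linear.has_derivative[OF bl C_on_has_derivative[OF Suc.prems assms(1) that]])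
      show "C_on k U (\<lambda>x. T (frechet_derivative f (at x) v))" for v
        using Suc.prems by (intro Suc.IH) simp
    qed
  qed
qed

lemma C_on_add:
  fixes f g :: "'a::euclidean_space \<Rightarrow> 'b::euclidean_space"
  assumes "open U" "C_on k U f" "C_on k U g"
  shows "C_on k U (\<lambda>x. f x + g x)"
  using assms(2,3)
proof (induction k arbitrary: f g)
  case 0
  then show ?case by (simp add: continuous_on_add)
next
  case (Suc k)
  show ?case
  proof (rule C_on_SucI[OF assms(1)])
    show "((\<lambda>x. f x + g x) has_derivative (\<lambda>v. frechet_derivative f (at x) v + frechet_derivative g (at x) v)) (at x)"
      if "x \<in> U" for x
      using Suc.prems that assms(1) by (intro has_derivative_add C_on_has_derivative)
    show "C_on k U (\<lambda>x. frechet_derivative f (at x) v + frechet_derivative g (at x) v)" for v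
      using Suc.prems by (intro Suc.IH) simp_all
  qed
qed

lemma C_on_const: "open U \<Longrightarrow> C_on k U (\<lambda>x. c)"
proof (induction k arbitrary: c)
  case (Suc k)
  then show ?case by (intro C_on_SucI[where f'="\<lambda>_ _. 0"]) auto
qed simp

lemma C_on_linear:
  fixes T :: "'a::euclidean_space \<Rightarrow> 'b::euclidean_space"
  assumes "open U" "linear T"
  shows "C_on k U T"
proof (cases k)
  case 0
  then show ?thesis using assms(2) by (simp add: linear_continuous_on linear_conv_bounded_linear)
next
  case (Suc j)
  have "C_on (Suc j) U T"
    by (rule C_on_SucI[OF assms(1) linear_imp_has_derivative[OF assms(2)] C_on_const[OF assms(1)]])
  then show ?thesis using Suc by simp
qed

text \<open>A single operator \<open>D\<close> with a scalar coefficient commutes with its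
  exponential. The derivative therefore has the shape of the function itself with another \<zeta>,
  and the induction closes once \<zeta> is arbitrary.\<close>

lemma C_on_expo:
  fixes \<zeta> :: "'a::euclidean_space \<Rightarrow> 'b::euclidean_space"
  assumes "open U" "linear l" "linear D" "C_on k U \<zeta>"
  shows "C_on k U (\<lambda>x. expo (\<lambda>w. l x *\<^sub>R D w) (\<zeta> x))"
  using assms(4)
proof (induction k arbitrary: \<zeta>)
  case 0
  have "continuous_on U (\<lambda>x. exp (l x *\<^sub>R endo_of D))"
    using assms(2) by (intro continuous_on_exp_algebra continuous_intros linear_continuous_on)
      (simp add: linear_conv_bounded_linear)
  then show ?case using 0 unfolding expo_scaleR[OF assms(3)]
    by (simp add: bounded_bilinear.continuous_on[OF bounded_bilinear_endo_apply])
next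
  case (Suc k)
  show ?case
  proof (rule C_on_SucI[OF assms(1), where f'="\<lambda>x v. expo (\<lambda>w. l x *\<^sub>R D w) (l v *\<^sub>R D (\<zeta> x) + frechet_derivative \<zeta> (at x) v)"])
    fix x assume x: "x \<in> U"
    have "((\<lambda>x. exp (l x *\<^sub>R endo_of D)) has_derivative (\<lambda>v. l v *\<^sub>R (exp (l x *\<^sub>R endo_of D) * endo_of D))) (at x)"
      using has_derivative_compose[OF linear_imp_has_derivative[OF assms(2), of "at x"]
          exp_scaleR_has_vector_derivative_right[of "endo_of D" "l x" UNIV, unfolded has_vector_derivative_def]]
      by simp
    from bounded_bilinear.FDERIV[OF bounded_bilinear_endo_apply this C_on_has_derivative[OF Suc.prems assms(1) x]]
    show "((\<lambda>x. expo (\<lambda>w. l x *\<^sub>R D w) (\<zeta> x)) has_derivative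
        (\<lambda>v. expo (\<lambda>w. l x *\<^sub>R D w) (l v *\<^sub>R D (\<zeta> x) + frechet_derivative \<zeta> (at x) v))) (at x)"
      unfolding expo_scaleR[OF assms(3)]
      by (simp add: endo_apply_of[OF assms(3)] linear_add[OF linear_endo_apply] linear_scale[OF linear_endo_apply] add.commute)
  next
    fix v
    show "C_on k U (\<lambda>x. expo (\<lambda>w. l x *\<^sub>R D w) (l v *\<^sub>R D (\<zeta> x) + frechet_derivative \<zeta> (at x) v))"
      using Suc.prems C_on_Suc_imp[OF Suc.prems] assms(1,3)
      by (intro Suc.IH C_on_add C_on_linear_compose[of U "\<lambda>y. l v *\<^sub>R D y" k \<zeta>] linear_compose_scale_right) simp_all
  qed
qed

text \<open>\<open>C_on\<close> controls the derivative in each fixed direction; the operator norm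
  is bounded by the sum over the basis directions.\<close>

lemma C_on_derivative_onorm:
  fixes f :: "'a::euclidean_space \<Rightarrow> 'b::euclidean_space"
  assumes "C_on (Suc 0) UNIV f" "0 < e"
  shows "\<exists>d>0. \<forall>x. dist a x < d \<longrightarrow>
    onorm (\<lambda>v. frechet_derivative f (at x) v - frechet_derivative f (at a) v) < e"
proof -
  define D where "D x v = frechet_derivative f (at x) v - frechet_derivative f (at a) v" for x v
  have lD: "linear (D x)" for x
    unfolding D_def using has_derivative_linear[OF C_on_has_derivative[OF assms(1) open_UNIV UNIV_I]]
    by (intro linear_compose_sub) auto
  have "continuous_on UNIV (\<lambda>x. \<Sum>b\<in>Basis. norm (D x b))"
    using assms(1) unfolding D_def by (intro continuous_intros) auto
  then have "open ((\<lambda>x. \<Sum>b\<in>Basis. norm (D x b)) -` {..<e})" by (intro open_vimage) auto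
  moreover have "a \<in> (\<lambda>x. \<Sum>b\<in>Basis. norm (D x b)) -` {..<e}" using assms(2) by (simp add: D_def)
  ultimately obtain d where d: "d > 0" "ball a d \<subseteq> (\<lambda>x. \<Sum>b\<in>Basis. norm (D x b)) -` {..<e}"
    using open_contains_ball by blast
  have "onorm (D x) < e" if "dist a x < d" for x
  proof -
    have "onorm (D x) \<le> (\<Sum>b\<in>Basis. norm (D x b))"
    proof (rule onorm_le)
      fix v :: 'a
      have "D x v = (\<Sum>b\<in>Basis. (v \<bullet> b) *\<^sub>R D x b)"
        using arg_cong[OF euclidean_representation[of v], of "D x"]
        by (simp add: linear_sum[OF lD] linear_scale[OF lD])
      also have "norm \<dots> \<le> (\<Sum>b\<in>Basis. norm v * norm (D x b))"
        by (intro sum_norm_le) (auto intro!: mult_right_mono Basis_le_norm)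
      finally show "norm (D x v) \<le> (\<Sum>b\<in>Basis. norm (D x b)) * norm v"
        by (simp add: sum_distrib_left mult.commute)
    qed
    also have "\<dots> < e" using d that by auto
    finally show ?thesis .
  qed
  then show ?thesis using d(1) unfolding D_def by blast
qed

section \<open>The foliation of a regular orbit by affine leaves\<close>

text \<open>The geometry uses \<open>n1\<close> only through these five properties, which the
  restricted roots supply later. The last one handles stabilizer elements that need not lie in the
  identity component.\<close>

locale orbit_foliation = regular_element G A c \<iota> br X
  for G :: "('g::{t2_space, second_countable_topology}) monoid"
    and A :: "('g, 'e::euclidean_space) chart set"
    and c :: "('g, 'e) chart"
    and \<iota> :: "real^'n \<Rightarrow> 'e"
    and br :: "real^'n \<Rightarrow> real^'n \<Rightarrow> real^'n"
    and X :: "real^'n" +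
  fixes n1 :: "(real^'n) set"
  assumes subspace_n1: "subspace n1"
    and n1_subalgebra: "u \<in> n1 \<Longrightarrow> v \<in> n1 \<Longrightarrow> br u v \<in> n1"
    and n1_normal: "br X H = 0 \<Longrightarrow> v \<in> n1 \<Longrightarrow> br H v \<in> n1"
    and n1_centralizer: "v \<in> n1 \<Longrightarrow> br X v = 0 \<Longrightarrow> v = 0"
    and n1_invariant: "lie_aut br \<phi> \<Longrightarrow> (\<And>H. br X H = 0 \<Longrightarrow> \<phi> H = H) \<Longrightarrow> v \<in> n1 \<Longrightarrow> \<phi> v \<in> n1"
begin

lemma brX_n1: "v \<in> n1 \<Longrightarrow> br X v \<in> n1"
  by (rule n1_normal) simp

lemma surj_on_n1:
  assumes "\<And>v. v \<in> n1 \<Longrightarrow> br Z v \<in> n1" "\<And>v. v \<in> n1 \<Longrightarrow> br Z v = 0 \<Longrightarrow> v = 0"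
  shows "br Z ` n1 = n1"
proof -
  have inj: "inj_on (br Z) n1"
  proof (rule inj_onI)
    fix u v assume uv: "u \<in> n1" "v \<in> n1" "br Z u = br Z v"
    have "u - v \<in> n1" by (rule subspace_diff[OF subspace_n1 uv(1,2)])
    moreover have "br Z (u - v) = 0" using uv(3) by (simp only: br.diff_right right_minus_eq)
    ultimately show "u = v" using assms(2) by (metis right_minus_eq)
  qed
  have "dim (br Z ` n1) = dim n1"
    using inj by (intro dim_image_eq linear_br) (simp add: span_eq_iff[THEN iffD2, OF subspace_n1])
  then show ?thesis
    using assms(1) by (intro subspace_dim_equal linear_subspace_image linear_br subspace_n1) auto
qed

lemma n1_range: "v \<in> n1 \<Longrightarrow> \<exists>u\<in>n1. v = br X u"
  using surj_on_n1[OF brX_n1 n1_centralizer] by blast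

section \<open>Splitting the algebra into \<open>n1\<close>, the centralizer and a
  complement\<close>

text \<open>With R the orthogonal complement of the direct sum of \<open>n1\<close> and the
  centralizer, the algebra is the direct sum of three subspaces. The two maps are projections
  belonging to this one decomposition, so that each annihilates the image of the other.\<close>

lemma projections:
  "\<exists>pn ph. linear pn \<and> linear ph \<and> (\<forall>v. pn v \<in> n1) \<and> (\<forall>v. br X (ph v) = 0) \<and>
    (\<forall>v\<in>n1. pn v = v \<and> ph v = 0) \<and> (\<forall>v. br X v = 0 \<longrightarrow> ph v = v \<and> pn v = 0)"
proof -
  let ?h = "{v. br X v = 0}"
  have sh: "subspace ?h" by (rule linear_subspace_kernel[OF linear_br])
  let ?q = "{x + y | x y. x \<in> n1 \<and> y \<in> ?h}"
  have sq: "subspace ?q" by (rule subspace_sums[OF subspace_n1 sh])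
  let ?R = "{y. \<forall>x\<in>?q. orthogonal x y}"
  have sR: "subspace ?R" by (rule subspace_orthogonal_to_vectors)
  have 0: "x = 0" if "x \<in> ?q" "x \<in> ?R" for x
  proof -
    have "orthogonal x x" using that by blast
    then show ?thesis by (simp add: orthogonal_self)
  qed
  have q1: "x \<in> ?q" if "x \<in> n1" for x
    using that subspace_0[OF sh] by (intro CollectI exI[of _ x] exI[of _ 0]) auto
  have q2: "x \<in> ?q" if "x \<in> ?h" for x
    using that subspace_0[OF subspace_n1] by (intro CollectI exI[of _ 0] exI[of _ x]) auto
  have dec: "\<exists>x y z. x \<in> n1 \<and> y \<in> ?h \<and> z \<in> ?R \<and> v = x + y + z" for v
  proof -
    obtain w z where wz: "w \<in> ?q" "\<forall>x\<in>?q. orthogonal x z" "v = w + z"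
      using orthogonal_decomp[OF sq, of v] by blast
    then obtain x y where "x \<in> n1" "y \<in> ?h" "w = x + y" by blast
    then show ?thesis using wz by blast
  qed
  have T: "subspace {x + y | x y. x \<in> ?h \<and> y \<in> ?R}" by (rule subspace_sums[OF sh sR])
  have T': "subspace {x + y | x y. x \<in> n1 \<and> y \<in> ?R}" by (rule subspace_sums[OF subspace_n1 sR])
  have "\<exists>p. linear p \<and> (\<forall>v. p v \<in> n1) \<and> (\<forall>v\<in>n1. p v = v) \<and> (\<forall>v\<in>?h. p v = 0)"
  proof (rule complement_projection[OF subspace_n1 T])
    show "n1 \<inter> {x + y | x y. x \<in> ?h \<and> y \<in> ?R} \<subseteq> {0}"
    proof
      fix u assume "u \<in> n1 \<inter> {x + y | x y. x \<in> ?h \<and> y \<in> ?R}"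
      then obtain x y where xy: "u \<in> n1" "u = x + y" "x \<in> ?h" "y \<in> ?R" by blast
      have "u - x \<in> ?q" using subspace_diff[OF sq q1[OF xy(1)] q2[OF xy(3)]] .
      then have "y = 0" using 0[of y] xy by simp
      then show "u \<in> {0}" using n1_centralizer[of u] xy by auto
    qed
    show "\<exists>s\<in>n1. v - s \<in> {x + y | x y. x \<in> ?h \<and> y \<in> ?R}" for v
    proof -
      obtain x y z where "x \<in> n1" "y \<in> ?h" "z \<in> ?R" "v = x + y + z" using dec[of v] by blast
      then show ?thesis by (intro bexI[of _ x] CollectI exI[of _ y] exI[of _ z]) auto
    qed
    fix p assume p: "linear p" "\<And>v. p v \<in> n1" "\<And>v. v \<in> n1 \<Longrightarrow> p v = v"
      "\<And>v. v \<in> {x + y | x y. x \<in> ?h \<and> y \<in> ?R} \<Longrightarrow> p v = 0"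
    have "p v = 0" if "v \<in> ?h" for v
      using that subspace_0[OF sR] by (intro p(4) CollectI exI[of _ v] exI[of _ 0]) auto
    then show ?thesis using p by blast
  qed
  then obtain pn where pn: "linear pn" "\<And>v. pn v \<in> n1" "\<And>v. v \<in> n1 \<Longrightarrow> pn v = v"
      "\<And>v. v \<in> ?h \<Longrightarrow> pn v = 0" by blast
  have "\<exists>p. linear p \<and> (\<forall>v. p v \<in> ?h) \<and> (\<forall>v\<in>?h. p v = v) \<and> (\<forall>v\<in>n1. p v = 0)"
  proof (rule complement_projection[OF sh T'])
    show "?h \<inter> {x + y | x y. x \<in> n1 \<and> y \<in> ?R} \<subseteq> {0}"
    proof
      fix u assume "u \<in> ?h \<inter> {x + y | x y. x \<in> n1 \<and> y \<in> ?R}"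
      then obtain x y where xy: "u \<in> ?h" "u = x + y" "x \<in> n1" "y \<in> ?R" by blast
      have "u - x \<in> ?q" using subspace_diff[OF sq q2[OF xy(1)] q1[OF xy(3)]] .
      then have "y = 0" using 0[of y] xy by simp
      then show "u \<in> {0}" using n1_centralizer[of u] xy by auto
    qed
    show "\<exists>s\<in>?h. v - s \<in> {x + y | x y. x \<in> n1 \<and> y \<in> ?R}" for v
    proof -
      obtain x y z where "x \<in> n1" "y \<in> ?h" "z \<in> ?R" "v = x + y + z" using dec[of v] by blast
      then show ?thesis by (intro bexI[of _ y] CollectI exI[of _ x] exI[of _ z]) auto
    qed
    fix p assume p: "linear p" "\<And>v. p v \<in> ?h" "\<And>v. v \<in> ?h \<Longrightarrow> p v = v"
      "\<And>v. v \<in> {x + y | x y. x \<in> n1 \<and> y \<in> ?R} \<Longrightarrow> p v = 0"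
    have "p v = 0" if "v \<in> n1" for v
      using that subspace_0[OF sR] by (intro p(4) CollectI exI[of _ v] exI[of _ 0]) auto
    then show ?thesis using p by blast
  qed
  then obtain ph where ph: "linear ph" "\<And>v. ph v \<in> ?h" "\<And>v. v \<in> ?h \<Longrightarrow> ph v = v"
      "\<And>v. v \<in> n1 \<Longrightarrow> ph v = 0" by blast
  show ?thesis using pn ph by (intro exI[of _ pn] exI[of _ ph]) auto
qed

definition pn :: "real^'n \<Rightarrow> real^'n" where
  "pn = (SOME pn. \<exists>ph. linear pn \<and> linear ph \<and> (\<forall>v. pn v \<in> n1) \<and> (\<forall>v. br X (ph v) = 0) \<and>
    (\<forall>v\<in>n1. pn v = v \<and> ph v = 0) \<and> (\<forall>v. br X v = 0 \<longrightarrow> ph v = v \<and> pn v = 0))"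

definition ph :: "real^'n \<Rightarrow> real^'n" where
  "ph = (SOME ph. linear pn \<and> linear ph \<and> (\<forall>v. pn v \<in> n1) \<and> (\<forall>v. br X (ph v) = 0) \<and>
    (\<forall>v\<in>n1. pn v = v \<and> ph v = 0) \<and> (\<forall>v. br X v = 0 \<longrightarrow> ph v = v \<and> pn v = 0))"

lemma pn_ph:
  "linear pn" "linear ph" "pn v \<in> n1" "br X (ph v) = 0" "v \<in> n1 \<Longrightarrow> pn v = v" "v \<in> n1 \<Longrightarrow> ph v = 0"
  "br X v = 0 \<Longrightarrow> ph v = v" "br X v = 0 \<Longrightarrow> pn v = 0"
proof -
  have "linear pn \<and> linear ph \<and> (\<forall>v. pn v \<in> n1) \<and> (\<forall>v. br X (ph v) = 0) \<and>
    (\<forall>v\<in>n1. pn v = v \<and> ph v = 0) \<and> (\<forall>v. br X v = 0 \<longrightarrow> ph v = v \<and> pn v = 0)"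
    unfolding ph_def using someI_ex[OF someI_ex[OF projections], folded pn_def] .
  then show "linear pn" "linear ph" "pn v \<in> n1" "br X (ph v) = 0" "v \<in> n1 \<Longrightarrow> pn v = v" "v \<in> n1 \<Longrightarrow> ph v = 0"
    "br X v = 0 \<Longrightarrow> ph v = v" "br X v = 0 \<Longrightarrow> pn v = 0" by blast+
qed

definition ps :: "real^'n \<Rightarrow> real^'n" where "ps v = v - pn v - ph v"

lemma linear_ps: "linear ps"
  unfolding ps_def by (intro linear_compose_sub linear_ident pn_ph)

lemma ps_simps [simp]: "pn (ps v) = 0" "ph (ps v) = 0" "ps (ps v) = ps v"
  "v \<in> n1 \<Longrightarrow> ps v = 0" "br X v = 0 \<Longrightarrow> ps v = 0"
proof -
  show 1: "pn (ps v) = 0" "ph (ps v) = 0"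
    unfolding ps_def by (simp_all add: linear_diff[OF pn_ph(1)] linear_diff[OF pn_ph(2)] pn_ph)
  show "ps (ps v) = ps v" unfolding ps_def[of "ps v"] 1 by simp
qed (simp_all add: ps_def pn_ph)

text \<open>The factors of \<open>sec\<close> do not commute, so an order of the basis has to be
  fixed.\<close>

definition basis_list :: "(real^'n) list" where
  "basis_list = (SOME bs. set bs = Basis \<and> distinct bs)"

lemma basis_list: "set basis_list = Basis" "distinct basis_list"
  using someI_ex[OF finite_distinct_list[OF finite_Basis]] unfolding basis_list_def by auto

text \<open>A product of one-parameter groups in the directions of a basis; unlike \<open>expo (br v)\<close> it is
  easily seen to be smooth in \<open>v\<close>.\<close>

definition sec :: "real^'n \<Rightarrow> real^'n \<Rightarrow> real^'n" where
  "sec v = expo_list (map (\<lambda>b. (v \<bullet> b) *\<^sub>R b) basis_list)"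

lemma linear_sec: "linear (sec v)" and lie_aut_sec: "lie_aut br (sec v)"
  by (simp_all add: sec_def linear_expo_list lie_aut_expo_list)

lemma expo_list_in_Ad: "\<exists>g. ad g = expo_list Ys"
proof (induction Ys)
  case Nil
  have "ad \<e> = expo_list []" by (simp add: fun_eq_iff Ad_one expo_list_def)
  then show ?case by blast
next
  case (Cons Y Ys)
  then obtain g where g: "ad g = expo_list Ys" by blast
  obtain g' where g': "ad g' = expo (br Y)" using expo_in_Ad by blast
  have "ad (gmult g' g) = expo_list (Y # Ys)"
    by (simp add: fun_eq_iff Ad_mult g g') (simp add: expo_list_def)
  then show ?case by blast
qed

lemma sec_in_Ad: "\<exists>g. ad g = sec v"
  by (simp add: sec_def expo_list_in_Ad)

lemma sec_0 [simp]: "sec 0 w = w"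
proof -
  have "expo_list (map (\<lambda>b. (0 \<bullet> b) *\<^sub>R b) bs) w = w" for bs
    by (induction bs) (auto simp: expo_list_def br_fun)
  then show ?thesis by (simp add: sec_def)
qed

lemma continuous_on_sec:
  assumes "continuous_on S f" "continuous_on S g"
  shows "continuous_on S (\<lambda>x. sec (f x) (g x))"
proof -
  have "continuous_on S (\<lambda>x. expo_list (map (\<lambda>b. (f x \<bullet> b) *\<^sub>R b) bs) (g x))" for bs
    by (induction bs) (auto simp: expo_list_def intro!: continuous_on_expo_br continuous_intros assms)
  then show ?thesis by (simp add: sec_def)
qed

lemma C_on_sec:
  assumes "open U" "linear q" "C_on k U g"
  shows "C_on k U (\<lambda>x. sec (q x) (g x))"
proof -
  have "C_on k U (\<lambda>x. expo_list (map (\<lambda>b. (q x \<bullet> b) *\<^sub>R b) bs) (g x))" for bs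
  proof (induction bs)
    case (Cons b bs)
    have "linear (\<lambda>x. q x \<bullet> b)"
      using assms(2) by (intro linearI) (simp_all add: linear_add linear_scale inner_add_left)
    from C_on_expo[OF assms(1) this linear_br Cons, of b]
    show ?case by (simp add: expo_list_def br_fun)
  qed (simp add: expo_list_def assms(3))
  then show ?thesis by (simp add: sec_def)
qed

text \<open>Where \<open>f x = 0\<close>, each factor contributes its own ad to first order and the
  order of the factors has no influence; the contributions add up to ad of the full vector.\<close>

lemma sec_has_derivative:
  assumes "(f has_derivative f') (at x)" "f x = 0" "(g has_derivative g') (at x)"
  shows "((\<lambda>x. sec (f x) (g x)) has_derivative (\<lambda>v. br (f' v) (g x) + g' v)) (at x)"
proof -
  have "((\<lambda>x. expo_list (map (\<lambda>b. (f x \<bullet> b) *\<^sub>R b) bs) (g x)) has_derivative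
      (\<lambda>v. (\<Sum>b\<leftarrow>bs. br ((f' v \<bullet> b) *\<^sub>R b) (g x)) + g' v)) (at x)" for bs
  proof (induction bs)
    case (Cons b bs)
    have 0: "expo_list (map (\<lambda>b. (f x \<bullet> b) *\<^sub>R b) bs) (g x) = g x"
      unfolding assms(2) by (induction bs) (auto simp: expo_list_def br_fun)
    have "((\<lambda>x. (f x \<bullet> b) *\<^sub>R b) has_derivative (\<lambda>v. (f' v \<bullet> b) *\<^sub>R b)) (at x)"
      using assms(1) by (auto intro!: derivative_eq_intros)
    from expo_br_has_derivative[OF this _ Cons] show ?case
      using 0 assms(2) by (simp add: expo_list_def add.assoc)
  qed (simp add: expo_list_def assms(3))
  from this[of basis_list] show ?thesis
    unfolding sec_def sum_list_distinct_conv_sum_set[OF basis_list(2)] basis_list(1)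
    by (simp flip: br.sum_left add: euclidean_representation)
qed

section \<open>A local diffeomorphism adapted to the orbit and its leaves\<close>

text \<open>\<open>pn v\<close> moves along the affine leaf, \<open>ps v\<close> moves across the
  leaves inside the orbit, and \<open>ph v\<close> leaves the orbit. Keeping \<open>ph\<close> makes
  \<open>chi\<close> a map between spaces of equal dimension, to which local injectivity theorems
  apply; the orbit is parametrised by \<open>ph v = 0\<close>.\<close>

definition chi :: "real^'n \<Rightarrow> real^'n" where
  "chi v = sec (ps v) (X + (pn v + ph v))"

lemma C_on_chi: "C_on k UNIV chi"
  unfolding chi_def
  by (intro C_on_sec C_on_add C_on_const C_on_linear linear_ps pn_ph open_UNIV)

lemma chi_0 [simp]: "chi 0 = X"
  by (simp add: chi_def linear_0[OF linear_ps] linear_0[OF pn_ph(1)] linear_0[OF pn_ph(2)])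

lemma chi_has_derivative: "(chi has_derivative frechet_derivative chi (at x)) (at x)"
  by (rule C_on_has_derivative[OF C_on_chi open_UNIV UNIV_I])

lemma chi_derivative_0: "frechet_derivative chi (at 0) = (\<lambda>v. br (ps v) X + (pn v + ph v))"
proof -
  have "((\<lambda>v. X + (pn v + ph v)) has_derivative (\<lambda>v. pn v + ph v)) (at 0)"
    using linear_imp_has_derivative[OF pn_ph(1)] linear_imp_has_derivative[OF pn_ph(2)]
    by (auto intro!: derivative_eq_intros)
  from sec_has_derivative[OF linear_imp_has_derivative[OF linear_ps] _ this]
  have "(chi has_derivative (\<lambda>v. br (ps v) X + (pn v + ph v))) (at 0)"
    by (simp add: chi_def[abs_def] linear_0[OF linear_ps] linear_0[OF pn_ph(1)] linear_0[OF pn_ph(2)])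
  then show ?thesis by (rule frechet_derivative_at[symmetric])
qed

text \<open>As \<open>pn v = [X, u]\<close> with \<open>u\<close> in \<open>n1\<close>, the equation
  puts \<open>ph v\<close> into the range of ad X as well as into its kernel. Semisimplicity
  separates the two, and \<open>ps\<close> then tells its argument from \<open>u\<close>.\<close>

lemma chi_derivative_0_inj:
  assumes "br (ps v) X + (pn v + ph v) = 0"
  shows "v = 0"
proof -
  obtain u where u: "u \<in> n1" "pn v = br X u" using n1_range[OF pn_ph(3)] by blast
  have "br (ps v) X = - br X (ps v)" by (rule br_anticomm)
  then have 1: "ph v = br X (ps v - u)" using assms u by (simp add: br.diff_right algebra_simps)
  then have "br X (br X (ps v - u)) = 0" using pn_ph(4)[of v] by simp
  then have 2: "br X (ps v - u) = 0" by (rule semisimple)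
  then have "ps (ps v - u) = 0" by simp
  then have "ps v = 0" using u by (simp add: linear_diff[OF linear_ps])
  moreover have "u = 0"
    using 2 \<open>ps v = 0\<close> n1_centralizer[OF u(1)] by (simp add: br.minus_right)
  ultimately have "pn v = 0" "ph v = 0" using 1 u(2) by (simp_all add: br.zero_right)
  then show ?thesis using \<open>ps v = 0\<close> unfolding ps_def by simp
qed

lemma chi_local:
  "\<exists>e>0. inj_on chi (ball 0 e) \<and> (\<forall>x\<in>ball 0 e. inj (frechet_derivative chi (at x)))"
proof -
  let ?D = "\<lambda>x. frechet_derivative chi (at x)"
  have l: "linear (?D x)" for x using has_derivative_linear[OF chi_has_derivative] .
  have inj0: "inj (?D 0)"
    using linear_injective_0[OF l[of 0]] chi_derivative_0_inj unfolding chi_derivative_0 by blast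
  then obtain g' where g': "linear g'" "g' \<circ> ?D 0 = id" using linear_injective_left_inverse l by blast
  obtain r where r: "r > 0" "inj_on chi (ball 0 r)"
  proof (rule has_derivative_locally_injective[of 0 UNIV g' "\<lambda>x. ?D x" chi])
    show "bounded_linear g'" using g' linear_conv_bounded_linear by blast
    show "g' \<circ> ?D 0 = id" by (rule g')
    show "(chi has_derivative ?D x) (at x)" for x by (rule chi_has_derivative)
    show "\<exists>d>0. \<forall>x. dist 0 x < d \<longrightarrow> onorm (\<lambda>v. ?D x v - ?D 0 v) < e" if "e > 0" for e
      using C_on_derivative_onorm[OF C_on_chi that] .
  qed auto
  \<comment> \<open>\<open>B\<close> bounds the derivative at 0 from below, so a perturbation of
    operator norm less than \<open>B\<close> leaves it injective.\<close>
  obtain B where B: "B > 0" "\<And>x. B * norm x \<le> norm (?D 0 x)" using linear_inj_bounded_below_pos[OF l inj0] by blast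
  obtain d where d: "d > 0" "\<And>x. dist 0 x < d \<Longrightarrow> onorm (\<lambda>v. ?D x v - ?D 0 v) < B"
    using C_on_derivative_onorm[OF C_on_chi B(1)] by blast
  have "inj (?D x)" if "dist 0 x < d" for x
  proof -
    have "v = 0" if v: "?D x v = 0" for v
    proof (rule ccontr)
      assume "v \<noteq> 0"
      have "bounded_linear (\<lambda>v. ?D x v - ?D 0 v)"
        using l linear_conv_bounded_linear by (intro bounded_linear_sub) blast+
      then have "norm (?D x v - ?D 0 v) \<le> onorm (\<lambda>v. ?D x v - ?D 0 v) * norm v" by (rule onorm)
      also have "\<dots> < B * norm v" using d(2)[OF \<open>dist 0 x < d\<close>] \<open>v \<noteq> 0\<close> by simp
      finally show False using B(2)[of v] v by simp
    qed
    then show ?thesis using linear_injective_0[OF l] by blast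
  qed
  then show ?thesis
    using r d by (intro exI[of _ "min r d"]) (auto intro: inj_on_subset)
qed

text \<open>\<open>expo (br u) Z - Z\<close> stays in \<open>n1\<close> for \<open>u \<in> n1\<close>, and its derivative at \<open>u = 0\<close> is onto.\<close>

lemma expo_n1_diff:
  assumes "\<And>v. v \<in> n1 \<Longrightarrow> br Z v \<in> n1" "u \<in> n1"
  shows "expo (br u) Z - Z \<in> n1"
proof (rule expo_diff_in_subspace[OF linear_br subspace_n1])
  show "br u w \<in> n1" if "w \<in> n1" for w using n1_subalgebra assms that by blast
  show "br u Z \<in> n1" using assms br_anticomm[of u Z] subspace_neg[OF subspace_n1] by simp
qed

lemma slide:
  assumes "\<And>v. v \<in> n1 \<Longrightarrow> br Z v \<in> n1" "\<And>v. v \<in> n1 \<Longrightarrow> br Z v = 0 \<Longrightarrow> v = 0" "0 < e"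
  shows "\<exists>d>0. \<forall>b\<in>n1. norm b < d \<longrightarrow> (\<exists>u\<in>n1. norm u < e \<and> Z + b = expo (br u) Z)"
proof -
  \<comment> \<open>The map on \<open>n1\<close> is completed by the identity on the kernel of
    \<open>pn\<close>, so that the open mapping theorem can be applied on the whole space.\<close>
  define f where "f v = (expo (br (pn v)) Z - Z) + (v - pn v)" for v
  define f' where "f' v = br (pn v) Z + (v - pn v)" for v
  have lin: "linear f'"
    unfolding f'_def using linear_compose[OF pn_ph(1) linear_br_left[of Z]]
    by (intro linear_compose_add linear_compose_sub linear_ident pn_ph) (simp add: o_def)
  have pn0: "pn (v - pn v) = 0" for v by (simp add: linear_diff[OF pn_ph(1)] pn_ph)
  have "v = 0" if "f' v = 0" for v
  proof -
    have br: "br (pn v) Z = - br Z (pn v)" by (rule br_anticomm)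
    then have "br (pn v) Z \<in> n1" using assms(1)[OF pn_ph(3)] subspace_neg[OF subspace_n1] by simp
    then have "br (pn v) Z = pn (f' v)" by (simp add: f'_def linear_add[OF pn_ph(1)] pn0 pn_ph)
    then have "br (pn v) Z = 0" using that by (simp add: linear_0[OF pn_ph(1)])
    then have "pn v = 0" using br assms(2)[OF pn_ph(3)] by simp
    then show "v = 0" using that by (simp add: f'_def br.zero_left)
  qed
  then have "inj f'" using linear_injective_0[OF lin] by blast
  then have "surj f'" using linear_injective_imp_surjective lin by blast
  then obtain g' where g': "linear g'" "f' \<circ> g' = id" using linear_surjective_right_inverse lin by blast
  have "((\<lambda>v. expo (br (pn v)) Z) has_derivative (\<lambda>v. br (pn v) Z + 0)) (at 0)"
    by (rule expo_br_has_derivative[OF linear_imp_has_derivative[OF pn_ph(1)] _ has_derivative_const])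
      (simp add: linear_0[OF pn_ph(1)])
  then have "(f has_derivative f') (at 0)"
    unfolding f_def f'_def using linear_imp_has_derivative[OF pn_ph(1)]
    by (auto intro!: derivative_eq_intros)
  moreover have "continuous_on UNIV f"
    unfolding f_def using linear_continuous_on[of pn] pn_ph(1)
    by (intro continuous_intros continuous_on_expo_br) (auto simp: linear_conv_bounded_linear)
  moreover have "bounded_linear g'" using g' linear_conv_bounded_linear by blast
  moreover obtain B where B: "B > 0" "\<And>x. norm (pn x) \<le> B * norm x" using linear_bounded_pos[OF pn_ph(1)] by blast
  ultimately have "f 0 \<in> interior (f ` ball 0 (e / B))"
    using g' assms(3) by (intro sussmann_open_mapping[of UNIV f 0 f' g' "ball 0 (e / B)"]) auto
  moreover have "f 0 = 0" by (simp add: f_def linear_0[OF pn_ph(1)] br_fun)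
  ultimately obtain d where d: "d > 0" "ball 0 d \<subseteq> f ` ball 0 (e / B)" unfolding mem_interior by auto
  have "\<exists>u\<in>n1. norm u < e \<and> Z + b = expo (br u) Z" if b: "b \<in> n1" "norm b < d" for b
  proof -
    have "b \<in> ball 0 d" using b by simp
    then obtain v where v: "v \<in> ball 0 (e / B)" "b = f v" using d(2) by blast
    have eZ: "expo (br (pn v)) Z - Z \<in> n1" by (rule expo_n1_diff[OF assms(1) pn_ph(3)])
    have "pn b = expo (br (pn v)) Z - Z" by (simp add: v(2) f_def linear_add[OF pn_ph(1)] pn0 pn_ph(5)[OF eZ])
    then have "Z + b = expo (br (pn v)) Z" using b pn_ph(5)[of b] by simp
    moreover have "norm (pn v) < e"
    proof -
      have "norm (pn v) \<le> B * norm v" by (rule B(2))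
      also have "\<dots> < e" using v(1) B(1) by (simp add: field_simps)
      finally show ?thesis .
    qed
    ultimately show ?thesis using pn_ph(3) by blast
  qed
  then show ?thesis using d(1) by blast
qed

lemma br_X_plus_n1:
  assumes "b \<in> n1" "v \<in> n1"
  shows "br (X + b) v \<in> n1"
  using assms brX_n1 n1_subalgebra subspace_add[OF subspace_n1] by (simp add: br.add_left)

text \<open>Needed to apply \<open>slide\<close> at every point of a plaque and not only at
  \<open>X\<close>. Completed by the identity on the kernel of \<open>pn\<close>, ad X is invertible
  and bounded below, which a small \<open>b\<close> cannot destroy.\<close>

lemma nondegenerate_near_X:
  "\<exists>e>0. \<forall>b v. norm b < e \<longrightarrow> v \<in> n1 \<longrightarrow> br (X + b) v = 0 \<longrightarrow> v = 0"
proof -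
  define f where "f v = br X (pn v) + (v - pn v)" for v
  have lin: "linear f"
    unfolding f_def using linear_compose[OF pn_ph(1) linear_br[of X]]
    by (intro linear_compose_add linear_compose_sub linear_ident pn_ph) (simp add: o_def)
  have "v = 0" if "f v = 0" for v
  proof -
    have "br X (pn v) = pn (f v)"
      by (simp add: f_def linear_add[OF pn_ph(1)] linear_diff[OF pn_ph(1)] pn_ph brX_n1)
    then have "br X (pn v) = 0" using that by (simp add: linear_0[OF pn_ph(1)])
    then have "pn v = 0" using n1_centralizer[OF pn_ph(3)] by simp
    then show "v = 0" using that by (simp add: f_def br.zero_right)
  qed
  then have "inj f" using linear_injective_0[OF lin] by blast
  then obtain B where B: "B > 0" "\<And>x. B * norm x \<le> norm (f x)" using linear_inj_bounded_below_pos lin by blast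
  obtain K where K: "K > 0" "\<And>X Y. norm (br X Y) \<le> K * norm X * norm Y" using br_bounded by blast
  have "v = 0" if v: "norm b < B / K" "v \<in> n1" "br (X + b) v = 0" for b v
  proof (rule ccontr)
    assume "v \<noteq> 0"
    have "B * norm v \<le> norm (br X v)" using B(2)[of v] v by (simp add: f_def pn_ph)
    also have "br X v = - br b v" using v(3) by (simp add: br.add_left add_eq_0_iff)
    also have "norm (- br b v) \<le> K * norm b * norm v" using K(2) by simp
    also have "\<dots> < B * norm v" using v(1) K(1) \<open>v \<noteq> 0\<close> by (simp add: field_simps)
    finally show False by simp
  qed
  then show ?thesis using B(1) K(1) by (intro exI[of _ "B / K"]) auto
qed

lemma Ad_stabilizer_n1:
  assumes "ad g X = X"
  shows "ad g ` n1 = n1"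
proof -
  have sub: "ad k ` n1 \<subseteq> n1" if "ad k X = X" for k
    using n1_invariant[OF lie_aut_Ad stabilizer_fixes_centralizer[OF that]] by blast
  have "ad (ginv g) X = X" using assms Ad_inv(1)[of g X] by simp
  then have "ad (ginv g) ` n1 \<subseteq> n1" by (rule sub)
  then have "n1 \<subseteq> ad g ` n1" by (metis Ad_inv(2) image_eqI image_subset_iff subsetI)
  then show ?thesis using sub[OF assms] by blast
qed

lemma expo_n1: "u \<in> n1 \<Longrightarrow> expo (br u) ` n1 = n1"
proof -
  assume u: "u \<in> n1"
  have sub: "expo (br u) ` n1 \<subseteq> n1" if "u \<in> n1" for u
    using expo_in_subspace[OF linear_br subspace_n1] n1_subalgebra that by blast
  have "expo (br (- u)) ` n1 \<subseteq> n1" using sub[of "- u"] subspace_neg[OF subspace_n1 u] by simp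
  then have "n1 \<subseteq> expo (br u) ` n1" by (metis expo_br_inverse(2) image_eqI image_subset_iff subsetI)
  then show ?thesis using sub[OF u] by blast
qed

text \<open>An exponential of an element of \<open>n1\<close> preserves \<open>n1\<close>, so the
  direction is constant along a plaque; two ways to reach the same point differ by an element that
  fixes \<open>X\<close>, which preserves \<open>n1\<close> as well.\<close>

lemma leaf_directions_unique:
  assumes "u \<in> n1" "u' \<in> n1" "ad g (expo (br u) X) = ad g' (expo (br u') X)"
  shows "ad g ` n1 = ad g' ` n1"
proof -
  obtain k where k: "ad k = expo (br u)" using expo_in_Ad by blast
  obtain k' where k': "ad k' = expo (br u')" using expo_in_Ad by blast
  define s where "s = gmult (ginv (gmult g' k')) (gmult g k)"
  have gs: "gmult (gmult g' k') s = gmult g k" unfolding s_def by (simp flip: m_assoc)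
  have "ad (gmult g k) X = ad (gmult g' k') X" using assms(3) by (simp add: Ad_mult k k')
  then have "ad s X = X" by (metis Ad_inv(1) Ad_mult s_def)
  then have "ad s ` n1 = n1" by (rule Ad_stabilizer_n1)
  then have "ad (gmult g k) ` n1 = ad (gmult g' k') ` n1"
    unfolding gs[symmetric] Ad_mult[of "gmult g' k'" s] by (simp flip: image_image)
  moreover have "ad (gmult g k) ` n1 = ad g ` (expo (br u) ` n1)"
    unfolding image_image by (rule image_cong) (simp_all only: Ad_mult k)
  moreover have "ad (gmult g' k') ` n1 = ad g' ` (expo (br u') ` n1)"
    unfolding image_image by (rule image_cong) (simp_all only: Ad_mult k')
  ultimately show ?thesis by (simp only: expo_n1 assms)
qed

lemma family_near:
  fixes \<kappa> :: "'b::metric_space \<Rightarrow> real^'n \<Rightarrow> real^'n"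
  assumes "\<And>w. continuous_on UNIV (\<lambda>v. \<kappa> v w)" "\<And>v. linear (\<kappa> v)" "\<And>w. \<kappa> v0 w = w" "0 < d"
  shows "\<exists>r>0. \<forall>v. dist v v0 < r \<longrightarrow> near_id d (\<kappa> v)"
proof -
  define W where "W = (\<Inter>i. (\<lambda>v. norm (\<kappa> v (axis i 1) - axis i 1)) -` {..<d / CARD('n)})"
  have "open ((\<lambda>v. norm (\<kappa> v (axis i 1) - axis i 1)) -` {..<d / CARD('n)})" for i
    by (intro open_vimage continuous_intros assms(1))
  then have "open W" unfolding W_def by (intro open_INT) auto
  moreover have "v0 \<in> W" using assms(3,4) by (simp add: W_def)
  ultimately obtain r where r: "r > 0" "ball v0 r \<subseteq> W" using open_contains_ball by blast
  have "near_id d (\<kappa> v)" if "dist v v0 < r" for v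
  proof (rule near_id_axis[OF assms(2)])
    have "v \<in> W" using r that by (auto simp: dist_commute)
    then show "norm (\<kappa> v (axis i 1) - axis i 1) \<le> d / CARD('n)" for i
      unfolding W_def by (blast intro: less_imp_le)
  qed
  then show ?thesis using r by blast
qed

section \<open>The topology of the orbit\<close>

lemma orbit_eq: "orbit ad X = range (\<lambda>g. ad g X)"
  by (simp add: orbit_def)

text \<open>\<open>Ad_covers\<close> gives one direction and \<open>Ad_near\<close> the other.
  Continuity and openness of charts then become statements about moving a point by a small
  automorphism.\<close>

lemma openin_orbit_iff:
  "openin (orbit_topology ad X) V \<longleftrightarrow>
    V \<subseteq> orbit ad X \<and> (\<forall>Z\<in>V. \<exists>d>0. \<forall>\<phi>. lie_aut br \<phi> \<longrightarrow> near_id d \<phi> \<longrightarrow> \<phi> Z \<in> V)"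
proof -
  have "(\<forall>Z\<in>V. \<exists>d>0. \<forall>\<phi>. lie_aut br \<phi> \<longrightarrow> near_id d \<phi> \<longrightarrow> \<phi> Z \<in> V)"
    if o: "open {g. ad g X \<in> V}" and V: "V \<subseteq> orbit ad X"
  proof
    fix Z assume Z: "Z \<in> V"
    then obtain g0 where g0: "Z = ad g0 X" using V unfolding orbit_eq by blast
    define W where "W = (\<lambda>h. gmult h g0) -` {g. ad g X \<in> V}"
    have "open W" unfolding W_def
      by (intro open_vimage[OF o] continuous_on_mult continuous_intros)
    moreover have "\<e> \<in> W" using Z by (simp add: W_def g0)
    ultimately obtain d where d: "d > 0" "\<forall>\<phi>. lie_aut br \<phi> \<longrightarrow> near_id d \<phi> \<longrightarrow> (\<exists>g\<in>W. ad g = \<phi>)"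
      using Ad_covers by blast
    have "\<phi> Z \<in> V" if \<phi>: "lie_aut br \<phi>" "near_id d \<phi>" for \<phi>
    proof -
      obtain h where h: "h \<in> W" "ad h = \<phi>" using d(2) \<phi> by blast
      have "\<phi> Z = ad (gmult h g0) X" by (simp add: g0 Ad_mult h(2))
      then show ?thesis using h(1) by (simp add: W_def)
    qed
    then show "\<exists>d>0. \<forall>\<phi>. lie_aut br \<phi> \<longrightarrow> near_id d \<phi> \<longrightarrow> \<phi> Z \<in> V" using d(1) by blast
  qed
  moreover have "open {g. ad g X \<in> V}"
    if *: "\<forall>Z\<in>V. \<exists>d>0. \<forall>\<phi>. lie_aut br \<phi> \<longrightarrow> near_id d \<phi> \<longrightarrow> \<phi> Z \<in> V"
  proof (subst open_subopen, intro ballI)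
    fix g0 assume "g0 \<in> {g. ad g X \<in> V}"
    then have "ad g0 X \<in> V" by simp
    then obtain d where d: "d > 0" "\<forall>\<phi>. lie_aut br \<phi> \<longrightarrow> near_id d \<phi> \<longrightarrow> \<phi> (ad g0 X) \<in> V"
      using * by blast
    obtain W where W: "open W" "\<e> \<in> W" "\<forall>g\<in>W. near_id d (ad g)" using Ad_near[OF d(1)] by blast
    define T where "T = (\<lambda>g. gmult g (ginv g0)) -` W"
    have "open T" unfolding T_def
      by (intro open_vimage[OF W(1)] continuous_on_mult continuous_intros)
    moreover have "g0 \<in> T" using W(2) by (simp add: T_def)
    moreover have "ad g X \<in> V" if "g \<in> T" for g
    proof -
      have "ad g X = ad (gmult g (ginv g0)) (ad g0 X)"
        by (simp add: Ad_mult)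
      moreover have "near_id d (ad (gmult g (ginv g0)))" using that W(3) unfolding T_def by blast
      ultimately show ?thesis using d(2) lie_aut_Ad by simp
    qed
    ultimately show "\<exists>T. open T \<and> g0 \<in> T \<and> T \<subseteq> {g. ad g X \<in> V}" by blast
  qed
  ultimately show ?thesis unfolding openin_orbit_topology by blast
qed

section \<open>Foliation charts\<close>

text \<open>A complement of the centralizer of \<open>X\<close>, so it has the dimension of the
  orbit.\<close>

definition model :: "(real^'n) set" where "model = {v. ph v = 0}"

lemma subspace_model: "subspace model"
  unfolding model_def by (rule linear_subspace_kernel[OF pn_ph(2)])

lemma n1_model: "n1 \<subseteq> model"
  by (auto simp: model_def pn_ph)

lemma chi_model: "v \<in> model \<Longrightarrow> chi v = sec (ps v) (X + pn v)"
  by (simp add: chi_def model_def)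

text \<open>The last clause keeps plaques with different transverse parameters apart. It admits
  every \<open>b\<close> in \<open>n1\<close>, because in \<open>plaques_match\<close> the vector
  \<open>b\<close> arises without a bound; the equation itself forces it to be small.\<close>

lemma good_radius:
  "\<exists>e>0. inj_on chi (ball 0 e) \<and> (\<forall>x\<in>ball 0 e. inj (frechet_derivative chi (at x))) \<and>
    (\<forall>v\<in>ball 0 e. (\<forall>w\<in>n1. br (X + pn v) w = 0 \<longrightarrow> w = 0) \<and> (\<exists>u\<in>n1. X + pn v = expo (br u) X)) \<and>
    (\<forall>v\<in>ball 0 e. \<forall>v'\<in>ball 0 e. \<forall>b\<in>n1. sec (ps v) X = sec (ps v') (X + b) \<longrightarrow> ps v = ps v')"
proof -
  obtain e0 where e0: "e0 > 0" "inj_on chi (ball 0 e0)" "\<forall>x\<in>ball 0 e0. inj (frechet_derivative chi (at x))"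
    using chi_local by blast
  obtain e1 where e1: "e1 > 0" "\<And>b v. norm b < e1 \<Longrightarrow> v \<in> n1 \<Longrightarrow> br (X + b) v = 0 \<Longrightarrow> v = 0"
    using nondegenerate_near_X by blast
  obtain e2 where e2: "e2 > 0" "\<And>b. b \<in> n1 \<Longrightarrow> norm b < e2 \<Longrightarrow> \<exists>u\<in>n1. norm u < 1 \<and> X + b = expo (br u) X"
    using slide[OF brX_n1 n1_centralizer zero_less_one] by blast
  obtain B where B: "B > 0" "\<And>v. norm (pn v) \<le> B * norm v" using linear_bounded_pos[OF pn_ph(1)] by blast
  obtain C where C: "C > 0" "\<And>v. norm (ps v) \<le> C * norm v" using linear_bounded_pos[OF linear_ps] by blast
  have cps: "continuous_on UNIV ps"
    using linear_ps by (intro linear_continuous_on) (simp add: linear_conv_bounded_linear)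
  have "\<exists>r>0. \<forall>v. dist v 0 < r \<longrightarrow> near_id (1/2) (sec (ps v))"
  proof (rule family_near)
    show "continuous_on UNIV (\<lambda>v. sec (ps v) w)" for w
      by (intro continuous_on_sec cps continuous_intros)
  qed (simp_all add: linear_sec linear_0[OF linear_ps])
  then obtain e3 where e3: "e3 > 0" "\<And>v. dist v 0 < e3 \<Longrightarrow> near_id (1/2) (sec (ps v))"
    by blast
  have "continuous_on UNIV (\<lambda>v. norm (sec (ps v) X - X))"
    by (intro continuous_intros continuous_on_sec cps)
  then have "open ((\<lambda>v. norm (sec (ps v) X - X)) -` {..<e0 / 16})" by (intro open_vimage) auto
  moreover have "0 \<in> (\<lambda>v. norm (sec (ps v) X - X)) -` {..<e0 / 16}"
    using e0(1) by (simp add: linear_0[OF linear_ps])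
  ultimately obtain e4 where e4: "e4 > 0" "ball 0 e4 \<subseteq> (\<lambda>v. norm (sec (ps v) X - X)) -` {..<e0 / 16}"
    using open_contains_ball by blast
  \<comment> \<open>The parameters \<open>ps\<close> stay below e0 / 2. The two displacements of
    \<open>X\<close> stay below e0 / 16, so the image of \<open>b\<close> is below e0 / 8 and
    \<open>b\<close> below e0 / 4. Both arguments of \<open>chi\<close> thus lie in the ball where
    it is injective.\<close>
  define e where "e = min (min (min e0 (e1 / B)) (min (e2 / B) e3)) (min e4 (e0 / (2 * C)))"
  have e: "e > 0" "e \<le> e0" "e \<le> e1 / B" "e \<le> e2 / B" "e \<le> e3" "e \<le> e4" "e \<le> e0 / (2 * C)"
    using e0(1) e1(1) e2(1) e3(1) e4(1) B(1) C(1) by (auto simp: e_def)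
  have pnb: "norm (pn v) < b" if "v \<in> ball 0 e" "e \<le> b / B" for v b
  proof -
    have "norm (pn v) \<le> B * norm v" by (rule B(2))
    also have "\<dots> < B * (b / B)" using that B(1) by (intro mult_strict_left_mono) auto
    finally show ?thesis using B(1) by simp
  qed
  have sep: "ps v = ps v'" if v: "v \<in> ball 0 e" "v' \<in> ball 0 e" "b \<in> n1" "sec (ps v) X = sec (ps v') (X + b)" for v v' b
  proof -
    have psb: "norm (ps w) < e0 / 2" if "w \<in> ball 0 e" for w
    proof -
      have "norm (ps w) \<le> C * norm w" by (rule C(2))
      also have "\<dots> < C * (e0 / (2 * C))" using that e(7) C(1) by (intro mult_strict_left_mono) auto
      finally show ?thesis using C(1) by simp
    qed
    have near: "norm (sec (ps v') b - b) \<le> 1/2 * norm b"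
      using e3(2)[of v'] v(2) e(5) by (simp add: near_id_def)
    have small: "norm (sec (ps w) X - X) < e0 / 16" if "w \<in> ball 0 e" for w
    proof -
      have "w \<in> ball 0 e4" using that e(6) by simp
      then show ?thesis using e4(2) by blast
    qed
    have "sec (ps v') b = (sec (ps v) X - X) - (sec (ps v') X - X)"
      using v(4) by (simp add: linear_add[OF linear_sec])
    then have "norm (sec (ps v') b) < e0 / 8"
      using norm_triangle_ineq4[of "sec (ps v) X - X" "sec (ps v') X - X"] small[OF v(1)] small[OF v(2)] by simp
    moreover have "norm b \<le> norm (sec (ps v') b) + norm (sec (ps v') b - b)"
      using norm_triangle_ineq4[of "sec (ps v') b" "sec (ps v') b - b"] by simp
    ultimately have "norm b < e0 / 4" using near by simp
    then have in2: "ps v' + b \<in> ball 0 e0"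
      using psb[OF v(2)] norm_triangle_ineq[of "ps v'" b] e0(1) by simp
    have in1: "ps v \<in> ball 0 e0" using psb[OF v(1)] e0(1) by simp
    have "chi (ps v) = sec (ps v) X" by (simp add: chi_def)
    moreover have "chi (ps v' + b) = sec (ps v') (X + b)"
      using v(3) by (simp add: chi_def linear_add[OF linear_ps] linear_add[OF pn_ph(1)] linear_add[OF pn_ph(2)] pn_ph)
    ultimately have "ps v = ps v' + b" using e0(2) in1 in2 v(4) by (metis inj_onD)
    then have "ps (ps v) = ps (ps v') + ps b" by (simp only: linear_add[OF linear_ps])
    then show ?thesis using v(3) by simp
  qed
  have "ball 0 e \<subseteq> ball (0::real^'n) e0" using e(2) by auto
  then have "inj_on chi (ball 0 e)" "\<forall>x\<in>ball 0 e. inj (frechet_derivative chi (at x))"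
    using e0(2,3) inj_on_subset by blast+
  moreover have "\<forall>v\<in>ball 0 e. (\<forall>w\<in>n1. br (X + pn v) w = 0 \<longrightarrow> w = 0)"
    using e1(2) pnb[OF _ e(3)] by blast
  moreover have "\<forall>v\<in>ball 0 e. \<exists>u\<in>n1. X + pn v = expo (br u) X"
    using e2(2)[OF pn_ph(3)] pnb[OF _ e(4)] by blast
  ultimately show ?thesis using sep e(1) by (intro exI[of _ e]) blast
qed

definition rad :: real where
  "rad = (SOME e. e > 0 \<and> inj_on chi (ball 0 e) \<and> (\<forall>x\<in>ball 0 e. inj (frechet_derivative chi (at x))) \<and>
    (\<forall>v\<in>ball 0 e. (\<forall>w\<in>n1. br (X + pn v) w = 0 \<longrightarrow> w = 0) \<and> (\<exists>u\<in>n1. X + pn v = expo (br u) X)) \<and>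
    (\<forall>v\<in>ball 0 e. \<forall>v'\<in>ball 0 e. \<forall>b\<in>n1. sec (ps v) X = sec (ps v') (X + b) \<longrightarrow> ps v = ps v'))"

definition pdom :: "(real^'n) set" where "pdom = model \<inter> ball 0 rad"

definition psi :: "'g \<Rightarrow> real^'n \<Rightarrow> real^'n" where "psi p v = ad p (chi v)"

lemma rad:
  "rad > 0" "inj_on chi (ball 0 rad)" "x \<in> ball 0 rad \<Longrightarrow> inj (frechet_derivative chi (at x))"
  "x \<in> ball 0 rad \<Longrightarrow> w \<in> n1 \<Longrightarrow> br (X + pn x) w = 0 \<Longrightarrow> w = 0"
  "x \<in> ball 0 rad \<Longrightarrow> \<exists>u\<in>n1. X + pn x = expo (br u) X"
  "x \<in> ball 0 rad \<Longrightarrow> x' \<in> ball 0 rad \<Longrightarrow> b \<in> n1 \<Longrightarrow> sec (ps x) X = sec (ps x') (X + b) \<Longrightarrow> ps x = ps x'"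
  using someI_ex[OF good_radius, folded rad_def] by blast+

lemma openin_pdom: "openin (top_of_set model) pdom"
  unfolding pdom_def by (intro openin_open_Int) simp

lemma zero_pdom: "0 \<in> pdom"
  using rad(1) subspace_0[OF subspace_model] by (simp add: pdom_def)

lemma pdom_D: "v \<in> pdom \<Longrightarrow> v \<in> model" "v \<in> pdom \<Longrightarrow> v \<in> ball 0 rad"
  by (simp_all add: pdom_def)

lemma Ad_inj: "ad g v = ad g w \<longleftrightarrow> v = w"
  by (metis Ad_inv(1))

lemma inj_psi: "inj_on (psi p) pdom"
  using rad(2) unfolding inj_on_def psi_def Ad_inj pdom_def by blast

lemma psi_translate: "v \<in> pdom \<Longrightarrow> \<exists>k u. u \<in> n1 \<and> ad k = sec (ps v) \<and> psi p v = ad (gmult p k) (expo (br u) X)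
    \<and> X + pn v = expo (br u) X"
proof -
  assume v: "v \<in> pdom"
  obtain u where u: "u \<in> n1" "X + pn v = expo (br u) X" using rad(5)[OF pdom_D(2)[OF v]] by blast
  obtain k where "ad k = sec (ps v)" using sec_in_Ad by blast
  then show ?thesis using u v
    by (intro exI[of _ k] exI[of _ u]) (simp add: psi_def chi_model pdom_D Ad_mult)
qed

lemma psi_base: "v \<in> pdom \<Longrightarrow> \<exists>p0. psi p v = ad p0 X"
proof -
  assume "v \<in> pdom"
  then obtain k u where "psi p v = ad (gmult p k) (expo (br u) X)" using psi_translate by blast
  moreover obtain k' where "ad k' = expo (br u)" using expo_in_Ad by blast
  ultimately have "psi p v = ad (gmult (gmult p k) k') X" by (simp add: Ad_mult)
  then show ?thesis by blast
qed

lemma psi_in_orbit: "psi p ` pdom \<subseteq> orbit ad X"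
  using psi_base unfolding orbit_eq by blast

text \<open>Continuity of \<open>psi\<close> in the language of automorphisms: \<open>slide\<close>
  provides a small exponential that moves along the plaque, the quotient of two values of
  \<open>sec\<close> moves across, and everything is conjugated to the given place.\<close>

lemma psi_moved_by_aut:
  assumes v0: "v0 \<in> pdom" and "0 < d"
  shows "\<exists>r>0. \<forall>v\<in>pdom. dist v v0 < r \<longrightarrow> (\<exists>\<phi>. lie_aut br \<phi> \<and> near_id d \<phi> \<and> psi p v = \<phi> (psi p v0))"
proof -
  obtain k where k: "ad k = sec (ps v0)" using sec_in_Ad by blast
  define q where "q = gmult p k"
  obtain C where C: "C > 0"
      "\<And>d \<phi>. near_id d \<phi> \<Longrightarrow> near_id (C * d) (\<lambda>v. ad q (\<phi> (ad (ginv q) v)))"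
    using near_id_conj[OF linear_Ad linear_Ad, of q "ginv q"] by auto
  \<comment> \<open>Two maps within d' \<le> 1 of the identity compose to one within 3 d', and
    conjugation costs a further factor \<open>C\<close>.\<close>
  define d' where "d' = min 1 (d / (3 * C))"
  have d': "d' > 0" "d' \<le> 1" "C * (3 * d') \<le> d"
    using C(1) \<open>0 < d\<close> by (auto simp: d'_def min_def field_simps)
  obtain r1 where r1: "r1 > 0" "\<And>u. norm u \<le> r1 \<Longrightarrow> near_id d' (expo (br u))"
    using norm_expo_br_near[OF d'(1)] by blast
  obtain r2 where r2: "r2 > 0" "\<And>b. b \<in> n1 \<Longrightarrow> norm b < r2 \<Longrightarrow>
      \<exists>u\<in>n1. norm u < r1 \<and> X + pn v0 + b = expo (br u) (X + pn v0)"
    using slide[OF br_X_plus_n1[OF pn_ph(3)] rad(4)[OF pdom_D(2)[OF v0]] r1(1)] by blast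
  have cps: "continuous_on UNIV ps"
    using linear_ps by (intro linear_continuous_on) (simp add: linear_conv_bounded_linear)
  obtain r3 where r3: "r3 > 0" "\<And>v. dist v v0 < r3 \<Longrightarrow> near_id d' (\<lambda>w. ad (ginv k) (sec (ps v) w))"
  proof -
    have "\<exists>r>0. \<forall>v. dist v v0 < r \<longrightarrow> near_id d' (\<lambda>w. ad (ginv k) (sec (ps v) w))"
    proof (rule family_near[OF _ _ _ d'(1)])
      show "continuous_on UNIV (\<lambda>v. ad (ginv k) (sec (ps v) w))" for w
        using linear_Ad[of "ginv k"]
        by (intro continuous_on_compose2[OF linear_continuous_on[of "ad (ginv k)"]] continuous_on_sec cps
            continuous_intros) (auto simp: linear_conv_bounded_linear)
      show "linear (\<lambda>w. ad (ginv k) (sec (ps v) w))" for v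
        using linear_compose[OF linear_sec linear_Ad] by (simp add: o_def)
      show "ad (ginv k) (sec (ps v0) w) = w" for w
        by (simp flip: k)
    qed
    then show thesis using that by blast
  qed
  obtain B where B: "B > 0" "\<And>v. norm (pn v) \<le> B * norm v" using linear_bounded_pos[OF pn_ph(1)] by blast
  have "\<exists>\<phi>. lie_aut br \<phi> \<and> near_id d \<phi> \<and> psi p v = \<phi> (psi p v0)"
    if v: "v \<in> pdom" "dist v v0 < min r3 (r2 / B)" for v
  proof -
    define b where "b = pn (v - v0)"
    have "norm b \<le> B * norm (v - v0)" unfolding b_def by (rule B(2))
    also have "\<dots> < B * (r2 / B)" using v(2) B(1) by (intro mult_strict_left_mono) (auto simp: dist_norm)
    finally have "norm b < r2" using B(1) by simp
    then obtain u where u: "u \<in> n1" "norm u < r1" "X + pn v0 + b = expo (br u) (X + pn v0)"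
      using r2(2)[of b] pn_ph(3) unfolding b_def by blast
    have Xv: "X + pn v = expo (br u) (X + pn v0)"
      unfolding u(3)[symmetric] b_def by (simp add: linear_diff[OF pn_ph(1)])
    define \<phi>0 where "\<phi>0 w = ad (ginv k) (sec (ps v) (expo (br u) w))" for w
    have a0: "lie_aut br \<phi>0"
      unfolding \<phi>0_def
      by (intro lie_aut_comp[OF lie_aut_Ad] lie_aut_comp[OF lie_aut_sec] expo_br_aut)
    have "near_id (d' * (1 + d') + d') \<phi>0"
      unfolding \<phi>0_def using r3(2)[of v] r1(2)[of u] u(2) v(2) d'(1)
      by (intro near_id_comp[of d' "\<lambda>w. ad (ginv k) (sec (ps v) w)"]) auto
    moreover have "d' * (1 + d') + d' \<le> 3 * d'" using d' by (simp add: algebra_simps mult_left_le)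
    ultimately have n0: "near_id (3 * d') \<phi>0" by (rule near_id_mono)
    define \<phi> where "\<phi> w = ad q (\<phi>0 (ad (ginv q) w))" for w
    have "near_id (C * (3 * d')) \<phi>" unfolding \<phi>_def by (rule C(2)[OF n0])
    then have "near_id d \<phi>" using d'(3) by (rule near_id_mono)
    moreover have "lie_aut br \<phi>"
      unfolding \<phi>_def by (intro lie_aut_comp[OF lie_aut_Ad] lie_aut_comp[OF a0] lie_aut_Ad)
    moreover have "psi p v = \<phi> (psi p v0)"
    proof -
      have 1: "psi p v0 = ad q (X + pn v0)"
        using v0 by (simp add: psi_def chi_model pdom_D q_def Ad_mult k)
      have "\<phi> (psi p v0) = ad q (\<phi>0 (X + pn v0))" by (simp add: \<phi>_def 1)
      also have "\<dots> = ad p (ad k (ad (ginv k) (sec (ps v) (X + pn v))))"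
        by (simp only: \<phi>0_def Xv q_def Ad_mult)
      also have "\<dots> = psi p v" using v(1) by (simp add: psi_def chi_model pdom_D)
      finally show ?thesis by simp
    qed
    ultimately show ?thesis by blast
  qed
  then show ?thesis using r3(1) r2(1) B(1) by (intro exI[of _ "min r3 (r2 / B)"]) auto
qed

text \<open>Every automorphism near the identity is a product of \<open>sec (ps v)\<close>,
  \<open>expo (br (pn v))\<close> and \<open>expo (br (ph v))\<close>. The last factor fixes
  \<open>X\<close> and the second moves it inside X + \<open>n1\<close>, so the result is a value of
  \<open>chi\<close> on the model space.\<close>

lemma chi_covers_X:
  assumes "0 < e"
  shows "\<exists>d>0. \<forall>\<phi>. lie_aut br \<phi> \<longrightarrow> near_id d \<phi> \<longrightarrow> (\<exists>v\<in>model. norm v < e \<and> \<phi> X = chi v)"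
proof -
  define \<kappa> where "\<kappa> v w = sec (ps v) (expo (br (pn v)) (expo (br (ph v)) w))" for v w
  define f where "f v = ps v + (expo (br (pn v)) X - X)" for v
  have cont: "continuous_on UNIV ps" "continuous_on UNIV pn" "continuous_on UNIV ph"
    using linear_ps pn_ph(1,2) by (auto intro!: linear_continuous_on simp: linear_conv_bounded_linear)
  have "continuous_on UNIV (\<lambda>v. norm (f v))"
    unfolding f_def by (intro continuous_intros continuous_on_expo_br cont)
  then have "open ((\<lambda>v. norm (f v)) -` {..<e})" by (intro open_vimage) auto
  moreover have "0 \<in> (\<lambda>v. norm (f v)) -` {..<e}"
    using assms by (simp add: f_def linear_0[OF linear_ps] linear_0[OF pn_ph(1)] br_fun)
  ultimately obtain r where r: "r > 0" "ball 0 r \<subseteq> (\<lambda>v. norm (f v)) -` {..<e}"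
    using open_contains_ball by blast
  obtain d where d: "d > 0" "\<And>\<phi>. lie_aut br \<phi> \<Longrightarrow> near_id d \<phi> \<Longrightarrow> \<exists>v\<in>UNIV. dist v 0 < r \<and> \<kappa> v = \<phi>"
  proof (rule aut_family_covers[OF open_UNIV UNIV_I r(1)])
    show "lie_aut br (\<kappa> v)" for v
      unfolding \<kappa>_def by (intro lie_aut_comp[OF lie_aut_sec] lie_aut_comp[OF expo_br_aut] expo_br_aut)
    show "continuous_on UNIV (\<lambda>v. \<kappa> v w)" for w
      unfolding \<kappa>_def by (intro continuous_on_sec continuous_on_expo_br cont continuous_intros)
    show "\<kappa> 0 w = w" for w
      by (simp add: \<kappa>_def linear_0[OF linear_ps] linear_0[OF pn_ph(1)] linear_0[OF pn_ph(2)] br_fun)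
    show "((\<lambda>v. \<kappa> v w) has_derivative (\<lambda>v. br v w)) (at 0)" for w
    proof -
      note l0 = linear_0[OF linear_ps] linear_0[OF pn_ph(1)] linear_0[OF pn_ph(2)]
      have 1: "((\<lambda>v. expo (br (ph v)) w) has_derivative (\<lambda>v. br (ph v) w + 0)) (at 0)"
        by (rule expo_br_has_derivative[OF linear_imp_has_derivative[OF pn_ph(2)] l0(3) has_derivative_const])
      have 2: "((\<lambda>v. expo (br (pn v)) (expo (br (ph v)) w)) has_derivative
          (\<lambda>v. br (pn v) (expo (br (ph 0)) w) + (br (ph v) w + 0))) (at 0)"
        by (rule expo_br_has_derivative[OF linear_imp_has_derivative[OF pn_ph(1)] l0(2) 1])
      have 3: "((\<lambda>v. \<kappa> v w) has_derivative
          (\<lambda>v. br (ps v) (expo (br (pn 0)) (expo (br (ph 0)) w)) + (br (pn v) (expo (br (ph 0)) w) + (br (ph v) w + 0)))) (at 0)"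
        unfolding \<kappa>_def by (rule sec_has_derivative[OF linear_imp_has_derivative[OF linear_ps] l0(1) 2])
      have "br (ps v) w + (br (pn v) w + br (ph v) w) = br v w" for v
        by (simp add: ps_def flip: br.add_left)
      then show ?thesis using 3 by (simp add: l0 br_fun)
    qed
    show "bounded_linear (\<lambda>v :: real^'n. v)" by simp
  qed auto
  have "\<exists>v\<in>model. norm v < e \<and> \<phi> X = chi v" if \<phi>: "lie_aut br \<phi>" "near_id d \<phi>" for \<phi>
  proof -
    obtain v where v: "dist v 0 < r" "\<kappa> v = \<phi>" using d(2)[OF \<phi>] by blast
    define b where "b = expo (br (pn v)) X - X"
    have b: "b \<in> n1" unfolding b_def by (rule expo_n1_diff[OF brX_n1 pn_ph(3)])
    have phX: "br (ph v) X = 0" using pn_ph(4)[of v] br_anticomm[of "ph v" X] by simp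
    have "\<phi> X = sec (ps v) (expo (br (pn v)) X)"
      unfolding v(2)[symmetric] \<kappa>_def using phX by (simp add: expo_fixed linear_br)
    also have "\<dots> = chi (ps v + b)"
      using b by (simp add: chi_def linear_add[OF linear_ps] linear_add[OF pn_ph(1)] linear_add[OF pn_ph(2)] pn_ph b_def)
    finally have "\<phi> X = chi (ps v + b)" .
    moreover have "ps v + b \<in> model" using b by (simp add: model_def linear_add[OF pn_ph(2)] pn_ph)
    moreover have "norm (ps v + b) < e"
    proof -
      have "v \<in> ball 0 r" using v(1) by (simp add: dist_commute)
      then show ?thesis using r(2) by (auto simp: f_def b_def)
    qed
    ultimately show ?thesis by blast
  qed
  then show ?thesis using d(1) by blast
qed

lemma psi_covers:
  assumes "0 < e"
  shows "\<exists>d>0. \<forall>\<phi>. lie_aut br \<phi> \<longrightarrow> near_id d \<phi> \<longrightarrow> (\<exists>v\<in>model. norm v < e \<and> \<phi> (ad p X) = psi p v)"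
proof -
  obtain d where d: "d > 0" "\<And>\<phi>. lie_aut br \<phi> \<Longrightarrow> near_id d \<phi> \<Longrightarrow> \<exists>v\<in>model. norm v < e \<and> \<phi> X = chi v"
    using chi_covers_X[OF assms] by blast
  obtain C where C: "C > 0"
      "\<And>d \<phi>. near_id d \<phi> \<Longrightarrow> near_id (C * d) (\<lambda>v. ad (ginv p) (\<phi> (ad p v)))"
    using near_id_conj[OF linear_Ad linear_Ad, of "ginv p" p] by auto
  have "\<exists>v\<in>model. norm v < e \<and> \<phi> (ad p X) = psi p v" if \<phi>: "lie_aut br \<phi>" "near_id (d / C) \<phi>" for \<phi>
  proof -
    have "lie_aut br (\<lambda>v. ad (ginv p) (\<phi> (ad p v)))"
      by (intro lie_aut_comp[OF lie_aut_Ad] lie_aut_comp[OF \<phi>(1)] lie_aut_Ad)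
    moreover have "near_id d (\<lambda>v. ad (ginv p) (\<phi> (ad p v)))" using C(2)[OF \<phi>(2)] C(1) by simp
    ultimately obtain v where v: "v \<in> model" "norm v < e" "ad (ginv p) (\<phi> (ad p X)) = chi v" using d(2) by blast
    then have "\<phi> (ad p X) = psi p v" unfolding psi_def v(3)[symmetric] by simp
    then show ?thesis using v by blast
  qed
  then show ?thesis using d(1) C(1) by (intro exI[of _ "d / C"]) auto
qed

text \<open>By invariance of domain, the transition to the chart centred at a point of the orbit is open.\<close>

lemma psi_open_map:
  assumes N: "openin (top_of_set pdom) N"
  shows "openin (orbit_topology ad X) (psi p ` N)"
  unfolding openin_orbit_iff
proof (intro conjI ballI)
  have Nd: "N \<subseteq> pdom" using openin_imp_subset[OF N] .
  then show "psi p ` N \<subseteq> orbit ad X" using psi_in_orbit[of p] by blast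
  have Nm: "openin (top_of_set model) N" using openin_trans[OF N openin_pdom] .
  fix Z assume "Z \<in> psi p ` N"
  then obtain v0 where v0: "v0 \<in> N" "Z = psi p v0" by blast
  then have v0d: "v0 \<in> pdom" using Nd by blast
  \<comment> \<open>\<open>psi_covers\<close> describes neighbourhoods of the centre of a chart
    only, hence the passage to the chart in which this point has parameter 0.\<close>
  obtain p0 where p0: "psi p v0 = ad p0 X" using psi_base[OF v0d] by blast
  define K where "K = model \<inter> cball 0 (rad / 2)"
  have K: "compact K" unfolding K_def
    by (intro closed_Int_compact closed_subspace subspace_model compact_cball)
  have Kr: "K \<subseteq> ball 0 rad" unfolding K_def using rad(1) by auto
  have injK: "inj_on chi K" using inj_on_subset[OF rad(2) Kr] .
  have contchi: "continuous_on S chi" for S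
    using continuous_on_subset[of UNIV chi S] C_on_chi[of 0] by simp
  \<comment> \<open>A continuous injection on a compact set has a continuous inverse; this is the
    purpose of the smaller closed ball.\<close>
  have invcont: "continuous_on (chi ` K) (inv_into K chi)"
    by (rule continuous_on_inv[OF contchi K]) (simp add: inv_into_f_f[OF injK])
  obtain d2 where d2: "d2 > 0" "\<And>\<phi>. lie_aut br \<phi> \<Longrightarrow> near_id d2 \<phi> \<Longrightarrow> \<exists>v\<in>model. norm v < rad / 2 \<and> \<phi> (ad p0 X) = psi p0 v"
    using psi_covers[of "rad / 2" p0] rad(1) by auto
  obtain r where r: "r > 0" "\<And>v. v \<in> pdom \<Longrightarrow> dist v v0 < r \<Longrightarrow> \<exists>\<phi>. lie_aut br \<phi> \<and> near_id d2 \<phi> \<and> psi p v = \<phi> (psi p v0)"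
    using psi_moved_by_aut[OF v0d d2(1), of p] by blast
  define N0 where "N0 = N \<inter> ball v0 r"
  have N0: "openin (top_of_set model) N0" unfolding N0_def
    using Nm by (rule openin_Int_open) simp
  have v0N: "v0 \<in> N0" using v0 r(1) by (simp add: N0_def)
  define s where "s = gmult (ginv p0) p"
  define \<theta> where "\<theta> v = inv_into K chi (ad s (chi v))" for v
  have \<theta>: "ad s (chi v) \<in> chi ` K" if v: "v \<in> N0" for v
  proof -
    have "v \<in> pdom" "dist v v0 < r" using v Nd by (auto simp: N0_def dist_commute)
    then obtain \<phi> where \<phi>: "lie_aut br \<phi>" "near_id d2 \<phi>" "psi p v = \<phi> (psi p v0)" using r(2) by blast
    then obtain w where w: "w \<in> model" "norm w < rad / 2" "psi p v = psi p0 w"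
      using d2(2)[OF \<phi>(1,2)] p0 by auto
    have "ad s (chi v) = ad (ginv p0) (psi p v)" by (simp add: s_def Ad_mult psi_def)
    also have "\<dots> = chi w" unfolding w(3) by (simp add: psi_def)
    finally have "ad s (chi v) = chi w" .
    moreover have "w \<in> K" using w by (simp add: K_def)
    ultimately show ?thesis by blast
  qed
  have \<theta>K: "\<theta> v \<in> K" "chi (\<theta> v) = ad s (chi v)" if "v \<in> N0" for v
    using \<theta>[OF that] unfolding \<theta>_def by (auto intro: inv_into_into f_inv_into_f)
  have psi_\<theta>: "psi p0 (\<theta> v) = psi p v" if "v \<in> N0" for v
    using \<theta>K(2)[OF that] by (simp add: psi_def s_def Ad_mult)
  have "openin (top_of_set model) (\<theta> ` N0)"
  proof (rule invariance_of_domain_subspaces[OF N0 subspace_model subspace_model order_refl])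
    have "continuous_on N0 (\<lambda>v. ad s (chi v))"
      using linear_Ad[of s]
      by (intro continuous_on_compose2[OF linear_continuous_on[of "ad s"] contchi]) (auto simp: linear_conv_bounded_linear)
    then show "continuous_on N0 \<theta>"
      unfolding \<theta>_def using \<theta> by (intro continuous_on_compose2[OF invcont]) auto
    show "\<theta> \<in> N0 \<rightarrow> model" using \<theta>K(1) by (auto simp: K_def)
    show "inj_on \<theta> N0"
    proof (rule inj_onI)
      fix v w assume vw: "v \<in> N0" "w \<in> N0" "\<theta> v = \<theta> w"
      then have "psi p v = psi p w" using psi_\<theta> by metis
      then show "v = w" using inj_psi[of p] vw Nd unfolding N0_def inj_on_def by blast
    qed
  qed
  moreover have "\<theta> v0 = 0"
  proof -
    have "0 \<in> K" using rad(1) subspace_0[OF subspace_model] by (simp add: K_def)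
    moreover have "chi (\<theta> v0) = chi 0"
      using \<theta>K(2)[OF v0N] p0 by (simp add: s_def Ad_mult psi_def)
    ultimately show ?thesis using injK \<theta>K(1)[OF v0N] by (metis inj_onD)
  qed
  then have "0 \<in> \<theta> ` N0" using v0N by force
  ultimately obtain e3 where e3: "e3 > 0" "ball 0 e3 \<inter> model \<subseteq> \<theta> ` N0"
    unfolding openin_contains_ball by blast
  obtain d3 where d3: "d3 > 0" "\<And>\<phi>. lie_aut br \<phi> \<Longrightarrow> near_id d3 \<phi> \<Longrightarrow> \<exists>v\<in>model. norm v < e3 \<and> \<phi> (ad p0 X) = psi p0 v"
    using psi_covers[OF e3(1), of p0] by blast
  have "\<phi> Z \<in> psi p ` N" if \<phi>: "lie_aut br \<phi>" "near_id d3 \<phi>" for \<phi>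
  proof -
    obtain w where w: "w \<in> model" "norm w < e3" "\<phi> Z = psi p0 w" using d3(2)[OF \<phi>] v0 p0 by auto
    then obtain v where v: "v \<in> N0" "w = \<theta> v" using e3(2) by force
    then show ?thesis using w psi_\<theta> by (auto simp: N0_def)
  qed
  then show "\<exists>d>0. \<forall>\<phi>. lie_aut br \<phi> \<longrightarrow> near_id d \<phi> \<longrightarrow> \<phi> Z \<in> psi p ` N" using d3(1) by blast
qed

lemma psi_preimage_open:
  assumes "openin (orbit_topology ad X) V"
  shows "openin (top_of_set pdom) {v \<in> pdom. psi p v \<in> V}"
  unfolding openin_contains_ball
proof (intro conjI ballI)
  fix v0 assume "v0 \<in> {v \<in> pdom. psi p v \<in> V}"
  then have v0: "v0 \<in> pdom" "psi p v0 \<in> V" by auto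
  then obtain d where d: "d > 0" "\<And>\<phi>. lie_aut br \<phi> \<Longrightarrow> near_id d \<phi> \<Longrightarrow> \<phi> (psi p v0) \<in> V"
    using assms unfolding openin_orbit_iff by blast
  obtain r where r: "r > 0" "\<And>v. v \<in> pdom \<Longrightarrow> dist v v0 < r \<Longrightarrow> \<exists>\<phi>. lie_aut br \<phi> \<and> near_id d \<phi> \<and> psi p v = \<phi> (psi p v0)"
    using psi_moved_by_aut[OF v0(1) d(1), of p] by blast
  have "ball v0 r \<inter> pdom \<subseteq> {v \<in> pdom. psi p v \<in> V}"
    using r(2) d(2) by (fastforce simp: dist_commute)
  then show "\<exists>e>0. ball v0 e \<inter> pdom \<subseteq> {v \<in> pdom. psi p v \<in> V}" using r(1) by blast
qed auto

section \<open>Plaques and changes of charts\<close>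

definition plaque_charts :: "((real^'n) set \<times> (real^'n \<Rightarrow> real^'n)) set" where
  "plaque_charts = range (\<lambda>p. (pdom, psi p))"

lemma C_on_psi: "C_on k UNIV (psi p)"
  unfolding psi_def by (rule C_on_linear_compose[OF open_UNIV linear_Ad C_on_chi])

lemma psi_has_derivative:
  "(psi p has_derivative (\<lambda>v. ad p (frechet_derivative chi (at x) v))) (at x)"
  unfolding psi_def using linear_Ad linear_conv_bounded_linear
  by (intro bounded_linear.has_derivative[OF _ chi_has_derivative]) blast

lemma psi_parametrization: "parametrization (orbit_topology ad X) model (pdom, psi p)"
  unfolding parametrization_def prod.case
proof (intro conjI ballI)
  show "openin (top_of_set model) pdom" by (rule openin_pdom)
  show "smooth_on pdom (psi p)"
    unfolding smooth_on_def using C_on_psi by (intro ballI exI[of _ UNIV] exI[of _ "psi p"]) simp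
  show "openin (orbit_topology ad X) (psi p ` pdom)"
    by (rule psi_open_map) simp
  show "homeomorphic_map (top_of_set pdom) (subtopology (orbit_topology ad X) (psi p ` pdom)) (psi p)"
  proof (rule bijective_open_imp_homeomorphic_map)
    have "continuous_map (top_of_set pdom) (orbit_topology ad X) (psi p)"
      unfolding continuous_map_def topspace_orbit_topology
      using psi_in_orbit psi_preimage_open by auto
    then show "continuous_map (top_of_set pdom) (subtopology (orbit_topology ad X) (psi p ` pdom)) (psi p)"
      by (rule continuous_map_into_subtopology) auto
    show "open_map (top_of_set pdom) (subtopology (orbit_topology ad X) (psi p ` pdom)) (psi p)"
      unfolding open_map_def
    proof (intro allI impI)
      fix U assume U: "openin (top_of_set pdom) U"
      have "psi p ` U \<subseteq> psi p ` pdom" using openin_imp_subset[OF U] by blast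
      then show "openin (subtopology (orbit_topology ad X) (psi p ` pdom)) (psi p ` U)"
        unfolding openin_subtopology using psi_open_map[OF U] by blast
    qed
    show "psi p ` topspace (top_of_set pdom) = topspace (subtopology (orbit_topology ad X) (psi p ` pdom))"
      using psi_in_orbit[of p] by (simp add: topspace_orbit_topology Int_absorb1)
    show "inj_on (psi p) (topspace (top_of_set pdom))" by (simp add: inj_psi)
  qed
  fix x assume x: "x \<in> pdom"
  have "inj (\<lambda>v. ad p (frechet_derivative chi (at x) v))"
    using rad(3)[OF pdom_D(2)[OF x]] unfolding inj_def Ad_inj .
  then have "inj_on (\<lambda>v. ad p (frechet_derivative chi (at x) v)) model"
    by (rule inj_on_subset) simp
  then show "\<exists>D. (psi p has_derivative D) (at x within pdom) \<and> inj_on D model"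
    using has_derivative_at_withinI[OF psi_has_derivative] by blast
qed

lemma psi_eq: "v \<in> pdom \<Longrightarrow> psi p v = ad p (sec (ps v) (X + pn v))"
  by (simp add: psi_def chi_model pdom_D)

lemma psi_eq_directions:
  assumes "v \<in> pdom" "v' \<in> pdom" "psi p v = psi p' v'"
    "ad k = sec (ps v)" "ad k' = sec (ps v')"
  shows "ad (gmult p k) ` n1 = ad (gmult p' k') ` n1"
proof -
  obtain u where u: "u \<in> n1" "X + pn v = expo (br u) X" using rad(5) pdom_D(2) assms(1) by blast
  obtain u' where u': "u' \<in> n1" "X + pn v' = expo (br u') X" using rad(5) pdom_D(2) assms(2) by blast
  have "ad (gmult p k) (expo (br u) X) = ad (gmult p' k') (expo (br u') X)"
    using assms by (simp add: psi_eq Ad_mult u u')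
  then show ?thesis by (rule leaf_directions_unique[OF u(1) u'(1)])
qed

text \<open>Both points carry the same direction space \<open>L\<close>, in either chart. Since leaf
  coordinates only add elements of \<open>L\<close>, the images of \<open>X\<close> under the two
  transverse motions of the second chart differ by an element of \<open>L\<close>, and the
  separation clause of \<open>rad\<close> makes the transverse parameters equal.\<close>

lemma plaques_match:
  assumes y: "y \<in> pdom" "z \<in> pdom" "y - z \<in> n1"
    and y': "y' \<in> pdom" "psi p y = psi p' y'" and z': "z' \<in> pdom" "psi p z = psi p' z'"
  shows "y' - z' \<in> n1"
proof -
  have "ps (y - z) = 0" using y(3) by simp
  then have ps: "ps z = ps y" by (simp add: linear_diff[OF linear_ps])
  obtain k where k: "ad k = sec (ps y)" using sec_in_Ad by blast
  obtain k1 where k1: "ad k1 = sec (ps y')" using sec_in_Ad by blast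
  obtain k2 where k2: "ad k2 = sec (ps z')" using sec_in_Ad by blast
  define L where "L = ad (gmult p' k2) ` n1"
  have L: "ad (gmult p k) ` n1 = L" "ad (gmult p' k1) ` n1 = L"
    using psi_eq_directions[OF y(1) y'(1) y'(2) k k1] psi_eq_directions[OF y(2) z'(1) z'(2) _ k2] k ps
    by (simp_all add: L_def)
  have sL: "subspace L" unfolding L_def by (rule linear_subspace_image[OF linear_Ad subspace_n1])
  have 1: "ad (gmult p k) (X + pn y) = ad (gmult p' k1) (X + pn y')"
    using y'(2) y y'(1) by (simp add: psi_eq Ad_mult k k1)
  have 2: "ad (gmult p k) (X + pn z) = ad (gmult p' k2) (X + pn z')"
    using z'(2) y z'(1) by (simp add: psi_eq Ad_mult k k2 ps)
  have "ad (gmult p k) (pn y - pn z) = ad (gmult p' k1) (X + pn y') - ad (gmult p' k2) (X + pn z')"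
    unfolding 1[symmetric] 2[symmetric] by (simp flip: linear_diff[OF linear_Ad])
  then have eq: "ad (gmult p' k1) X - ad (gmult p' k2) X =
      ad (gmult p k) (pn y - pn z) - ad (gmult p' k1) (pn y') + ad (gmult p' k2) (pn z')"
    by (simp add: linear_add[OF linear_Ad])
  have "pn y - pn z \<in> n1" by (intro subspace_diff subspace_n1 pn_ph)
  then have "ad (gmult p k) (pn y - pn z) \<in> L" using L(1) by blast
  moreover have "ad (gmult p' k1) (pn y') \<in> L" using L(2) pn_ph(3) by blast
  moreover have "ad (gmult p' k2) (pn z') \<in> L" unfolding L_def using pn_ph(3) by blast
  ultimately have "ad (gmult p' k1) X - ad (gmult p' k2) X \<in> L"
    unfolding eq by (intro subspace_add[OF sL] subspace_diff[OF sL])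
  then obtain b where b: "b \<in> n1" "ad (gmult p' k1) X - ad (gmult p' k2) X = ad (gmult p' k2) b"
    unfolding L_def by blast
  then have "ad (gmult p' k1) X = ad (gmult p' k2) (X + b)" by (simp add: linear_add[OF linear_Ad] algebra_simps)
  then have "sec (ps y') X = sec (ps z') (X + b)" unfolding Ad_mult Ad_inj k1 k2 .
  then have "ps y' = ps z'" using rad(6) pdom_D(2) y'(1) z'(1) b(1) by blast
  moreover have "y' = ps y' + pn y'" "z' = ps z' + pn z'"
    using pdom_D(1)[OF y'(1)] pdom_D(1)[OF z'(1)] by (simp_all add: ps_def model_def)
  ultimately have "y' - z' = pn y' - pn z'" by (metis add_diff_cancel_left)
  then show ?thesis using subspace_diff[OF subspace_n1 pn_ph(3) pn_ph(3)] by simp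
qed

lemma foliation_plaque_charts: "foliation (orbit_topology ad X) model n1 plaque_charts"
  unfolding foliation_def
proof (intro conjI)
  show "subspace model" "subspace n1" "n1 \<subseteq> model"
    by (rule subspace_model subspace_n1 n1_model)+
  show "\<forall>P\<in>plaque_charts. parametrization (orbit_topology ad X) model P"
    unfolding plaque_charts_def using psi_parametrization by blast
  have sub: "orbit ad X \<subseteq> (\<Union>p. psi p ` pdom)"
  proof
    fix Y assume "Y \<in> orbit ad X"
    then obtain g where "Y = ad g X" unfolding orbit_eq by blast
    then have "Y = psi g 0" by (simp add: psi_def)
    then show "Y \<in> (\<Union>p. psi p ` pdom)" using zero_pdom by blast
  qed
  have sup: "(\<Union>p. psi p ` pdom) \<subseteq> orbit ad X" using psi_in_orbit by (rule UN_least)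
  have "(\<Union>(W, \<psi>)\<in>plaque_charts. \<psi> ` W) = (\<Union>p. psi p ` pdom)"
    by (simp add: plaque_charts_def)
  then show "(\<Union>(W, \<psi>)\<in>plaque_charts. \<psi> ` W) = topspace (orbit_topology ad X)"
    unfolding topspace_orbit_topology using subset_antisym[OF sup sub] by (rule trans)
  have "\<exists>N. openin (top_of_set pdom) N \<and> x \<in> N \<and> psi p ` N \<subseteq> psi p' ` pdom \<and>
      (\<forall>y\<in>N. \<forall>z\<in>N. y - z \<in> n1 \<longrightarrow> inv_into pdom (psi p') (psi p y) - inv_into pdom (psi p') (psi p z) \<in> n1)"
    if x: "x \<in> pdom" "psi p x \<in> psi p' ` pdom" for x p p'
  proof (intro exI conjI ballI impI)
    \<comment> \<open>The whole overlap serves, since \<open>plaques_match\<close> holds on all of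
      it.\<close>
    let ?N = "{v \<in> pdom. psi p v \<in> psi p' ` pdom}"
    show "openin (top_of_set pdom) ?N"
      by (rule psi_preimage_open[OF psi_open_map]) simp
    show "x \<in> ?N" using x by blast
    show "psi p ` ?N \<subseteq> psi p' ` pdom" by blast
    fix y z assume y: "y \<in> ?N" and z: "z \<in> ?N" and yz: "y - z \<in> n1"
    have yp: "psi p y \<in> psi p' ` pdom" and zp: "psi p z \<in> psi p' ` pdom" using y z by blast+
    have yd: "y \<in> pdom" and zd: "z \<in> pdom" using y z by blast+
    show "inv_into pdom (psi p') (psi p y) - inv_into pdom (psi p') (psi p z) \<in> n1"
      by (rule plaques_match[OF yd zd yz inv_into_into[OF yp] f_inv_into_f[OF yp, symmetric]
            inv_into_into[OF zp] f_inv_into_f[OF zp, symmetric]])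
  qed
  then show "\<forall>(W, \<psi>)\<in>plaque_charts. \<forall>(W', \<psi>')\<in>plaque_charts. \<forall>x\<in>W. \<psi> x \<in> \<psi>' ` W' \<longrightarrow>
        (\<exists>N. openin (top_of_set W) N \<and> x \<in> N \<and> \<psi> ` N \<subseteq> \<psi>' ` W' \<and>
           (\<forall>y\<in>N. \<forall>z\<in>N. y - z \<in> n1 \<longrightarrow>
              inv_into W' \<psi>' (\<psi> y) - inv_into W' \<psi>' (\<psi> z) \<in> n1))"
    by (simp add: plaque_charts_def)
qed

section \<open>Leaf tangents: invariance and isotropy\<close>

text \<open>A derivative within \<open>pdom\<close> is determined along the model space only. It is
  therefore computed along the line x + t v, which stays in \<open>pdom\<close> for small t and on
  which \<open>psi\<close> is affine.\<close>

lemma psi_derivative_leaf: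
  assumes x: "x \<in> pdom" and D: "(psi p has_derivative D) (at x within pdom)" and v: "v \<in> n1"
  shows "D v = ad p (sec (ps x) v)"
proof -
  define f where "f t = x + t *\<^sub>R v" for t :: real
  define T where "T = f -` ball 0 rad"
  have cf: "continuous_on UNIV f" unfolding f_def by (intro continuous_intros)
  have oT: "open T" unfolding T_def using cf by (intro open_vimage) auto
  have 0: "0 \<in> T" using pdom_D(2)[OF x] by (simp add: T_def f_def)
  have fT: "f t \<in> pdom" if "t \<in> T" for t
  proof -
    have "t *\<^sub>R v \<in> model" using subspace_scale[OF subspace_n1 v] n1_model by blast
    then have "f t \<in> model" unfolding f_def using pdom_D(1)[OF x] by (intro subspace_add[OF subspace_model])
    then show ?thesis using that by (simp add: pdom_def T_def)
  qed
  have "(f has_derivative (\<lambda>t. t *\<^sub>R v)) (at 0 within T)"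
    unfolding f_def by (auto intro!: derivative_eq_intros)
  moreover have "(psi p has_derivative D) (at (f 0) within f ` T)"
  proof -
    have "f ` T \<subseteq> pdom" using fT by blast
    then show ?thesis using has_derivative_subset[OF D] by (simp add: f_def)
  qed
  ultimately have "((\<lambda>t. psi p (f t)) has_derivative (\<lambda>t. D (t *\<^sub>R v))) (at 0 within T)"
    using has_derivative_in_compose by blast
  then have 1: "((\<lambda>t. psi p (f t)) has_derivative (\<lambda>t. D (t *\<^sub>R v))) (at 0)"
    using at_within_open[OF 0 oT] by simp
  have eq: "psi p x + t *\<^sub>R ad p (sec (ps x) v) = psi p (f t)" if "t \<in> T" for t
  proof -
    have tv: "t *\<^sub>R v \<in> n1" using subspace_scale[OF subspace_n1 v] .
    have "ps (f t) = ps x" "pn (f t) = pn x + t *\<^sub>R v"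
      using tv pn_ph(5)[OF tv] by (simp_all add: f_def linear_add[OF linear_ps] linear_add[OF pn_ph(1)])
    then show ?thesis
      using fT[OF that] x by (simp add: psi_eq linear_add[OF linear_sec] linear_add[OF linear_Ad]
          linear_scale[OF linear_sec] linear_scale[OF linear_Ad])
  qed
  have "((\<lambda>t. psi p x + t *\<^sub>R ad p (sec (ps x) v)) has_derivative (\<lambda>t. t *\<^sub>R ad p (sec (ps x) v))) (at 0)"
    by (auto intro!: derivative_eq_intros)
  from has_derivative_transform_within_open[OF this oT 0 eq]
  have "((\<lambda>t. psi p (f t)) has_derivative (\<lambda>t. t *\<^sub>R ad p (sec (ps x) v))) (at 0)" .
  from has_derivative_unique[OF 1 this]
  have "(\<lambda>t. D (t *\<^sub>R v)) = (\<lambda>t. t *\<^sub>R ad p (sec (ps x) v))" .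
  from fun_cong[OF this, of 1] show ?thesis by simp
qed

lemma leaf_tangent_eq:
  assumes x: "x \<in> pdom" and k: "ad k = sec (ps x)"
  shows "leaf_tangent n1 plaque_charts (psi p x) = ad (gmult p k) ` n1"
proof (intro subset_antisym subsetI)
  fix w assume "w \<in> leaf_tangent n1 plaque_charts (psi p x)"
  then obtain p' x' D v where *: "x' \<in> pdom" "psi p' x' = psi p x"
      "(psi p' has_derivative D) (at x' within pdom)" "v \<in> n1" "w = D v"
    unfolding leaf_tangent_def plaque_charts_def by blast
  obtain k' where k': "ad k' = sec (ps x')" using sec_in_Ad by blast
  have "w = ad (gmult p' k') v"
    using psi_derivative_leaf[OF *(1,3,4)] by (simp add: *(5) Ad_mult k')
  then show "w \<in> ad (gmult p k) ` n1"
    using psi_eq_directions[OF x *(1) *(2)[symmetric] k k'] *(4) by blast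
next
  fix w assume "w \<in> ad (gmult p k) ` n1"
  then obtain v where v: "v \<in> n1" "w = ad (gmult p k) v" by blast
  have der: "(psi p has_derivative (\<lambda>v. ad p (frechet_derivative chi (at x) v))) (at x within pdom)"
    by (rule has_derivative_at_withinI[OF psi_has_derivative])
  have "w = ad p (frechet_derivative chi (at x) v)"
    using psi_derivative_leaf[OF x der v(1)] by (simp add: v(2) Ad_mult k)
  moreover have "(pdom, psi p) \<in> plaque_charts" unfolding plaque_charts_def by blast
  ultimately show "w \<in> leaf_tangent n1 plaque_charts (psi p x)"
    unfolding leaf_tangent_def using x der v(1)
    by (intro CollectI exI[of _ pdom] exI[of _ "psi p"] exI[of _ x]
        exI[of _ "\<lambda>v. ad p (frechet_derivative chi (at x) v)"] exI[of _ v] conjI) simp_all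
qed

lemma leaf_tangent_Ad: "leaf_tangent n1 plaque_charts (ad p X) = ad p ` n1"
proof -
  have "ad \<e> = sec (ps 0)" by (simp add: fun_eq_iff Ad_one linear_0[OF linear_ps])
  from leaf_tangent_eq[OF zero_pdom this, of p] show ?thesis by (simp add: psi_def)
qed

lemma left_invariant_plaques: "left_invariant ad (orbit ad X) (leaf_tangent n1 plaque_charts)"
  unfolding left_invariant_def orbit_eq
proof (intro allI ballI)
  fix g Y assume "Y \<in> range (\<lambda>g. ad g X)"
  then obtain p where p: "Y = ad p X" by blast
  have "leaf_tangent n1 plaque_charts (ad g Y) = ad (gmult g p) ` n1"
    unfolding p Ad_mult[symmetric] by (rule leaf_tangent_Ad)
  also have "\<dots> = ad g ` ad p ` n1" unfolding image_image by (rule image_cong) (simp_all only: Ad_mult)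
  finally show "leaf_tangent n1 plaque_charts (ad g Y) = ad g ` leaf_tangent n1 plaque_charts Y"
    unfolding p leaf_tangent_Ad .
qed

text \<open>Well-definedness of the Kirillov form: by invariance the value depends on
  \<open>U\<close> only through [U, Y], and by antisymmetry the same holds for
  \<open>V\<close>.\<close>

lemma killing_Y_bracket_independent:
  assumes "br U Y = br U' Y" "br V Y = br V' Y"
  shows "killing br Y (br U V) = killing br Y (br U' V')"
proof -
  have inv: "killing br Y (br U V) = - killing br (br U Y) V" for U V
    using killing_invariant[of Y U V] br_anticomm[of Y U] by (simp add: killing.minus_left)
  have "killing br Y (br U V) = killing br Y (br U' V)" unfolding inv assms(1) ..
  also have "\<dots> = - killing br Y (br V U')"
    using br_anticomm[of U' V] by (simp add: killing.minus_right)
  also have "killing br Y (br V U') = killing br Y (br V' U')" unfolding inv assms(2) ..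
  also have "- \<dots> = killing br Y (br U' V')"
    using br_anticomm[of V' U'] by (simp add: killing.minus_right)
  finally show ?thesis .
qed

lemma isotropic_plaques: "isotropic br (orbit ad X) (leaf_tangent n1 plaque_charts)"
  unfolding isotropic_def orbit_eq
proof (intro ballI)
  fix Y u v assume "Y \<in> range (\<lambda>g. ad g X)"
    and u: "u \<in> leaf_tangent n1 plaque_charts Y" and v: "v \<in> leaf_tangent n1 plaque_charts Y"
  then obtain p where p: "Y = ad p X" by blast
  \<comment> \<open>Lifts must exist, since otherwise the condition inside the definite description
    of \<open>kirillov_form\<close> would hold for every number.\<close>
  have lift: "\<exists>U\<in>n1. br (ad p U) Y = w" if w: "w \<in> ad p ` n1" for w
  proof -
    obtain w0 where w0: "w0 \<in> n1" "w = ad p w0" using w by blast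
    obtain m where m: "m \<in> n1" "w0 = br X m" using n1_range[OF w0(1)] by blast
    have "br (ad p (- m)) Y = ad p (br (- m) X)" by (simp add: p Ad_bracket)
    also have "br (- m) X = w0" using m(2) br_anticomm[of m X] by (simp add: br.minus_left)
    finally show ?thesis using w0 m(1) subspace_neg[OF subspace_n1] by (intro bexI[of _ "- m"]) auto
  qed
  obtain U0 where U0: "U0 \<in> n1" "br (ad p U0) Y = u" using lift u unfolding p leaf_tangent_Ad by blast
  obtain V0 where V0: "V0 \<in> n1" "br (ad p V0) Y = v" using lift v unfolding p leaf_tangent_Ad by blast
  have zero: "killing br Y (br (ad p U0) (ad p V0)) = 0"
  proof -
    obtain m where m: "br U0 V0 = br X m" using n1_range n1_subalgebra[OF U0(1) V0(1)] by blast
    have "br (ad p U0) (ad p V0) = br Y (ad p m)" by (simp add: p m flip: Ad_bracket)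
    then show ?thesis using killing_invariant[of Y Y "ad p m"] by (simp add: killing.zero_left)
  qed
  show "kirillov_form br Y u v = 0"
    unfolding kirillov_form_def
  proof (rule the_equality)
    show "\<forall>U V. br U Y = u \<and> br V Y = v \<longrightarrow> 0 = killing br Y (br U V)"
    proof (intro allI impI)
      fix U V assume "br U Y = u \<and> br V Y = v"
      then have "killing br Y (br U V) = killing br Y (br (ad p U0) (ad p V0))"
        using U0(2) V0(2) by (intro killing_Y_bracket_independent) auto
      then show "0 = killing br Y (br U V)" using zero by simp
    qed
    fix w assume "\<forall>U V. br U Y = u \<and> br V Y = v \<longrightarrow> w = killing br Y (br U V)"
    then show "w = 0" using U0(2) V0(2) zero by auto
  qed
qed

text \<open>The tangent space is \<open>n1\<close> as a set of vectors, and ad X maps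
  \<open>n1\<close> onto itself; the form with brackets is the one under which a subspace of the
  algebra is regarded as a tangent space.\<close>

lemma leaf_tangent_X: "leaf_tangent n1 plaque_charts X = (\<lambda>U. br U X) ` n1"
proof -
  have "leaf_tangent n1 plaque_charts X = n1"
    using leaf_tangent_Ad[of "\<e>"] by (simp add: Ad_one)
  moreover have "(\<lambda>U. br U X) ` n1 = n1"
  proof (intro subset_antisym subsetI)
    fix w assume "w \<in> (\<lambda>U. br U X) ` n1"
    then obtain m where "m \<in> n1" "w = - br X m" using br_anticomm by blast
    then show "w \<in> n1" using brX_n1 subspace_neg[OF subspace_n1] by blast
  next
    fix w assume "w \<in> n1"
    then obtain m where m: "m \<in> n1" "w = br X m" using n1_range by blast
    have "w = br (- m) X" using br_anticomm[of m X] by (simp add: m(2) br.minus_left)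
    then show "w \<in> (\<lambda>U. br U X) ` n1" using subspace_neg[OF subspace_n1 m(1)] by blast
  qed
  ultimately show ?thesis by simp
qed

theorem ex_foliation:
  "\<exists>M L \<F>. foliation (orbit_topology ad X) M L \<F> \<and>
     left_invariant ad (orbit ad X) (leaf_tangent L \<F>) \<and>
     isotropic br (orbit ad X) (leaf_tangent L \<F>) \<and>
     leaf_tangent L \<F> X = (\<lambda>U. br U X) ` n1"
  using foliation_plaque_charts left_invariant_plaques isotropic_plaques leaf_tangent_X by blast

end

section \<open>Restricted roots\<close>

locale cartan_lie_alg = lie_alg br
  for br :: "real^'n \<Rightarrow> real^'n \<Rightarrow> real^'n" +
  fixes \<theta> :: "real^'n \<Rightarrow> real^'n"
  assumes cartan: "cartan_involution br \<theta>"
begin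

lemma linear_theta: "linear \<theta>" and theta_theta [simp]: "\<theta> (\<theta> X) = X"
  and theta_br: "\<theta> (br X Y) = br (\<theta> X) (\<theta> Y)"
  using cartan by (auto simp: cartan_involution_def)

lemmas theta_simps = linear_add[OF linear_theta] linear_diff[OF linear_theta]
  linear_scale[OF linear_theta] linear_neg[OF linear_theta] linear_0[OF linear_theta]

definition ip :: "real^'n \<Rightarrow> real^'n \<Rightarrow> real" where "ip X Y = - killing br X (\<theta> Y)"

lemma ip_pos: "X \<noteq> 0 \<Longrightarrow> ip X X > 0"
  using cartan by (auto simp: cartan_involution_def ip_def)

lemma ip_zero_iff: "ip X X = 0 \<longleftrightarrow> X = 0"
proof
  show "ip X X = 0 \<Longrightarrow> X = 0" using ip_pos[of X] by fastforce
qed (simp add: ip_def killing.zero_left)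

lemma ip_nonneg: "ip X X \<ge> 0"
  by (cases "X = 0") (simp_all add: ip_zero_iff less_imp_le[OF ip_pos] ip_zero_iff[THEN iffD2])

lemma bilinear_ip: "bilinear ip"
  unfolding bilinear_def ip_def
  by (auto intro!: linearI simp: killing.add_left killing.add_right killing.scaleR_left killing.scaleR_right theta_simps)

sublocale ip: bounded_bilinear ip
  using bilinear_ip by (simp add: bilinear_conv_bounded_bilinear)

lemma lie_aut_theta: "lie_aut br \<theta>"
  by (simp add: lie_aut_def linear_theta theta_br)

lemma ip_commute: "ip X Y = ip Y X"
  using killing_aut[OF lie_aut_theta, of \<theta> X "\<theta> Y"] by (simp add: ip_def killing_commute)

lemma ip_br: "ip (br Z X) Y = - ip X (br (\<theta> Z) Y)"
proof -
  have "killing br (br Z X) (\<theta> Y) = - killing br X (br Z (\<theta> Y))"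
    using killing_invariant[of X Z "\<theta> Y"] br_anticomm[of Z X] by (simp add: killing.minus_left)
  then show ?thesis by (simp add: ip_def theta_br)
qed

sublocale semisimple_lie_alg br
proof unfold_locales
  fix X assume "\<And>Y. killing br X Y = 0"
  then have "ip X X = 0" by (simp add: ip_def)
  then show "X = 0" by (simp add: ip_zero_iff)
qed

text \<open>The adjoint of ad H for \<open>ip\<close> is - ad (\<theta> H), which commutes with ad H
  by assumption. For a normal operator the kernel of the square is the kernel.\<close>

lemma normal_semisimple:
  assumes "br H (\<theta> H) = 0" "br H (br H V) = 0"
  shows "br H V = 0"
proof -
  define W where "W = br H V"
  define U where "U = br (\<theta> H) W"
  have "br H U = br (br H (\<theta> H)) W + br (\<theta> H) (br H W)"
    unfolding U_def by (rule br_derivation)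
  then have "br H U = 0" using assms by (simp add: W_def br.zero_left br.zero_right)
  then have "ip U U = 0" using ip_br[of "\<theta> H" W U] by (simp add: U_def ip.zero_right)
  then have "U = 0" by (simp add: ip_zero_iff)
  then have "ip W W = 0" using ip_br[of H V W] by (simp add: W_def[symmetric] U_def ip.zero_right)
  then show ?thesis by (simp add: W_def ip_zero_iff)
qed

text \<open>If the next term of the central series vanishes, the current one is central in
  \<open>h\<close>, and moving ad X to the other side of \<open>ip\<close> shows that it is
  orthogonal to all brackets that span it. So it is zero, and the series collapses down to its first
  step.\<close>

lemma theta_stable_nilpotent_abelian:
  assumes h: "subspace h" "\<And>X Y. X \<in> h \<Longrightarrow> Y \<in> h \<Longrightarrow> br X Y \<in> h" "\<And>X. X \<in> h \<Longrightarrow> \<theta> X \<in> h"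
    and nil: "lower_central br h k = {0}" and XY: "X \<in> h" "Y \<in> h"
  shows "br X Y = 0"
proof -
  have sub: "lower_central br h k \<subseteq> h" for k
  proof (induction k)
    case (Suc k)
    have "{br X Y | X Y. X \<in> h \<and> Y \<in> lower_central br h k} \<subseteq> h" using Suc h(2) by blast
    then show ?case using span_minimal[OF _ h(1)] by simp
  qed simp
  have step: "lower_central br h (Suc k) = {0}" if z: "lower_central br h (Suc (Suc k)) = {0}" for k
  proof -
    have central: "br X Z = 0" if "X \<in> h" "Z \<in> lower_central br h (Suc k)" for X Z
    proof -
      have "br X Z \<in> {br X Y | X Y. X \<in> h \<and> Y \<in> lower_central br h (Suc k)}" using that by blast
      then have "br X Z \<in> lower_central br h (Suc (Suc k))" unfolding lower_central.simps(2)[of br h "Suc k"] by (rule span_base)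
      then show ?thesis using z by blast
    qed
    have "Z = 0" if Z: "Z \<in> lower_central br h (Suc k)" for Z
    proof -
      have "{br X Y | X Y. X \<in> h \<and> Y \<in> lower_central br h k} \<subseteq> {W. ip W Z = 0}"
      proof clarify
        fix X Y assume "X \<in> h" "Y \<in> lower_central br h k"
        then show "ip (br X Y) Z = 0" using central[OF h(3) Z] by (simp add: ip_br ip.zero_right)
      qed
      moreover have "subspace {W. ip W Z = 0}"
        by (simp add: subspace_def ip.zero_left ip.add_left ip.scaleR_left)
      ultimately have "lower_central br h (Suc k) \<subseteq> {W. ip W Z = 0}"
        unfolding lower_central.simps by (rule span_minimal)
      then have "ip Z Z = 0" using Z by blast
      then show ?thesis by (simp add: ip_zero_iff)
    qed
    moreover have "0 \<in> lower_central br h (Suc k)" by (simp add: span_zero)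
    ultimately show ?thesis by blast
  qed
  have "lower_central br h (Suc 0) = {0}"
  proof (cases k)
    case 0
    then have "h = {0}" using nil by simp
    then have "lower_central br h (Suc 0) \<subseteq> {0}" using sub[of "Suc 0"] by blast
    moreover have "0 \<in> lower_central br h (Suc 0)" by (simp add: span_zero)
    ultimately show ?thesis by blast
  next
    case (Suc j)
    have "lower_central br h (Suc j) = {0} \<Longrightarrow> lower_central br h (Suc 0) = {0}" for j
    proof (induction j)
      case (Suc j)
      show ?case by (rule Suc.IH[OF step[OF Suc.prems]])
    qed
    then show ?thesis using nil Suc by blast
  qed
  moreover have "br X Y \<in> lower_central br h (Suc 0)"
    unfolding lower_central.simps by (rule span_base) (use XY in blast)
  ultimately show ?thesis by blast
qed

text \<open>Orthogonality refers to \<open>ip\<close>, while the available projection belongs to the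
  dot product. \<open>Q\<close> represents \<open>ip\<close> through the dot product, and its
  compression to \<open>S\<close> is injective, hence onto.\<close>

lemma ip_projection:
  assumes "subspace S"
  shows "\<exists>s\<in>S. \<forall>t\<in>S. ip t (w - s) = 0"
proof -
  define Q where "Q v = (\<Sum>b\<in>Basis. ip b v *\<^sub>R b)" for v
  have lQ: "linear Q"
    by (rule linearI) (simp_all add: Q_def ip.add_right ip.scaleR_right scaleR_add_left sum.distrib scaleR_sum_right)
  have Q: "t \<bullet> Q v = ip t v" for t v
  proof -
    have "ip t v = ip (\<Sum>b\<in>Basis. (t \<bullet> b) *\<^sub>R b) v" by (simp add: euclidean_representation)
    then show ?thesis by (simp add: Q_def inner_sum_right ip.sum_left ip.scaleR_left mult.commute)
  qed
  have ex: "\<exists>s\<in>S. v - s \<in> {z. \<forall>w\<in>S. orthogonal w z}" for v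
  proof -
    obtain y z where "y \<in> S" "\<forall>w\<in>S. orthogonal w z" "v = y + z" using orthogonal_decomp[OF assms, of v] by blast
    then show ?thesis by (intro bexI[of _ y]) auto
  qed
  have "\<exists>p. linear p \<and> (\<forall>v. p v \<in> S) \<and> (\<forall>v. \<forall>t\<in>S. orthogonal t (v - p v))"
  proof (rule complement_projection[OF assms subspace_orthogonal_to_vectors _ ex])
    show "S \<inter> {z. \<forall>w\<in>S. orthogonal w z} \<subseteq> {0}" by (auto simp: orthogonal_self)
  qed blast
  then obtain p where p: "linear p" "\<And>v. p v \<in> S" "\<And>v t. t \<in> S \<Longrightarrow> t \<bullet> (v - p v) = 0"
    unfolding orthogonal_def by blast
  have tp: "t \<bullet> p (Q v) = ip t v" if "t \<in> S" for t v
    using p(3)[OF that, of "Q v"] by (simp add: inner_diff_right Q)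
  have lT: "linear (\<lambda>v. p (Q v))" using linear_compose[OF lQ p(1)] by (simp add: o_def)
  have "inj_on (\<lambda>v. p (Q v)) S"
  proof (rule inj_onI)
    fix u v assume uv: "u \<in> S" "v \<in> S" "p (Q u) = p (Q v)"
    have "u - v \<in> S" by (rule subspace_diff[OF assms uv(1,2)])
    then have "ip (u - v) (u - v) = 0"
      using tp[of "u - v" "u"] tp[of "u - v" v] uv(3) by (simp add: ip.diff_right)
    then show "u = v" by (simp add: ip_zero_iff)
  qed
  then have "dim ((\<lambda>v. p (Q v)) ` S) = dim S"
    by (intro dim_image_eq lT) (simp add: span_eq_iff[THEN iffD2, OF assms])
  then have "(\<lambda>v. p (Q v)) ` S = S"
    using p(2) by (intro subspace_dim_equal linear_subspace_image lT assms) auto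
  then obtain s where s: "s \<in> S" "p (Q w) = p (Q s)" using p(2)[of "Q w"] by (metis imageE)
  have "ip t (w - s) = 0" if "t \<in> S" for t
    using tp[OF that, of w] tp[OF that, of s] s(2) by (simp add: ip.diff_right)
  then show ?thesis using s(1) by blast
qed

text \<open>The Rayleigh quotient is invariant under scaling, so its maximum over the Euclidean unit
  sphere is a maximum over all nonzero vectors. At a maximum \<open>v\<close> the residual z = l v -
  T v is orthogonal to \<open>v\<close>, and a step along z has first order effect proportional to
  \<open>ip z z\<close>, which must vanish.\<close>

lemma symmetric_eigenvector:
  assumes V: "subspace V" "V \<noteq> {0}" and T: "linear T" "\<And>v. v \<in> V \<Longrightarrow> T v \<in> V"
    and sym: "\<And>v w. ip (T v) w = ip v (T w)"
  shows "\<exists>v\<in>V. \<exists>l. v \<noteq> 0 \<and> T v = l *\<^sub>R v"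
proof -
  define K where "K = V \<inter> sphere 0 1"
  have "compact K" unfolding K_def by (intro closed_Int_compact closed_subspace V compact_sphere)
  moreover obtain v1 where v1: "v1 \<in> V" "v1 \<noteq> 0" using V subspace_0 by blast
  then have "v1 /\<^sub>R norm v1 \<in> K" unfolding K_def using V by (auto simp: subspace_scale)
  then have "K \<noteq> {}" by blast
  moreover have "continuous_on K (\<lambda>v. ip (T v) v / ip v v)"
  proof -
    have "ip v v \<noteq> 0" if "v \<in> K" for v
    proof -
      have "norm v = 1" using that by (simp add: K_def)
      then show ?thesis by (auto simp: ip_zero_iff)
    qed
    moreover have "continuous_on K T"
      using T(1) by (intro linear_continuous_on) (simp add: linear_conv_bounded_linear)
    ultimately show ?thesis by (intro continuous_intros ip.continuous_on) auto
  qed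
  ultimately obtain v where v: "v \<in> K" "\<And>w. w \<in> K \<Longrightarrow> ip (T w) w / ip w w \<le> ip (T v) v / ip v v"
    using continuous_attains_sup[of K "\<lambda>v. ip (T v) v / ip v v"] by blast
  define l where "l = ip (T v) v / ip v v"
  have vV: "v \<in> V" "v \<noteq> 0" using v(1) by (auto simp: K_def)
  have le: "ip (T w) w \<le> l * ip w w" if w: "w \<in> V" for w
  proof (cases "w = 0")
    case False
    define u where "u = w /\<^sub>R norm w"
    have "u \<in> K" unfolding K_def u_def using w V False by (auto simp: subspace_scale)
    then have "ip (T u) u / ip u u \<le> l" unfolding l_def by (rule v(2))
    moreover have "ip (T u) u / ip u u = ip (T w) w / ip w w"
      unfolding u_def using False
      by (simp add: linear_scale[OF T(1)] ip.scaleR_left ip.scaleR_right)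
    ultimately show ?thesis using ip_pos[OF False] by (simp add: divide_le_eq)
  qed (simp add: ip.zero_right)
  define z where "z = l *\<^sub>R v - T v"
  have zV: "z \<in> V" unfolding z_def using vV T(2) V by (intro subspace_diff subspace_scale) auto
  have vz: "ip z v = 0" using vV ip_pos[of v] by (simp add: z_def ip.diff_left ip.scaleR_left l_def)
  define m where "m = l * ip z z - ip (T z) z"
  have q: "0 \<le> 2 * s * ip z z + s * s * m" for s
  proof -
    have "v + s *\<^sub>R z \<in> V" using vV zV V by (intro subspace_add subspace_scale)
    from le[OF this] have "0 \<le> l * ip (v + s *\<^sub>R z) (v + s *\<^sub>R z) - ip (T (v + s *\<^sub>R z)) (v + s *\<^sub>R z)" by simp
    also have "ip (v + s *\<^sub>R z) (v + s *\<^sub>R z) = ip v v + s * s * ip z z"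
      using vz ip_commute[of z v] by (simp add: ip.add_left ip.add_right ip.scaleR_left ip.scaleR_right)
    also have "ip (T (v + s *\<^sub>R z)) (v + s *\<^sub>R z) = ip (T v) v + 2 * s * ip (T v) z + s * s * ip (T z) z"
      using sym[of z v] ip_commute[of z "T v"]
      by (simp add: linear_add[OF T(1)] linear_scale[OF T(1)] ip.add_left ip.add_right ip.scaleR_left ip.scaleR_right algebra_simps)
    also have "ip (T v) z = - ip z z"
    proof -
      have "T v = l *\<^sub>R v - z" by (simp add: z_def)
      then show ?thesis using vz ip_commute[of z v] by (simp add: ip.diff_left ip.scaleR_left)
    qed
    also have "ip (T v) v = l * ip v v" using ip_pos[of v] vV by (simp add: l_def)
    finally show ?thesis by (simp add: m_def algebra_simps)
  qed
  have "ip z z = 0"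
  proof (rule ccontr)
    assume "ip z z \<noteq> 0"
    then have zp: "ip z z > 0" using ip_nonneg[of z] by simp
    \<comment> \<open>Negative and so small that the quadratic term cannot outweigh half of the
      linear one.\<close>
    define s where "s = - ip z z / (\<bar>m\<bar> + 1)"
    have sn: "s < 0" unfolding s_def using zp by (simp add: divide_neg_pos)
    have "s * s * m \<le> s * s * \<bar>m\<bar>" by (intro mult_left_mono) auto
    also have "\<dots> \<le> s * s * (\<bar>m\<bar> + 1)" by (intro mult_left_mono) auto
    also have "\<dots> = - s * ip z z" by (simp add: s_def)
    finally have "2 * s * ip z z + s * s * m \<le> s * ip z z" by simp
    also have "\<dots> < 0" using sn zp by (simp add: mult_neg_pos)
    finally show False using q[of s] by simp
  qed
  then have "z = 0" by (simp add: ip_zero_iff)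
  then show ?thesis using vV by (intro bexI[of _ v] exI[of _ l]) (auto simp: z_def)
qed

end

section \<open>Weights of \<open>a\<close> and their strings\<close>

locale restricted_roots = cartan_lie_alg br \<theta>
  for br :: "real^'n \<Rightarrow> real^'n \<Rightarrow> real^'n" and \<theta> :: "real^'n \<Rightarrow> real^'n" +
  fixes a :: "(real^'n) set"
  assumes subspace_a: "subspace a" and a_abelian: "H \<in> a \<Longrightarrow> H' \<in> a \<Longrightarrow> br H H' = 0"
    and a_p: "H \<in> a \<Longrightarrow> \<theta> H = - H"
    and a_maximal: "\<theta> P = - P \<Longrightarrow> (\<And>H. H \<in> a \<Longrightarrow> br H P = 0) \<Longrightarrow> P \<in> a"
begin

abbreviation "rs \<equiv> root_space br a"

lemma rs_iff: "Z \<in> rs \<mu> \<longleftrightarrow> (\<forall>H\<in>a. br H Z = \<mu> H *\<^sub>R Z)"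
  by (simp add: root_space_def scalar_mult_eq_scaleR)

lemma rsD: "Z \<in> rs \<mu> \<Longrightarrow> H \<in> a \<Longrightarrow> br H Z = \<mu> H *\<^sub>R Z"
  by (simp add: rs_iff)

lemma br_a_symmetric: "H \<in> a \<Longrightarrow> ip (br H v) w = ip v (br H w)"
  by (simp add: ip_br a_p br.minus_left ip.minus_right)

text \<open>In a nonzero invariant subspace of least dimension every eigenspace of some ad H is
  invariant, because \<open>a\<close> is abelian, and hence is everything; so all of
  \<open>a\<close> acts by scalars.\<close>

lemma common_eigenvector:
  assumes V: "subspace V" "V \<noteq> {0}" "\<And>H v. H \<in> a \<Longrightarrow> v \<in> V \<Longrightarrow> br H v \<in> V"
  shows "\<exists>v\<in>V. v \<noteq> 0 \<and> (\<exists>\<nu>. functional_on a \<nu> \<and> v \<in> rs \<nu>)"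
proof -
  define P where "P V' \<longleftrightarrow> subspace V' \<and> V' \<noteq> {0} \<and> V' \<subseteq> V \<and> (\<forall>H\<in>a. \<forall>v\<in>V'. br H v \<in> V')" for V'
  have "P V" using V by (simp add: P_def)
  then obtain V' where V': "P V'" "\<And>V''. P V'' \<Longrightarrow> dim V' \<le> dim V''"
    using ex_has_least_nat[of P V dim] by blast
  have sV': "subspace V'" "V' \<noteq> {0}" "V' \<subseteq> V" and inv: "\<And>H v. H \<in> a \<Longrightarrow> v \<in> V' \<Longrightarrow> br H v \<in> V'"
    using V'(1) by (auto simp: P_def)
  have scal: "\<exists>l. \<forall>v\<in>V'. br H v = l *\<^sub>R v" if H: "H \<in> a" for H
  proof -
    obtain v l where vl: "v \<in> V'" "v \<noteq> 0" "br H v = l *\<^sub>R v"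
      using symmetric_eigenvector[OF sV'(1,2) linear_br, of H] inv[OF H] br_a_symmetric[OF H] by blast
    define E where "E = {w \<in> V'. br H w = l *\<^sub>R w}"
    have sE: "subspace E"
      using sV'(1) unfolding subspace_def E_def
      by (auto simp: br.add_right br.zero_right br.scaleR_right scaleR_add_right)
    moreover have "E \<noteq> {0}" using vl by (auto simp: E_def)
    moreover have "E \<subseteq> V'" by (auto simp: E_def)
    moreover have "br H' w \<in> E" if "H' \<in> a" "w \<in> E" for H' w
    proof -
      have "br H (br H' w) = br H' (br H w)"
        using br_derivation[of H H' w] a_abelian[OF H that(1)] by (simp add: br.zero_left)
      then show ?thesis using that inv by (simp add: E_def br.scaleR_right)
    qed
    ultimately have "P E" using sV'(3) unfolding P_def by blast
    then have "E = V'" using V'(2) sE sV'(1) \<open>E \<subseteq> V'\<close> by (intro subspace_dim_equal) auto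
    then show ?thesis unfolding E_def by blast
  qed
  then obtain l where l: "\<And>H v. H \<in> a \<Longrightarrow> v \<in> V' \<Longrightarrow> br H v = l H *\<^sub>R v" by metis
  obtain v where v: "v \<in> V'" "v \<noteq> 0" using sV' subspace_0 by blast
  define \<nu> where "\<nu> H = (if H \<in> a then l H else 0)" for H
  have "\<nu> (H + H') = \<nu> H + \<nu> H'" if "H \<in> a" "H' \<in> a" for H H'
  proof -
    have HH: "H + H' \<in> a" using that subspace_add[OF subspace_a] by blast
    have "l (H + H') *\<^sub>R v = (l H + l H') *\<^sub>R v"
      using l[OF HH v(1)] l[OF that(1) v(1)] l[OF that(2) v(1)] by (simp add: br.add_left scaleR_add_left)
    then show ?thesis using v(2) that HH by (simp add: \<nu>_def)
  qed
  moreover have "\<nu> (r *s H) = r * \<nu> H" if "H \<in> a" for r H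
  proof -
    have rH: "r *\<^sub>R H \<in> a" using that subspace_scale[OF subspace_a] by blast
    have "l (r *\<^sub>R H) *\<^sub>R v = (r * l H) *\<^sub>R v"
      using l[OF rH v(1), symmetric] l[OF that v(1)] by (simp add: br.scaleR_left)
    then show ?thesis using v(2) that rH by (simp add: \<nu>_def scalar_mult_eq_scaleR)
  qed
  ultimately have "functional_on a \<nu>" unfolding functional_on_def by (simp add: \<nu>_def)
  moreover have "v \<in> rs \<nu>" unfolding rs_iff using l v(1) by (simp add: \<nu>_def)
  ultimately show ?thesis using v sV'(3) by blast
qed

text \<open>The part of \<open>V\<close> orthogonal to all weight vectors is invariant again; if
  nonzero it would contain a weight vector orthogonal to itself.\<close>

lemma invariant_subspace_decomposition:
  assumes V: "subspace V" "\<And>H v. H \<in> a \<Longrightarrow> v \<in> V \<Longrightarrow> br H v \<in> V"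
  shows "V \<subseteq> span {Z \<in> V. \<exists>\<nu>. functional_on a \<nu> \<and> Z \<in> rs \<nu>}"
proof -
  let ?B = "{Z \<in> V. \<exists>\<nu>. functional_on a \<nu> \<and> Z \<in> rs \<nu>}"
  have sub: "span ?B \<subseteq> V" by (rule span_minimal[OF _ V(1)]) blast
  have inv: "br H s \<in> span ?B" if H: "H \<in> a" and s: "s \<in> span ?B" for H s
  proof -
    have "subspace {s. br H s \<in> span ?B}"
      by (simp add: subspace_def br.zero_right br.add_right br.scaleR_right span_zero span_add span_scale)
    moreover have "?B \<subseteq> {s. br H s \<in> span ?B}"
    proof clarify
      fix Z \<nu> assume Z: "Z \<in> V" "functional_on a \<nu>" "Z \<in> rs \<nu>"
      then have "Z \<in> span ?B" by (intro span_base) blast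
      then show "br H Z \<in> span ?B" using rsD[OF Z(3) H] by (simp add: span_scale)
    qed
    ultimately show ?thesis using span_minimal s by blast
  qed
  define V' where "V' = {v \<in> V. \<forall>s\<in>span ?B. ip s v = 0}"
  have sV': "subspace V'"
    using V(1) unfolding V'_def subspace_def by (auto simp: ip.add_right ip.scaleR_right ip.zero_right)
  have "V' = {0}"
  proof (rule ccontr)
    assume "V' \<noteq> {0}"
    moreover have "br H v \<in> V'" if "H \<in> a" "v \<in> V'" for H v
      using that V(2) inv br_a_symmetric[OF that(1)] unfolding V'_def by (auto simp: br_a_symmetric[OF that(1), symmetric])
    ultimately obtain v \<nu> where v: "v \<in> V'" "v \<noteq> 0" "functional_on a \<nu>" "v \<in> rs \<nu>"
      using common_eigenvector[OF sV'] by blast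
    then have "v \<in> span ?B" by (intro span_base) (auto simp: V'_def)
    then have "ip v v = 0" using v(1) by (auto simp: V'_def)
    then show False using v(2) by (simp add: ip_zero_iff)
  qed
  show ?thesis
  proof
    fix v assume v: "v \<in> V"
    obtain s where s: "s \<in> span ?B" "\<forall>t\<in>span ?B. ip t (v - s) = 0"
      using ip_projection[OF subspace_span] by blast
    have "v - s \<in> V" using v s(1) sub V(1) by (auto intro: subspace_diff)
    then have "v - s \<in> V'" using s(2) by (simp add: V'_def)
    then show "v \<in> span ?B" using \<open>V' = {0}\<close> s(1) by simp
  qed
qed

lemma functional_onD:
  assumes "functional_on a \<mu>" "H \<in> a" "H' \<in> a"
  shows "\<mu> (H + H') = \<mu> H + \<mu> H'" "\<mu> (H - H') = \<mu> H - \<mu> H'" "\<mu> (r *\<^sub>R H) = r * \<mu> H"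
proof -
  have sc: "\<mu> (r *\<^sub>R H) = r * \<mu> H" if "H \<in> a" for r H
    using assms(1) that unfolding functional_on_def scalar_mult_eq_scaleR by blast
  have add: "\<mu> (H + H') = \<mu> H + \<mu> H'" if "H \<in> a" "H' \<in> a" for H H'
    using assms(1) that unfolding functional_on_def by blast
  show "\<mu> (H + H') = \<mu> H + \<mu> H'" "\<mu> (r *\<^sub>R H) = r * \<mu> H" using add sc assms by auto
  have "(-1) *\<^sub>R H' \<in> a" using subspace_scale[OF subspace_a assms(3)] .
  then show "\<mu> (H - H') = \<mu> H - \<mu> H'" using add[OF assms(2), of "(-1) *\<^sub>R H'"] sc[OF assms(3), of "-1"] by simp
qed

lemma functional_on_add:
  "functional_on a \<mu> \<Longrightarrow> functional_on a \<nu> \<Longrightarrow> functional_on a (\<lambda>H. \<mu> H + \<nu> H)"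
  unfolding functional_on_def by (simp add: algebra_simps)

lemma functional_on_scale: "functional_on a \<mu> \<Longrightarrow> functional_on a (\<lambda>H. r * \<mu> H)"
  unfolding functional_on_def by (simp add: algebra_simps)

lemma rs_bracket: "Z \<in> rs \<mu> \<Longrightarrow> W \<in> rs \<nu> \<Longrightarrow> br Z W \<in> rs (\<lambda>H. \<mu> H + \<nu> H)"
  unfolding rs_iff by (simp add: br_derivation br.scaleR_left br.scaleR_right scaleR_add_left)

lemma rs_theta: "Z \<in> rs \<mu> \<Longrightarrow> \<theta> Z \<in> rs (\<lambda>H. - \<mu> H)"
  unfolding rs_iff
proof
  fix H assume Z: "\<forall>H\<in>a. br H Z = \<mu> H *\<^sub>R Z" and H: "H \<in> a"
  have "br H (\<theta> Z) = \<theta> (br (\<theta> H) Z)" by (simp add: theta_br)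
  also have "\<dots> = - \<theta> (br H Z)" using H by (simp add: a_p br.minus_left theta_simps)
  also have "\<dots> = - \<mu> H *\<^sub>R \<theta> Z" using Z H by (simp add: theta_simps)
  finally show "br H (\<theta> Z) = - \<mu> H *\<^sub>R \<theta> Z" .
qed

lemma rs_orthogonal:
  assumes "Z \<in> rs \<mu>" "W \<in> rs \<nu>" "H \<in> a" "\<mu> H \<noteq> \<nu> H"
  shows "ip Z W = 0"
proof -
  have "\<mu> H * ip Z W = \<nu> H * ip Z W"
    using br_a_symmetric[OF assms(3), of Z W] rsD[OF assms(1,3)] rsD[OF assms(2,3)]
    by (simp add: ip.scaleR_left ip.scaleR_right)
  then show ?thesis using assms(4) by simp
qed

text \<open>Unlike \<open>roots\<close> this admits the zero functional, so that strings may pass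
  through zero.\<close>

definition wt :: "(real^'n \<Rightarrow> real) \<Rightarrow> bool" where
  "wt \<mu> \<longleftrightarrow> functional_on a \<mu> \<and> (\<exists>Z\<in>rs \<mu>. Z \<noteq> 0)"

lemma zero_rs: "0 \<in> rs \<mu>"
  by (simp add: rs_iff br.zero_right)

lemma roots_iff: "\<mu> \<in> roots br a \<longleftrightarrow> wt \<mu> \<and> \<mu> \<noteq> (\<lambda>_. 0)"
  unfolding roots_def wt_def using zero_rs[of \<mu>] by auto

lemma functional_neq: "functional_on a \<mu> \<Longrightarrow> functional_on a \<nu> \<Longrightarrow> \<mu> \<noteq> \<nu> \<Longrightarrow> \<exists>H\<in>a. \<mu> H \<noteq> \<nu> H"
  unfolding functional_on_def by (metis ext)

lemma finite_wt: "finite {\<mu>. wt \<mu>}"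
proof (rule ccontr)
  assume "infinite {\<mu>. wt \<mu>}"
  then obtain T where T: "T \<subseteq> {\<mu>. wt \<mu>}" "finite T" "card T = Suc CARD('n)"
    using infinite_arbitrarily_large by blast
  have "\<forall>\<mu>\<in>T. \<exists>Z. Z \<in> rs \<mu> \<and> Z \<noteq> 0" using T(1) by (auto simp: wt_def)
  then obtain u where u: "\<And>\<mu>. \<mu> \<in> T \<Longrightarrow> u \<mu> \<in> rs \<mu>" "\<And>\<mu>. \<mu> \<in> T \<Longrightarrow> u \<mu> \<noteq> 0" by metis
  have orth: "ip (u \<mu>) (u \<nu>) = 0" if "\<mu> \<in> T" "\<nu> \<in> T" "\<mu> \<noteq> \<nu>" for \<mu> \<nu>
  proof -
    have "functional_on a \<mu>" "functional_on a \<nu>" using that T(1) by (auto simp: wt_def)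
    then obtain H where "H \<in> a" "\<mu> H \<noteq> \<nu> H" using functional_neq \<open>\<mu> \<noteq> \<nu>\<close> by blast
    then show ?thesis using rs_orthogonal[OF u(1)[OF that(1)] u(1)[OF that(2)]] by blast
  qed
  have inj: "inj_on u T"
  proof (rule inj_onI, rule ccontr)
    fix \<mu> \<nu> assume *: "\<mu> \<in> T" "\<nu> \<in> T" "u \<mu> = u \<nu>" "\<mu> \<noteq> \<nu>"
    then have "ip (u \<mu>) (u \<mu>) = 0" using orth[OF *(1,2,4)] by simp
    then show False using u(2)[OF *(1)] by (simp add: ip_zero_iff)
  qed
  have "independent (u ` T)"
  proof -
    have "\<forall>v\<in>u ` T. q v = 0" if q: "(\<Sum>v\<in>u ` T. q v *\<^sub>R v) = 0" for q
    proof clarify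
      fix \<mu> assume \<mu>: "\<mu> \<in> T"
      have "0 = ip (\<Sum>\<nu>\<in>T. q (u \<nu>) *\<^sub>R u \<nu>) (u \<mu>)" using q by (simp add: sum.reindex[OF inj] ip.zero_left)
      also have "\<dots> = (\<Sum>\<nu>\<in>T. q (u \<nu>) * ip (u \<nu>) (u \<mu>))" by (simp add: ip.sum_left ip.scaleR_left)
      also have "\<dots> = q (u \<mu>) * ip (u \<mu>) (u \<mu>)"
        using T(2) \<mu> orth by (subst sum.remove[of T \<mu>]) (auto intro!: sum.neutral)
      finally show "q (u \<mu>) = 0" using u(2)[OF \<mu>] by (simp add: ip_zero_iff)
    qed
    then show ?thesis using T(2) by (auto simp: dependent_finite)
  qed
  then have "card (u ` T) \<le> CARD('n)" using independent_bound by force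
  then show False using T inj by (simp add: card_image)
qed

text \<open>For \<open>Z\<close> in the root space of \<mu> this is a positive multiple of the
  vector that represents \<mu> through the Killing form (\<open>killing_cr\<close>); it serves as a
  coroot up to scale.\<close>

definition cr :: "real^'n \<Rightarrow> real^'n" where "cr Z = br (\<theta> Z) Z"

lemma cr_in_a:
  assumes "Z \<in> rs \<mu>"
  shows "cr Z \<in> a"
proof (rule a_maximal)
  show "\<theta> (cr Z) = - cr Z" using br_anticomm[of Z "\<theta> Z"] by (simp add: cr_def theta_br)
  show "br H (cr Z) = 0" if "H \<in> a" for H
    using rsD[OF rs_bracket[OF rs_theta[OF assms] assms] that] by (simp add: cr_def)
qed

lemma killing_cr:
  assumes "Z \<in> rs \<mu>" "H \<in> a"
  shows "killing br (cr Z) H = \<mu> H * ip Z Z"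
proof -
  have "killing br (cr Z) H = killing br (\<theta> Z) (br Z H)" unfolding cr_def by (rule killing_invariant)
  also have "br Z H = - (\<mu> H *\<^sub>R Z)" using rsD[OF assms] br_anticomm[of Z H] by simp
  finally show ?thesis by (simp add: killing.minus_right killing.scaleR_right ip_def killing_commute)
qed

lemma killing_a_pos: "H \<in> a \<Longrightarrow> H \<noteq> 0 \<Longrightarrow> killing br H H > 0"
  using ip_pos[of H] by (simp add: ip_def a_p killing.minus_right)

lemma cr_pos:
  assumes "Z \<in> rs \<mu>" "Z \<noteq> 0" "functional_on a \<mu>" "\<mu> \<noteq> (\<lambda>_. 0)"
  shows "\<mu> (cr Z) > 0"
proof -
  have "functional_on a (\<lambda>_. 0)" by (simp add: functional_on_def)
  then obtain H where H: "H \<in> a" "\<mu> H \<noteq> 0" using functional_neq[OF assms(3) _ assms(4)] by blast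
  then have "killing br (cr Z) H \<noteq> 0" using killing_cr[OF assms(1)] assms(2) by (simp add: ip_zero_iff)
  then have "cr Z \<noteq> 0" by (auto simp: killing.zero_left)
  then have "killing br (cr Z) (cr Z) > 0" using killing_a_pos cr_in_a[OF assms(1)] by blast
  then show ?thesis using killing_cr[OF assms(1) cr_in_a[OF assms(1)]] ip_pos[OF assms(2)]
    by (simp add: zero_less_mult_iff)
qed

text \<open>The sign of \<nu> (cr Z) decides which of [Z, W] and [\<theta> Z, W] is certainly
  nonzero, that is, whether \<nu> + \<mu> or \<nu> - \<mu> is a weight.\<close>

lemma norm_identity:
  assumes "Z \<in> rs \<mu>" "W \<in> rs \<nu>"
  shows "ip (br Z W) (br Z W) = ip (br (\<theta> Z) W) (br (\<theta> Z) W) - \<nu> (cr Z) * ip W W"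
proof -
  have "br (\<theta> Z) (br Z W) = \<nu> (cr Z) *\<^sub>R W + br Z (br (\<theta> Z) W)"
    using br_derivation[of "\<theta> Z" Z W] rsD[OF assms(2) cr_in_a[OF assms(1)]] by (simp add: cr_def)
  moreover have "ip W (br Z (br (\<theta> Z) W)) = - ip (br (\<theta> Z) W) (br (\<theta> Z) W)"
    using ip_br[of Z "br (\<theta> Z) W" W] ip_commute[of W "br Z (br (\<theta> Z) W)"] by simp
  ultimately show ?thesis
    using ip_br[of Z W "br Z W"] by (simp add: ip.add_right ip.scaleR_right)
qed

lemma wt_plus:
  assumes "Z \<in> rs \<mu>" "W \<in> rs \<nu>" "W \<noteq> 0" "\<nu> (cr Z) < 0"
    and "functional_on a \<mu>" "functional_on a \<nu>"
  shows "wt (\<lambda>H. \<mu> H + \<nu> H)"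
proof -
  have "\<nu> (cr Z) * ip W W < 0" using assms(4) ip_pos[OF assms(3)] by (simp add: mult_neg_pos)
  then have "ip (br Z W) (br Z W) > 0"
    using norm_identity[OF assms(1,2)] ip_nonneg[of "br (\<theta> Z) W"] by linarith
  then have "br Z W \<noteq> 0" by (auto simp: ip.zero_left)
  then show ?thesis using rs_bracket[OF assms(1,2)] functional_on_add[OF assms(5,6)] by (auto simp: wt_def)
qed

lemma wt_minus:
  assumes "Z \<in> rs \<mu>" "W \<in> rs \<nu>" "W \<noteq> 0" "\<nu> (cr Z) > 0"
    and "functional_on a \<mu>" "functional_on a \<nu>"
  shows "wt (\<lambda>H. \<nu> H - \<mu> H)"
proof -
  have "\<nu> (cr Z) * ip W W > 0" using assms(4) ip_pos[OF assms(3)] by simp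
  then have "ip (br (\<theta> Z) W) (br (\<theta> Z) W) > 0"
    using norm_identity[OF assms(1,2)] ip_nonneg[of "br Z W"] by linarith
  then have "br (\<theta> Z) W \<noteq> 0" by (auto simp: ip.zero_left)
  moreover have "br (\<theta> Z) W \<in> rs (\<lambda>H. - \<mu> H + \<nu> H)" using rs_bracket[OF rs_theta[OF assms(1)] assms(2)] .
  moreover have "functional_on a (\<lambda>H. - 1 * \<mu> H + \<nu> H)"
    using functional_on_add[OF functional_on_scale[OF assms(5)] assms(6)] .
  ultimately show ?thesis by (auto simp: wt_def)
qed

lemma wt_neg: "wt \<mu> \<Longrightarrow> wt (\<lambda>H. - \<mu> H)"
  unfolding wt_def using rs_theta functional_on_scale[of \<mu> "- 1"]
  by (metis (no_types, lifting) mult_minus1 theta_theta theta_simps(5) ext)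

lemma string_finite:
  assumes "\<mu> \<noteq> (\<lambda>_. 0)"
  shows "\<exists>k::nat. \<not> wt (\<lambda>H. \<nu> H + of_nat k * \<mu> H)"
proof (rule ccontr)
  assume "\<not> ?thesis"
  then have "range (\<lambda>k::nat. (\<lambda>H. \<nu> H + of_nat k * \<mu> H)) \<subseteq> {\<mu>. wt \<mu>}" by blast
  then have "finite (range (\<lambda>k::nat. (\<lambda>H. \<nu> H + of_nat k * \<mu> H)))" using finite_wt finite_subset by blast
  moreover have "inj (\<lambda>k::nat. (\<lambda>H. \<nu> H + of_nat k * \<mu> H))"
  proof (rule injI)
    fix j k :: nat assume "(\<lambda>H. \<nu> H + of_nat j * \<mu> H) = (\<lambda>H. \<nu> H + of_nat k * \<mu> H)"
    then have "of_nat j * \<mu> H = of_nat k * \<mu> H" for H by (metis add_left_cancel)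
    moreover obtain H where "\<mu> H \<noteq> 0" using assms by blast
    ultimately show "j = k" by (metis mult_right_cancel of_nat_eq_iff)
  qed
  ultimately show False using finite_imageD infinite_UNIV_nat by blast
qed

lemma funpow_rs:
  assumes "Z \<in> rs \<mu>" "W \<in> rs \<nu>"
  shows "(br Z ^^ k) W \<in> rs (\<lambda>H. \<nu> H + of_nat k * \<mu> H)"
proof (induction k)
  case (Suc k)
  have "br Z ((br Z ^^ k) W) \<in> rs (\<lambda>H. \<mu> H + (\<nu> H + of_nat k * \<mu> H))"
    by (rule rs_bracket[OF assms(1) Suc])
  then show ?case by (simp add: algebra_simps)
qed (simp add: assms)

lemma string_end:
  assumes "Z \<in> rs \<mu>" "W \<in> rs \<nu>" "W \<noteq> 0" "functional_on a \<mu>" "functional_on a \<nu>" "\<mu> \<noteq> (\<lambda>_. 0)"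
  shows "\<exists>k. (br Z ^^ k) W \<noteq> 0 \<and> (br Z ^^ Suc k) W = 0"
proof -
  obtain k where k: "\<not> wt (\<lambda>H. \<nu> H + of_nat k * \<mu> H)" using string_finite[OF assms(6)] by blast
  have "functional_on a (\<lambda>H. \<nu> H + of_nat k * \<mu> H)"
    using functional_on_add[OF assms(5) functional_on_scale[OF assms(4)]] .
  then have "(br Z ^^ k) W = 0" using k funpow_rs[OF assms(1,2), of k] by (auto simp: wt_def)
  then obtain j where j: "(br Z ^^ j) W = 0" "\<And>i. i < j \<Longrightarrow> (br Z ^^ i) W \<noteq> 0"
    using exists_least_iff[of "\<lambda>k. (br Z ^^ k) W = 0"] by blast
  then obtain i where "j = Suc i" using assms(3) by (cases j) auto
  then show ?thesis using j by (intro exI[of _ i]) auto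
qed

text \<open>The representation theory of the three-dimensional algebra spanned by \<open>Z\<close>, \<open>\<theta> Z\<close> and \<open>cr Z\<close>.\<close>

lemma integrality:
  assumes Z: "Z \<in> rs \<mu>" "Z \<noteq> 0" "functional_on a \<mu>" "\<mu> \<noteq> (\<lambda>_. 0)" and \<nu>: "wt \<nu>"
  shows "2 * \<nu> (cr Z) / \<mu> (cr Z) \<in> \<int>"
proof -
  define H where "H = cr Z"
  have H: "H \<in> a" "\<mu> H > 0" using cr_in_a[OF Z(1)] cr_pos[OF Z] by (auto simp: H_def)
  obtain W where W: "W \<in> rs \<nu>" "W \<noteq> 0" and f\<nu>: "functional_on a \<nu>" using \<nu> by (auto simp: wt_def)
  obtain j where j: "(br Z ^^ j) W \<noteq> 0" "(br Z ^^ Suc j) W = 0" using string_end[OF Z(1) W Z(3) f\<nu> Z(4)] by blast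
  define U where "U = (br Z ^^ j) W"
  define \<rho> where "\<rho> H = \<nu> H + of_nat j * \<mu> H" for H
  have U: "U \<in> rs \<rho>" "U \<noteq> 0" "br Z U = 0"
    using funpow_rs[OF Z(1) W(1), of j] j by (auto simp: U_def \<rho>_def[abs_def])
  have f\<rho>: "functional_on a \<rho>"
    unfolding \<rho>_def using functional_on_add[OF f\<nu> functional_on_scale[OF Z(3)]] .
  define \<mu>' where "\<mu>' H = - \<mu> H" for H
  have \<mu>': "\<theta> Z \<in> rs \<mu>'" "functional_on a \<mu>'" "\<mu>' \<noteq> (\<lambda>_. 0)"
    using rs_theta[OF Z(1)] functional_on_scale[OF Z(3), of "- 1"] Z(4)
    by (auto simp: \<mu>'_def[abs_def] fun_eq_iff)
  obtain N where N: "(br (\<theta> Z) ^^ N) U \<noteq> 0" "(br (\<theta> Z) ^^ Suc N) U = 0"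
    using string_end[OF \<mu>'(1) U(1,2) \<mu>'(2) f\<rho> \<mu>'(3)] by blast
  \<comment> \<open>The sum of the weights \<rho> H - i \<mu> H for i < k, picked up when
    \<open>Z\<close> is commuted past k factors \<theta> Z. That it vanishes at the end of the
    lowering string makes \<rho> H a half-integral multiple of \<mu> H.\<close>
  define c where "c k = of_nat k * \<rho> H - of_nat k * (of_nat k - 1) / 2 * \<mu> H" for k :: nat
  have rec: "br Z ((br (\<theta> Z) ^^ Suc k) U) = - c (Suc k) *\<^sub>R (br (\<theta> Z) ^^ k) U" for k
  proof (induction k)
    case 0
    have "br Z (br (\<theta> Z) U) = br (br Z (\<theta> Z)) U + br (\<theta> Z) (br Z U)" by (rule br_derivation)
    also have "br Z (\<theta> Z) = - H" unfolding H_def cr_def by (rule br_anticomm)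
    finally show ?case using U rsD[OF U(1) H(1)] by (simp add: br.minus_left br.zero_right c_def)
  next
    case (Suc k)
    define U' where "U' = (br (\<theta> Z) ^^ Suc k) U"
    have "U' \<in> rs (\<lambda>H. \<rho> H + of_nat (Suc k) * \<mu>' H)"
      unfolding U'_def by (rule funpow_rs[OF \<mu>'(1) U(1)])
    from rsD[OF this H(1)] have HU: "br H U' = (\<rho> H - of_nat (Suc k) * \<mu> H) *\<^sub>R U'" by (simp add: \<mu>'_def)
    have "br Z (br (\<theta> Z) U') = br (br Z (\<theta> Z)) U' + br (\<theta> Z) (br Z U')" by (rule br_derivation)
    also have "br Z (\<theta> Z) = - H" unfolding H_def cr_def by (rule br_anticomm)
    also have "br Z U' = - c (Suc k) *\<^sub>R (br (\<theta> Z) ^^ k) U" unfolding U'_def by (rule Suc)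
    also have "br (\<theta> Z) (- c (Suc k) *\<^sub>R (br (\<theta> Z) ^^ k) U) = - c (Suc k) *\<^sub>R U'"
      by (simp add: br.scaleR_right br.minus_right U'_def)
    also have "br (- H) U' + - c (Suc k) *\<^sub>R U' = - (c (Suc k) + (\<rho> H - of_nat (Suc k) * \<mu> H)) *\<^sub>R U'"
      using HU by (simp add: br.minus_left algebra_simps)
    also have "c (Suc k) + (\<rho> H - of_nat (Suc k) * \<mu> H) = c (Suc (Suc k))"
      by (simp add: c_def field_simps)
    finally show ?case by (simp add: U'_def)
  qed
  have "c (Suc N) = 0" using rec[of N] N by (simp add: br.zero_right)
  then have "of_nat (Suc N) * (\<rho> H - of_nat N / 2 * \<mu> H) = 0" by (simp add: c_def field_simps)
  then have "\<rho> H = of_nat N / 2 * \<mu> H" by simp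
  then have "2 * \<nu> H / \<mu> H = of_int (int N - 2 * int j)"
    using H(2) by (simp add: \<rho>_def field_simps)
  then show ?thesis unfolding H_def[symmetric] by (metis Ints_of_int)
qed

end

section \<open>Strings through a simple restricted root\<close>

locale simple_restricted_root = restricted_roots br \<theta> a
  for br :: "real^'n \<Rightarrow> real^'n \<Rightarrow> real^'n" and \<theta> :: "real^'n \<Rightarrow> real^'n"
    and a :: "(real^'n) set" +
  fixes P S1 :: "(real^'n \<Rightarrow> real) set" and \<beta> :: "real^'n \<Rightarrow> real" and E :: "real^'n"
  assumes positive: "positive_system (roots br a) P" and simple: "\<beta> \<in> simple_roots P"
    and E: "E \<in> rs \<beta>" "E \<noteq> 0"
    and S1: "reduced_roots (roots br a) \<and> S1 = P - {\<beta>} \<or>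
             \<beta> \<in> roots br a \<and> (\<lambda>H. 2 * \<beta> H) \<in> roots br a \<and> S1 = P - {\<beta>, \<lambda>H. 2 * \<beta> H}"
begin

lemma P_root: "\<mu> \<in> P \<Longrightarrow> wt \<mu> \<and> \<mu> \<noteq> (\<lambda>_. 0)"
proof -
  assume "\<mu> \<in> P"
  then have "\<mu> \<in> roots br a" using positive unfolding positive_system_def by blast
  then show ?thesis unfolding roots_iff .
qed

lemma P_functional: "\<mu> \<in> P \<Longrightarrow> functional_on a \<mu>"
  using P_root[of \<mu>] unfolding wt_def by blast

lemma P_or_neg:
  assumes "wt \<mu>" "\<mu> \<noteq> (\<lambda>_. 0)"
  shows "(\<mu> \<in> P) \<noteq> ((\<lambda>H. - \<mu> H) \<in> P)"
proof -
  have "\<mu> \<in> roots br a" unfolding roots_iff using assms by blast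
  then show ?thesis using positive unfolding positive_system_def by blast
qed

lemma P_add:
  assumes *: "\<mu> \<in> P" "\<nu> \<in> P" "wt (\<lambda>H. \<mu> H + \<nu> H)"
  shows "(\<lambda>H. \<mu> H + \<nu> H) \<in> P"
proof -
  have "(\<lambda>H. \<mu> H + \<nu> H) \<noteq> (\<lambda>_. 0)"
  proof
    assume "(\<lambda>H. \<mu> H + \<nu> H) = (\<lambda>_. 0)"
    then have "\<mu> H + \<nu> H = 0" for H by (rule fun_cong)
    then have "\<nu> = (\<lambda>H. - \<mu> H)" by (intro ext) (simp add: eq_neg_iff_add_eq_0 add.commute)
    then show False using P_or_neg[of \<mu>] P_root[OF *(1)] *(1,2) by blast
  qed
  then have "(\<lambda>H. \<mu> H + \<nu> H) \<in> roots br a" unfolding roots_iff using *(3) by blast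
  then show ?thesis using positive *(1,2) unfolding positive_system_def by blast
qed

lemma beta: "\<beta> \<in> P" "wt \<beta>" "functional_on a \<beta>" "\<beta> \<noteq> (\<lambda>_. 0)"
proof -
  show "\<beta> \<in> P" using simple unfolding simple_roots_def by blast
  then show "wt \<beta>" "functional_on a \<beta>" "\<beta> \<noteq> (\<lambda>_. 0)"
    using P_root[of \<beta>] P_functional[of \<beta>] by blast+
qed

lemma beta_not_sum:
  assumes "\<mu> \<in> P" "\<nu> \<in> P"
  shows "(\<lambda>H. \<mu> H + \<nu> H) \<noteq> \<beta>"
proof
  assume "(\<lambda>H. \<mu> H + \<nu> H) = \<beta>"
  then have "\<exists>\<nu>\<in>P. \<exists>\<rho>\<in>P. \<beta> = (\<lambda>H. \<nu> H + \<rho> H)" using assms by blast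
  then show False using simple unfolding simple_roots_def by blast
qed

text \<open>The Cartan integer of \<nu> with respect to \<beta>; the scale of \<open>cr E\<close>
  cancels.\<close>

definition xx :: "(real^'n \<Rightarrow> real) \<Rightarrow> real" where "xx \<nu> = 2 * \<nu> (cr E) / \<beta> (cr E)"

lemma crE: "cr E \<in> a" "\<beta> (cr E) > 0"
  using cr_in_a[OF E(1)] cr_pos[OF E beta(3,4)] by auto

lemma xx_int: "wt \<nu> \<Longrightarrow> xx \<nu> \<in> \<int>"
  unfolding xx_def by (rule integrality[OF E beta(3,4)])

text \<open>Integrality in both directions makes 2 r and 2 / r integers with product 4.\<close>

lemma multiple_of_beta:
  assumes w: "wt (\<lambda>H. r * \<beta> H)" and r: "r \<noteq> 0"
  shows "\<bar>r\<bar> \<in> {1/2, 1, 2}"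
proof -
  have "xx (\<lambda>H. r * \<beta> H) = 2 * r" using crE by (simp add: xx_def)
  then have 1: "2 * r \<in> \<int>" using xx_int[OF w] by simp
  obtain Z where Z: "Z \<in> rs (\<lambda>H. r * \<beta> H)" "Z \<noteq> 0" using w by (auto simp: wt_def)
  have nz: "(\<lambda>H. r * \<beta> H) \<noteq> (\<lambda>_. 0)" using r beta(4) by (simp add: fun_eq_iff)
  have f: "functional_on a (\<lambda>H. r * \<beta> H)" using w by (simp add: wt_def)
  have "2 * \<beta> (cr Z) / (r * \<beta> (cr Z)) \<in> \<int>" by (rule integrality[OF Z f nz beta(2)])
  moreover have "r * \<beta> (cr Z) > 0" by (rule cr_pos[OF Z f nz])
  ultimately have 2: "2 / r \<in> \<int>" using r by (simp add: field_simps split: if_splits)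
  obtain m where m: "2 * r = of_int m" using 1 by (auto elim: Ints_cases)
  obtain k where k: "2 / r = of_int k" using 2 by (auto elim: Ints_cases)
  have "of_int m * of_int k = (4 :: real)" using m k r by (simp flip: m k)
  then have "real_of_int (m * k) = real_of_int 4" by simp
  then have mk: "m * k = 4" unfolding of_int_eq_iff .
  have "m dvd 4" using dvd_triv_left[of m k] unfolding mk .
  then have "\<bar>m\<bar> \<le> 4" using dvd_imp_le_int[of 4 m] by simp
  moreover have "m \<noteq> 0" using mk by auto
  moreover have "\<bar>m\<bar> \<noteq> 3"
  proof
    assume "\<bar>m\<bar> = 3"
    then have "(3::int) dvd 4" using \<open>m dvd 4\<close> abs_dvd_iff[of m 4] by simp
    then show False by simp
  qed
  ultimately have "\<bar>m\<bar> \<in> {1, 2, 4}" by auto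
  then have "\<bar>2 * r\<bar> \<in> {1, 2, 4}" unfolding m by auto
  then show ?thesis by (auto simp: abs_mult)
qed

lemma positive_multiple_of_beta:
  assumes "(\<lambda>H. r * \<beta> H) \<in> P"
  shows "r = 1 \<or> r = 2"
proof -
  have r: "r \<noteq> 0" "wt (\<lambda>H. r * \<beta> H)" using P_root[OF assms] by auto
  have neg: "(\<lambda>H. - \<beta> H) \<notin> P" using P_or_neg[OF beta(2,4)] beta(1) by blast
  have wneg: "wt (\<lambda>H. - \<beta> H)" by (rule wt_neg[OF beta(2)])
  have "r \<noteq> 1/2"
  proof
    assume "r = 1/2"
    then have "(\<lambda>H. r * \<beta> H + r * \<beta> H) = \<beta>" by (simp add: fun_eq_iff)
    then show False using beta_not_sum[OF assms assms] by blast
  qed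
  moreover have "r \<noteq> - 1/2"
  proof
    assume "r = - 1/2"
    then have "(\<lambda>H. r * \<beta> H + r * \<beta> H) = (\<lambda>H. - \<beta> H)" by (simp add: fun_eq_iff)
    then show False using P_add[OF assms assms] wneg neg by simp
  qed
  moreover have "r \<noteq> - 1" using assms neg by auto
  moreover have "r \<noteq> - 2"
  proof
    assume "r = - 2"
    then have "(\<lambda>H. r * \<beta> H + \<beta> H) = (\<lambda>H. - \<beta> H)" by (simp add: fun_eq_iff)
    then show False using P_add[OF assms beta(1)] wneg neg by simp
  qed
  ultimately show ?thesis using multiple_of_beta[OF r(2,1)] by (auto simp: abs_if split: if_splits)
qed

lemma S1_iff: "\<mu> \<in> S1 \<longleftrightarrow> \<mu> \<in> P \<and> (\<forall>r. \<mu> \<noteq> (\<lambda>H. r * \<beta> H))"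
proof
  assume \<mu>: "\<mu> \<in> S1"
  then have P: "\<mu> \<in> P" "\<mu> \<noteq> \<beta>" using S1 by auto
  have "\<mu> \<noteq> (\<lambda>H. 2 * \<beta> H)"
    using S1
  proof
    assume "reduced_roots (roots br a) \<and> S1 = P - {\<beta>}"
    then have "(\<lambda>H. 2 * \<beta> H) \<notin> roots br a"
      using beta by (auto simp: reduced_roots_def roots_iff)
    then show ?thesis using P_root[OF P(1)] by (auto simp: roots_iff)
  qed (use \<mu> in auto)
  then have "\<mu> \<noteq> (\<lambda>H. r * \<beta> H)" for r
    using positive_multiple_of_beta[of r] P by auto
  then show "\<mu> \<in> P \<and> (\<forall>r. \<mu> \<noteq> (\<lambda>H. r * \<beta> H))" using P by blast
next
  assume \<mu>: "\<mu> \<in> P \<and> (\<forall>r. \<mu> \<noteq> (\<lambda>H. r * \<beta> H))"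
  then have "\<mu> \<noteq> (\<lambda>H. 1 * \<beta> H)" "\<mu> \<noteq> (\<lambda>H. 2 * \<beta> H)" by blast+
  then show "\<mu> \<in> S1" using S1 \<mu> by auto
qed

lemma S1_P: "\<mu> \<in> S1 \<Longrightarrow> \<mu> \<in> P" by (simp add: S1_iff)

lemma S1_wt: "\<mu> \<in> S1 \<Longrightarrow> wt \<mu>" using P_root S1_P by blast

lemma S1_not_multiple: "\<mu> \<in> S1 \<Longrightarrow> \<mu> \<noteq> (\<lambda>H. r * \<beta> H)" by (simp add: S1_iff)

text \<open>If \<mu> - \<beta> were negative, \<beta> would be the sum of the positive roots \<mu>
  and \<beta> - \<mu>, against simplicity.\<close>

lemma S1_shift:
  assumes "\<mu> \<in> S1"
  shows "wt (\<lambda>H. \<mu> H + \<beta> H) \<Longrightarrow> (\<lambda>H. \<mu> H + \<beta> H) \<in> S1"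
    and "wt (\<lambda>H. \<mu> H - \<beta> H) \<Longrightarrow> (\<lambda>H. \<mu> H - \<beta> H) \<in> S1"
proof -
  have nm: "(\<lambda>H. \<mu> H + s * \<beta> H) \<noteq> (\<lambda>H. r * \<beta> H)" for r s
  proof
    assume *: "(\<lambda>H. \<mu> H + s * \<beta> H) = (\<lambda>H. r * \<beta> H)"
    have "\<mu> H = (r - s) * \<beta> H" for H using fun_cong[OF *, of H] by (simp add: algebra_simps)
    then show False using S1_not_multiple[OF assms] by blast
  qed
  show "(\<lambda>H. \<mu> H + \<beta> H) \<in> S1" if "wt (\<lambda>H. \<mu> H + \<beta> H)"
    using P_add[OF S1_P[OF assms] beta(1) that] nm[of 1] by (simp add: S1_iff)
  show "(\<lambda>H. \<mu> H - \<beta> H) \<in> S1" if w: "wt (\<lambda>H. \<mu> H - \<beta> H)"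
  proof -
    have nz: "(\<lambda>H. \<mu> H - \<beta> H) \<noteq> (\<lambda>_. 0)" using nm[of "- 1" 0] by simp
    have "(\<lambda>H. \<mu> H - \<beta> H) \<in> P"
    proof (rule ccontr)
      assume "(\<lambda>H. \<mu> H - \<beta> H) \<notin> P"
      then have "(\<lambda>H. - (\<mu> H - \<beta> H)) \<in> P" using P_or_neg[OF w nz] by blast
      from beta_not_sum[OF S1_P[OF assms] this] show False by simp
    qed
    then show ?thesis using nm[of "- 1"] by (simp add: S1_iff)
  qed
qed

lemma xx_shift: "xx (\<lambda>H. \<mu> H + \<beta> H) = xx \<mu> + 2" "xx (\<lambda>H. \<mu> H - \<beta> H) = xx \<mu> - 2"
  using crE by (simp_all add: xx_def field_simps)

lemma shift_wt:
  assumes "wt \<mu>"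
  shows "xx \<mu> > 0 \<Longrightarrow> wt (\<lambda>H. \<mu> H - \<beta> H)" and "xx \<mu> < 0 \<Longrightarrow> wt (\<lambda>H. \<mu> H + \<beta> H)"
proof -
  obtain W where W: "W \<in> rs \<mu>" "W \<noteq> 0" "functional_on a \<mu>" using assms by (auto simp: wt_def)
  show "wt (\<lambda>H. \<mu> H - \<beta> H)" if "xx \<mu> > 0"
  proof (rule wt_minus[OF E(1) W(1,2) _ beta(3) W(3)])
    show "\<mu> (cr E) > 0" using that crE by (simp add: xx_def zero_less_divide_iff)
  qed
  show "wt (\<lambda>H. \<mu> H + \<beta> H)" if "xx \<mu> < 0"
  proof -
    have "\<mu> (cr E) < 0" using that crE by (simp add: xx_def divide_less_0_iff)
    from wt_plus[OF E(1) W(1,2) this beta(3) W(3)] show ?thesis by (simp add: add.commute)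
  qed
qed

text \<open>A shift by \<beta> against the sign of \<open>xx\<close> exists while \<open>xx\<close>
  is nonzero and changes it by 2. Each string thus has a representative with Cartan integer -1, 0 or
  1, which leaves few sign combinations.\<close>

lemma S1_small_weight:
  assumes "\<mu> \<in> S1"
  shows "\<exists>\<mu>'\<in>S1. \<exists>s. \<mu>' = (\<lambda>H. \<mu> H + s * \<beta> H) \<and> xx \<mu>' \<in> {-1, 0, 1}"
proof -
  have "\<exists>\<mu>'\<in>S1. \<exists>s. \<mu>' = (\<lambda>H. \<mu> H + s * \<beta> H) \<and> xx \<mu>' \<in> {-1, 0, 1}"
    if "\<mu> \<in> S1" "\<bar>xx \<mu>\<bar> \<le> of_nat m" for m \<mu>
    using that
  proof (induction m arbitrary: \<mu>)
    case 0
    then show ?case by (intro bexI[of _ \<mu>] exI[of _ 0]) auto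
  next
    case (Suc m)
    obtain i where i: "xx \<mu> = of_int i" using xx_int[OF S1_wt[OF Suc.prems(1)]] by (auto elim: Ints_cases)
    consider "i \<in> {-1, 0, 1}" | "i \<ge> 2" | "i \<le> - 2" by force
    then show ?case
    proof cases
      case 1
      then show ?thesis using Suc.prems i by (intro bexI[of _ \<mu>] exI[of _ 0]) auto
    next
      case 2
      have m: "(\<lambda>H. \<mu> H - \<beta> H) \<in> S1"
        using S1_shift(2)[OF Suc.prems(1)] shift_wt(1)[OF S1_wt[OF Suc.prems(1)]] 2 i by simp
      have "\<bar>xx (\<lambda>H. \<mu> H - \<beta> H)\<bar> \<le> of_nat m" unfolding xx_shift using 2 i Suc.prems(2) by simp
      from Suc.IH[OF m this] obtain s where
        "(\<lambda>H. \<mu> H - \<beta> H + s * \<beta> H) \<in> S1" "xx (\<lambda>H. \<mu> H - \<beta> H + s * \<beta> H) \<in> {-1, 0, 1}" by blast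
      moreover have "(\<lambda>H. \<mu> H - \<beta> H + s * \<beta> H) = (\<lambda>H. \<mu> H + (s - 1) * \<beta> H)" by (simp add: algebra_simps)
      ultimately show ?thesis by auto
    next
      case 3
      have m: "(\<lambda>H. \<mu> H + \<beta> H) \<in> S1"
        using S1_shift(1)[OF Suc.prems(1)] shift_wt(2)[OF S1_wt[OF Suc.prems(1)]] 3 i by simp
      have "\<bar>xx (\<lambda>H. \<mu> H + \<beta> H)\<bar> \<le> of_nat m" unfolding xx_shift using 3 i Suc.prems(2) by simp
      from Suc.IH[OF m this] obtain s where
        "(\<lambda>H. \<mu> H + \<beta> H + s * \<beta> H) \<in> S1" "xx (\<lambda>H. \<mu> H + \<beta> H + s * \<beta> H) \<in> {-1, 0, 1}" by blast
      moreover have "(\<lambda>H. \<mu> H + \<beta> H + s * \<beta> H) = (\<lambda>H. \<mu> H + (s + 1) * \<beta> H)" by (simp add: algebra_simps)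
      ultimately show ?thesis by auto
    qed
  qed
  moreover obtain m :: nat where "\<bar>xx \<mu>\<bar> \<le> of_nat m" using real_arch_simple by blast
  ultimately show ?thesis using assms by blast
qed

text \<open>Cauchy--Schwarz for \<open>cr Z\<close> and \<open>cr E\<close>, strict because \<open>\<mu>\<close> is no multiple of \<open>\<beta>\<close>.\<close>

lemma opposite_weights_negative:
  assumes \<mu>: "\<mu> \<in> S1" and Z: "Z \<in> rs \<mu>" "Z \<noteq> 0" and \<nu>: "\<nu> = (\<lambda>H. r * \<beta> H - \<mu> H)"
    and sign: "xx \<mu> * xx \<nu> \<le> 0"
  shows "\<nu> (cr Z) < 0"
proof -
  define C where "C = cr Z" define D where "D = cr E"
  have CD: "C \<in> a" "D \<in> a" using cr_in_a[OF Z(1)] crE by (auto simp: C_def D_def)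
  have kC: "killing br C H = \<mu> H * ip Z Z" if "H \<in> a" for H unfolding C_def by (rule killing_cr[OF Z(1) that])
  have kD: "killing br D H = \<beta> H * ip E E" if "H \<in> a" for H unfolding D_def by (rule killing_cr[OF E(1) that])
  have z: "ip Z Z > 0" and e: "ip E E > 0" using ip_pos Z(2) E(2) by auto
  have bD: "\<beta> D > 0" using crE by (simp add: D_def)
  have f: "functional_on a \<mu>" using P_functional S1_P \<mu> by blast
  have sym: "\<beta> C * ip E E = \<mu> D * ip Z Z"
    using kC[OF CD(2)] kD[OF CD(1)] killing_commute[of C D] by simp
  \<comment> \<open>The coefficient of the orthogonal projection of \<open>C\<close> to
    \<open>D\<close> with respect to the Killing form.\<close>
  define s where "s = \<mu> D * ip Z Z / (\<beta> D * ip E E)"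
  have "C - s *\<^sub>R D \<noteq> 0"
  proof
    assume "C - s *\<^sub>R D = 0"
    then have C: "C = s *\<^sub>R D" by simp
    have "\<mu> H = (s * ip E E / ip Z Z) * \<beta> H" for H
    proof (cases "H \<in> a")
      case True
      have "\<mu> H * ip Z Z = s * (\<beta> H * ip E E)"
        using kC[OF True] kD[OF True] by (simp add: C killing.scaleR_left)
      then show ?thesis using z by (simp add: field_simps)
    next
      case False
      then show ?thesis using f beta(3) by (simp add: functional_on_def)
    qed
    then show False using S1_not_multiple[OF \<mu>] by blast
  qed
  then have "killing br (C - s *\<^sub>R D) (C - s *\<^sub>R D) > 0"
    using CD by (intro killing_a_pos subspace_diff[OF subspace_a] subspace_scale[OF subspace_a])
  also have "killing br (C - s *\<^sub>R D) (C - s *\<^sub>R D) =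
      killing br C C - 2 * s * killing br C D + s * s * killing br D D"
    using killing_commute[of D C]
    by (simp add: killing.diff_left killing.diff_right killing.scaleR_left killing.scaleR_right algebra_simps)
  also have "\<dots> = \<mu> C * ip Z Z - 2 * s * (\<mu> D * ip Z Z) + s * s * (\<beta> D * ip E E)"
    using kC CD kD by simp
  also have "s * s * (\<beta> D * ip E E) = s * (\<mu> D * ip Z Z)"
    using bD e by (simp add: s_def)
  finally have "s * \<mu> D * ip Z Z < \<mu> C * ip Z Z" by (simp add: algebra_simps)
  then have 1: "s * \<mu> D < \<mu> C" using z by simp
  have bC: "\<beta> C = s * \<beta> D" using sym bD e by (simp add: s_def field_simps)
  have mD: "\<mu> D = xx \<mu> * \<beta> D / 2" using bD by (simp add: xx_def D_def)
  have nD: "r * \<beta> D - \<mu> D = xx \<nu> * \<beta> D / 2" using bD by (simp add: xx_def D_def \<nu>)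
  have s: "s = xx \<mu> * (ip Z Z / (2 * ip E E))" using bD e by (simp add: s_def mD field_simps)
  have "\<nu> C = r * (s * \<beta> D) - \<mu> C" by (simp add: \<nu> bC)
  also have "\<dots> < s * (r * \<beta> D - \<mu> D)" using 1 by (simp add: algebra_simps)
  also have "\<dots> = (xx \<mu> * xx \<nu>) * (ip Z Z / (2 * ip E E) * \<beta> D / 2)" unfolding nD s by simp
  also have "\<dots> \<le> 0" using z e bD by (intro mult_nonpos_nonneg[OF sign]) auto
  finally show ?thesis by (simp add: C_def)
qed

text \<open>For representatives with small Cartan integers the sum is q \<beta>, where 2 q is the
  sum of the two integers. If their product is not positive, the sum is itself a positive root, so q
  is 1 or 2: here 1 contradicts simplicity and 2 exceeds the bound on the integers. If both are 1,
  then q = 1 again. If both are -1, then \<mu>' + \<beta> = - \<nu>' lies in \<open>S1\<close>,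
  against positivity of \<nu>'.\<close>

lemma S1_sum_not_multiple:
  assumes "\<mu> \<in> S1" "\<nu> \<in> S1"
  shows "(\<lambda>H. \<mu> H + \<nu> H) \<noteq> (\<lambda>H. r * \<beta> H)"
proof
  assume eq: "(\<lambda>H. \<mu> H + \<nu> H) = (\<lambda>H. r * \<beta> H)"
  obtain \<mu>' s where \<mu>': "\<mu>' \<in> S1" "\<mu>' = (\<lambda>H. \<mu> H + s * \<beta> H)" "xx \<mu>' \<in> {-1, 0, 1}"
    using S1_small_weight[OF assms(1)] by blast
  obtain \<nu>' t where \<nu>': "\<nu>' \<in> S1" "\<nu>' = (\<lambda>H. \<nu> H + t * \<beta> H)" "xx \<nu>' \<in> {-1, 0, 1}"
    using S1_small_weight[OF assms(2)] by blast
  define q where "q = r + s + t"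
  have sum: "\<mu>' H + \<nu>' H = q * \<beta> H" for H
    using fun_cong[OF eq, of H] by (simp add: \<mu>'(2) \<nu>'(2) q_def algebra_simps)
  have "xx \<mu>' + xx \<nu>' = 2 * (\<mu>' (cr E) + \<nu>' (cr E)) / \<beta> (cr E)" by (simp add: xx_def add_divide_distrib)
  then have xq: "xx \<mu>' + xx \<nu>' = 2 * q" using crE unfolding sum by simp
  have opp: "\<mu>' \<noteq> (\<lambda>H. - \<nu>' H)"
  proof
    assume "\<mu>' = (\<lambda>H. - \<nu>' H)"
    then show False using P_or_neg[of \<nu>'] P_root S1_P \<mu>'(1) \<nu>'(1) by blast
  qed
  have "q \<noteq> 0" using sum opp by (auto simp: fun_eq_iff add_eq_0_iff2)
  have q1: "q \<noteq> 1" using beta_not_sum[OF S1_P[OF \<mu>'(1)] S1_P[OF \<nu>'(1)]] sum by (auto simp: fun_eq_iff)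
  show False
  proof (cases "xx \<mu>' * xx \<nu>' \<le> 0")
    case True
    obtain Z where Z: "Z \<in> rs \<mu>'" "Z \<noteq> 0" using S1_wt[OF \<mu>'(1)] by (auto simp: wt_def)
    obtain W where W: "W \<in> rs \<nu>'" "W \<noteq> 0" using S1_wt[OF \<nu>'(1)] by (auto simp: wt_def)
    have "\<nu>' = (\<lambda>H. q * \<beta> H - \<mu>' H)" using sum by (auto simp: fun_eq_iff algebra_simps)
    then have "\<nu>' (cr Z) < 0" using opposite_weights_negative[OF \<mu>'(1) Z _ True] by blast
    then have w: "wt (\<lambda>H. \<mu>' H + \<nu>' H)"
      using Z(1) W S1_wt \<mu>'(1) \<nu>'(1) by (intro wt_plus[OF Z(1) W]) (auto simp: wt_def)
    have "(\<lambda>H. \<mu>' H + \<nu>' H) \<in> P" by (rule P_add[OF S1_P[OF \<mu>'(1)] S1_P[OF \<nu>'(1)] w])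
    then have "q = 1 \<or> q = 2" using positive_multiple_of_beta[of q] by (simp add: sum)
    then show False using q1 xq \<mu>'(3) \<nu>'(3) by auto
  next
    case False
    then have "xx \<mu>' = 1 \<and> xx \<nu>' = 1 \<or> xx \<mu>' = - 1 \<and> xx \<nu>' = - 1" using \<mu>'(3) \<nu>'(3) by auto
    then show False
    proof
      assume "xx \<mu>' = 1 \<and> xx \<nu>' = 1"
      then show False using xq q1 by simp
    next
      assume x: "xx \<mu>' = - 1 \<and> xx \<nu>' = - 1"
      then have "(\<lambda>H. \<mu>' H + \<beta> H) \<in> S1"
        using S1_shift(1)[OF \<mu>'(1)] shift_wt(2)[OF S1_wt[OF \<mu>'(1)]] by simp
      moreover have "q = - 1" using xq x by simp
      then have "\<mu>' H + \<beta> H = - \<nu>' H" for H using sum[of H] by simp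
      then have "(\<lambda>H. \<mu>' H + \<beta> H) = (\<lambda>H. - \<nu>' H)" by (rule ext)
      ultimately have "(\<lambda>H. - \<nu>' H) \<in> P" using S1_P by simp
      then show False using P_or_neg[of \<nu>'] P_root S1_P \<nu>'(1) by blast
    qed
  qed
qed

lemma S1_add:
  assumes "\<mu> \<in> S1" "\<nu> \<in> S1" "wt (\<lambda>H. \<mu> H + \<nu> H)"
  shows "(\<lambda>H. \<mu> H + \<nu> H) \<in> S1"
  using P_add[OF S1_P S1_P] assms S1_sum_not_multiple by (simp add: S1_iff)

text \<open>A weight on the \<beta>-line of \<mu> that was not positive would have its negative in
  \<open>S1\<close>, and that negative plus \<mu> would be a multiple of \<beta>. So
  \<open>S1\<close> contains entire lines of weights.\<close>

lemma S1_translate: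
  assumes "\<mu> \<in> S1" "wt \<nu>" "\<nu> = (\<lambda>H. \<mu> H + r * \<beta> H)"
  shows "\<nu> \<in> S1"
proof -
  have nm: "\<nu> \<noteq> (\<lambda>H. s * \<beta> H)" for s
  proof
    assume *: "\<nu> = (\<lambda>H. s * \<beta> H)"
    have "\<mu> H = (s - r) * \<beta> H" for H using fun_cong[OF *, of H] by (simp add: assms(3) algebra_simps)
    then show False using S1_not_multiple[OF assms(1)] by blast
  qed
  have "\<nu> \<in> P"
  proof (rule ccontr)
    assume "\<nu> \<notin> P"
    moreover have "\<nu> \<noteq> (\<lambda>_. 0)" using nm[of 0] by simp
    ultimately have "(\<lambda>H. - \<nu> H) \<in> P" using P_or_neg[OF assms(2)] by blast
    moreover have "(\<lambda>H. - \<nu> H) \<noteq> (\<lambda>H. s * \<beta> H)" for s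
    proof
      assume *: "(\<lambda>H. - \<nu> H) = (\<lambda>H. s * \<beta> H)"
      have "\<nu> H = - s * \<beta> H" for H using fun_cong[OF *, of H] by simp
      then show False using nm[of "- s"] by blast
    qed
    ultimately have "(\<lambda>H. - \<nu> H) \<in> S1" by (simp add: S1_iff)
    from S1_sum_not_multiple[OF assms(1) this, of "- r"] show False by (simp add: assms(3))
  qed
  then show ?thesis using nm by (simp add: S1_iff)
qed

section \<open>The subalgebra spanned by the root spaces of \<open>S1\<close>\<close>

definition nn :: "(real^'n) set" where "nn = span (\<Union>\<mu>\<in>S1. rs \<mu>)"

lemma subspace_nn: "subspace nn"
  by (simp add: nn_def)

lemma rs_nn: "\<mu> \<in> S1 \<Longrightarrow> Z \<in> rs \<mu> \<Longrightarrow> Z \<in> nn"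
  unfolding nn_def by (intro span_base) blast

lemma nn_induct:
  assumes "Z \<in> nn" "subspace S" "\<And>\<mu> Z. \<mu> \<in> S1 \<Longrightarrow> Z \<in> rs \<mu> \<Longrightarrow> Z \<in> S"
  shows "Z \<in> S"
proof -
  have "(\<Union>\<mu>\<in>S1. rs \<mu>) \<subseteq> S" using assms(3) by blast
  then show ?thesis using assms(1) span_minimal[OF _ assms(2)] unfolding nn_def by blast
qed

lemma subspace_br_preimage: "subspace S \<Longrightarrow> subspace {v. br Z v \<in> S}"
  by (simp add: subspace_def br.zero_right br.add_right br.scaleR_right)

lemma subspace_br_left_preimage: "subspace S \<Longrightarrow> subspace {v. br v Z \<in> S}"
  by (simp add: subspace_def br.zero_left br.add_left br.scaleR_left)

lemma rs_in_nn:
  assumes "Z \<in> rs \<mu>" "functional_on a \<mu>" "wt \<mu> \<Longrightarrow> \<mu> \<in> S1"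
  shows "Z \<in> nn"
proof (cases "Z = 0")
  case False
  then show ?thesis using assms rs_nn by (auto simp: wt_def)
qed (use subspace_0[OF subspace_nn] in simp)

lemma nn_subalgebra: "u \<in> nn \<Longrightarrow> v \<in> nn \<Longrightarrow> br u v \<in> nn"
proof -
  assume u: "u \<in> nn" and v: "v \<in> nn"
  have 1: "br Z v \<in> nn" if \<mu>: "\<mu> \<in> S1" "Z \<in> rs \<mu>" for \<mu> Z
  proof -
    have "v \<in> {v. br Z v \<in> nn}"
    proof (rule nn_induct[OF v subspace_br_preimage[OF subspace_nn]])
      fix \<nu> W assume \<nu>: "\<nu> \<in> S1" "W \<in> rs \<nu>"
      have "br Z W \<in> nn"
        using S1_add[OF \<mu>(1) \<nu>(1)] functional_on_add[OF P_functional[OF S1_P[OF \<mu>(1)]] P_functional[OF S1_P[OF \<nu>(1)]]]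
        by (intro rs_in_nn[OF rs_bracket[OF \<mu>(2) \<nu>(2)]])
      then show "W \<in> {v. br Z v \<in> nn}" by simp
    qed
    then show ?thesis by simp
  qed
  have "u \<in> {u. br u v \<in> nn}"
    using nn_induct[OF u subspace_br_left_preimage[OF subspace_nn]] 1 by blast
  then show ?thesis by simp
qed

lemma br_E_nn: "v \<in> nn \<Longrightarrow> br E v \<in> nn" "v \<in> nn \<Longrightarrow> br (\<theta> E) v \<in> nn"
proof -
  assume v: "v \<in> nn"
  have "v \<in> {v. br E v \<in> nn}"
  proof (rule nn_induct[OF v subspace_br_preimage[OF subspace_nn]])
    fix \<nu> W assume \<nu>: "\<nu> \<in> S1" "W \<in> rs \<nu>"
    have "br E W \<in> nn"
      using S1_shift(1)[OF \<nu>(1)] functional_on_add[OF beta(3) P_functional[OF S1_P[OF \<nu>(1)]]]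
      by (intro rs_in_nn[OF rs_bracket[OF E(1) \<nu>(2)]]) (simp_all add: add.commute)
    then show "W \<in> {v. br E v \<in> nn}" by simp
  qed
  then show "br E v \<in> nn" by simp
  have "v \<in> {v. br (\<theta> E) v \<in> nn}"
  proof (rule nn_induct[OF v subspace_br_preimage[OF subspace_nn]])
    fix \<nu> W assume \<nu>: "\<nu> \<in> S1" "W \<in> rs \<nu>"
    have "functional_on a (\<lambda>H. - \<beta> H + \<nu> H)"
      using functional_on_add[OF functional_on_scale[OF beta(3), of "- 1"] P_functional[OF S1_P[OF \<nu>(1)]]] by simp
    then have "br (\<theta> E) W \<in> nn"
      using S1_shift(2)[OF \<nu>(1)]
      by (intro rs_in_nn[OF rs_bracket[OF rs_theta[OF E(1)] \<nu>(2)]]) simp_all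
    then show "W \<in> {v. br (\<theta> E) v \<in> nn}" by simp
  qed
  then show "br (\<theta> E) v \<in> nn" by simp
qed

lemma br_centralizer_nn:
  assumes "\<And>H'. H' \<in> a \<Longrightarrow> br H' H = 0" "v \<in> nn"
  shows "br H v \<in> nn"
proof -
  have "v \<in> {v. br H v \<in> nn}"
  proof (rule nn_induct[OF assms(2) subspace_br_preimage[OF subspace_nn]])
    fix \<nu> W assume \<nu>: "\<nu> \<in> S1" "W \<in> rs \<nu>"
    have "H \<in> rs (\<lambda>_. 0)" using assms(1) by (simp add: rs_iff)
    from rs_bracket[OF this \<nu>(2)] have "br H W \<in> rs \<nu>" by simp
    then show "W \<in> {v. br H v \<in> nn}" using rs_nn[OF \<nu>(1)] by simp
  qed
  then show ?thesis by simp
qed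

lemma nn_orthogonal:
  assumes "v \<in> nn" "Y \<in> rs (\<lambda>H. r * \<beta> H)"
  shows "ip v Y = 0"
proof -
  have "v \<in> {v. ip v Y = 0}"
  proof (rule nn_induct[OF assms(1)])
    show "subspace {v. ip v Y = 0}" by (simp add: subspace_def ip.zero_left ip.add_left ip.scaleR_left)
    fix \<mu> Z assume \<mu>: "\<mu> \<in> S1" "Z \<in> rs \<mu>"
    obtain H where "H \<in> a" "\<mu> H \<noteq> r * \<beta> H"
      using functional_neq[OF P_functional[OF S1_P[OF \<mu>(1)]] functional_on_scale[OF beta(3)] S1_not_multiple[OF \<mu>(1)]]
      by blast
    then show "Z \<in> {v. ip v Y = 0}" using rs_orthogonal[OF \<mu>(2) assms(2)] by simp
  qed
  then show ?thesis by simp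
qed

text \<open>The right-hand side has components of weights 0, \<beta> and - \<beta> only, all
  orthogonal to \<open>nn\<close>.\<close>

lemma nn_trivial_intersection:
  assumes "v \<in> nn" "v = H + r *\<^sub>R (E + \<theta> E)" "\<And>H'. H' \<in> a \<Longrightarrow> br H' H = 0"
  shows "v = 0"
proof -
  have "H \<in> rs (\<lambda>H. 0 * \<beta> H)" using assms(3) by (simp add: rs_iff)
  moreover have "E \<in> rs (\<lambda>H. 1 * \<beta> H)" using E(1) by simp
  moreover have "\<theta> E \<in> rs (\<lambda>H. (- 1) * \<beta> H)" using rs_theta[OF E(1)] by simp
  ultimately have "ip v H = 0" "ip v E = 0" "ip v (\<theta> E) = 0"
    using nn_orthogonal[OF assms(1)] by blast+
  then have "ip v v = 0" by (subst (2) assms(2)) (simp add: ip.add_right ip.scaleR_right)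
  then show ?thesis by (simp add: ip_zero_iff)
qed

text \<open>As \<phi> fixes the kernel of \<beta> in \<open>a\<close>, it maps a root space into the
  joint eigenspace of that kernel. The weights occurring there differ from \<mu> by multiples of
  \<beta>, hence belong to \<open>S1\<close>.\<close>

lemma nn_invariant:
  assumes \<phi>: "lie_aut br \<phi>" "\<And>H. H \<in> a \<Longrightarrow> \<beta> H = 0 \<Longrightarrow> \<phi> H = H" and v: "v \<in> nn"
  shows "\<phi> v \<in> nn"
proof -
  have l: "linear \<phi>" using \<phi> by (simp add: lie_aut_def)
  have "\<phi> Z \<in> nn" if \<mu>: "\<mu> \<in> S1" and Z: "Z \<in> rs \<mu>" for \<mu> Z
  proof -
    define V where "V = {W. \<forall>H\<in>a. \<beta> H = 0 \<longrightarrow> br H W = \<mu> H *\<^sub>R W}"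
    have sV: "subspace V"
      by (simp add: V_def subspace_def br.zero_right br.add_right br.scaleR_right scaleR_add_right scaleR_left_commute)
    have inv: "br H W \<in> V" if H: "H \<in> a" and W: "W \<in> V" for H W
    proof -
      have "br H' (br H W) = \<mu> H' *\<^sub>R br H W" if "H' \<in> a" "\<beta> H' = 0" for H'
      proof -
        have "br H' (br H W) = br H (br H' W)"
          using br_derivation[of H' H W] a_abelian[OF that(1) H] by (simp add: br.zero_left)
        then show ?thesis using W that by (simp add: V_def br.scaleR_right)
      qed
      then show ?thesis by (simp add: V_def)
    qed
    have "\<phi> Z \<in> V"
    proof -
      have "br H (\<phi> Z) = \<mu> H *\<^sub>R \<phi> Z" if "H \<in> a" "\<beta> H = 0" for H
      proof -
        have "br H (\<phi> Z) = \<phi> (br H Z)" using \<phi> that by (simp add: lie_aut_def)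
        then show ?thesis using rsD[OF Z that(1)] by (simp add: linear_scale[OF l])
      qed
      then show ?thesis by (simp add: V_def)
    qed
    moreover have "{Z \<in> V. \<exists>\<nu>. functional_on a \<nu> \<and> Z \<in> rs \<nu>} \<subseteq> nn"
    proof clarify
      fix W \<nu> assume W: "W \<in> V" "functional_on a \<nu>" "W \<in> rs \<nu>"
      have f\<mu>: "functional_on a \<mu>" using P_functional[OF S1_P[OF \<mu>]] .
      show "W \<in> nn"
      proof (cases "W = 0")
        case True
        then show ?thesis using subspace_0[OF subspace_nn] by simp
      next
        case False
        show ?thesis
        proof (rule rs_in_nn[OF W(3,2)])
          assume w: "wt \<nu>"
          have eq: "\<nu> H = \<mu> H" if "H \<in> a" "\<beta> H = 0" for H
            using rsD[OF W(3) that(1)] W(1) that False by (auto simp: V_def)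
          \<comment> \<open>\<open>cr E\<close> spans a complement of the kernel of \<beta> in
            \<open>a\<close>, so comparison there determines the multiple.\<close>
          define r where "r = (\<nu> (cr E) - \<mu> (cr E)) / \<beta> (cr E)"
          have "\<nu> H = \<mu> H + r * \<beta> H" for H
          proof (cases "H \<in> a")
            case True
            define t where "t = \<beta> H / \<beta> (cr E)"
            have tE: "t *\<^sub>R cr E \<in> a" using crE subspace_scale[OF subspace_a] by blast
            have "H - t *\<^sub>R cr E \<in> a" using True tE subspace_diff[OF subspace_a] by blast
            moreover have "\<beta> (H - t *\<^sub>R cr E) = 0"
              using functional_onD(2)[OF beta(3) True tE] functional_onD(3)[OF beta(3) crE(1) crE(1)] crE(2)
              by (simp add: t_def)
            ultimately have "\<nu> (H - t *\<^sub>R cr E) = \<mu> (H - t *\<^sub>R cr E)" by (rule eq)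
            then have "\<nu> H - t * \<nu> (cr E) = \<mu> H - t * \<mu> (cr E)"
              using functional_onD(2)[OF W(2) True tE] functional_onD(3)[OF W(2) crE(1) crE(1)]
                functional_onD(2)[OF f\<mu> True tE] functional_onD(3)[OF f\<mu> crE(1) crE(1)] by simp
            then show ?thesis using crE(2) by (simp add: r_def t_def field_simps)
          next
            case False
            then show ?thesis using W(2) f\<mu> beta(3) by (simp add: functional_on_def)
          qed
          then show "\<nu> \<in> S1" using S1_translate[OF \<mu> w] by blast
        qed
      qed
    qed
    then have "span {Z \<in> V. \<exists>\<nu>. functional_on a \<nu> \<and> Z \<in> rs \<nu>} \<subseteq> nn"
      by (rule span_minimal[OF _ subspace_nn])
    ultimately show ?thesis using invariant_subspace_decomposition[OF sV inv] by blast
  qed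
  then have "v \<in> {v. \<phi> v \<in> nn}"
    using nn_induct[OF v linear_subspace_vimage[OF l subspace_nn, unfolded vimage_def]] by blast
  then show ?thesis by simp
qed

end

section \<open>Maximally noncompact Cartan subalgebras\<close>

lemma lie_algebra_imp_lie_alg: "lie_algebra br \<Longrightarrow> lie_alg br"
  unfolding lie_algebra_def by unfold_locales blast+

context cartan_lie_alg
begin

lemma br_span_zero:
  assumes "\<And>X Y. X \<in> S \<Longrightarrow> Y \<in> S \<Longrightarrow> br X Y = 0" "X \<in> span S" "Y \<in> span S"
  shows "br X Y = 0"
proof -
  have 1: "br X Y = 0" if "X \<in> S" "Y \<in> span S" for X Y
  proof -
    have "span S \<subseteq> {Y. br X Y = 0}"
      using assms(1)[OF that(1)]
      by (intro span_minimal) (auto simp: subspace_def br.zero_right br.add_right br.scaleR_right)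
    then show ?thesis using that(2) by blast
  qed
  have "span S \<subseteq> {X. br X Y = 0}"
    using 1[OF _ assms(3)]
    by (intro span_minimal) (auto simp: subspace_def br.zero_left br.add_left br.scaleR_left)
  then show ?thesis using assms(2) by blast
qed

lemma theta_span:
  assumes "\<And>X. X \<in> S \<Longrightarrow> \<theta> X \<in> span S" "X \<in> span S"
  shows "\<theta> X \<in> span S"
proof -
  have "span S \<subseteq> {X. \<theta> X \<in> span S}"
    using assms(1)
    by (intro span_minimal) (auto simp: subspace_def theta_simps span_zero span_add span_scale)
  then show ?thesis using assms(2) by blast
qed

lemma stable_csa_abelian:
  assumes csa: "cartan_subalgebra br h" "\<theta> ` h = h" and H: "H \<in> h" "H' \<in> h"
  shows "br H H' = 0"
proof -
  obtain k where k: "lower_central br h k = {0}" using csa(1) by (auto simp: cartan_subalgebra_def)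
  have c: "br X Y \<in> h" if "X \<in> h" "Y \<in> h" for X Y using csa(1) that by (auto simp: cartan_subalgebra_def)
  have t: "\<theta> X \<in> h" if "X \<in> h" for X using csa(2) that by blast
  have "subspace h" using csa(1) by (simp add: cartan_subalgebra_def)
  from theta_stable_nilpotent_abelian[OF this c t k H] show ?thesis .
qed

definition stable_abelian :: "(real^'n) set \<Rightarrow> bool" where
  "stable_abelian T \<longleftrightarrow> subspace T \<and> (\<forall>X\<in>T. \<theta> X \<in> T) \<and> (\<forall>X\<in>T. \<forall>Y\<in>T. br X Y = 0)"

lemma stable_abelian_insert:
  assumes "stable_abelian T" "\<And>H. H \<in> T \<Longrightarrow> br H U = 0" "\<theta> U = s *\<^sub>R U"
  shows "stable_abelian (span (insert U T))"
proof -
  have T: "\<And>X. X \<in> T \<Longrightarrow> \<theta> X \<in> T" "\<And>X Y. X \<in> T \<Longrightarrow> Y \<in> T \<Longrightarrow> br X Y = 0"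
    using assms(1) by (auto simp: stable_abelian_def)
  have "br U H = 0" if "H \<in> T" for H using assms(2)[OF that] br_anticomm[of U H] by simp
  then have ab: "br X Y = 0" if "X \<in> insert U T" "Y \<in> insert U T" for X Y
    using that T(2) assms(2) by auto
  have "\<theta> X \<in> span (insert U T)" if "X \<in> insert U T" for X
    using that T(1) assms(3) by (auto simp: span_scale span_base)
  then have "\<theta> X \<in> span (insert U T)" if "X \<in> span (insert U T)" for X
    using theta_span that by blast
  then show ?thesis using br_span_zero[OF ab] unfolding stable_abelian_def by blast
qed

text \<open>An extension stays \<theta>-stable if it is made by an eigenvector of \<theta>. An
  element that normalizes \<open>T\<close> centralizes it because ad is normal on \<open>T\<close>;
  its two \<theta>-eigencomponents can then be adjoined and so already lie in
  \<open>T\<close>.\<close>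

lemma maximal_stable_abelian_csa:
  assumes T: "stable_abelian T" and max: "\<And>T'. stable_abelian T' \<Longrightarrow> T \<subseteq> T' \<Longrightarrow> dim T' \<le> dim T"
  shows "cartan_subalgebra br T \<and> \<theta> ` T = T"
proof -
  have T': "subspace T" "\<And>X. X \<in> T \<Longrightarrow> \<theta> X \<in> T" "\<And>X Y. X \<in> T \<Longrightarrow> Y \<in> T \<Longrightarrow> br X Y = 0"
    using T by (auto simp: stable_abelian_def)
  have mem: "U \<in> T" if "\<And>H. H \<in> T \<Longrightarrow> br H U = 0" "\<theta> U = s *\<^sub>R U" for U s
  proof -
    have sub: "T \<subseteq> span (insert U T)" using span_superset by blast
    have "dim (span (insert U T)) \<le> dim T" by (rule max[OF stable_abelian_insert[OF T that] sub])
    then have "T = span (insert U T)" by (intro subspace_dim_equal T' subspace_span sub)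
    then show ?thesis using span_base[of U "insert U T"] by simp
  qed
  have "X \<in> T" if X: "\<forall>Y\<in>T. br X Y \<in> T" for X
  proof -
    have 1: "br H X = 0" if "H \<in> T" for H
    proof (rule normal_semisimple)
      show "br H (\<theta> H) = 0" using T' that by blast
      have "br H (br X H) = 0" using T' X that by blast
      then show "br H (br H X) = 0" using br_anticomm[of X H] by (simp add: br.minus_right)
    qed
    have 2: "br H (\<theta> X) = 0" if "H \<in> T" for H
      using 1[OF T'(2)[OF that]] theta_br[of "\<theta> H" X] by (simp add: theta_simps)
    have "X + \<theta> X \<in> T" by (rule mem[of _ 1]) (simp_all add: br.add_right 1 2 theta_simps add.commute)
    moreover have "X - \<theta> X \<in> T" by (rule mem[of _ "- 1"]) (simp_all add: br.diff_right 1 2 theta_simps)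
    ultimately have "(X + \<theta> X) + (X - \<theta> X) \<in> T" by (rule subspace_add[OF T'(1)])
    then have "(1/2) *\<^sub>R ((X + \<theta> X) + (X - \<theta> X)) \<in> T" by (rule subspace_scale[OF T'(1)])
    then show ?thesis by (simp flip: scaleR_2)
  qed
  moreover have "\<forall>Y\<in>T. br X Y \<in> T" if "X \<in> T" for X using T' that subspace_0 by auto
  ultimately have norm: "{X. \<forall>Y\<in>T. br X Y \<in> T} = T" by blast
  have "lower_central br T 1 \<subseteq> {0}"
    unfolding One_nat_def lower_central.simps by (rule span_minimal) (use T'(3) in auto)
  moreover have "0 \<in> lower_central br T 1" by (simp add: span_zero)
  ultimately have "\<exists>k. lower_central br T k = {0}" by blast
  moreover have "T \<subseteq> \<theta> ` T"
  proof
    fix X assume "X \<in> T"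
    then show "X \<in> \<theta> ` T" using T'(2) by (intro image_eqI[of _ _ "\<theta> X"]) simp_all
  qed
  ultimately show ?thesis using T' norm subspace_0[OF T'(1)] unfolding cartan_subalgebra_def by auto
qed

text \<open>Adjoin \<open>P\<close> to the noncompact part of \<open>h\<close> and enlarge to a
  maximal \<theta>-stable abelian subalgebra. This is a Cartan subalgebra, so its noncompact part
  cannot exceed that of \<open>h\<close> in dimension, and \<open>P\<close> was in \<open>h\<close>
  from the start.\<close>

lemma max_noncompact_csa_maximal:
  assumes h: "max_noncompact_csa br \<theta> h" and ab: "\<And>H H'. H \<in> h \<Longrightarrow> H' \<in> h \<Longrightarrow> br H H' = 0"
    and P: "\<theta> P = - P" "\<And>H. H \<in> h \<inter> \<pp> \<theta> \<Longrightarrow> br H P = 0"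
  shows "P \<in> h \<inter> \<pp> \<theta>"
proof -
  define a where "a = h \<inter> \<pp> \<theta>"
  have sp: "subspace (\<pp> \<theta>)" by (simp add: \<pp>_def subspace_def theta_simps)
  have sh: "subspace h" using h by (simp add: max_noncompact_csa_def cartan_subalgebra_def)
  have sa: "subspace a" unfolding a_def by (rule subspace_inter[OF sh sp])
  have "\<theta> H \<in> a" if "H \<in> a" for H using that subspace_neg[OF sa that] by (simp add: a_def \<pp>_def)
  then have "stable_abelian a" using sa ab by (simp add: stable_abelian_def a_def)
  then have "stable_abelian (span (insert P a))"
    by (rule stable_abelian_insert[of _ _ "- 1"]) (use P in \<open>simp_all add: a_def\<close>)
  then have "\<exists>T. (stable_abelian T \<and> span (insert P a) \<subseteq> T) \<and>
      (\<forall>T'. stable_abelian T' \<and> span (insert P a) \<subseteq> T' \<longrightarrow> dim T' \<le> dim T)"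
    by (intro ex_has_greatest_nat[of _ "span (insert P a)" _ "Suc DIM(real^'n)"])
      (simp_all add: dim_subset_UNIV less_Suc_eq_le del: DIM_cart)
  then obtain T where T: "stable_abelian T" "span (insert P a) \<subseteq> T"
    and max: "\<And>T'. stable_abelian T' \<Longrightarrow> span (insert P a) \<subseteq> T' \<Longrightarrow> dim T' \<le> dim T" by blast
  have "cartan_subalgebra br T \<and> \<theta> ` T = T"
    using T(2) max by (intro maximal_stable_abelian_csa[OF T(1)]) blast
  then have le: "dim (T \<inter> \<pp> \<theta>) \<le> dim a" using h by (simp add: max_noncompact_csa_def a_def)
  have PT: "insert P a \<subseteq> T \<inter> \<pp> \<theta>"
    using T(2) span_superset[of "insert P a"] P(1) by (auto simp: a_def \<pp>_def)
  have "a = T \<inter> \<pp> \<theta>"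
    using T(1) PT le by (intro subspace_dim_equal sa subspace_inter sp) (auto simp: stable_abelian_def)
  then show ?thesis using PT by (auto simp: a_def)
qed

end

section \<open>A real root and its Cayley transform\<close>

lemma re_vec_cvec [simp]: "re_vec (cvec X Y) = X" and im_vec_cvec [simp]: "im_vec (cvec X Y) = Y"
  by (simp_all add: re_vec_def im_vec_def cvec_def vec_eq_iff)

lemma cvec_0_add: "cvec (X + Y) 0 = cvec X 0 + cvec Y 0"
  by (simp add: cvec_def vec_eq_iff complex_eq_iff)

lemma cvec_split: "cvec X Y = cvec X 0 + \<i> *s cvec Y 0"
  by (simp add: cvec_def vec_eq_iff complex_eq_iff)

lemma scale_cvec: "z *s cvec X 0 = cvec (Re z *\<^sub>R X) (Im z *\<^sub>R X)"
  by (simp add: cvec_def vec_eq_iff complex_eq_iff)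

lemma alpha_vanishes:
  assumes "\<alpha> \<in> roots (cbr br) (complexify h)" "0 \<in> h" and 0: "\<And>H. H \<in> h \<Longrightarrow> \<alpha> (cvec H 0) = 0"
  shows False
proof -
  have \<alpha>: "functional_on (complexify h) \<alpha>" "\<alpha> \<noteq> (\<lambda>_. 0)" using assms(1) by (auto simp: roots_def)
  have "\<alpha> Z = 0" for Z
  proof (cases "Z \<in> complexify h")
    case True
    then obtain A B where AB: "A \<in> h" "B \<in> h" "Z = cvec A B" by (auto simp: complexify_def)
    have mem: "cvec A 0 \<in> complexify h" "cvec B 0 \<in> complexify h" "\<i> *s cvec B 0 \<in> complexify h"
      using AB assms(2) by (auto simp: scale_cvec complexify_def)
    have "\<alpha> (cvec A 0 + \<i> *s cvec B 0) = \<alpha> (cvec A 0) + \<alpha> (\<i> *s cvec B 0)"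
      using \<alpha>(1) mem unfolding functional_on_def by blast
    moreover have "\<alpha> (\<i> *s cvec B 0) = \<i> * \<alpha> (cvec B 0)"
      using \<alpha>(1) mem unfolding functional_on_def by blast
    ultimately have "\<alpha> (cvec A B) = 0" using 0 AB by (simp add: cvec_split[of A B])
    then show ?thesis using AB(3) by simp
  next
    case False
    then show ?thesis using \<alpha>(1) by (simp add: functional_on_def)
  qed
  then show False using \<alpha>(2) by blast
qed

locale real_root_vector = cartan_lie_alg br \<theta>
  for br :: "real^'n \<Rightarrow> real^'n \<Rightarrow> real^'n" and \<theta> :: "real^'n \<Rightarrow> real^'n" +
  fixes h :: "(real^'n) set" and \<alpha> :: "complex^'n \<Rightarrow> complex" and E :: "real^'n"
  assumes csa: "max_noncompact_csa br \<theta> h"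
    and root: "\<alpha> \<in> roots (cbr br) (complexify h)" "real_root h \<alpha>"
    and root_vector: "cvec E 0 \<in> root_space (cbr br) (complexify h) \<alpha>" "E \<noteq> 0"
begin

definition \<alpha>\<^sub>r :: "real^'n \<Rightarrow> real" where "\<alpha>\<^sub>r H = Re (\<alpha> (cvec H 0))"

lemma csa_h: "cartan_subalgebra br h" "\<theta> ` h = h"
  using csa by (auto simp: max_noncompact_csa_def)

lemma subspace_h: "subspace h" and theta_h: "H \<in> h \<Longrightarrow> \<theta> H \<in> h"
  using csa_h by (auto simp: cartan_subalgebra_def)

lemmas h_abelian = stable_csa_abelian[OF csa_h(1,2)]

lemma cvec_in_complexify: "H \<in> h \<Longrightarrow> cvec H 0 \<in> complexify h"
  using subspace_0[OF subspace_h] by (auto simp: complexify_def)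

lemma alpha_eq: "H \<in> h \<Longrightarrow> \<alpha> (cvec H 0) = of_real (\<alpha>\<^sub>r H)"
  using root(2) by (simp add: real_root_def \<alpha>\<^sub>r_def complex_is_Real_iff complex_eq_iff)

lemma alpha_functional: "functional_on (complexify h) \<alpha>"
  using root(1) by (simp add: roots_def)

lemma alpha_r_add: "H \<in> h \<Longrightarrow> H' \<in> h \<Longrightarrow> \<alpha>\<^sub>r (H + H') = \<alpha>\<^sub>r H + \<alpha>\<^sub>r H'"
proof -
  assume "H \<in> h" "H' \<in> h"
  then have "\<alpha> (cvec H 0 + cvec H' 0) = \<alpha> (cvec H 0) + \<alpha> (cvec H' 0)"
    using alpha_functional cvec_in_complexify unfolding functional_on_def by blast
  then show ?thesis by (simp add: \<alpha>\<^sub>r_def cvec_0_add)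
qed

lemma alpha_r_nonzero: "\<exists>H\<in>h. \<alpha>\<^sub>r H \<noteq> 0"
proof (rule ccontr)
  assume "\<not> ?thesis"
  then have "\<alpha> (cvec H 0) = 0" if "H \<in> h" for H using alpha_eq[OF that] that by auto
  then show False using alpha_vanishes[OF root(1) subspace_0[OF subspace_h]] by blast
qed

lemma br_E: "H \<in> h \<Longrightarrow> br H E = \<alpha>\<^sub>r H *\<^sub>R E"
proof -
  assume H: "H \<in> h"
  have "cbr br (cvec H 0) (cvec E 0) = \<alpha> (cvec H 0) *s cvec E 0"
    using root_vector(1) cvec_in_complexify[OF H] unfolding root_space_def by blast
  then have "re_vec (cvec (br H E) 0) = re_vec (cvec (\<alpha>\<^sub>r H *\<^sub>R E) (Im (\<alpha> (cvec H 0)) *\<^sub>R E))"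
    by (simp add: cbr_def br.zero_left br.zero_right scale_cvec \<alpha>\<^sub>r_def)
  then show ?thesis by simp
qed

text \<open>On \<theta>-fixed elements ad is skew for \<open>ip\<close>, so its real eigenvalue on
  \<open>E\<close> is zero there.\<close>

lemma alpha_r_theta: "H \<in> h \<Longrightarrow> \<alpha>\<^sub>r (\<theta> H) = - \<alpha>\<^sub>r H"
proof -
  assume H: "H \<in> h"
  define U where "U = H + \<theta> H"
  have U: "U \<in> h" "\<theta> U = U"
    using subspace_add[OF subspace_h H theta_h[OF H]] by (simp_all add: U_def theta_simps add.commute)
  have "\<alpha>\<^sub>r U * ip E E = - (\<alpha>\<^sub>r U * ip E E)"
    using ip_br[of U E E] U br_E[OF U(1)] by (simp add: ip.scaleR_left ip.scaleR_right)
  then have "\<alpha>\<^sub>r U = 0" using root_vector(2) by (simp add: ip_zero_iff)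
  then show ?thesis using alpha_r_add[OF H theta_h[OF H]] by (simp add: U_def)
qed

lemma br_theta_E: "H \<in> h \<Longrightarrow> br H (\<theta> E) = - \<alpha>\<^sub>r H *\<^sub>R \<theta> E"
  using br_E[OF theta_h] alpha_r_theta[of H] theta_br[of "\<theta> H" E] by (simp add: theta_simps)

lemma cayley_csa_iff:
  "Y \<in> cayley_csa \<theta> h \<alpha> E \<longleftrightarrow> (\<exists>H r. Y = H + r *\<^sub>R (E + \<theta> E) \<and> H \<in> h \<and> \<alpha>\<^sub>r H = 0)"
  unfolding cayley_csa_def using alpha_eq by auto

lemma cayley_csa_abelian:
  assumes "Y \<in> cayley_csa \<theta> h \<alpha> E" "Z \<in> cayley_csa \<theta> h \<alpha> E"
  shows "br Y Z = 0"
proof -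
  obtain H r where Y: "Y = H + r *\<^sub>R (E + \<theta> E)" "H \<in> h" "\<alpha>\<^sub>r H = 0" using assms(1) cayley_csa_iff by blast
  obtain K s where Z: "Z = K + s *\<^sub>R (E + \<theta> E)" "K \<in> h" "\<alpha>\<^sub>r K = 0" using assms(2) cayley_csa_iff by blast
  have "br H (E + \<theta> E) = 0" using Y(2,3) by (simp add: br.add_right br_E br_theta_E)
  moreover have "br K (E + \<theta> E) = 0" using Z(2,3) by (simp add: br.add_right br_E br_theta_E)
  then have "br (E + \<theta> E) K = 0" using br_anticomm[of "E + \<theta> E" K] by simp
  ultimately show ?thesis
    unfolding Y(1) Z(1) using h_abelian[OF Y(2) Z(2)]
    by (simp only: br.add_left[of H] br.add_right[of _ K] br.scaleR_left br.scaleR_right br_self) simp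
qed

lemma cayley_csa_theta:
  assumes "Y \<in> cayley_csa \<theta> h \<alpha> E"
  shows "\<theta> Y \<in> cayley_csa \<theta> h \<alpha> E"
proof -
  obtain H r where Y: "Y = H + r *\<^sub>R (E + \<theta> E)" "H \<in> h" "\<alpha>\<^sub>r H = 0" using assms cayley_csa_iff by blast
  have "\<theta> Y = \<theta> H + r *\<^sub>R (E + \<theta> E)" by (simp add: Y(1) theta_simps add.commute)
  moreover have "\<theta> H \<in> h" "\<alpha>\<^sub>r (\<theta> H) = 0" using Y theta_h alpha_r_theta by auto
  ultimately show ?thesis unfolding cayley_csa_iff by blast
qed

lemma restrict_root_nonzero: "restrict_root \<alpha> (h \<inter> \<pp> \<theta>) \<noteq> (\<lambda>_. 0)"
proof
  assume 0: "restrict_root \<alpha> (h \<inter> \<pp> \<theta>) = (\<lambda>_. 0)"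
  obtain H where H: "H \<in> h" "\<alpha>\<^sub>r H \<noteq> 0" using alpha_r_nonzero by blast
  have mh: "- \<theta> H \<in> h" using subspace_neg[OF subspace_h theta_h[OF H(1)]] .
  have "H + - \<theta> H \<in> h \<inter> \<pp> \<theta>"
    using subspace_add[OF subspace_h H(1) mh] by (simp add: \<pp>_def theta_simps)
  then have "\<alpha>\<^sub>r (H + - \<theta> H) = 0" using fun_cong[OF 0, of "H + - \<theta> H"] by (simp add: restrict_root_def \<alpha>\<^sub>r_def)
  moreover have "\<alpha>\<^sub>r H = \<alpha>\<^sub>r (H + - \<theta> H) + \<alpha>\<^sub>r (\<theta> H)"
    using alpha_r_add[OF _ theta_h[OF H(1)], of "H + - \<theta> H"] \<open>H + - \<theta> H \<in> h \<inter> \<pp> \<theta>\<close> by simp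
  ultimately show False using alpha_r_theta[OF H(1)] H(2) by simp
qed

end

text \<open>The first conjunct is the condition under which \<open>n\<^sub>1\<close> may be regarded
  as the subspace of brackets with \<open>X\<close> of the tangent space, which is how the last
  equation refers to it.\<close>

theorem theorem3p7:
  fixes G :: "('g::{t2_space, second_countable_topology}) monoid"
    and A :: "('g, 'e::euclidean_space) chart set"
    and c :: "('g, 'e) chart"
    and \<iota> :: "real^'n \<Rightarrow> 'e"
    and br :: "real^'n \<Rightarrow> real^'n \<Rightarrow> real^'n"
    and \<theta> :: "real^'n \<Rightarrow> real^'n"
    and h\<^sub>0 a :: "(real^'n) set"
    and \<Delta> \<Delta>p :: "(complex^'n \<Rightarrow> complex) set"
    and \<Sigma> \<Sigma>p \<Sigma>\<^sub>1 :: "(real^'n \<Rightarrow> real) set"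
    and \<alpha> :: "complex^'n \<Rightarrow> complex"
    and \<beta> :: "real^'n \<Rightarrow> real"
    and n\<^sub>1 \<Omega> :: "(real^'n) set"
    and E X :: "real^'n"
  assumes lie_group: "lie_group G A" "connected (UNIV :: 'g set)" "has_lie_algebra G A c \<iota> br"
    and simple: "simple_lie_algebra br"
    and noncompact: "\<not> compact_lie_algebra br"
    and noncomplex: "\<not> complex_lie_algebra br"
    and theta: "cartan_involution br \<theta>"
    and h0: "max_noncompact_csa br \<theta> h\<^sub>0"
    and a: "a = h\<^sub>0 \<inter> \<pp> \<theta>"
    and Delta: "\<Delta> = roots (cbr br) (complexify h\<^sub>0)" "positive_system \<Delta> \<Delta>p"
    and Sigma: "\<Sigma> = roots br a" "positive_system \<Sigma> \<Sigma>p"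
    and compatible: "compatible_positivity a \<Delta>p \<Sigma>p"
    and alpha: "\<alpha> \<in> simple_roots \<Delta>p" "real_root h\<^sub>0 \<alpha>"
    and beta: "\<beta> = restrict_root \<alpha> a"
    and Sigma1: "reduced_roots \<Sigma> \<and> \<Sigma>\<^sub>1 = \<Sigma>p - {\<beta>} \<or>
                 \<beta> \<in> \<Sigma> \<and> (\<lambda>H. 2 * \<beta> H) \<in> \<Sigma> \<and> \<Sigma>\<^sub>1 = \<Sigma>p - {\<beta>, \<lambda>H. 2 * \<beta> H}"
    and n1: "n\<^sub>1 = span (\<Union>\<mu>\<in>\<Sigma>\<^sub>1. root_space br a \<mu>)"
    and E: "normalized_root_vector br \<theta> h\<^sub>0 \<alpha> E"
    and X: "regular br X" "stabilizer br X = cayley_csa \<theta> h\<^sub>0 \<alpha> E"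
    and Omega: "\<Omega> = orbit (Ad G c \<iota>) X"
               "orbit_of_type br (Ad G c \<iota>) \<Omega> (cayley_csa \<theta> h\<^sub>0 \<alpha> E)"
  shows "n\<^sub>1 \<inter> stabilizer br X = {0} \<and>
    (\<exists>M L \<F>. foliation (orbit_topology (Ad G c \<iota>) X) M L \<F> \<and>
       left_invariant (Ad G c \<iota>) \<Omega> (leaf_tangent L \<F>) \<and>
       isotropic br \<Omega> (leaf_tangent L \<F>) \<and>
       leaf_tangent L \<F> X = (\<lambda>U. br U X) ` n\<^sub>1)"
proof -
  interpret lie_alg br using simple by (simp add: simple_lie_algebra_def lie_algebra_imp_lie_alg)
  interpret cartan_lie_alg br \<theta> by unfold_locales (rule theta)
  have csa: "cartan_subalgebra br h\<^sub>0" "\<theta> ` h\<^sub>0 = h\<^sub>0" using h0 by (auto simp: max_noncompact_csa_def)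
  then have sh: "subspace h\<^sub>0" by (simp add: cartan_subalgebra_def)
  note h_abelian = stable_csa_abelian[OF csa]
  have alpha_root: "\<alpha> \<in> roots (cbr br) (complexify h\<^sub>0)"
    using alpha(1) Delta unfolding simple_roots_def positive_system_def by blast
  have E_root: "cvec E 0 \<in> root_space (cbr br) (complexify h\<^sub>0) \<alpha>"
    using E by (simp add: normalized_root_vector_def)
  \<comment> \<open>The normalization yields this only once \<open>root_norm_sq\<close> is known to
    be nonzero. Instead: if \<open>E\<close> were zero, the stabilizer would be the kernel of
    \<alpha> in \<open>h\<^sub>0\<close>; it contains \<open>X\<close>, and then all of the abelian
    \<open>h\<^sub>0\<close> stabilizes \<open>X\<close>, so \<alpha> would vanish.\<close>
  have "E \<noteq> 0"
  proof
    assume E0: "E = 0"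
    have "X \<in> cayley_csa \<theta> h\<^sub>0 \<alpha> E" using X(2) by (auto simp: stabilizer_def)
    then have "X \<in> h\<^sub>0" by (auto simp: cayley_csa_def E0 theta_simps)
    then have "h\<^sub>0 \<subseteq> cayley_csa \<theta> h\<^sub>0 \<alpha> E" using h_abelian X(2) by (auto simp: stabilizer_def)
    then have 0: "\<alpha> (cvec H 0) = 0" if "H \<in> h\<^sub>0" for H using that by (auto simp: cayley_csa_def E0 theta_simps)
    show False using alpha_vanishes[OF alpha_root subspace_0[OF sh] 0] by blast
  qed
  interpret real_root_vector br \<theta> h\<^sub>0 \<alpha> E
    by unfold_locales (fact h0 alpha_root alpha(2) E_root \<open>E \<noteq> 0\<close>)+
  have a_iff: "H \<in> a \<longleftrightarrow> H \<in> h\<^sub>0 \<and> \<theta> H = - H" for H by (simp add: a \<pp>_def)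
  interpret restricted_roots br \<theta> a
  proof unfold_locales
    show "subspace a" using sh by (auto simp: subspace_def a_iff theta_simps)
    show "br H H' = 0" if "H \<in> a" "H' \<in> a" for H H' using that h_abelian by (simp add: a_iff)
    show "\<theta> H = - H" if "H \<in> a" for H using that by (simp add: a_iff)
    show "P \<in> a" if "\<theta> P = - P" "\<And>H. H \<in> a \<Longrightarrow> br H P = 0" for P
      unfolding a by (rule max_noncompact_csa_maximal[OF h0 h_abelian that(1) that(2)[unfolded a]])
  qed
  have beta_r: "\<beta> H = \<alpha>\<^sub>r H" if "H \<in> a" for H
    using that by (simp add: beta restrict_root_def \<alpha>\<^sub>r_def)
  interpret simple_restricted_root br \<theta> a \<Sigma>p \<Sigma>\<^sub>1 \<beta> E
  proof unfold_locales
    show "positive_system (roots br a) \<Sigma>p" using Sigma by simp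
    show "\<beta> \<in> simple_roots \<Sigma>p"
      using compatible alpha(1) restrict_root_nonzero unfolding compatible_positivity_def beta a by blast
    show "E \<in> root_space br a \<beta>"
      unfolding rs_iff using br_E beta_r by (simp add: a_iff)
    show "E \<noteq> 0" by fact
    show "reduced_roots (roots br a) \<and> \<Sigma>\<^sub>1 = \<Sigma>p - {\<beta>} \<or>
        \<beta> \<in> roots br a \<and> (\<lambda>H. 2 * \<beta> H) \<in> roots br a \<and> \<Sigma>\<^sub>1 = \<Sigma>p - {\<beta>, \<lambda>H. 2 * \<beta> H}"
      using Sigma1 unfolding Sigma(1) .
  qed
  have n1_nn: "n\<^sub>1 = nn" by (simp add: n1 nn_def)
  have stab: "br X H = 0 \<longleftrightarrow> (\<exists>K r. H = K + r *\<^sub>R (E + \<theta> E) \<and> K \<in> h\<^sub>0 \<and> \<alpha>\<^sub>r K = 0)" for H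
    unfolding cayley_csa_iff[symmetric] X(2)[symmetric] by (simp add: stabilizer_def)
  have cayley: "br X H = 0 \<longleftrightarrow> H \<in> cayley_csa \<theta> h\<^sub>0 \<alpha> E" for H
    unfolding X(2)[symmetric] by (simp add: stabilizer_def)
  have K_a: "br H' K = 0" if "K \<in> h\<^sub>0" "H' \<in> a" for K H' using that h_abelian by (simp add: a_iff)
  have trivial: "v = 0" if v: "v \<in> nn" "br X v = 0" for v
  proof -
    obtain K r where K: "v = K + r *\<^sub>R (E + \<theta> E)" "K \<in> h\<^sub>0" using v(2) unfolding stab by blast
    show ?thesis by (rule nn_trivial_intersection[OF v(1) K(1) K_a[OF K(2)]])
  qed
  interpret foliation: orbit_foliation G A c \<iota> br X nn
  proof unfold_locales
    show "lie_group G A" "has_lie_algebra G A c \<iota> br" "connected (UNIV :: 'g set)" by fact+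
    show "br X V = 0" if "br X (br X V) = 0" for V
    \<comment> \<open>\<open>X\<close> lies in its own stabilizer, which is \<theta>-stable, so
      \<theta> X commutes with \<open>X\<close>.\<close>
    proof (rule normal_semisimple[OF _ that])
      have "X \<in> cayley_csa \<theta> h\<^sub>0 \<alpha> E" using cayley by (simp flip: cayley)
      then show "br X (\<theta> X) = 0" unfolding cayley by (rule cayley_csa_theta)
    qed
    show "br U V = 0" if "br X U = 0" "br X V = 0" for U V
      using cayley_csa_abelian that unfolding cayley by blast
    show "subspace nn" by (rule subspace_nn)
    show "br u v \<in> nn" if "u \<in> nn" "v \<in> nn" for u v by (rule nn_subalgebra[OF that])
    show "br H v \<in> nn" if H: "br X H = 0" and v: "v \<in> nn" for H v
    proof -
      obtain K r where K: "H = K + r *\<^sub>R (E + \<theta> E)" "K \<in> h\<^sub>0" using H unfolding stab by blast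
      have "br K v + r *\<^sub>R (br E v + br (\<theta> E) v) \<in> nn"
        by (intro subspace_add subspace_scale subspace_nn br_E_nn v br_centralizer_nn K_a[OF K(2)])
      then show ?thesis by (simp add: K(1) br.add_left br.scaleR_left)
    qed
    show "v = 0" if "v \<in> nn" "br X v = 0" for v by (rule trivial[OF that])
    show "\<phi> v \<in> nn" if \<phi>: "lie_aut br \<phi>" "\<And>H. br X H = 0 \<Longrightarrow> \<phi> H = H" and v: "v \<in> nn" for \<phi> v
    proof (rule nn_invariant[OF \<phi>(1) _ v])
      fix H assume "H \<in> a" "\<beta> H = 0"
      then have "H = H + 0 *\<^sub>R (E + \<theta> E) \<and> H \<in> h\<^sub>0 \<and> \<alpha>\<^sub>r H = 0" using beta_r by (simp add: a_iff)
      then have "br X H = 0" unfolding stab by blast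
      then show "\<phi> H = H" by (rule \<phi>(2))
    qed
  qed
  have "n\<^sub>1 \<inter> stabilizer br X = {0}"
    using trivial subspace_0[OF subspace_nn] by (auto simp: n1_nn stabilizer_def br.zero_right)
  then show ?thesis using foliation.ex_foliation unfolding n1_nn Omega(1) by blast
qed

end
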